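(* Let $a_1,a_2,b_1,b_2\in\mathbb{C}^*$ and $t=q^\tau$ with $\tau\in\mathbb{C}$ satisfy $|q\,t^{2i-2}|<1$ and $q<|a_1a_2b_1b_2t^{2i-2}|$ for $i=1,2,\ldots,n$. Then for all $x_1,x_2\in\mathbb{C}^*$ (parameters and $x_1,x_2$ being generic, i.e. such that all sums $J(\zeta_i(x_1,x_2))$ are defined and no denominator below vanishes) $$ \sum_{i=0}^{n}J(\zeta_i(x_1,x_2)) \prod_{j=1}^{i}\frac{(x_1t^{j-1})^{-1-2(n-j)\tau}}{\theta(x_2x_1^{-1}t^{-j+1})} \prod_{k=1}^{n-i}\frac{(x_2t^{k-1})^{-1-2(n-i-k)\tau}}{\theta(x_1x_2^{-1}t^{i-k+1})} =C_0\prod_{k=1}^n \frac{\theta(x_1x_2b_1b_2t^{n+k-2})}{\prod_{i=1}^2\prod_{j=1}^2\theta(x_ib_jt^{k-1})}, $$ where $C_0$ is a constant independent of $x_1$ and $x_2$, explicitly $$ C_0=(1-q)^n\prod_{k=1}^n\frac{(q)_\infty(t)_\infty\prod_{i=1}^2\prod_{j=1}^2(qa_i^{-1}b_j^{-1}t^{-(k-1)})_\infty} {(t^{k})_\infty(qa_1^{-1}a_2^{-1}b_1^{-1}b_2^{-1}t^{-(n+k-2)})_\infty}. $$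
   Context: Fix $0<q<1$ and an integer $n\ge1$. Put $(a)_\infty=\prod_{i\ge0}(1-q^ia)$ and $\theta(a)=(a)_\infty(q/a)_\infty$. Let $t=q^\tau$, $$\Phi(z)=\prod_{i=1}^n z_i\frac{(qa_1^{-1}z_i)_\infty(qa_2^{-1}z_i)_\infty}{(b_1z_i)_\infty(b_2z_i)_\infty}\prod_{1\le j<k\le n}z_j^{2\tau-1}\frac{(qt^{-1}z_k/z_j)_\infty}{(tz_k/z_j)_\infty},\qquad \Delta(z)=\prod_{1\le i<j\le n}(z_i-z_j).$$ For $x\in(\mathbb{C}^* )^n$, $J(x)=(1-q)^n\sum_{\nu\in\mathbb{Z}^n}\Phi(xq^\nu)\Delta(xq^\nu)$ with $xq^\nu=(x_1q^{\nu_1},\ldots,x_nq^{\nu_n})$. For $x_1,x_2\in\mathbb{C}^*$ and $0\le i\le n$, $$\zeta_i(x_1,x_2)=(x_1,x_1t,\ldots,x_1t^{i-1},\,x_2,x_2t,\ldots,x_2t^{n-i-1})\in(\mathbb{C}^* )^n .$$ When $t^l\notin q^{\mathbb{Z}}$ for $1\le l\le n$, the terms of $J(\zeta_i(x_1,x_2))$ vanish unless $\nu_1\le\cdots\le\nu_i$ and $\nu_{i+1}\le\cdots\le\nu_n$; for the remaining $\tau$ (e.g. $\tau$ a positive integer) $J(\zeta_i(x_1,x_2))$ denotes the continuous extension in $\tau$, i.e. the sum restricted to $\nu$ with $\nu_1\le\cdots\le\nu_i$ and $\nu_{i+1}\le\cdots\le\nu_n$ (where for $\tau$ a positive integer $(q^{1-\tau}u)_\infty/(q^\tau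 u)_\infty=\prod_{l=1-\tau}^{\tau-1}(1-q^lu)$). Complex powers: fix logarithms of $x_1,x_2$, take $\log q$ real, $\log t=\tau\log q$, and logarithms additive on products, so that $(xt^jq^\nu)^s=x^sq^{s(j\tau+\nu)}$. *)

theory Defs
  imports "HOL-Analysis.Analysis"
begin

definition qpoch :: "real \<Rightarrow> complex \<Rightarrow> complex" where
  "qpoch q a = (\<Prod>i. 1 - of_real q ^ i * a)"

definition qtheta :: "real \<Rightarrow> complex \<Rightarrow> complex" where
  "qtheta q a = qpoch q a * qpoch q (of_real q / a)"

text \<open>
  Since \<open>q > 0\<close>, the principal power used here is \<open>exp (\<tau> * ln q)\<close> with the real logarithm of \<open>q\<close>.
\<close>

definition qt :: "real \<Rightarrow> complex \<Rightarrow> complex" where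
  "qt q \<tau> = of_real q powr \<tau>"

text \<open>
  Because of the factors \<open>z j\<close> to the power \<open>2 * \<tau> - 1\<close>, a point \<open>z\<close> of the torus is given by
  chosen logarithms \<open>w\<close> of its coordinates: \<open>z j = exp (w j)\<close> for \<open>j\<close> in \<open>{1..n}\<close>, and
  \<open>z j\<close> to the power \<open>s\<close> is \<open>exp (s * w j)\<close>. The parameters \<open>a 1\<close>, \<open>a 2\<close>, \<open>b 1\<close>, \<open>b 2\<close>
  are the values of functions \<open>a\<close> and \<open>b\<close>.
\<close>

definition Phi :: "real \<Rightarrow> nat \<Rightarrow> complex \<Rightarrow> (nat \<Rightarrow> complex) \<Rightarrow> (nat \<Rightarrow> complex)
    \<Rightarrow> (nat \<Rightarrow> complex) \<Rightarrow> complex" where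
  "Phi q n \<tau> a b w =
     (let t = qt q \<tau>; z = (\<lambda>i. exp (w i)) in
       (\<Prod>i\<in>{1..n}. z i *
          (qpoch q (of_real q * inverse (a 1) * z i) * qpoch q (of_real q * inverse (a 2) * z i)) /
          (qpoch q (b 1 * z i) * qpoch q (b 2 * z i))) *
       (\<Prod>j\<in>{1..n}. \<Prod>k\<in>{j<..n}. exp ((2 * \<tau> - 1) * w j) *
          qpoch q (of_real q * inverse t * z k / z j) / qpoch q (t * z k / z j)))"

definition Phi_defined :: "real \<Rightarrow> nat \<Rightarrow> complex \<Rightarrow> (nat \<Rightarrow> complex)
    \<Rightarrow> (nat \<Rightarrow> complex) \<Rightarrow> bool" where
  "Phi_defined q n \<tau> b w \<longleftrightarrow>
     (let t = qt q \<tau>; z = (\<lambda>i. exp (w i)) in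
       (\<forall>i\<in>{1..n}. qpoch q (b 1 * z i) \<noteq> 0 \<and> qpoch q (b 2 * z i) \<noteq> 0) \<and>
       (\<forall>j\<in>{1..n}. \<forall>k\<in>{j<..n}. qpoch q (t * z k / z j) \<noteq> 0))"

definition Vandermonde :: "nat \<Rightarrow> (nat \<Rightarrow> complex) \<Rightarrow> complex" where
  "Vandermonde n w = (\<Prod>i\<in>{1..n}. \<Prod>j\<in>{i<..n}. exp (w i) - exp (w j))"

text \<open>The logarithms of the coordinates of \<open>x q^\<nu>\<close>, when \<open>w\<close> are those of \<open>x\<close>.\<close>

definition qshift :: "real \<Rightarrow> (nat \<Rightarrow> complex) \<Rightarrow> (nat \<Rightarrow> int) \<Rightarrow> nat \<Rightarrow> complex" where
  "qshift q w \<nu> = (\<lambda>i. w i + of_int (\<nu> i) * of_real (ln q))"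

definition J_term :: "real \<Rightarrow> nat \<Rightarrow> complex \<Rightarrow> (nat \<Rightarrow> complex) \<Rightarrow> (nat \<Rightarrow> complex)
    \<Rightarrow> (nat \<Rightarrow> complex) \<Rightarrow> (nat \<Rightarrow> int) \<Rightarrow> complex" where
  "J_term q n \<tau> a b w \<nu> = Phi q n \<tau> a b (qshift q w \<nu>) * Vandermonde n (qshift q w \<nu>)"

definition lattice_pts :: "nat \<Rightarrow> (nat \<Rightarrow> int) set" where
  "lattice_pts n = ({1..n} \<rightarrow>\<^sub>E UNIV)"

definition J_sum :: "real \<Rightarrow> nat \<Rightarrow> complex \<Rightarrow> (nat \<Rightarrow> complex) \<Rightarrow> (nat \<Rightarrow> complex)
    \<Rightarrow> (nat \<Rightarrow> int) set \<Rightarrow> (nat \<Rightarrow> complex) \<Rightarrow> complex" where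
  "J_sum q n \<tau> a b N w = of_real (1 - q) ^ n * (\<Sum>\<^sub>\<infinity>\<nu>\<in>N. J_term q n \<tau> a b w \<nu>)"

text \<open>
  The logarithms of the coordinates of \<open>\<zeta>_i(x_1, x_2)\<close>, when \<open>L 1\<close> and \<open>L 2\<close> are logarithms
  of \<open>x_1\<close> and \<open>x_2\<close>.
\<close>

definition zeta_log :: "real \<Rightarrow> complex \<Rightarrow> (nat \<Rightarrow> complex) \<Rightarrow> nat \<Rightarrow> nat \<Rightarrow> complex" where
  "zeta_log q \<tau> L i = (\<lambda>j. if j \<le> i then L 1 + of_nat (j - 1) * \<tau> * of_real (ln q)
                           else L 2 + of_nat (j - i - 1) * \<tau> * of_real (ln q))"

definition chamber :: "nat \<Rightarrow> nat \<Rightarrow> (nat \<Rightarrow> int) set" where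
  "chamber n i = {\<nu> \<in> lattice_pts n.
     (\<forall>j k. 1 \<le> j \<and> j \<le> k \<and> k \<le> i \<longrightarrow> \<nu> j \<le> \<nu> k) \<and>
     (\<forall>j k. i < j \<and> j \<le> k \<and> k \<le> n \<longrightarrow> \<nu> j \<le> \<nu> k)}"

text \<open>
  The index set of the sum \<open>J(\<zeta>_i)\<close>: the whole lattice for generic \<open>\<tau>\<close>. For the remaining \<open>\<tau>\<close>,
  \<open>J(\<zeta>_i)\<close> denotes its continuous extension in \<open>\<tau>\<close>, which is the sum over the chamber; outside
  of it a term may be of the form \<open>0 / 0\<close>.
\<close>

definition J_range :: "real \<Rightarrow> nat \<Rightarrow> complex \<Rightarrow> nat \<Rightarrow> (nat \<Rightarrow> int) set" where
  "J_range q n \<tau> i =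
     (if \<forall>l\<in>{1..n}. \<forall>m::int. qt q \<tau> ^ l \<noteq> of_real q powi m then lattice_pts n else chamber n i)"

definition J_zeta :: "real \<Rightarrow> nat \<Rightarrow> complex \<Rightarrow> (nat \<Rightarrow> complex) \<Rightarrow> (nat \<Rightarrow> complex)
    \<Rightarrow> (nat \<Rightarrow> complex) \<Rightarrow> nat \<Rightarrow> complex" where
  "J_zeta q n \<tau> a b L i = J_sum q n \<tau> a b (J_range q n \<tau> i) (zeta_log q \<tau> L i)"

text \<open>\<open>(x t^j)^s\<close>, where \<open>l\<close> is the logarithm of \<open>x\<close>.\<close>

definition xt_pow :: "real \<Rightarrow> complex \<Rightarrow> complex \<Rightarrow> nat \<Rightarrow> complex \<Rightarrow> complex" where
  "xt_pow q \<tau> l j s = exp (s * (l + of_nat j * \<tau> * of_real (ln q)))"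

definition C0 :: "real \<Rightarrow> nat \<Rightarrow> complex \<Rightarrow> (nat \<Rightarrow> complex) \<Rightarrow> (nat \<Rightarrow> complex) \<Rightarrow> complex" where
  "C0 q n \<tau> a b =
     (let t = qt q \<tau> in
       of_real (1 - q) ^ n *
       (\<Prod>k\<in>{1..n}.
          qpoch q (of_real q) * qpoch q t *
          (\<Prod>i\<in>{1..2}. \<Prod>j\<in>{1..2}.
             qpoch q (of_real q * inverse (a i) * inverse (b j) * t powi (- (int k - 1)))) /
          (qpoch q (t ^ k) *
           qpoch q (of_real q * inverse (a 1) * inverse (a 2) * inverse (b 1) * inverse (b 2) *
                    t powi (- (int n + int k - 2))))))"

end

theory Submission
  imports Defs
begin

text \<open>
  After cancellation of the complex powers, the left-hand side is \<open>(1 - q)\<^sup>n\<close> times a sum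
  \<open>FF x1 x2 \<alpha>1 \<alpha>2\<close> with \<open>\<alpha>i = 1 / a_i\<close>. Telescoping in each coordinate separately shows that
  \<open>H(c)\<close>, the sum of the weight times \<open>(z_1 - c) \<cdots> (z_n - c)\<close>, satisfies a second order
  \<open>t\<close>-difference equation in \<open>c\<close>: the boundary terms at \<open>z_k = 0\<close> do not vanish, but they cancel
  between the points \<open>\<zeta>_i\<close> and \<open>\<zeta>_(i-1)\<close>, and this is what the theta quotients are for. Comparing
  \<open>H(a_1)\<close> with the leading coefficient of \<open>H\<close> gives a first order recursion in \<open>\<alpha>1 \<mapsto> q \<alpha>1\<close>;
  iterating it expresses \<open>FF x1 x2 \<alpha>1 \<alpha>2\<close> through \<open>FF x1 x2 0 0\<close>. The latter, multiplied by the
  theta functions in \<open>x_i b_j\<close>, has the same multipliers under \<open>x_i \<mapsto> q x_i\<close> as the theta product on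
  the right-hand side. So the base points may be moved to \<open>0\<close> along their lattices; taking there
  \<open>a_i = x_i\<close>, which truncates the sums from below, only one term survives in the limit.
\<close>

section \<open>The \<open>q\<close>-shifted factorial and the theta function\<close>

text \<open>Two constraints shape the proof. The second convergence condition of the theorem is just
  strong enough for the bare sum; the linear factors \<open>z_j - c\<close> cost one more power of
  \<open>q\<close> at infinity. The difference equation is therefore used with
  \<open>Q * \<alpha>1\<close> in place of \<open>\<alpha>1\<close>, which gains exactly this power.
  The value at \<open>\<alpha>1\<close> is still reached, since at
  \<open>c = 1 / (Q * \<alpha>1)\<close> the linear factors lower the parameter again by one step.
  The truncated sums with \<open>\<alpha>i = 1 / X_i\<close> may violate the convergence condition
  altogether. Hence bounds are demanded only where the summand is nonzero, and the recursion covers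
  both kinds of parameters. This also replaces any analytic argument in \<open>x1\<close>,
  \<open>x2\<close>: the two sides to be compared pick up the same nonzero multiplier along a
  lattice orbit, so an identity in the limit towards 0 is an identity at the starting point. The
  base point \<open>x2\<close> is moved twice as fast as \<open>x1\<close>; this separates the
  blocks and makes every coordinate of the second block negligible.\<close>

locale q_base =
  fixes q :: real
  assumes q_pos: "0 < q" and q_less_1: "q < 1"
begin

abbreviation Q :: complex where "Q \<equiv> complex_of_real q"

lemma q_nonzero [simp]: "q \<noteq> 0"
  using q_pos by simp

lemma Q_power_tendsto_0: "(\<lambda>n. Q ^ n) \<longlonglongrightarrow> 0"
  using q_pos q_less_1 by (intro LIMSEQ_power_zero) simp

lemma mult_Q_power_tendsto_0: "(\<lambda>n. c * Q ^ n) \<longlonglongrightarrow> 0"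
  using tendsto_mult_left[OF Q_power_tendsto_0, of c] by simp

lemma qpoch_convergent: "convergent_prod (\<lambda>i. 1 - Q ^ i * a)"
proof -
  have "summable (\<lambda>i. norm a * q ^ i)"
    using q_pos q_less_1 by (intro summable_mult summable_geometric) auto
  hence "summable (\<lambda>i. norm ((1 - Q ^ i * a) - 1))"
    using q_pos by (simp add: norm_mult norm_power mult.commute)
  thus ?thesis
    by (intro abs_convergent_prod_imp_convergent_prod summable_imp_abs_convergent_prod)
qed

lemma qpoch_partial_tendsto: "(\<lambda>n. \<Prod>i<n. 1 - Q ^ i * a) \<longlonglongrightarrow> qpoch q a"
proof -
  have "(\<lambda>n. \<Prod>i\<le>n. 1 - Q ^ i * a) \<longlonglongrightarrow> qpoch q a"
    unfolding qpoch_def by (rule convergent_prod_LIMSEQ[OF qpoch_convergent])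
  thus ?thesis
    unfolding lessThan_Suc_atMost[symmetric] by (rule LIMSEQ_imp_Suc)
qed

lemma qpoch_rec: "qpoch q a = (1 - a) * qpoch q (Q * a)"
proof -
  have "(\<lambda>n. \<Prod>i<Suc n. 1 - Q ^ i * a) \<longlonglongrightarrow> qpoch q a"
    using qpoch_partial_tendsto by (rule LIMSEQ_Suc)
  moreover have "(\<lambda>n. \<Prod>i<Suc n. 1 - Q ^ i * a) = (\<lambda>n. (1 - a) * (\<Prod>i<n. 1 - Q ^ i * (Q * a)))"
    by (subst prod.lessThan_Suc_shift) (simp add: mult_ac)
  moreover have "(\<lambda>n. (1 - a) * (\<Prod>i<n. 1 - Q ^ i * (Q * a))) \<longlonglongrightarrow> (1 - a) * qpoch q (Q * a)"
    by (intro tendsto_mult tendsto_const qpoch_partial_tendsto)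
  ultimately show ?thesis
    by (metis (no_types) LIMSEQ_unique)
qed

lemma qpoch_split: "qpoch q a = (\<Prod>i<n. 1 - Q ^ i * a) * qpoch q (Q ^ n * a)"
proof (induction n)
  case (Suc n)
  show ?case
    unfolding Suc.IH by (subst qpoch_rec[of "Q ^ n * a"]) (simp add: mult_ac)
qed simp

lemma qpoch_eq_0_iff: "qpoch q a = 0 \<longleftrightarrow> (\<exists>i. Q ^ i * a = 1)"
proof -
  have "(\<lambda>i. 1 - Q ^ i * a) has_prod qpoch q a"
    unfolding qpoch_def using qpoch_convergent by (rule convergent_prod_has_prod)
  from has_prod_eq_0_iff[OF this] have "qpoch q a = 0 \<longleftrightarrow> (\<exists>i. 0 = 1 - Q ^ i * a)"
    by (simp only: image_iff bex_UNIV)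
  also have "\<dots> \<longleftrightarrow> (\<exists>i. Q ^ i * a = 1)"
    by (metis right_minus_eq)
  finally show ?thesis .
qed

lemma qpoch_0 [simp]: "qpoch q 0 = 1"
  unfolding qpoch_def by simp

lemma qpoch_shift_nonzero: "qpoch q a \<noteq> 0 \<Longrightarrow> qpoch q (Q ^ n * a) \<noteq> 0"
  using qpoch_split[of a n] by auto

text \<open>Dividing \<open>qpoch q a\<close> by its partial products gives the limit as long as
  \<open>qpoch q a\<close> is nonzero. If a factor of \<open>qpoch q c\<close> vanishes, it is the
  only one, and starting one step beyond it removes the obstruction.\<close>

lemma qpoch_tendsto_1: "(\<lambda>n. qpoch q (c * Q ^ n)) \<longlonglongrightarrow> 1"
proof -
  have *: "(\<lambda>n. qpoch q (a * Q ^ n)) \<longlonglongrightarrow> 1" if a: "qpoch q a \<noteq> 0" for a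
  proof -
    have "(\<lambda>n. qpoch q a / (\<Prod>i<n. 1 - Q ^ i * a)) \<longlonglongrightarrow> qpoch q a / qpoch q a"
      by (intro tendsto_divide tendsto_const qpoch_partial_tendsto a)
    moreover have "qpoch q a / (\<Prod>i<n. 1 - Q ^ i * a) = qpoch q (a * Q ^ n)" for n
      using qpoch_split[of a n] a by (auto simp: field_simps)
    ultimately show ?thesis using a by simp
  qed
  have "\<exists>k. qpoch q (c * Q ^ k) \<noteq> 0"
  proof (cases "qpoch q c = 0")
    case True
    then obtain i where i: "Q ^ i * c = 1" by (auto simp: qpoch_eq_0_iff)
    have "Q ^ j * (c * Q ^ Suc i) \<noteq> 1" for j
    proof
      assume "Q ^ j * (c * Q ^ Suc i) = 1"
      moreover have "Q ^ j * (c * Q ^ Suc i) = (Q ^ i * c) * Q ^ Suc j" by simp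
      ultimately have "Q ^ Suc j = 1" unfolding i by (simp only: mult_1_left)
      hence "norm (Q ^ Suc j) = 1" by (simp only: norm_one)
      moreover have "norm (Q ^ Suc j) = q ^ Suc j"
        unfolding norm_power norm_of_real using q_pos by (subst abs_of_pos) auto
      moreover have "q ^ Suc j < 1"
        by (rule power_Suc_less_one[OF q_pos q_less_1])
      ultimately show False by linarith
    qed
    hence "qpoch q (c * Q ^ Suc i) \<noteq> 0" by (simp only: qpoch_eq_0_iff) blast
    thus ?thesis ..
  next
    case False
    thus ?thesis by (intro exI[of _ 0]) simp
  qed
  then obtain k where "qpoch q (c * Q ^ k) \<noteq> 0" ..
  from *[OF this] have "(\<lambda>n. qpoch q (c * Q ^ (n + k))) \<longlonglongrightarrow> 1"
    by (simp add: power_add mult_ac)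
  thus ?thesis by (rule LIMSEQ_offset)
qed

text \<open>One factor moves in each of the two products: \<open>qpoch q (Q * u)\<close> lacks the
  factor \<open>1 - u\<close>, and \<open>qpoch q (1 / u)\<close> has the extra factor
  \<open>1 - 1 / u\<close>.\<close>

lemma qtheta_Q_mult:
  assumes "u \<noteq> 0" shows "qtheta q (Q * u) = - (1 / u) * qtheta q u"
proof -
  have "qtheta q (Q * u) = qpoch q (Q * u) * qpoch q (1 / u)"
    using assms by (simp add: qtheta_def)
  also have "\<dots> = (1 - 1 / u) * qpoch q (Q * u) * qpoch q (Q / u)"
    by (subst (2) qpoch_rec) simp
  also have "(1 - 1 / u) = - (1 / u) * (1 - u)" using assms by (simp add: field_simps)
  also have "- (1 / u) * (1 - u) * qpoch q (Q * u) * qpoch q (Q / u) = - (1 / u) * qtheta q u"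
    unfolding qtheta_def by (subst (3) qpoch_rec) simp
  finally show ?thesis .
qed

lemma qtheta_Q_div:
  assumes "u \<noteq> 0" shows "qtheta q (u / Q) = - (u / Q) * qtheta q u"
  using qtheta_Q_mult[of "u / Q"] assms by (simp add: field_simps)

lemma qtheta_inverse:
  assumes "u \<noteq> 0" shows "qtheta q (1 / u) = - (1 / u) * qtheta q u"
  using qtheta_Q_mult[OF assms] assms by (simp add: qtheta_def mult.commute)

text \<open>The zeros of the two products are the two halves of the lattice of powers of
  \<open>Q\<close>. One theta condition at a base point thus controls its whole lattice, which is
  the form in which genericity is used.\<close>

lemma qtheta_nonzero_iff:
  assumes "u \<noteq> 0" shows "qtheta q u \<noteq> 0 \<longleftrightarrow> (\<forall>m. Q powi m * u \<noteq> 1)"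
proof -
  have "qtheta q u = 0 \<longleftrightarrow> (\<exists>m. Q powi m * u = 1)"
  proof
    assume "qtheta q u = 0"
    hence "(\<exists>i. Q ^ i * u = 1) \<or> (\<exists>i. Q ^ i * (Q / u) = 1)"
      by (auto simp: qtheta_def qpoch_eq_0_iff)
    thus "\<exists>m. Q powi m * u = 1"
    proof (elim disjE exE)
      fix i assume "Q ^ i * u = 1"
      thus ?thesis by (intro exI[of _ "int i"]) simp
    next
      fix i assume "Q ^ i * (Q / u) = 1"
      hence "u = Q ^ Suc i" using assms by (simp add: field_simps)
      moreover have "Q powi (- int (Suc i)) * Q ^ Suc i = 1"
        by (simp only: power_int_minus power_int_of_nat) (simp del: power_Suc)
      ultimately show ?thesis by blast
    qed
  next
    assume "\<exists>m. Q powi m * u = 1"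
    then obtain m where m: "Q powi m * u = 1" by blast
    show "qtheta q u = 0"
    proof (cases "m \<ge> 0")
      case True
      hence "Q ^ nat m * u = 1" using m by (simp add: power_int_def)
      thus ?thesis by (auto simp: qtheta_def qpoch_eq_0_iff)
    next
      case False
      define i where "i = nat (- m - 1)"
      have "m = - int (Suc i)" using False by (simp add: i_def)
      hence "u = Q ^ Suc i" using m assms
        by (simp only: power_int_minus power_int_of_nat) (simp add: field_simps)
      hence "Q ^ i * (Q / u) = 1" by simp
      thus ?thesis by (auto simp: qtheta_def qpoch_eq_0_iff)
    qed
  qed
  thus ?thesis by blast
qed

lemma qtheta_nonzero_imp_qpoch:
  assumes "u \<noteq> 0" "qtheta q u \<noteq> 0" shows "qpoch q (Q powi m * u) \<noteq> 0"
proof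
  assume "qpoch q (Q powi m * u) = 0"
  then obtain i where "Q ^ i * (Q powi m * u) = 1" by (auto simp: qpoch_eq_0_iff)
  hence "Q powi (int i + m) * u = 1" by (simp add: power_int_add mult_ac)
  thus False using qtheta_nonzero_iff[of u] assms by blast
qed

lemma qtheta_nonzero_imp_neq_1:
  assumes "u \<noteq> 0" "qtheta q u \<noteq> 0" shows "Q powi m * u \<noteq> 1"
  using qtheta_nonzero_iff[of u] assms by blast

lemma qtheta_nonzero_shift:
  assumes "u \<noteq> 0" "qtheta q u \<noteq> 0" shows "qtheta q (Q powi m * u) \<noteq> 0"
proof -
  have "Q powi k * (Q powi m * u) \<noteq> 1" for k
    using qtheta_nonzero_imp_neq_1[OF assms, of "k + m"] by (simp add: power_int_add mult_ac)
  thus ?thesis using assms by (subst qtheta_nonzero_iff) auto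
qed

lemma qtheta_inverse_nonzero:
  assumes "u \<noteq> 0" "qtheta q u \<noteq> 0" shows "qtheta q (1 / u) \<noteq> 0"
  using assms by (simp add: qtheta_inverse)

text \<open>For \<open>u = z_k / z_j\<close> this is the pair factor of the weight together with the
  Vandermonde factor \<open>z_j - z_k = z_j (1 - u)\<close>. The split-off \<open>z_j\<close> raises
  the complex power from \<open>2 \<tau> - 1\<close> to \<open>2 \<tau>\<close>, which on the
  lattice becomes an integer power of \<open>t\<close> times a constant.\<close>

definition pair_fun :: "complex \<Rightarrow> complex \<Rightarrow> complex" where
  "pair_fun t u = (1 - u) * qpoch q (Q * u / t) / qpoch q (t * u)"

text \<open>The connection factor between \<open>pair_fun t u\<close> and
  \<open>pair_fun t (1 / u)\<close>. As a theta quotient it changes along a lattice only by powers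
  of \<open>t\<close>, and these are compensated by the powers of \<open>t\<close> in the
  weight.\<close>

definition pair_conn :: "complex \<Rightarrow> complex \<Rightarrow> complex" where
  "pair_conn t c = - c * qtheta q (t / c) / qtheta q (t * c)"

lemma pair_fun_tendsto_1: "(\<lambda>m. pair_fun t (c * Q ^ m)) \<longlonglongrightarrow> 1"
proof -
  have "(\<lambda>m. (1 - c * Q ^ m) * qpoch q (Q * c / t * Q ^ m) / qpoch q (t * c * Q ^ m)) \<longlonglongrightarrow> (1 - 0) * 1 / 1"
    by (intro tendsto_intros mult_Q_power_tendsto_0 qpoch_tendsto_1) auto
  thus ?thesis by (simp add: pair_fun_def mult_ac)
qed

text \<open>Each of the two infinite products loses one factor. This first order equation is the
  contribution of a pair to the telescoping in one coordinate.\<close>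

lemma pair_fun_shift:
  assumes "u \<noteq> 1" "qpoch q (t * u) \<noteq> 0"
  shows "pair_fun t (Q * u) * (1 - Q * u / t) = pair_fun t u * ((1 - Q * u) * (1 - t * u) / (1 - u))"
proof -
  have 1: "qpoch q (t * u) = (1 - t * u) * qpoch q (t * (Q * u))"
    by (subst qpoch_rec) (simp add: mult_ac)
  have 2: "qpoch q (Q * u / t) = (1 - Q * u / t) * qpoch q (Q * (Q * u) / t)"
    by (subst qpoch_rec) (simp add: mult_ac)
  have 3: "qpoch q (t * (Q * u)) \<noteq> 0" "1 - t * u \<noteq> 0" "1 - u \<noteq> 0"
    using assms 1 by auto
  have "pair_fun t u * ((1 - Q * u) * (1 - t * u) / (1 - u)) =
    ((1 - u) / (1 - u)) * ((1 - t * u) / (1 - t * u)) *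
      ((1 - Q * u) * ((1 - Q * u / t) * qpoch q (Q * (Q * u) / t)) / qpoch q (t * (Q * u)))"
    unfolding pair_fun_def 1 2 by simp
  also have "\<dots> = pair_fun t (Q * u) * (1 - Q * u / t)"
    using 3 by (simp add: pair_fun_def)
  finally show ?thesis by simp
qed

text \<open>The four infinite products match up as two theta functions; what remains is
  \<open>1 - u\<close> against \<open>1 - 1 / u\<close>, whose quotient \<open>- u\<close> is the
  prefactor of \<open>pair_conn\<close>.\<close>

lemma pair_fun_inverse:
  assumes "u \<noteq> 0" "t \<noteq> 0" "qtheta q (t * u) \<noteq> 0" "qtheta q (t / u) \<noteq> 0"
  shows "pair_fun t u = pair_conn t u * pair_fun t (1 / u)"
proof -
  have nz: "qpoch q (t / u) \<noteq> 0" "qpoch q (Q / (t * u)) \<noteq> 0" "qpoch q (t * u) \<noteq> 0"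
    using assms by (auto simp: qtheta_def)
  have aux: "(1 - u) * B / C = - u * (A * B) / (C * D) * ((1 - 1 / u) * D / A)"
    if "A \<noteq> 0" "C \<noteq> 0" "D \<noteq> 0" for A B C D :: complex
    using that assms(1) by (simp add: divide_simps) (simp add: algebra_simps)
  have "qtheta q (t / u) = qpoch q (t / u) * qpoch q (Q * u / t)"
    "qtheta q (t * u) = qpoch q (t * u) * qpoch q (Q / (t * u))"
    "Q * (1 / u) / t = Q / (t * u)" "t * (1 / u) = t / u"
    using assms by (simp_all add: qtheta_def mult.commute)
  thus ?thesis
    using aux[OF nz(1,3,2), of "qpoch q (Q * u / t)"] by (simp only: pair_conn_def pair_fun_def)
qed

lemma pair_conn_Q_div:
  assumes "u \<noteq> 0" "t \<noteq> 0"
  shows "t\<^sup>2 * pair_conn t (u / Q) = pair_conn t u"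
proof -
  have 1: "qtheta q (t / (u / Q)) = - (u / t) * qtheta q (t / u)"
    using qtheta_Q_mult[of "t / u"] assms by (simp add: mult_ac)
  have 2: "qtheta q (t * (u / Q)) = - (t * u / Q) * qtheta q (t * u)"
    using qtheta_Q_div[of "t * u"] assms by simp
  have aux: "t\<^sup>2 * (- (u / Q) * (- (u / t) * X) / (- (t * u / Q) * Y)) = - u * X / Y" for X Y
    using assms by (cases "Y = 0") (simp_all add: divide_simps power2_eq_square)
  show ?thesis
    unfolding pair_conn_def 1 2 by (rule aux)
qed

text \<open>Large arguments are traded for small ones by inversion, and \<open>t ^ (2 * m)\<close>
  is absorbed by the quasi-periodicity of \<open>pair_conn\<close>. So the pair factor, taken with
  the power of \<open>t\<close> from the weight, has a limit also when its argument tends to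
  infinity.\<close>

lemma pair_fun_backward:
  assumes "c \<noteq> 0" "t \<noteq> 0" "qtheta q (t * c) \<noteq> 0" "qtheta q (t / c) \<noteq> 0"
  shows "t ^ (2 * m) * pair_fun t (c / Q ^ m) = pair_conn t c * pair_fun t (1 / c * Q ^ m)"
proof -
  have *: "t ^ (2 * m) * pair_conn t (c / Q ^ m) = pair_conn t c" for m
  proof (induction m)
    case (Suc m)
    have "t ^ (2 * Suc m) * pair_conn t (c / Q ^ Suc m) =
          t ^ (2 * m) * (t\<^sup>2 * pair_conn t (c / Q ^ m / Q))"
      by (simp add: power2_eq_square mult_ac)
    also have "\<dots> = pair_conn t c"
      using assms by (subst pair_conn_Q_div) (auto simp: Suc.IH)
    finally show ?case .
  qed simp
  have "qtheta q (Q powi (- int m) * (t * c)) \<noteq> 0"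
    by (rule qtheta_nonzero_shift) (use assms in auto)
  moreover have "Q powi (- int m) * (t * c) = t * (c / Q ^ m)"
    by (simp add: power_int_minus divide_inverse)
  moreover have "qtheta q (Q powi (int m) * (t / c)) \<noteq> 0"
    by (rule qtheta_nonzero_shift) (use assms in auto)
  moreover have "Q powi (int m) * (t / c) = t / (c / Q ^ m)"
    by simp
  ultimately have "qtheta q (t * (c / Q ^ m)) \<noteq> 0" "qtheta q (t / (c / Q ^ m)) \<noteq> 0"
    by metis+
  hence "pair_fun t (c / Q ^ m) = pair_conn t (c / Q ^ m) * pair_fun t (1 / (c / Q ^ m))"
    using assms by (intro pair_fun_inverse) auto
  hence "t ^ (2 * m) * pair_fun t (c / Q ^ m) =
      t ^ (2 * m) * pair_conn t (c / Q ^ m) * pair_fun t (1 / (c / Q ^ m))"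
    by (simp only: mult.assoc)
  also have "1 / (c / Q ^ m) = 1 / c * Q ^ m" by simp
  finally show ?thesis unfolding * .
qed

end

text \<open>Tannery's theorem for unconditional sums: a finite set carries the sum of
  \<open>h\<close> up to \<open>e / 4\<close>, and on this set the convergence is termwise.\<close>

lemma infsum_dominated_tendsto:
  fixes f :: "nat \<Rightarrow> 'a \<Rightarrow> complex"
  assumes lim: "\<And>x. x \<in> X \<Longrightarrow> (\<lambda>n. f n x) \<longlonglongrightarrow> g x"
    and bd: "\<And>n x. x \<in> X \<Longrightarrow> norm (f n x) \<le> h x"
    and h: "h summable_on X"
  shows "(\<lambda>n. infsum (f n) X) \<longlonglongrightarrow> infsum g X"
proof -
  have gb: "norm (g x) \<le> h x" if "x \<in> X" for x
    using LIMSEQ_le_const2[OF tendsto_norm[OF lim[OF that]]] bd[OF that] by blast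
  have h0: "h x \<ge> 0" if "x \<in> X" for x
    using order_trans[OF norm_ge_zero gb[OF that]] .
  have dom: "u summable_on Y" if "h summable_on Y" "\<And>x. x \<in> Y \<Longrightarrow> norm (u x) \<le> h x" for u :: "'a \<Rightarrow> complex" and Y
    by (rule abs_summable_summable[OF Infinite_Sum.abs_summable_on_comparison_test'[OF that]])
  have sf: "f n summable_on X" for n
    by (rule dom[OF h bd])
  have sg: "g summable_on X"
    by (rule dom[OF h gb])
  show ?thesis
  proof (rule LIMSEQ_I)
    fix e :: real assume e: "e > 0"
    obtain F where F: "finite F" "F \<subseteq> X" and Fe: "dist (sum h F) (infsum h X) \<le> e / 4"
      using infsum_finite_approximation[OF h, of "e / 4"] e by auto
    have hX: "h summable_on (X - F)" using h by (rule summable_on_subset_banach) auto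
    have eq: "F \<union> (X - F) = X" using F by blast
    have split: "infsum u X = sum u F + infsum u (X - F)" if "u summable_on X"
      for u :: "'a \<Rightarrow> 'b :: banach"
    proof -
      have "u summable_on (X - F)" using that by (rule summable_on_subset_banach) auto
      hence "infsum u (F \<union> (X - F)) = infsum u F + infsum u (X - F)"
        by (intro infsum_Un_disjoint) (use F in auto)
      thus ?thesis unfolding eq using F by simp
    qed
    have tail: "infsum h (X - F) \<le> e / 4"
      using Fe split[OF h] by (simp add: dist_real_def)
    have small: "norm (infsum u (X - F)) \<le> e / 4" if u: "\<And>x. x \<in> X \<Longrightarrow> norm (u x) \<le> h x" for u :: "'a \<Rightarrow> complex"
    proof -
      have "u summable_on (X - F)"
        by (rule dom[OF hX]) (rule u, blast)
      hence "norm (infsum u (X - F)) \<le> infsum h (X - F)"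
        by (rule norm_infsum_le[OF has_sum_infsum has_sum_infsum[OF hX]]) (rule u, blast)
      thus ?thesis using tail by simp
    qed
    have "(\<lambda>n. sum (f n) F) \<longlonglongrightarrow> sum g F"
      using F by (intro tendsto_sum lim) auto
    then obtain N where N: "\<And>n. n \<ge> N \<Longrightarrow> norm (sum (f n) F - sum g F) < e / 4"
      using LIMSEQ_D[of _ _ "e / 4"] e by (metis divide_pos_pos zero_less_numeral)
    show "\<exists>N. \<forall>n\<ge>N. norm (infsum (f n) X - infsum g X) < e"
    proof (intro exI allI impI)
      fix n assume n: "n \<ge> N"
      have "infsum (f n) X - infsum g X = (sum (f n) F - sum g F) + (infsum (f n) (X - F) - infsum g (X - F))"
        using split[OF sf] split[OF sg] by simp
      also have "norm \<dots> \<le> norm (sum (f n) F - sum g F) + (norm (infsum (f n) (X - F)) + norm (infsum g (X - F)))"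
        by (intro norm_triangle_mono norm_triangle_ineq4) auto
      also have "\<dots> < e / 4 + (e / 4 + e / 4)"
        using N[OF n] small[of "f n"] small[of g] bd gb by (intro add_less_le_mono add_mono) auto
      also have "\<dots> < e" using e by simp
      finally show "norm (infsum (f n) X - infsum g X) < e" .
    qed
  qed
qed

section \<open>Interpolation and \<open>q\<close>-difference operators\<close>

lemma coeff_quadratic_mult:
  fixes p :: "'a :: comm_ring_1 poly"
  shows "coeff ([:1, b, c:] * p) 0 = coeff p 0"
    "coeff ([:1, b, c:] * p) (Suc 0) = coeff p (Suc 0) + b * coeff p 0"
    "coeff ([:1, b, c:] * p) (Suc (Suc m)) = coeff p (Suc (Suc m)) + b * coeff p (Suc m) + c * coeff p m"
  by simp_all

text \<open>With the parameters \<open>\<alpha>1\<close>, \<open>\<alpha>2\<close> and with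
  \<open>b1\<close>, \<open>b2\<close> these are the two polynomial coefficients in the first order
  \<open>q\<close>-difference equation of the one-variable weight.\<close>

definition quad :: "complex \<Rightarrow> complex \<Rightarrow> complex \<Rightarrow> complex" where
  "quad u v c = (1 - u * c) * (1 - v * c)"

lemma degree_prod_linear_le:
  "degree (\<Prod>j\<in>I. [:z j, -1 :: 'a :: comm_ring_1:]) \<le> card I"
proof (cases "finite I")
  case True
  have "degree (\<Prod>j\<in>I. [:z j, -1:]) \<le> (\<Sum>j\<in>I. degree [:z j, -1:])"
    by (rule degree_prod_sum_le[OF True, unfolded o_def])
  also have "\<dots> \<le> (\<Sum>j\<in>I. 1)"
    by (intro sum_mono) simp
  finally show ?thesis by simp
qed simp

text \<open>
  Both sides are \<open>c\<^sup>2\<close> times a polynomial in \<open>c\<close> of degree less than \<open>card I\<close>, so that it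
  suffices to compare them at the points \<open>z k\<close>.
\<close>

lemma t_difference_interpolation:
  fixes z :: "'b \<Rightarrow> complex" and \<alpha>1 \<alpha>2 b1 b2 c t :: complex
  assumes I: "finite I" and inj: "inj_on z I" and z0: "\<And>k. k \<in> I \<Longrightarrow> z k \<noteq> 0"
    and t: "t \<noteq> 0"
  defines "n \<equiv> card I"
  defines "h \<equiv> \<lambda>c. \<Prod>j\<in>I. z j - c"
  defines "\<kappa> \<equiv> t * \<alpha>1 * \<alpha>2 * (1 - 1 / t ^ n) + b1 * b2 * (1 - t ^ n)"
  shows "t * quad \<alpha>1 \<alpha>2 c * (h (c / t) - h c) + quad b1 b2 c * (h (t * c) - h c) + c\<^sup>2 * \<kappa> * h c =
    - (c\<^sup>2 * (1 - t) * (t / t ^ n)) *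
      (\<Sum>k\<in>I. (quad \<alpha>1 \<alpha>2 (z k) * (\<Prod>j\<in>I-{k}. z k - t * z j) -
          t ^ n / t * quad b1 b2 (z k) * (\<Prod>j\<in>I-{k}. t * z k - z j)) /
        (z k * (\<Prod>j\<in>I-{k}. z k - z j)) * (\<Prod>j\<in>I-{k}. z j - c))"
proof -
  define hp where "hp = (\<Prod>j\<in>I. [:z j, -1:])"
  have hp: "poly hp c = h c" for c
    by (simp add: hp_def h_def poly_prod)
  have deg_hp: "degree hp \<le> n"
    unfolding hp_def n_def by (rule degree_prod_linear_le)
  define h1 where "h1 = pcompose hp [:0, 1 / t:] - hp"
  define h2 where "h2 = pcompose hp [:0, t:] - hp"
  have h1: "coeff h1 m = (1 / t ^ m - 1) * coeff hp m" for m
    by (simp add: h1_def coeff_pcompose_linear power_one_over algebra_simps)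
  have h2: "coeff h2 m = (t ^ m - 1) * coeff hp m" for m
    by (simp add: h2_def coeff_pcompose_linear algebra_simps)
  define R where "R = smult t ([:1, - (\<alpha>1 + \<alpha>2), \<alpha>1 * \<alpha>2:] * h1) + [:1, - (b1 + b2), b1 * b2:] * h2 +
    [:0, 0, \<kappa>:] * hp"
  have R: "poly R c = t * quad \<alpha>1 \<alpha>2 c * (h (c / t) - h c) + quad b1 b2 c * (h (t * c) - h c) + c\<^sup>2 * \<kappa> * h c" for c
  proof -
    have 1: "poly [:1, - (u + v), u * v:] c = quad u v c" for u v
      by (simp add: quad_def algebra_simps)
    have 2: "poly h1 c = h (c / t) - h c" "poly h2 c = h (t * c) - h c"
      by (simp_all add: h1_def h2_def poly_pcompose hp mult.commute)
    have "poly R c = t * (quad \<alpha>1 \<alpha>2 c * (h (c / t) - h c)) + quad b1 b2 c * (h (t * c) - h c) +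
        poly [:0, 0, \<kappa>:] c * h c"
      unfolding R_def poly_add poly_smult poly_mult 1 2 hp ..
    thus ?thesis by (simp add: power2_eq_square mult_ac)
  qed
  have R0: "coeff R 0 = 0"
    unfolding R_def coeff_add coeff_smult coeff_quadratic_mult h1 h2 by simp
  \<comment> \<open>The factor \<open>t\<close> in front of the first quadratic makes the linear
    contributions \<open>t * (1 / t - 1)\<close> and \<open>t - 1\<close> cancel.\<close>
  have R1: "coeff R (Suc 0) = 0"
    unfolding R_def coeff_add coeff_smult coeff_quadratic_mult h1 h2 using t
    by (simp add: algebra_simps)
  \<comment> \<open>\<open>\<kappa>\<close> is the number that cancels the coefficient of degree
    \<open>n + 2\<close>. After division by \<open>c\<^sup>2\<close> the degree is then below
    \<open>n\<close>, so that the \<open>n\<close> points \<open>z k\<close> determine the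
    quotient.\<close>
  have RS: "coeff R (Suc (Suc m)) = 0" if "m \<ge> n" for m
  proof -
    have z: "coeff hp (Suc m) = 0" "coeff hp (Suc (Suc m)) = 0"
      using deg_hp that by (auto intro!: coeff_eq_0)
    show ?thesis
    proof (cases "m = n")
      case True
      show ?thesis
        unfolding R_def coeff_add coeff_smult coeff_quadratic_mult h1 h2 z
        using True by (simp add: \<kappa>_def algebra_simps)
    next
      case False
      hence "coeff hp m = 0" using deg_hp that by (auto intro!: coeff_eq_0)
      thus ?thesis
        unfolding R_def coeff_add coeff_smult coeff_quadratic_mult h1 h2 z by simp
    qed
  qed
  define r where "r = poly_shift 2 R"
  have cr: "coeff r m = coeff R (Suc (Suc m))" for m
    by (simp add: r_def coeff_poly_shift numeral_2_eq_2)
  have Rr: "R = pCons 0 (pCons 0 r)"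
    by (rule poly_eqI) (auto simp: coeff_pCons cr R0 R1 split: nat.splits)
  have Rr': "poly R c = c\<^sup>2 * poly r c" for c
    by (simp add: Rr power2_eq_square)
  define w where "w = (\<lambda>k. (quad \<alpha>1 \<alpha>2 (z k) * (\<Prod>j\<in>I-{k}. z k - t * z j) -
          t ^ n / t * quad b1 b2 (z k) * (\<Prod>j\<in>I-{k}. t * z k - z j)) /
        (z k * (\<Prod>j\<in>I-{k}. z k - z j)))"
  define T where "T = smult (- ((1 - t) * (t / t ^ n))) (\<Sum>k\<in>I. smult (w k) (\<Prod>j\<in>I-{k}. [:z j, -1:]))"
  have T: "poly T c = - ((1 - t) * (t / t ^ n)) * (\<Sum>k\<in>I. w k * (\<Prod>j\<in>I-{k}. z j - c))" for c
    by (simp add: T_def poly_sum poly_prod)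
  have "r = T"
  proof (cases "I = {}")
    case True
    have "r = 0" using RS True by (intro poly_eqI) (simp add: cr n_def)
    thus ?thesis using True by (simp add: T_def)
  next
    case False
    hence n: "n > 0" using I by (simp add: n_def card_gt_0_iff)
    show ?thesis
    proof (rule poly_eqI_degree[of "z ` I"])
      show "poly r x = poly T x" if x: "x \<in> z ` I" for x
      proof -
        obtain k where k: "k \<in> I" "x = z k" using x by blast
        have "poly r (z k) * (z k)\<^sup>2 = poly T (z k) * (z k)\<^sup>2"
        proof -
          have card: "card (I - {k}) = n - 1" using k I by (simp add: n_def)
          have n': "t ^ n = t * t ^ (n - 1)" using n by (cases n) auto
          have neq: "z k - z j \<noteq> 0" if "j \<in> I - {k}" for j
            using inj k that by (auto simp: inj_on_def)
          define P where "P = (\<Prod>j\<in>I-{k}. z k - z j)"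
          have P: "P \<noteq> 0" unfolding P_def using I neq by simp
          define U where "U = (\<Prod>j\<in>I-{k}. z k - t * z j)"
          define V where "V = (\<Prod>j\<in>I-{k}. t * z k - z j)"
          define s :: complex where "s = (-1) ^ (n - 1)"
          have neg: "(\<Prod>j\<in>I-{k}. f j - g j) = s * (\<Prod>j\<in>I-{k}. g j - f j)" for f g :: "'b \<Rightarrow> complex"
          proof -
            have "(\<Prod>j\<in>I-{k}. f j - g j) = (\<Prod>j\<in>I-{k}. (-1) * (g j - f j))"
              by (intro prod.cong) auto
            thus ?thesis by (simp only: prod.distrib prod_constant card s_def)
          qed
          have h0: "h (z k) = 0" unfolding h_def using I k by (auto simp: prod_zero_iff)
          have hsplit: "h c = (z k - c) * (\<Prod>j\<in>I-{k}. z j - c)" for c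
            unfolding h_def using I k by (simp add: prod.remove)
          have "h (z k / t) = (z k - z k / t) * (\<Prod>j\<in>I-{k}. (1 / t) * (t * z j - z k))"
            unfolding hsplit using t by (simp add: diff_divide_distrib)
          also have "(\<Prod>j\<in>I-{k}. (1 / t) * (t * z j - z k)) = s * U / t ^ (n - 1)"
            unfolding prod.distrib prod_constant card U_def by (subst neg) (simp add: power_one_over)
          finally have ht: "h (z k / t) = (z k - z k / t) * (s * U / t ^ (n - 1))" .
          have ht': "h (t * z k) = (z k - t * z k) * (s * V)"
            unfolding hsplit V_def by (subst neg) simp
          have sum: "(\<Sum>k'\<in>I. w k' * (\<Prod>j\<in>I-{k'}. z j - z k)) = w k * (s * P)"
          proof -
            have "(\<Prod>j\<in>I-{k'}. z j - z k) = 0" if "k' \<in> I - {k}" for k'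
              using I k that by (auto simp: prod_zero_iff)
            hence "(\<Sum>k'\<in>I-{k}. w k' * (\<Prod>j\<in>I-{k'}. z j - z k)) = 0"
              by (intro sum.neutral ballI) (simp only: mult_zero_right)
            hence "(\<Sum>k'\<in>I. w k' * (\<Prod>j\<in>I-{k'}. z j - z k)) = w k * (\<Prod>j\<in>I-{k}. z j - z k)"
              unfolding sum.remove[OF I k(1)] by (simp only: add_0_right)
            also have "(\<Prod>j\<in>I-{k}. z j - z k) = s * P" unfolding P_def by (rule neg)
            finally show ?thesis .
          qed
          have wk: "w k = (quad \<alpha>1 \<alpha>2 (z k) * U - t ^ n / t * quad b1 b2 (z k) * V) / (z k * P)"
            by (simp add: w_def U_def V_def P_def)
          have "poly r (z k) * (z k)\<^sup>2 = poly R (z k)" by (simp add: Rr')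
          also have "\<dots> = t * quad \<alpha>1 \<alpha>2 (z k) * ((z k - z k / t) * (s * U / t ^ (n - 1))) +
              quad b1 b2 (z k) * ((z k - t * z k) * (s * V))"
            unfolding R ht ht' h0 by simp
          also have "\<dots> = - ((1 - t) * (t / t ^ n)) * (w k * (s * P)) * (z k)\<^sup>2"
            unfolding wk n' using t P z0[OF k(1)]
            by (simp add: field_simps) (simp add: power2_eq_square algebra_simps)
          also have "\<dots> = poly T (z k) * (z k)\<^sup>2" unfolding T sum ..
          finally show ?thesis .
        qed
        thus ?thesis using z0[OF k(1)] k by simp
      qed
      have cz: "card (z ` I) = n" using inj by (simp add: card_image n_def)
      show "degree r < card (z ` I)" unfolding cz
      proof (cases "r = 0")
        case False
        have "coeff r (degree r) \<noteq> 0" using False by simp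
        thus "degree r < n" using RS[of "degree r"] unfolding cr by (meson not_le)
      qed (use n in simp)
      have "degree T \<le> n - 1"
      proof -
        have "degree (smult (w k) (\<Prod>j\<in>I-{k}. [:z j, -1:])) \<le> n - 1" if "k \<in> I" for k
          using degree_prod_linear_le[of z "I - {k}"] that I
            degree_smult_le[of "w k" "\<Prod>j\<in>I-{k}. [:z j, -1:]"] by (simp add: n_def)
        hence "degree (\<Sum>k\<in>I. smult (w k) (\<Prod>j\<in>I-{k}. [:z j, -1:])) \<le> n - 1"
          using I by (intro degree_sum_le) auto
        thus ?thesis unfolding T_def by (rule order.trans[OF degree_smult_le])
      qed
      thus "degree T < card (z ` I)" using n cz by simp
    qed
  qed
  hence "poly R c = - (c\<^sup>2 * (1 - t) * (t / t ^ n)) * (\<Sum>k\<in>I. w k * (\<Prod>j\<in>I-{k}. z j - c))"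
    unfolding Rr' by (simp only: T mult_minus_left mult_minus_right mult.assoc)
  thus ?thesis unfolding R w_def .
qed

text \<open>Subtracting \<open>coeff H (Suc n)\<close> times the monic Newton polynomial of degree
  \<open>Suc n\<close> lowers the degree. The top Newton coefficient is thus the ordinary leading
  coefficient, whatever the nodes are.\<close>

lemma newton_expansion:
  fixes node :: "nat \<Rightarrow> complex"
  assumes "degree H \<le> n"
  shows "\<exists>cs. (\<forall>x. poly H x = (\<Sum>s\<le>n. cs s * (\<Prod>l<s. x - node l))) \<and> cs n = coeff H n"
  using assms
proof (induction n arbitrary: H)
  case 0
  then obtain a where "H = [:a:]" by (metis degree_eq_zeroE le_zero_eq)
  thus ?case by (intro exI[of _ "\<lambda>_. a"]) simp
next
  case (Suc n)
  define p where "p = (\<Prod>l<Suc n. [:- node l, 1:])"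
  have deg_p: "degree p = Suc n"
    by (simp del: prod.lessThan_Suc add: p_def degree_prod_eq_sum_degree)
  have "lead_coeff p = (\<Prod>l<Suc n. lead_coeff [:- node l, 1:])"
    unfolding p_def by (rule lead_coeff_prod)
  also have "\<dots> = 1" by (intro prod.neutral) simp
  finally have "coeff p (Suc n) = 1" unfolding deg_p .
  note p = deg_p this
  define H' where "H' = H - smult (coeff H (Suc n)) p"
  have "degree H' \<le> n"
  proof (rule degree_le, intro allI impI)
    fix i assume "n < i"
    show "coeff H' i = 0"
    proof (cases "i = Suc n")
      case True
      thus ?thesis using p by (simp add: H'_def)
    next
      case False
      hence "degree H < i" "degree p < i" using Suc.prems \<open>n < i\<close> p by auto
      thus ?thesis by (simp add: H'_def coeff_eq_0)
    qed
  qed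
  from Suc.IH[OF this] obtain cs where
    cs: "\<And>x. poly H' x = (\<Sum>s\<le>n. cs s * (\<Prod>l<s. x - node l))" by blast
  have "poly H x = poly H' x + coeff H (Suc n) * (\<Prod>l<Suc n. x - node l)" for x
    by (simp add: H'_def p_def poly_prod algebra_simps)
  hence "poly H x = (\<Sum>s\<le>Suc n. (cs(Suc n := coeff H (Suc n))) s * (\<Prod>l<s. x - node l))" for x
    by (simp add: cs)
  thus ?case by (intro exI[of _ "cs(Suc n := coeff H (Suc n))"]) simp
qed

text \<open>
  The operator maps the Newton basis with nodes \<open>a, a t, a t\<^sup>2, \<dots>\<close> to \<open>c\<^sup>2\<close> times a two-term
  combination of basis elements, which yields a first order recursion for the coefficients.
\<close>

lemma t_difference_leading_coeff:
  fixes H :: "complex poly"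
  assumes deg: "degree H \<le> n" and a: "a \<noteq> 0" and t: "t \<noteq> 0"
    and t1: "\<And>s. s \<in> {1..n} \<Longrightarrow> t ^ s \<noteq> 1"
    and eq: "\<And>c. c \<noteq> 0 \<Longrightarrow> t * quad (1 / a) \<alpha>2 c * (poly H (c / t) - poly H c) +
        quad b1 b2 c * (poly H (t * c) - poly H c) +
        c\<^sup>2 * (t * (1 / a) * \<alpha>2 * (1 - 1 / t ^ n) + b1 * b2 * (1 - t ^ n)) * poly H c = 0"
  shows "poly H a * (\<Prod>s<n. t * (1 / a) * \<alpha>2 * (1 / t ^ s - 1 / t ^ n) + b1 * b2 * (t ^ s - t ^ n)) =
    (\<Prod>s<n. (1 - t ^ Suc s) * (1 - a * b1 * t ^ s) * (1 - a * b2 * t ^ s) / (a * t ^ s)) * coeff H n"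
proof -
  define \<phi> where "\<phi> = (\<lambda>s c. \<Prod>l<s. c - a * t ^ l)"
  define lam where "lam = (\<lambda>s. t * (1 / a) * \<alpha>2 * (1 / t ^ s - 1 / t ^ n) + b1 * b2 * (t ^ s - t ^ n))"
  define sig where "sig = (\<lambda>s. (1 - t ^ Suc s) * (1 - a * b1 * t ^ s) * (1 - a * b2 * t ^ s) / (a * t ^ s))"
  define kap where "kap = t * (1 / a) * \<alpha>2 * (1 - 1 / t ^ n) + b1 * b2 * (1 - t ^ n)"
  define Lop where "Lop = (\<lambda>f c. t * quad (1 / a) \<alpha>2 c * (f (c / t) - f c) +
        quad b1 b2 c * (f (t * c) - f c) + c\<^sup>2 * kap * f c)"
  have L0: "Lop (\<phi> 0) c = c\<^sup>2 * (lam 0 * \<phi> 0 c)" for c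
    by (simp add: Lop_def \<phi>_def lam_def kap_def)
  \<comment> \<open>The nodes of \<open>\<phi> (Suc s) (c / t)\<close> are, as a polynomial in
    \<open>c\<close>, \<open>a * t, ..., a * t ^ Suc s\<close>; the factor \<open>1 - c / a\<close>
    of \<open>quad (1 / a) \<alpha>2 c\<close> supplies the missing node \<open>a\<close>. This is
    why only two neighbouring basis elements are coupled.\<close>
  have LS: "Lop (\<phi> (Suc s)) c = c\<^sup>2 * (lam (Suc s) * \<phi> (Suc s) c - sig s * \<phi> s c)" for s c
  proof -
    define T where "T = t ^ s"
    define N where "N = t ^ n"
    have TN: "T \<noteq> 0" "N \<noteq> 0" using t by (auto simp: T_def N_def)
    define X where "X = \<phi> s c"
    have 1: "\<phi> (Suc s) c = X * (c - a * T)"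
      by (simp add: \<phi>_def X_def T_def)
    have 2: "\<phi> (Suc s) (t * c) = (t * c - a) * T * X"
    proof -
      have "\<phi> (Suc s) (t * c) = (t * c - a) * (\<Prod>l<s. t * (c - a * t ^ l))"
        unfolding \<phi>_def by (subst prod.lessThan_Suc_shift) (simp add: algebra_simps)
      thus ?thesis by (simp add: prod.distrib X_def \<phi>_def T_def)
    qed
    have 3: "(c - a) * \<phi> (Suc s) (c / t) = (c - a * (t * T)) * (X * (c - a * T)) / (t * T)"
    proof -
      have "\<phi> (Suc s) (c / t) = (\<Prod>l<Suc s. (1 / t) * (c - a * t ^ Suc l))"
        unfolding \<phi>_def using t by (intro prod.cong) (auto simp: field_simps)
      also have "\<dots> = (1 / t) ^ Suc s * (\<Prod>l<Suc s. c - a * t ^ Suc l)"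
        by (simp only: prod.distrib prod_constant card_lessThan)
      also have "(c - a) * \<dots> = (1 / t) ^ Suc s * ((c - a * t ^ 0) * (\<Prod>l<Suc s. c - a * t ^ Suc l))"
        by simp
      also have "(c - a * t ^ 0) * (\<Prod>l<Suc s. c - a * t ^ Suc l) = \<phi> (Suc (Suc s)) c"
        unfolding \<phi>_def by (subst (2) prod.lessThan_Suc_shift) (rule refl)
      also have "\<phi> (Suc (Suc s)) c = (c - a * (t * T)) * (X * (c - a * T))"
        by (simp add: \<phi>_def X_def T_def)
      finally show ?thesis using t by (simp add: T_def power_one_over divide_simps)
    qed
    have 4: "t * quad (1 / a) \<alpha>2 c * \<phi> (Suc s) (c / t) =
        - (1 / (a * T)) * (1 - \<alpha>2 * c) * ((c - a * (t * T)) * (X * (c - a * T)))"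
    proof -
      have "t * quad (1 / a) \<alpha>2 c * \<phi> (Suc s) (c / t) =
         - (t / a) * (1 - \<alpha>2 * c) * ((c - a) * \<phi> (Suc s) (c / t))"
        unfolding quad_def using a by (simp add: field_simps)
      thus ?thesis unfolding 3 using a t TN by simp
    qed
    have 5: "lam (Suc s) = t * (1 / a) * \<alpha>2 * (1 / (t * T) - 1 / N) + b1 * b2 * (t * T - N)"
      by (simp add: lam_def T_def N_def)
    have 6: "sig s = (1 - t * T) * (1 - a * b1 * T) * (1 - a * b2 * T) / (a * T)"
      by (simp add: sig_def T_def)
    have "Lop (\<phi> (Suc s)) c = - (1 / (a * T)) * (1 - \<alpha>2 * c) * ((c - a * (t * T)) * (X * (c - a * T))) -
       t * quad (1 / a) \<alpha>2 c * (X * (c - a * T)) + quad b1 b2 c * ((t * c - a) * T * X - X * (c - a * T)) +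
       c\<^sup>2 * (t * (1 / a) * \<alpha>2 * (1 - 1 / N) + b1 * b2 * (1 - N)) * (X * (c - a * T))"
      unfolding Lop_def 1 2 right_diff_distrib[of "t * quad (1 / a) \<alpha>2 c"] 4 kap_def N_def[symmetric] ..
    also have "\<dots> = X * (c\<^sup>2 * (lam (Suc s) * (c - a * T) - sig s))"
      unfolding 5 6 quad_def using a t TN
      by (simp add: field_simps power2_eq_square)
    finally show ?thesis by (simp add: 1 X_def algebra_simps)
  qed
  obtain cs where cs: "\<And>x. poly H x = (\<Sum>s\<le>n. cs s * \<phi> s x)" and csn: "cs n = coeff H n"
    using newton_expansion[OF deg, of "\<lambda>l. a * t ^ l"] unfolding \<phi>_def by blast
  have Lsum: "Lop (\<lambda>c. \<Sum>s\<in>S. cs s * \<phi> s c) c = (\<Sum>s\<in>S. cs s * Lop (\<phi> s) c)" if "finite S" for S c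
    using that
  proof induction
    case (insert s S)
    have "Lop (\<lambda>c. k * f c + g c) c = k * Lop f c + Lop g c" for k f g
      by (simp add: Lop_def algebra_simps)
    with insert show ?case by simp
  qed (simp add: Lop_def)
  have "(\<Sum>s<n. (lam s * cs s - sig s * cs (Suc s)) * \<phi> s c) = 0" if c: "c \<noteq> 0" for c
  proof -
    have "0 = Lop (poly H) c" using eq[OF c] by (simp add: Lop_def kap_def)
    also have "poly H = (\<lambda>c. \<Sum>s\<le>n. cs s * \<phi> s c)" by (simp add: fun_eq_iff cs)
    also have "Lop \<dots> c = (\<Sum>s\<le>n. cs s * Lop (\<phi> s) c)" by (rule Lsum) simp
    also have "\<dots> = (\<Sum>s\<le>n. c\<^sup>2 * (lam s * cs s * \<phi> s c)) - (\<Sum>s<n. c\<^sup>2 * (sig s * cs (Suc s) * \<phi> s c))"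
      unfolding lessThan_Suc_atMost[symmetric] sum.lessThan_Suc_shift[of _ n] L0 LS
      by (simp add: sum_subtractf algebra_simps)
    \<comment> \<open>\<open>lam n\<close> is zero, so the top summand drops out and both sums run
      over \<open>s < n\<close>.\<close>
    also have "(\<Sum>s\<le>n. c\<^sup>2 * (lam s * cs s * \<phi> s c)) = (\<Sum>s<n. c\<^sup>2 * (lam s * cs s * \<phi> s c))"
      unfolding lessThan_Suc_atMost[symmetric] by (simp add: lam_def)
    also have "\<dots> - (\<Sum>s<n. c\<^sup>2 * (sig s * cs (Suc s) * \<phi> s c)) =
      c\<^sup>2 * (\<Sum>s<n. (lam s * cs s - sig s * cs (Suc s)) * \<phi> s c)"
      by (simp add: sum_subtractf[symmetric] sum_distrib_left algebra_simps)
    finally show ?thesis using c by simp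
  qed
  note sum0 = this
  \<comment> \<open>At the node \<open>a * t ^ s\<close>, which is nonzero as \<open>sum0\<close>
    requires, all basis elements of index above \<open>s\<close> vanish, and the coefficients of
    index below \<open>s\<close> vanish by induction. \<open>\<phi> s\<close> itself does not vanish
    there because no \<open>t ^ k\<close> with \<open>1 \<le> k \<le> n\<close> equals 1.\<close>
  have rec: "lam s * cs s = sig s * cs (Suc s)" if "s < n" for s
    using that
  proof (induction s rule: less_induct)
    case (less s)
    have "a * t ^ s \<noteq> 0" using a t by simp
    from sum0[OF this] have "0 = (\<Sum>m<n. (lam m * cs m - sig m * cs (Suc m)) * \<phi> m (a * t ^ s))" by simp
    also have "\<dots> = (\<Sum>m<n. if m = s then (lam m * cs m - sig m * cs (Suc m)) * \<phi> m (a * t ^ s) else 0)"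
    proof (intro sum.cong refl)
      fix m assume m: "m \<in> {..<n}"
      have "\<phi> m (a * t ^ s) = 0" if "m > s" using that by (auto simp: \<phi>_def prod_zero_iff)
      moreover have "lam m * cs m - sig m * cs (Suc m) = 0" if "m < s" using less that by simp
      ultimately show "(lam m * cs m - sig m * cs (Suc m)) * \<phi> m (a * t ^ s) =
        (if m = s then (lam m * cs m - sig m * cs (Suc m)) * \<phi> m (a * t ^ s) else 0)"
        by (cases m s rule: linorder_cases) auto
    qed
    also have "\<dots> = (lam s * cs s - sig s * cs (Suc s)) * \<phi> s (a * t ^ s)"
      using less.prems by simp
    finally have "lam s * cs s - sig s * cs (Suc s) = 0 \<or> \<phi> s (a * t ^ s) = 0" by auto
    moreover have "\<phi> s (a * t ^ s) \<noteq> 0"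
    proof
      assume "\<phi> s (a * t ^ s) = 0"
      then obtain l where l: "l < s" "a * t ^ s = a * t ^ l" by (auto simp: \<phi>_def prod_zero_iff)
      hence "t ^ (l + (s - l)) = t ^ l" using a by simp
      hence "t ^ (s - l) = 1" using t by (simp add: power_add)
      moreover have "s - l \<in> {1..n}" using l less.prems by auto
      ultimately show False using t1 by blast
    qed
    ultimately show ?case by simp
  qed
  have "cs 0 * (\<Prod>s<m. lam s) = (\<Prod>s<m. sig s) * cs m" if "m \<le> n" for m
    using that
  proof (induction m)
    case (Suc m)
    have "cs 0 * (\<Prod>s<Suc m. lam s) = (cs 0 * (\<Prod>s<m. lam s)) * lam m" by simp
    also have "\<dots> = (\<Prod>s<m. sig s) * (lam m * cs m)" using Suc by simp
    also have "lam m * cs m = sig m * cs (Suc m)" using rec Suc.prems by simp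
    finally show ?case by simp
  qed simp
  from this[of n] have "cs 0 * (\<Prod>s<n. lam s) = (\<Prod>s<n. sig s) * coeff H n" by (simp add: csn)
  moreover have "poly H a = cs 0"
  proof -
    have "\<phi> s a = 0" if "s > 0" for s
      using that by (auto simp: \<phi>_def prod_zero_iff intro!: bexI[of _ 0])
    hence "poly H a = (\<Sum>s\<le>n. if s = 0 then cs s * \<phi> s a else 0)"
      unfolding cs by (intro sum.cong) auto
    also have "\<dots> = cs 0" by (simp add: \<phi>_def)
    finally show ?thesis .
  qed
  ultimately show ?thesis unfolding lam_def sig_def by simp
qed

section \<open>Estimates along geometric progressions\<close>

text \<open>A ratio test: beyond some \<open>M\<close> the ratio stays below
  \<open>\<sigma>\<close>, and the finitely many earlier values enter the constant
  \<open>K\<close>.\<close>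

lemma geometric_bound_of_ratio:
  fixes y r :: "nat \<Rightarrow> real"
  assumes y: "\<And>m. 0 \<le> y m" and rec: "\<And>m. y (Suc m) \<le> r m * y m"
    and r: "r \<longlonglongrightarrow> r0" "r0 < \<sigma>" and \<sigma>: "\<sigma> > 0"
  shows "\<exists>K. \<forall>m. y m \<le> K * \<sigma> ^ m"
proof -
  have "eventually (\<lambda>m. r m < \<sigma>) sequentially"
    using r by (rule order_tendstoD)
  then obtain M where M: "\<And>m. m \<ge> M \<Longrightarrow> r m < \<sigma>"
    by (auto simp: eventually_sequentially)
  define K where "K = (\<Sum>m\<le>M. y m / \<sigma> ^ m)"
  have base: "y m \<le> K * \<sigma> ^ m" if "m \<le> M" for m
  proof -
    have "y m / \<sigma> ^ m \<le> K"
      unfolding K_def using that y \<sigma> by (intro member_le_sum) auto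
    thus ?thesis using \<sigma> by (simp add: field_simps)
  qed
  have "y (M + k) \<le> K * \<sigma> ^ (M + k)" for k
  proof (induction k)
    case 0
    show ?case using base[of M] by simp
  next
    case (Suc k)
    have "y (M + Suc k) \<le> r (M + k) * y (M + k)" using rec[of "M + k"] by simp
    also have "\<dots> \<le> \<sigma> * y (M + k)"
      using M[of "M + k"] y by (intro mult_right_mono) (auto intro: less_imp_le)
    also have "\<dots> \<le> \<sigma> * (K * \<sigma> ^ (M + k))"
      using Suc \<sigma> by (intro mult_left_mono) auto
    finally show ?case by (simp add: mult_ac)
  qed
  hence "y m \<le> K * \<sigma> ^ m" for m
    using base[of m] by (metis le_add_diff_inverse nat_le_linear)
  thus ?thesis by blast
qed

lemma tendsto_imp_norm_bound:
  fixes f :: "nat \<Rightarrow> 'a :: real_normed_vector"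
  assumes "f \<longlonglongrightarrow> l" shows "\<exists>K>0. \<forall>m. norm (f m) \<le> K"
  using convergent_imp_Bseq[of f] assms unfolding convergent_def Bseq_def by blast

lemma int_norm_bound:
  fixes f :: "int \<Rightarrow> 'a :: real_normed_vector"
  assumes "(\<lambda>m. f (int m)) \<longlonglongrightarrow> l1" "(\<lambda>m. f (- int m)) \<longlonglongrightarrow> l2"
  shows "\<exists>K>0. \<forall>m. norm (f m) \<le> K"
proof -
  obtain K1 K2 where K: "K1 > 0" "\<And>m. norm (f (int m)) \<le> K1" "\<And>m. norm (f (- int m)) \<le> K2"
    using tendsto_imp_norm_bound[OF assms(1)] tendsto_imp_norm_bound[OF assms(2)] by blast
  have "norm (f m) \<le> max K1 K2" for m
  proof (cases "m \<ge> 0")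
    case True
    thus ?thesis using K(2)[of "nat m"] by simp
  next
    case False
    thus ?thesis using K(3)[of "nat (- m)"] by simp
  qed
  thus ?thesis using K(1) by (intro exI[of _ "max K1 K2"]) auto
qed

context q_base
begin

lemma norm_Q_powi: "norm (Q powi m) = q powi m"
  using q_pos by (simp add: norm_power_int)

text \<open>The triangle inequality in each factor. The bound sees \<open>a\<close> only through
  \<open>A\<close>, so it is a majorant uniform in the parameters when these tend to 0.\<close>

lemma qpoch_norm_le:
  assumes "norm a \<le> A" shows "norm (qpoch q a) \<le> norm (qpoch q (of_real (- A)))"
proof (rule LIMSEQ_le)
  have A: "A \<ge> 0" using norm_ge_zero assms by (rule order.trans)
  show "(\<lambda>n. norm (\<Prod>i<n. 1 - Q ^ i * a)) \<longlonglongrightarrow> norm (qpoch q a)"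
    by (intro tendsto_norm qpoch_partial_tendsto)
  show "(\<lambda>n. norm (\<Prod>i<n. 1 - Q ^ i * of_real (- A))) \<longlonglongrightarrow> norm (qpoch q (of_real (- A)))"
    by (intro tendsto_norm qpoch_partial_tendsto)
  have "norm (\<Prod>i<n. 1 - Q ^ i * a) \<le> norm (\<Prod>i<n. 1 - Q ^ i * of_real (- A))" for n
    unfolding prod_norm[symmetric]
  proof (intro prod_mono conjI norm_ge_zero)
    fix i
    have "norm (1 - Q ^ i * a) \<le> 1 + q ^ i * norm a"
      using norm_triangle_ineq4[of 1 "Q ^ i * a"] q_pos by (simp add: norm_mult norm_power)
    also have "\<dots> \<le> 1 + q ^ i * A" using assms q_pos by simp
    also have "\<dots> = norm (complex_of_real (1 + q ^ i * A))"
      unfolding norm_of_real using A q_pos by (subst abs_of_nonneg) auto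
    also have "complex_of_real (1 + q ^ i * A) = 1 - Q ^ i * of_real (- A)" by simp
    finally show "norm (1 - Q ^ i * a) \<le> norm (1 - Q ^ i * complex_of_real (- A))" .
  qed
  thus "\<exists>N. \<forall>n\<ge>N. norm (\<Prod>i<n. 1 - Q ^ i * a) \<le> norm (\<Prod>i<n. 1 - Q ^ i * of_real (- A))"
    by blast
qed

text \<open>The quotient tends to \<open>t\<close> for \<open>m\<close> towards plus infinity and to
  1 for \<open>m\<close> towards minus infinity. A pole on the lattice contributes the value 0 by
  the convention for division, so the bound holds for every \<open>m\<close>.\<close>

lemma moebius_lattice_bound:
  assumes "c \<noteq> 0" shows "\<exists>K>0. \<forall>m. norm ((c * Q powi m - t) / (c * Q powi m - 1)) \<le> K"
proof (rule int_norm_bound)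
  have "(\<lambda>m. (c * Q ^ m - t) / (c * Q ^ m - 1)) \<longlonglongrightarrow> (0 - t) / (0 - 1)"
    by (intro tendsto_intros mult_Q_power_tendsto_0) auto
  thus "(\<lambda>m. (c * Q powi int m - t) / (c * Q powi int m - 1)) \<longlonglongrightarrow> (0 - t) / (0 - 1)"
    by simp
  have "(\<lambda>m. (c - t * Q ^ m) / (c - 1 * Q ^ m)) \<longlonglongrightarrow> (c - 0) / (c - 0)"
    by (intro tendsto_intros mult_Q_power_tendsto_0) (use assms in auto)
  moreover have "(c - t * Q ^ m) / (c - 1 * Q ^ m) = (c * Q powi (- int m) - t) / (c * Q powi (- int m) - 1)" for m
    by (simp add: power_int_minus divide_simps)
  ultimately show "(\<lambda>m. (c * Q powi (- int m) - t) / (c * Q powi (- int m) - 1)) \<longlonglongrightarrow> (c - 0) / (c - 0)"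
    by simp
qed

end

text \<open>
  The coordinates are labelled so that those proportional to \<open>x1\<close> have labels in \<open>{1..n}\<close> and those
  proportional to \<open>x2\<close> have labels above \<open>n\<close>. Then removing the last coordinate of the first block
  of \<open>\<zeta>_i\<close> and the last coordinate of the second block of \<open>\<zeta>_(i-1)\<close> leaves the same set of labels,
  and the order of the coordinates is the order of the labels.
\<close>

locale q_selberg = q_base +
  fixes t b1 b2 :: complex and n :: nat
  assumes t_nonzero [simp]: "t \<noteq> 0" and b_nonzero: "b1 \<noteq> 0" "b2 \<noteq> 0" and n_pos: "n \<ge> 1"
    and qpoch_t: "\<And>k. k \<in> {1..n} \<Longrightarrow> qpoch q (t ^ k) \<noteq> 0"
    and conv0: "q * norm t ^ (2 * (n - 1)) < 1"
begin

definition phi :: "complex \<Rightarrow> complex \<Rightarrow> complex \<Rightarrow> complex" where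
  "phi \<alpha>1 \<alpha>2 z = qpoch q (Q * \<alpha>1 * z) * qpoch q (Q * \<alpha>2 * z) / (qpoch q (b1 * z) * qpoch q (b2 * z))"

text \<open>This is the maximum of 1 and \<open>norm t powi (2 * m)\<close>, written with a base
  that depends on the sign of \<open>m\<close>. Products of such one-variable weights decouple the
  pair factors.\<close>

definition gw :: "int \<Rightarrow> real" where
  "gw m = (if m \<ge> 0 then max 1 (norm t) powi (2 * m) else min 1 (norm t) powi (2 * m))"

text \<open>\<open>tmin\<close> and \<open>tmax\<close> are the minimum and the maximum of
  \<open>norm t\<close> to the power \<open>2 * i - 2\<close> over \<open>1 \<le> i \<le> n\<close>,
  attained at \<open>i = 1\<close> or \<open>i = n\<close>. The two families of convergence
  conditions thus become one bound with \<open>tmax\<close> and one with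
  \<open>tmin\<close>.\<close>

definition tmin :: real where "tmin = min 1 (norm t) ^ (2 * (n - 1))"

definition tmax :: real where "tmax = max 1 (norm t) ^ (2 * (n - 1))"

lemma tmin_pos: "tmin > 0"
  by (simp add: tmin_def)

lemma tmax_ge_1: "tmax \<ge> 1"
  unfolding tmax_def by (rule one_le_power) simp

lemma q_tmax: "q * tmax < 1"
proof (cases "norm t \<le> 1")
  case True
  thus ?thesis using q_less_1 by (simp add: tmax_def max_def)
next
  case False
  thus ?thesis using conv0 by (simp add: tmax_def max_def)
qed

lemma gw_ge_1: "gw m \<ge> 1"
proof (cases "m \<ge> 0")
  case True
  hence "gw m = max 1 (norm t) ^ (2 * nat m)" by (simp add: gw_def power_int_def nat_mult_distrib)
  thus ?thesis by (simp only:) (rule one_le_power, simp)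
next
  case False
  define k where "k = nat (- m)"
  have m: "2 * m = - int (2 * k)" using False by (simp add: k_def)
  have "gw m = inverse (min 1 (norm t) ^ (2 * k))"
    using False unfolding gw_def m power_int_minus power_int_of_nat by simp
  moreover have "min 1 (norm t) ^ (2 * k) \<le> 1" by (intro power_le_one) auto
  moreover have "min 1 (norm t) ^ (2 * k) > 0" by simp
  ultimately show ?thesis by (simp add: one_le_inverse_iff)
qed

lemma gw_pow_nonneg: "gw (int m) ^ (n - 1) = tmax ^ m"
proof -
  have "gw (int m) = max 1 (norm t) ^ (2 * m)"
    unfolding gw_def by (simp add: power_int_def nat_mult_distrib)
  thus ?thesis by (simp add: tmax_def power_mult[symmetric] mult_ac)
qed

lemma gw_pow_nonpos: "gw (- int m) ^ (n - 1) = 1 / tmin ^ m"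
proof -
  have "gw (- int m) = inverse (min 1 (norm t) ^ (2 * m))"
  proof (cases "m = 0")
    case True thus ?thesis by (simp add: gw_def)
  next
    case False
    have "2 * (- int m) = - int (2 * m)" by simp
    thus ?thesis using False unfolding gw_def by (simp only: power_int_minus power_int_of_nat) simp
  qed
  thus ?thesis by (simp add: tmin_def power_mult[symmetric] mult_ac field_simps)
qed

lemma norm_t_powi_le_gw: "norm t powi (2 * m) \<le> gw m"
proof (cases "m \<ge> 0")
  case True
  hence "norm t powi (2 * m) = norm t ^ (2 * nat m)" by (simp add: power_int_def nat_mult_distrib)
  also have "\<dots> \<le> max 1 (norm t) ^ (2 * nat m)" by (intro power_mono) auto
  also have "\<dots> = gw m" using True by (simp add: gw_def power_int_def nat_mult_distrib)
  finally show ?thesis .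
next
  case False
  define k where "k = nat (- m)"
  have m: "2 * m = - int (2 * k)" using False by (simp add: k_def)
  have "norm t powi (2 * m) = inverse (norm t ^ (2 * k))"
    unfolding m power_int_minus power_int_of_nat ..
  also have "\<dots> \<le> inverse (min 1 (norm t) ^ (2 * k))"
    by (intro le_imp_inverse_le power_mono) auto
  also have "\<dots> = gw m" using False unfolding gw_def m power_int_minus power_int_of_nat by simp
  finally show ?thesis .
qed

lemma gw_mono_nonneg: "0 \<le> x \<Longrightarrow> x \<le> y \<Longrightarrow> gw x \<le> gw y"
  unfolding gw_def by (auto intro!: power_int_increasing)

text \<open>Taking the minimum with a nonnegative exponent does not increase the weight of the other
  exponent. Hence one of the two weights may be replaced by 1, which spares a coordinate whose
  exponent runs to plus infinity.\<close>

lemma gw_min_le: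
  assumes "g1 = gw x \<or> (g1 = 1 \<and> 0 \<le> x)" "g2 = gw y \<or> (g2 = 1 \<and> 0 \<le> y)"
    "g1 = gw x \<or> g2 = gw y"
  shows "norm t powi (2 * min x y) \<le> g1 * g2"
proof -
  have "gw (min x y) \<le> g1 * g2"
  proof -
    have 1: "gw (min x y) \<le> gw x" if "0 \<le> y"
      using that gw_mono_nonneg[of "min x y" x] by (cases "x \<ge> 0") (auto simp: min_def)
    have 2: "gw (min x y) \<le> gw y" if "0 \<le> x"
      using that gw_mono_nonneg[of "min x y" y] by (cases "y \<ge> 0") (auto simp: min_def)
    have 3: "gw (min x y) \<le> gw x * gw y"
    proof (cases "x \<le> y")
      case True
      have "gw x * 1 \<le> gw x * gw y"
        using gw_ge_1[of y] gw_ge_1[of x] by (intro mult_left_mono) auto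
      thus ?thesis using True by (simp add: min_def)
    next
      case False
      have "1 * gw y \<le> gw x * gw y"
        using gw_ge_1[of y] gw_ge_1[of x] by (intro mult_right_mono) auto
      thus ?thesis using False by (simp add: min_def)
    qed
    show ?thesis using assms 1 2 3 by auto
  qed
  thus ?thesis using norm_t_powi_le_gw order.trans by blast
qed

text \<open>For \<open>x \<le> y\<close> the argument of \<open>pair_fun\<close> runs towards 0; for
  \<open>x > y\<close> the backward formula converts \<open>t powi (2 * x)\<close> into
  \<open>t powi (2 * y)\<close>. Both cases leave the minimum in the exponent. Within a block only
  \<open>x \<le> y\<close> occurs, and there the theta values of the backward formula may
  vanish.\<close>

lemma pair_lattice_bound:
  assumes "c \<noteq> 0" and "\<not> same \<Longrightarrow> qtheta q (t * c) \<noteq> 0 \<and> qtheta q (t / c) \<noteq> 0"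
  shows "\<exists>K>0. \<forall>x y. (same \<longrightarrow> x \<le> y) \<longrightarrow>
    norm (t powi (2 * x) * pair_fun t (c * Q powi (y - x))) \<le> K * norm t powi (2 * min x y)"
proof -
  obtain K1 where K1: "K1 > 0" "\<And>m. norm (pair_fun t (c * Q ^ m)) \<le> K1"
    using tendsto_imp_norm_bound[OF pair_fun_tendsto_1] by blast
  obtain K2 where K2: "K2 > 0" "\<And>m. norm (pair_fun t (1 / c * Q ^ m)) \<le> K2"
    using tendsto_imp_norm_bound[OF pair_fun_tendsto_1] by blast
  define K where "K = max K1 (norm (pair_conn t c) * K2)"
  have "norm (t powi (2 * x) * pair_fun t (c * Q powi (y - x))) \<le> K * norm t powi (2 * min x y)"
    if "same \<longrightarrow> x \<le> y" for x y
  proof (cases "x \<le> y")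
    case True
    have "c * Q powi (y - x) = c * Q ^ nat (y - x)" using True by (simp add: power_int_def)
    hence "norm (pair_fun t (c * Q powi (y - x))) \<le> K"
      unfolding K_def using K1(2)[of "nat (y - x)"] by (simp only: le_max_iff_disj simp_thms)
    thus ?thesis using True
      by (simp add: norm_mult norm_power_int mult.commute[of K] mult_left_mono zero_le_power_int)
  next
    case False
    hence ns: "\<not> same" using that by blast
    define m where "m = nat (x - y)"
    have x: "2 * x = 2 * y + int (2 * m)" and yx: "y - x = - int m" using False by (simp_all add: m_def)
    have "t powi (2 * x) * pair_fun t (c * Q powi (y - x)) =
        t powi (2 * y) * (t ^ (2 * m) * pair_fun t (c / Q ^ m))"
      unfolding x yx by (simp add: power_int_add power_int_minus divide_inverse del: of_nat_mult)
    also have "t ^ (2 * m) * pair_fun t (c / Q ^ m) = pair_conn t c * pair_fun t (1 / c * Q ^ m)"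
      using assms ns by (intro pair_fun_backward) auto
    also have "norm (t powi (2 * y) * \<dots>) \<le> norm t powi (2 * y) * K"
    proof -
      have "norm (pair_conn t c * pair_fun t (1 / c * Q ^ m)) \<le> norm (pair_conn t c) * K2"
        unfolding norm_mult by (intro mult_left_mono K2) auto
      also have "\<dots> \<le> K" by (simp add: K_def)
      finally show ?thesis
        unfolding norm_mult[of "t powi (2 * y)"] norm_power_int by (intro mult_left_mono) (auto intro: zero_le_power_int)
    qed
    finally show ?thesis using False by (simp add: min_def mult_ac)
  qed
  thus ?thesis using K1(1) by (intro exI[of _ K]) (auto simp: K_def)
qed

lemma phi_tendsto_1: "(\<lambda>m. phi \<alpha>1 \<alpha>2 (\<xi> * Q ^ m)) \<longlonglongrightarrow> 1"
proof -
  have "(\<lambda>m. qpoch q (Q * \<alpha>1 * \<xi> * Q ^ m) * qpoch q (Q * \<alpha>2 * \<xi> * Q ^ m) /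
      (qpoch q (b1 * \<xi> * Q ^ m) * qpoch q (b2 * \<xi> * Q ^ m))) \<longlonglongrightarrow> 1 * 1 / (1 * 1)"
    by (intro tendsto_intros qpoch_tendsto_1) auto
  thus ?thesis by (simp add: phi_def mult_ac)
qed

definition phi_maj :: "real \<Rightarrow> real \<Rightarrow> complex \<Rightarrow> real" where
  "phi_maj A1 A2 z = norm (qpoch q (of_real (- (q * A1 * norm z)))) *
     norm (qpoch q (of_real (- (q * A2 * norm z)))) / norm (qpoch q (b1 * z) * qpoch q (b2 * z))"

lemma phi_maj_nonneg: "phi_maj A1 A2 z \<ge> 0"
  by (simp add: phi_maj_def)

lemma phi_le_maj:
  assumes "norm \<alpha>1 \<le> A1" "norm \<alpha>2 \<le> A2"
  shows "norm (phi \<alpha>1 \<alpha>2 z) \<le> phi_maj A1 A2 z"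
proof -
  have "norm (qpoch q (Q * \<alpha> * z)) \<le> norm (qpoch q (of_real (- (q * A * norm z))))"
    if "norm \<alpha> \<le> A" for \<alpha> A
  proof (rule qpoch_norm_le)
    have "norm (Q * \<alpha> * z) = q * norm \<alpha> * norm z" using q_pos by (simp add: norm_mult)
    also have "\<dots> \<le> q * A * norm z" using q_pos that by (intro mult_right_mono mult_left_mono) auto
    finally show "norm (Q * \<alpha> * z) \<le> q * A * norm z" .
  qed
  note le = this
  show ?thesis unfolding phi_def phi_maj_def norm_divide norm_mult[of "qpoch q (Q * _ * z)"]
    by (intro divide_right_mono mult_mono le assms norm_ge_zero)
qed

lemma phi_maj_bound_nonneg: "\<exists>K>0. \<forall>m. phi_maj A1 A2 (\<xi> * Q ^ m) \<le> K"
proof -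
  have "(\<lambda>m. norm (qpoch q (of_real (- (q * A1 * norm \<xi>)) * Q ^ m)) *
     norm (qpoch q (of_real (- (q * A2 * norm \<xi>)) * Q ^ m)) /
      norm (qpoch q (b1 * \<xi> * Q ^ m) * qpoch q (b2 * \<xi> * Q ^ m))) \<longlonglongrightarrow>
       norm (1 :: complex) * norm (1 :: complex) / norm (1 * 1 :: complex)"
    by (intro tendsto_intros qpoch_tendsto_1) auto
  moreover have eq: "complex_of_real (- (q * A * norm (\<xi> * Q ^ m))) = of_real (- (q * A * norm \<xi>)) * Q ^ m" for A m
    using q_pos by (simp add: norm_mult norm_power)
  ultimately have "(\<lambda>m. phi_maj A1 A2 (\<xi> * Q ^ m)) \<longlonglongrightarrow> norm (1 :: complex) * norm (1 :: complex) / norm (1 * 1 :: complex)"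
    unfolding phi_maj_def eq by (simp only: mult.assoc)
  from tendsto_imp_norm_bound[OF this] show ?thesis
    using phi_maj_nonneg by auto
qed

text \<open>One step outwards adds one factor to each of the four products, and the quotient of
  these factors tends to \<open>q\<^sup>2 * (A1 * A2) / (norm b1 * norm b2)\<close>.\<close>

lemma phi_maj_bound_nonpos:
  assumes \<xi>: "\<xi> \<noteq> 0" and A: "A1 \<ge> 0" "A2 \<ge> 0"
    and b: "\<And>m. qpoch q (b1 * (\<xi> / Q ^ m)) \<noteq> 0" "\<And>m. qpoch q (b2 * (\<xi> / Q ^ m)) \<noteq> 0"
    and \<sigma>: "q\<^sup>2 * (A1 * A2) / (norm b1 * norm b2) < \<sigma>"
  shows "\<exists>K. \<forall>m. phi_maj A1 A2 (\<xi> / Q ^ m) \<le> K * \<sigma> ^ m"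
proof (rule geometric_bound_of_ratio)
  define r where "r = (\<lambda>m. (q ^ m + A1 * norm \<xi>) * (q ^ m + A2 * norm \<xi>) /
      (norm (Q ^ m - b1 * \<xi> / Q) * norm (Q ^ m - b2 * \<xi> / Q)))"
  show "phi_maj A1 A2 (\<xi> / Q ^ m) \<ge> 0" for m by (rule phi_maj_nonneg)
  show "phi_maj A1 A2 (\<xi> / Q ^ Suc m) \<le> r m * phi_maj A1 A2 (\<xi> / Q ^ m)" for m
  proof -
    have num: "norm (qpoch q (of_real (- (q * A * norm (\<xi> / Q ^ Suc m))))) =
        (q ^ m + A * norm \<xi>) / q ^ m * norm (qpoch q (of_real (- (q * A * norm (\<xi> / Q ^ m)))))"
      if "A \<ge> 0" for A
    proof -
      have 1: "complex_of_real (- (q * A * norm (\<xi> / Q ^ Suc m))) = of_real (- (A * norm \<xi> / q ^ m))"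
        using q_pos by (simp add: norm_divide norm_power norm_mult)
      have 2: "Q * of_real (- (A * norm \<xi> / q ^ m)) = complex_of_real (- (q * A * norm (\<xi> / Q ^ m)))"
        using q_pos by (simp add: norm_divide norm_power)
      have "norm (1 - complex_of_real (- (A * norm \<xi> / q ^ m))) = norm (complex_of_real (1 + A * norm \<xi> / q ^ m))"
        by simp
      also have "\<dots> = (q ^ m + A * norm \<xi>) / q ^ m"
        unfolding norm_of_real using q_pos that by (subst abs_of_nonneg) (auto simp: field_simps)
      finally show ?thesis
        unfolding 1 qpoch_rec[of "of_real (- (A * norm \<xi> / q ^ m))"] norm_mult 2 by simp
    qed
    have den: "norm (qpoch q (b * (\<xi> / Q ^ Suc m))) =
        norm (Q ^ m - b * \<xi> / Q) / q ^ m * norm (qpoch q (b * (\<xi> / Q ^ m)))" for b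
    proof -
      have 1: "1 - b * (\<xi> / Q ^ Suc m) = (Q ^ m - b * \<xi> / Q) / Q ^ m"
        by (simp add: field_simps)
      have 2: "Q * (b * (\<xi> / Q ^ Suc m)) = b * (\<xi> / Q ^ m)" by simp
      show ?thesis
        unfolding qpoch_rec[of "b * (\<xi> / Q ^ Suc m)"] norm_mult 1 2
        using q_pos by (simp add: norm_divide norm_power)
    qed
    have "phi_maj A1 A2 (\<xi> / Q ^ Suc m) = r m * phi_maj A1 A2 (\<xi> / Q ^ m)"
      unfolding phi_maj_def norm_mult num[OF A(1)] num[OF A(2)] den r_def
      using q_pos by (simp add: mult_ac)
    thus ?thesis by simp
  qed
  have lim0: "(\<lambda>m. q ^ m) \<longlonglongrightarrow> 0"
    using q_pos q_less_1 by (intro LIMSEQ_power_zero) auto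
  have "r \<longlonglongrightarrow> (0 + A1 * norm \<xi>) * (0 + A2 * norm \<xi>) / (norm (0 - b1 * \<xi> / Q) * norm (0 - b2 * \<xi> / Q))"
    unfolding r_def
    by (intro tendsto_intros lim0 Q_power_tendsto_0) (use b_nonzero \<xi> in auto)
  moreover have "(0 + A1 * norm \<xi>) * (0 + A2 * norm \<xi>) / (norm (0 - b1 * \<xi> / Q) * norm (0 - b2 * \<xi> / Q)) =
      q\<^sup>2 * (A1 * A2) / (norm b1 * norm b2)"
    using \<xi> q_pos b_nonzero by (simp add: norm_mult norm_divide field_simps power2_eq_square)
  ultimately show "r \<longlonglongrightarrow> q\<^sup>2 * (A1 * A2) / (norm b1 * norm b2)" by simp
  show "q\<^sup>2 * (A1 * A2) / (norm b1 * norm b2) < \<sigma>" by fact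
  have "0 \<le> q\<^sup>2 * (A1 * A2) / (norm b1 * norm b2)" using A by simp
  thus "\<sigma> > 0" using \<sigma> by linarith
qed

text \<open>What one coordinate contributes besides \<open>phi\<close>: the factor
  \<open>q powi m\<close> of the measure, its share \<open>gw m\<close> in each of its
  \<open>n - 1\<close> pairs, and for \<open>e = 1\<close> the size of a linear factor such as
  \<open>z - c\<close>. The bare sum corresponds to \<open>e = 0\<close>.\<close>

definition lat_wt :: "nat \<Rightarrow> complex \<Rightarrow> int \<Rightarrow> real" where
  "lat_wt e \<xi> m = q powi m * (1 + norm \<xi> * q powi m) ^ e * gw m ^ (n - 1)"

lemma lat_wt_nonneg: "lat_wt e \<xi> m \<ge> 0"
  unfolding lat_wt_def using q_pos gw_ge_1[of m]
  by (intro mult_nonneg_nonneg zero_le_power add_nonneg_nonneg) (auto intro: zero_le_power_int order.trans[of 0 1])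

lemma lat_wt_nonneg_bound: "lat_wt e \<xi> (int m) \<le> (1 + norm \<xi>) ^ e * (q * tmax) ^ m"
proof -
  have "norm \<xi> * q ^ m \<le> norm \<xi> * 1"
    using q_pos q_less_1 by (intro mult_left_mono power_le_one) auto
  hence "(1 + norm \<xi> * q ^ m) ^ e \<le> (1 + norm \<xi>) ^ e"
    using q_pos by (intro power_mono) auto
  hence "q ^ m * (1 + norm \<xi> * q ^ m) ^ e * tmax ^ m \<le> q ^ m * (1 + norm \<xi>) ^ e * tmax ^ m"
    using q_pos tmax_ge_1 by (intro mult_right_mono mult_left_mono) auto
  thus ?thesis unfolding lat_wt_def gw_pow_nonneg by (simp add: power_mult_distrib mult_ac)
qed

lemma lat_wt_nonpos_bound:
  assumes "e \<le> 1"
  shows "lat_wt e \<xi> (- int m) \<le> (1 + norm \<xi>) ^ e / (q ^ Suc e * tmin) ^ m"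
proof -
  have "1 \<le> 1 / q ^ m" using q_pos q_less_1 by (simp add: power_le_one)
  hence "1 + norm \<xi> * (1 / q ^ m) \<le> (1 + norm \<xi>) * (1 / q ^ m)"
    by (simp add: add_divide_distrib)
  hence "(1 + norm \<xi> * (1 / q ^ m)) ^ e \<le> ((1 + norm \<xi>) * (1 / q ^ m)) ^ e"
    using q_pos by (intro power_mono) auto
  hence "(1 / q ^ m) * (1 + norm \<xi> * (1 / q ^ m)) ^ e * (1 / tmin ^ m) \<le>
      (1 / q ^ m) * ((1 + norm \<xi>) * (1 / q ^ m)) ^ e * (1 / tmin ^ m)"
    using q_pos tmin_pos by (intro mult_right_mono mult_left_mono) auto
  also have "\<dots> = (1 + norm \<xi>) ^ e / (q ^ Suc e * tmin) ^ m"
    by (simp add: power_mult_distrib power_divide power_mult[symmetric] mult_ac)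
  finally show ?thesis unfolding lat_wt_def gw_pow_nonpos by (simp add: power_int_minus divide_inverse)
qed

lemma phi_maj_wt_nonneg:
  "\<exists>K>0. \<forall>m. phi_maj A1 A2 (\<xi> * Q powi int m) * lat_wt e \<xi> (int m) \<le> K * (q * tmax) ^ m"
proof -
  obtain K where K: "K > 0" "\<And>m. phi_maj A1 A2 (\<xi> * Q ^ m) \<le> K"
    using phi_maj_bound_nonneg by blast
  have "phi_maj A1 A2 (\<xi> * Q ^ m) * lat_wt e \<xi> (int m) \<le> K * ((1 + norm \<xi>) ^ e * (q * tmax) ^ m)" for m
    using K phi_maj_nonneg lat_wt_nonneg lat_wt_nonneg_bound by (intro mult_mono) (auto intro: less_imp_le)
  moreover have "K * (1 + norm \<xi>) ^ e > 0" using K by (intro mult_pos_pos zero_less_power add_pos_nonneg) auto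
  ultimately show ?thesis
    by (intro exI[of _ "K * (1 + norm \<xi>) ^ e"]) (auto simp: mult_ac)
qed

text \<open>Finitely many of the indices \<open>m \<ge> - int M\<close> are negative, and these
  enter the constant. This is the estimate for sums truncated from below, with \<open>A1\<close> and
  \<open>A2\<close> arbitrary.\<close>

lemma phi_maj_wt_bounded_below:
  "\<exists>K>0. \<forall>m. m \<ge> - int M \<longrightarrow> phi_maj A1 A2 (\<xi> * Q powi m) * lat_wt e \<xi> m \<le> K * (q * tmax) ^ nat \<bar>m\<bar>"
proof -
  obtain K where K: "K > 0" "\<And>m. phi_maj A1 A2 (\<xi> * Q powi int m) * lat_wt e \<xi> (int m) \<le> K * (q * tmax) ^ m"
    using phi_maj_wt_nonneg by blast
  have pos: "q * tmax > 0" using q_pos tmax_ge_1 by simp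
  define h where "h = (\<lambda>m. phi_maj A1 A2 (\<xi> * Q powi m) * lat_wt e \<xi> m / (q * tmax) ^ nat \<bar>m\<bar>)"
  have h: "h m \<ge> 0" for m
    unfolding h_def using pos phi_maj_nonneg lat_wt_nonneg by simp
  define K' where "K' = K + (\<Sum>m\<in>{- int M..0}. h m)"
  have "h m \<le> K'" if "m \<ge> - int M" for m
  proof (cases "m \<ge> 0")
    case True
    hence "h m \<le> K" using K(2)[of "nat m"] pos by (simp add: h_def divide_le_eq)
    also have "\<dots> \<le> K'" unfolding K'_def using h by (simp add: sum_nonneg)
    finally show ?thesis .
  next
    case False
    hence "h m \<le> (\<Sum>m\<in>{- int M..0}. h m)" using that h by (intro member_le_sum) auto
    thus ?thesis using K(1) by (simp add: K'_def)
  qed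
  moreover have "K' > 0" unfolding K'_def using K(1) h by (intro add_pos_nonneg sum_nonneg) auto
  ultimately show ?thesis using pos
    by (intro exI[of _ K']) (auto simp: h_def divide_le_eq)
qed

text \<open>Towards infinity \<open>phi\<close> changes by the ratio
  \<open>q\<^sup>2 * (A1 * A2) / (norm b1 * norm b2)\<close> per step, while \<open>lat_wt\<close>
  grows by at most \<open>1 / (q ^ Suc e * tmin)\<close>. The assumption says that the product is
  below 1; since a linear factor costs one power of \<open>q\<close>, it contains
  \<open>q ^ (1 - e)\<close>.\<close>

lemma phi_maj_wt_conv:
  assumes \<xi>: "\<xi> \<noteq> 0" and A: "A1 \<ge> 0" "A2 \<ge> 0" and e: "e \<le> 1"
    and b: "\<And>m. qpoch q (b1 * (\<xi> * Q powi m)) \<noteq> 0" "\<And>m. qpoch q (b2 * (\<xi> * Q powi m)) \<noteq> 0"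
    and conv: "q ^ (1 - e) * (A1 * A2) < norm b1 * norm b2 * tmin"
  shows "\<exists>K \<rho>. K > 0 \<and> 0 < \<rho> \<and> \<rho> < 1 \<and>
    (\<forall>m. phi_maj A1 A2 (\<xi> * Q powi m) * lat_wt e \<xi> m \<le> K * \<rho> ^ nat \<bar>m\<bar>)"
proof -
  obtain K1 where K1: "K1 > 0" "\<And>m. phi_maj A1 A2 (\<xi> * Q powi int m) * lat_wt e \<xi> (int m) \<le> K1 * (q * tmax) ^ m"
    using phi_maj_wt_nonneg by blast
  have "q\<^sup>2 * (A1 * A2) = q ^ Suc e * (q ^ (1 - e) * (A1 * A2))"
    using e by (cases e) (auto simp: power2_eq_square)
  also have "\<dots> < q ^ Suc e * (norm b1 * norm b2 * tmin)"
    using conv q_pos by (intro mult_strict_left_mono) auto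
  finally have "q\<^sup>2 * (A1 * A2) / (norm b1 * norm b2) < q ^ Suc e * tmin"
    using b_nonzero by (simp add: divide_less_eq mult_ac)
  \<comment> \<open>\<open>\<sigma>\<close> leaves room on both sides: the ratio test asks for a
    number strictly above the limit ratio, and \<open>\<rho>2\<close> has to stay strictly below
    1.\<close>
  from dense[OF this] obtain \<sigma> where \<sigma>: "q\<^sup>2 * (A1 * A2) / (norm b1 * norm b2) < \<sigma>" "\<sigma> < q ^ Suc e * tmin"
    by blast
  have "0 \<le> q\<^sup>2 * (A1 * A2) / (norm b1 * norm b2)" using A by simp
  hence \<sigma>0: "\<sigma> > 0" using \<sigma> by linarith
  have eqm: "\<xi> / Q ^ m = \<xi> * Q powi (- int m)" for m
    by (simp add: power_int_minus divide_inverse)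
  obtain K2 where K2: "\<And>m. phi_maj A1 A2 (\<xi> / Q ^ m) \<le> K2 * \<sigma> ^ m"
    using phi_maj_bound_nonpos[OF \<xi> A _ _ \<sigma>(1)] b unfolding eqm by blast
  define \<rho>2 where "\<rho>2 = \<sigma> / (q ^ Suc e * tmin)"
  have pos: "q ^ Suc e * tmin > 0" using q_pos tmin_pos by simp
  have \<rho>2: "0 < \<rho>2" "\<rho>2 < 1" using \<sigma>0 \<sigma>(2) pos by (auto simp: \<rho>2_def)
  have neg: "phi_maj A1 A2 (\<xi> * Q powi (- int m)) * lat_wt e \<xi> (- int m) \<le> (\<bar>K2\<bar> * (1 + norm \<xi>) ^ e) * \<rho>2 ^ m" for m
  proof -
    have "phi_maj A1 A2 (\<xi> * Q powi (- int m)) * lat_wt e \<xi> (- int m) \<le>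
        (\<bar>K2\<bar> * \<sigma> ^ m) * ((1 + norm \<xi>) ^ e / (q ^ Suc e * tmin) ^ m)"
    proof (intro mult_mono lat_wt_nonpos_bound e lat_wt_nonneg)
      have "K2 * \<sigma> ^ m \<le> \<bar>K2\<bar> * \<sigma> ^ m" using \<sigma>0 by (intro mult_right_mono) auto
      thus "phi_maj A1 A2 (\<xi> * Q powi - int m) \<le> \<bar>K2\<bar> * \<sigma> ^ m" using K2[of m] unfolding eqm by linarith
    qed (use \<sigma>0 in auto)
    thus ?thesis by (simp add: \<rho>2_def power_divide mult_ac)
  qed
  define \<rho> where "\<rho> = max (q * tmax) \<rho>2"
  define K where "K = max K1 (\<bar>K2\<bar> * (1 + norm \<xi>) ^ e)"
  have "phi_maj A1 A2 (\<xi> * Q powi m) * lat_wt e \<xi> m \<le> K * \<rho> ^ nat \<bar>m\<bar>" for m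
  proof (cases "m \<ge> 0")
    case True
    have "phi_maj A1 A2 (\<xi> * Q powi m) * lat_wt e \<xi> m \<le> K1 * (q * tmax) ^ nat m"
      using K1(2)[of "nat m"] True by simp
    also have "\<dots> \<le> K * \<rho> ^ nat m"
      using K1(1) q_pos tmax_ge_1 by (intro mult_mono power_mono) (auto simp: K_def \<rho>_def)
    finally show ?thesis using True by simp
  next
    case False
    have "phi_maj A1 A2 (\<xi> * Q powi m) * lat_wt e \<xi> m \<le> (\<bar>K2\<bar> * (1 + norm \<xi>) ^ e) * \<rho>2 ^ nat (- m)"
      using neg[of "nat (- m)"] False by simp
    also have "\<dots> \<le> K * \<rho> ^ nat (- m)"
      using \<rho>2 K1(1) by (intro mult_mono power_mono) (auto simp: K_def \<rho>_def)
    finally show ?thesis using False by simp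
  qed
  moreover have "K > 0" "\<rho> > 0" "\<rho> < 1"
    using K1 \<rho>2 q_tmax by (auto simp: K_def \<rho>_def)
  ultimately show ?thesis by blast
qed

end

section \<open>Sums over chambers\<close>

text \<open>The pairs containing \<open>k\<close> come from the row of \<open>k\<close> and from one
  entry in each earlier row; they merge into one product over the other indices, in which the
  smaller index stands first.\<close>

lemma prod_pairs_remove:
  fixes f :: "nat \<Rightarrow> nat \<Rightarrow> 'a :: comm_monoid_mult"
  assumes I: "finite I" and k: "k \<in> I"
  shows "(\<Prod>j\<in>I. \<Prod>l\<in>{l\<in>I. j < l}. f j l) =
    (\<Prod>j\<in>I-{k}. \<Prod>l\<in>{l\<in>I-{k}. j < l}. f j l) * (\<Prod>j\<in>I-{k}. if j < k then f j k else f k j)"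
proof -
  have inner: "(\<Prod>l\<in>{l\<in>I. j < l}. f j l) =
      (\<Prod>l\<in>{l\<in>I-{k}. j < l}. f j l) * (if j < k then f j k else 1)" if "j \<in> I - {k}" for j
  proof (cases "j < k")
    case True
    have "{l\<in>I. j < l} = insert k {l\<in>I-{k}. j < l}" using True k by auto
    thus ?thesis using I True by (simp add: mult.commute)
  next
    case False
    have "{l\<in>I. j < l} = {l\<in>I-{k}. j < l}" using False that by auto
    thus ?thesis using False by simp
  qed
  have eq: "{l\<in>I. k < l} = {l\<in>I-{k}. k < l}" by auto
  have row: "(\<Prod>l\<in>{l\<in>I. k < l}. f k l) = (\<Prod>j\<in>I-{k}. if k < j then f k j else 1)"
    unfolding eq by (rule prod.inter_filter) (use I in simp)
  have "(\<Prod>j\<in>I. \<Prod>l\<in>{l\<in>I. j < l}. f j l) =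
      (\<Prod>l\<in>{l\<in>I. k < l}. f k l) * (\<Prod>j\<in>I-{k}. \<Prod>l\<in>{l\<in>I. j < l}. f j l)"
    using I k by (rule prod.remove)
  also have "(\<Prod>j\<in>I-{k}. \<Prod>l\<in>{l\<in>I. j < l}. f j l) =
      (\<Prod>j\<in>I-{k}. \<Prod>l\<in>{l\<in>I-{k}. j < l}. f j l) * (\<Prod>j\<in>I-{k}. if j < k then f j k else 1)"
    unfolding prod.distrib[symmetric] by (intro prod.cong inner refl)
  also have "(\<Prod>l\<in>{l\<in>I. k < l}. f k l) * \<dots> =
      (\<Prod>j\<in>I-{k}. \<Prod>l\<in>{l\<in>I-{k}. j < l}. f j l) *
      ((\<Prod>j\<in>I-{k}. if k < j then f k j else 1) * (\<Prod>j\<in>I-{k}. if j < k then f j k else 1))"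
    unfolding row by (simp only: mult_ac)
  also have "(\<Prod>j\<in>I-{k}. if k < j then f k j else 1) * (\<Prod>j\<in>I-{k}. if j < k then f j k else 1) =
      (\<Prod>j\<in>I-{k}. if j < k then f j k else f k j)"
    unfolding prod.distrib[symmetric] by (intro prod.cong) auto
  finally show ?thesis .
qed

text \<open>Each index lies in \<open>card I - 1\<close> pairs, which is the origin of the exponent
  \<open>n - 1\<close> of \<open>gw\<close>.\<close>

lemma prod_pairs_weights:
  fixes g :: "nat \<Rightarrow> 'a :: comm_monoid_mult"
  assumes "finite I"
  shows "(\<Prod>j\<in>I. \<Prod>l\<in>{l\<in>I. j < l}. g j * g l) = (\<Prod>j\<in>I. g j ^ (card I - 1))"
  using assms
proof (induction I rule: finite_induct)
  case (insert k I)
  have "(\<Prod>j\<in>insert k I. \<Prod>l\<in>{l\<in>insert k I. j < l}. g j * g l) =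
     (\<Prod>j\<in>I. \<Prod>l\<in>{l\<in>I. j < l}. g j * g l) * (\<Prod>j\<in>I. if j < k then g j * g k else g k * g j)"
    using prod_pairs_remove[of "insert k I" k "\<lambda>j l. g j * g l"] insert by simp
  also have "(\<Prod>j\<in>I. if j < k then g j * g k else g k * g j) = (\<Prod>j\<in>I. g j * g k)"
    by (intro prod.cong) (auto simp: mult.commute)
  also have "\<dots> = (\<Prod>j\<in>I. g j) * g k ^ card I"
    by (simp add: prod.distrib)
  also have "(\<Prod>j\<in>I. \<Prod>l\<in>{l\<in>I. j < l}. g j * g l) = (\<Prod>j\<in>I. g j ^ (card I - 1))"
    by (rule insert.IH)
  also have "(\<Prod>j\<in>I. g j ^ (card I - 1)) * ((\<Prod>j\<in>I. g j) * g k ^ card I) =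
     (\<Prod>j\<in>I. g j ^ (card I - 1) * g j) * g k ^ card I"
    by (simp add: prod.distrib mult.assoc)
  also have "(\<Prod>j\<in>I. g j ^ (card I - 1) * g j) = (\<Prod>j\<in>I. g j ^ card I)"
  proof (intro prod.cong refl)
    fix j assume "j \<in> I"
    hence "card I > 0" using insert(1) by (auto simp: card_gt_0_iff)
    hence "card I = Suc (card I - 1)" by simp
    thus "g j ^ (card I - 1) * g j = g j ^ card I" by (metis power_Suc2)
  qed
  finally show ?case using insert by (simp add: mult.commute)
qed simp

section \<open>Sums over boxes exhausting the lattice\<close>

lemma summable_on_int_geometric:
  assumes "0 < \<rho>" "\<rho> < (1 :: real)"
  shows "(\<lambda>m::int. \<rho> ^ nat \<bar>m\<bar>) summable_on UNIV"
proof -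
  have geo: "(\<lambda>m. \<rho> ^ m) summable_on (UNIV :: nat set)"
    using assms by (intro norm_summable_imp_summable_on) (simp add: summable_geometric)
  have "(\<lambda>m::int. \<rho> ^ nat \<bar>m\<bar>) summable_on range int"
    by (subst summable_on_reindex) (use geo in \<open>auto simp: o_def\<close>)
  moreover have "(\<lambda>m::int. \<rho> ^ nat \<bar>m\<bar>) summable_on range (\<lambda>k. - int k)"
    by (subst summable_on_reindex) (use geo in \<open>auto simp: o_def inj_on_def\<close>)
  ultimately have "(\<lambda>m::int. \<rho> ^ nat \<bar>m\<bar>) summable_on (range int \<union> range (\<lambda>k. - int k))"
    by (rule summable_on_union)
  moreover have "range int \<union> range (\<lambda>k. - int k) = UNIV"
  proof -
    have "m \<in> range int \<union> range (\<lambda>k. - int k)" for m :: int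
      by (cases m rule: int_cases2) auto
    thus ?thesis by blast
  qed
  ultimately show ?thesis by simp
qed

lemma summable_on_prod_int_geometric:
  assumes "finite I" "0 < \<rho>" "\<rho> < (1 :: real)"
  shows "(\<lambda>\<nu>. \<Prod>j\<in>I. \<rho> ^ nat \<bar>\<nu> j\<bar>) summable_on (PiE I (\<lambda>_. UNIV :: int set))"
proof -
  have "(\<lambda>m::int. norm (\<rho> ^ nat \<bar>m\<bar>)) summable_on UNIV"
    using summable_on_int_geometric[OF assms(2,3)] assms(2) by simp
  hence "Infinite_Set_Sum.abs_summable_on (\<lambda>m::int. \<rho> ^ nat \<bar>m\<bar>) UNIV"
    by (simp only: abs_summable_equivalent)
  hence "Infinite_Set_Sum.abs_summable_on (\<lambda>\<nu>. \<Prod>j\<in>I. \<rho> ^ nat \<bar>\<nu> j\<bar>) (PiE I (\<lambda>_. UNIV :: int set))"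
    using assms(1) by (intro abs_summable_on_prod_PiE) auto
  hence "(\<lambda>\<nu>. norm (\<Prod>j\<in>I. \<rho> ^ nat \<bar>\<nu> j\<bar>)) summable_on (PiE I (\<lambda>_. UNIV :: int set))"
    by (simp only: abs_summable_equivalent)
  thus ?thesis by (rule abs_summable_summable)
qed

abbreviation box :: "nat set \<Rightarrow> nat \<Rightarrow> (nat \<Rightarrow> int) set" where
  "box I M \<equiv> PiE I (\<lambda>_. {- int M..int M})"

text \<open>The summand may depend on \<open>M\<close>. This is meant for boundary terms, where one
  coordinate is fixed at the moving edge of the box while the others are summed.\<close>

lemma sum_box_tendsto:
  fixes f :: "nat \<Rightarrow> (nat \<Rightarrow> int) \<Rightarrow> complex"
  assumes I: "finite I"
    and lim: "\<And>\<nu>. \<nu> \<in> PiE I (\<lambda>_. UNIV) \<Longrightarrow> (\<lambda>M. f M \<nu>) \<longlonglongrightarrow> g \<nu>"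
    and bd: "\<And>M \<nu>. \<nu> \<in> PiE I (\<lambda>_. UNIV) \<Longrightarrow> norm (f M \<nu>) \<le> h \<nu>"
    and h: "h summable_on PiE I (\<lambda>_. UNIV)"
  shows "(\<lambda>M. \<Sum>\<nu>\<in>box I M. f M \<nu>) \<longlonglongrightarrow> infsum g (PiE I (\<lambda>_. UNIV))"
proof -
  define X :: "(nat \<Rightarrow> int) set" where "X = PiE I (\<lambda>_. UNIV)"
  define f' where "f' = (\<lambda>M \<nu>. if \<nu> \<in> box I M then f M \<nu> else 0)"
  have sub: "box I M \<subseteq> X" for M by (auto simp: X_def PiE_def)
  have "infsum (f' M) X = (\<Sum>\<nu>\<in>box I M. f M \<nu>)" for M
  proof -
    have "infsum (f' M) X = infsum (f M) (box I M)"
      by (rule infsum_cong_neutral) (use sub in \<open>auto simp: f'_def\<close>)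
    thus ?thesis using I by (simp add: finite_PiE)
  qed
  moreover have "(\<lambda>M. infsum (f' M) X) \<longlonglongrightarrow> infsum g X"
  proof (rule infsum_dominated_tendsto)
    fix \<nu> assume \<nu>: "\<nu> \<in> X"
    have "eventually (\<lambda>M. \<bar>\<nu> j\<bar> \<le> int M) sequentially" for j
      by (rule eventually_sequentiallyI[of "nat \<bar>\<nu> j\<bar>"]) linarith
    hence "eventually (\<lambda>M. \<forall>j\<in>I. \<bar>\<nu> j\<bar> \<le> int M) sequentially"
      using I by (simp add: eventually_ball_finite_distrib)
    hence "eventually (\<lambda>M. f' M \<nu> = f M \<nu>) sequentially"
    proof eventually_elim
      case (elim M)
      have "\<nu> \<in> box I M"
      proof (rule PiE_I)
        show "\<nu> j \<in> {- int M..int M}" if "j \<in> I" for j using elim that by (auto simp: abs_le_iff)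
      qed (use \<nu> in \<open>auto simp: X_def PiE_def extensional_def\<close>)
      thus ?case by (simp add: f'_def)
    qed
    moreover have "(\<lambda>M. f M \<nu>) \<longlonglongrightarrow> g \<nu>" using \<nu> lim by (simp add: X_def)
    ultimately show "(\<lambda>M. f' M \<nu>) \<longlonglongrightarrow> g \<nu>" by (simp add: tendsto_cong)
    fix M
    have le: "norm (f M \<nu>) \<le> h \<nu>" using \<nu> bd by (simp add: X_def)
    have "0 \<le> h \<nu>" using le norm_ge_zero[of "f M \<nu>"] by linarith
    with le show "norm (f' M \<nu>) \<le> h \<nu>" by (simp add: f'_def)
  qed (use h in \<open>simp add: X_def\<close>)
  ultimately show ?thesis by (simp add: X_def)
qed

lemma sum_int_telescope:
  fixes f :: "int \<Rightarrow> 'a :: ab_group_add"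
  shows "(\<Sum>x\<in>{- int M..int M}. f x - f (x + 1)) = f (- int M) - f (int M + 1)"
proof (induction M)
  case (Suc M)
  have "{- int (Suc M)..int (Suc M)} = insert (- int (Suc M)) (insert (int (Suc M)) {- int M..int M})" by auto
  thus ?case using Suc by (simp add: algebra_simps)
qed simp

lemma sum_box_telescope:
  fixes g :: "(nat \<Rightarrow> int) \<Rightarrow> complex"
  assumes I: "finite I" and k: "k \<in> I"
  shows "(\<Sum>\<nu>\<in>box I M. g \<nu> - g (\<nu>(k := \<nu> k + 1))) =
    (\<Sum>\<nu>\<in>box (I - {k}) M. g (\<nu>(k := - int M)) - g (\<nu>(k := int M + 1)))"
proof -
  have I': "I = insert k (I - {k})" using k by blast
  have inj: "inj_on (\<lambda>(y, \<nu>). \<nu>(k := y)) ({- int M..int M} \<times> box (I - {k}) M)"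
    by (rule inj_combinator) simp
  have "box I M = (\<lambda>(y, \<nu>). \<nu>(k := y)) ` ({- int M..int M} \<times> box (I - {k}) M)"
    by (subst I', subst PiE_insert_eq) simp
  hence "(\<Sum>\<nu>\<in>box I M. g \<nu> - g (\<nu>(k := \<nu> k + 1))) =
      (\<Sum>(y, \<nu>)\<in>{- int M..int M} \<times> box (I - {k}) M. g (\<nu>(k := y)) - g (\<nu>(k := y + 1)))"
    using inj by (simp add: sum.reindex o_def case_prod_unfold)
  also have "\<dots> = (\<Sum>\<nu>\<in>box (I - {k}) M. \<Sum>y\<in>{- int M..int M}. g (\<nu>(k := y)) - g (\<nu>(k := y + 1)))"
    by (simp add: sum.cartesian_product[symmetric] sum.swap[of _ "box (I - {k}) M"])
  also have "\<dots> = (\<Sum>\<nu>\<in>box (I - {k}) M. g (\<nu>(k := - int M)) - g (\<nu>(k := int M + 1)))"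
    by (intro sum.cong refl sum_int_telescope)
  finally show ?thesis .
qed

context q_selberg
begin

text \<open>The pair factor on the lattice without the constant \<open>\<xi> j\<close> to the power
  \<open>2 \<tau>\<close>. Only integer powers of \<open>t\<close> remain, so that logarithms can be
  ignored until the sums \<open>J\<close> are treated.\<close>

definition vv :: "(nat \<Rightarrow> complex) \<Rightarrow> (nat \<Rightarrow> int) \<Rightarrow> nat \<Rightarrow> nat \<Rightarrow> complex" where
  "vv \<xi> \<nu> j k = t powi (2 * \<nu> j) * pair_fun t (\<xi> k / \<xi> j * Q powi (\<nu> k - \<nu> j))"

definition pv :: "(nat \<Rightarrow> complex) \<Rightarrow> (nat \<Rightarrow> int) \<Rightarrow> nat \<Rightarrow> nat \<Rightarrow> complex" where
  "pv \<xi> \<nu> k j = (if j < k then vv \<xi> \<nu> j k else vv \<xi> \<nu> k j)"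

definition pairs :: "(nat \<Rightarrow> complex) \<Rightarrow> nat set \<Rightarrow> (nat \<Rightarrow> int) \<Rightarrow> complex" where
  "pairs \<xi> I \<nu> = (\<Prod>j\<in>I. \<Prod>k\<in>{k\<in>I. j < k}. vv \<xi> \<nu> j k)"

definition wt1 :: "complex \<Rightarrow> complex \<Rightarrow> complex \<Rightarrow> int \<Rightarrow> complex" where
  "wt1 \<alpha>1 \<alpha>2 x m = Q powi m * phi \<alpha>1 \<alpha>2 (x * Q powi m)"

definition DD :: "complex \<Rightarrow> complex \<Rightarrow> (nat \<Rightarrow> complex) \<Rightarrow> nat set \<Rightarrow> (nat \<Rightarrow> int) \<Rightarrow> complex" where
  "DD \<alpha>1 \<alpha>2 \<xi> I \<nu> = (\<Prod>j\<in>I. wt1 \<alpha>1 \<alpha>2 (\<xi> j) (\<nu> j)) * pairs \<xi> I \<nu>"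

text \<open>The comparison of a label with \<open>n\<close> tells its block; exponents of different
  blocks are not compared.\<close>

definition ch :: "nat set \<Rightarrow> (nat \<Rightarrow> int) set" where
  "ch I = {\<nu> \<in> PiE I (\<lambda>_. UNIV). \<forall>j\<in>I. \<forall>k\<in>I. j < k \<and> (j \<le> n \<longleftrightarrow> k \<le> n) \<longrightarrow> \<nu> j \<le> \<nu> k}"

lemma ch_subset: "ch I \<subseteq> PiE I (\<lambda>_. UNIV)"
  by (auto simp: ch_def)

lemma chD: "\<nu> \<in> ch I \<Longrightarrow> j \<in> I \<Longrightarrow> k \<in> I \<Longrightarrow> j < k \<Longrightarrow> (j \<le> n \<longleftrightarrow> k \<le> n) \<Longrightarrow> \<nu> j \<le> \<nu> k"
  by (auto simp: ch_def)

lemma DD_remove: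
  assumes "finite I" "k \<in> I"
  shows "DD \<alpha>1 \<alpha>2 \<xi> I \<nu> =
    DD \<alpha>1 \<alpha>2 \<xi> (I - {k}) \<nu> * wt1 \<alpha>1 \<alpha>2 (\<xi> k) (\<nu> k) * (\<Prod>j\<in>I-{k}. pv \<xi> \<nu> k j)"
proof -
  have "pairs \<xi> I \<nu> = pairs \<xi> (I - {k}) \<nu> * (\<Prod>j\<in>I-{k}. pv \<xi> \<nu> k j)"
    unfolding pairs_def pv_def using assms by (rule prod_pairs_remove)
  moreover have "(\<Prod>j\<in>I. wt1 \<alpha>1 \<alpha>2 (\<xi> j) (\<nu> j)) =
      wt1 \<alpha>1 \<alpha>2 (\<xi> k) (\<nu> k) * (\<Prod>j\<in>I-{k}. wt1 \<alpha>1 \<alpha>2 (\<xi> j) (\<nu> j))"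
    using assms by (rule prod.remove)
  ultimately show ?thesis unfolding DD_def by (simp only: mult_ac)
qed

lemma DD_cong:
  assumes "\<And>j. j \<in> I \<Longrightarrow> \<nu> j = \<nu>' j"
  shows "DD \<alpha>1 \<alpha>2 \<xi> I \<nu> = DD \<alpha>1 \<alpha>2 \<xi> I \<nu>'"
  unfolding DD_def pairs_def vv_def
  using assms by (intro arg_cong2[of _ _ _ _ "(*)"] prod.cong) auto

lemma norm_wt1: "norm (wt1 \<alpha>1 \<alpha>2 x m) = q powi m * norm (phi \<alpha>1 \<alpha>2 (x * Q powi m))"
  by (simp add: wt1_def norm_mult norm_Q_powi)

text \<open>The first order \<open>q\<close>-difference equation of the one-variable weight,
  multiplied out so that zeros of \<open>quad \<alpha>1 \<alpha>2\<close> are harmless. Such zeros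
  occur in the truncated sums.\<close>

lemma phi_Q_mult:
  assumes "qpoch q (b1 * z) \<noteq> 0" "qpoch q (b2 * z) \<noteq> 0"
  shows "phi \<alpha>1 \<alpha>2 (Q * z) * quad \<alpha>1 \<alpha>2 (Q * z) = phi \<alpha>1 \<alpha>2 z * quad b1 b2 z"
proof -
  have a: "qpoch q (Q * \<alpha> * z) = (1 - \<alpha> * (Q * z)) * qpoch q (Q * \<alpha> * (Q * z))" for \<alpha>
    by (subst qpoch_rec) (simp add: mult_ac)
  have b: "qpoch q (b * z) = (1 - b * z) * qpoch q (b * (Q * z))" for b
    by (subst qpoch_rec) (simp add: mult_ac)
  have "1 - b1 * z \<noteq> 0" "1 - b2 * z \<noteq> 0" using assms b[of b1] b[of b2] by auto
  thus ?thesis unfolding phi_def quad_def a b[of b1] b[of b2] by simp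
qed

end

text \<open>One point \<open>\<zeta>_i\<close> in abstract form. Between the blocks, theta
  conditions make all lattice points regular; within a block, regularity comes from the geometric
  spacing and the order of the exponents. By contiguity, leaving the chamber in a single step can be
  detected at a neighbouring label.\<close>

locale q_config = q_selberg +
  fixes \<xi> :: "nat \<Rightarrow> complex" and I :: "nat set"
  assumes finite_I [simp]: "finite I" and card_I: "card I = n"
    and \<xi>_nonzero: "\<And>j. j \<in> I \<Longrightarrow> \<xi> j \<noteq> 0"
    and same_block: "\<And>j k. j \<in> I \<Longrightarrow> k \<in> I \<Longrightarrow> j < k \<Longrightarrow> (j \<le> n \<longleftrightarrow> k \<le> n) \<Longrightarrow>
      \<xi> k = \<xi> j * t ^ (k - j) \<and> k - j < n"
    and cross_block: "\<And>j k. j \<in> I \<Longrightarrow> k \<in> I \<Longrightarrow> j < k \<Longrightarrow> \<not> (j \<le> n \<longleftrightarrow> k \<le> n) \<Longrightarrow>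
      qtheta q (\<xi> k / \<xi> j) \<noteq> 0 \<and> qtheta q (t * (\<xi> k / \<xi> j)) \<noteq> 0 \<and> qtheta q (t / (\<xi> k / \<xi> j)) \<noteq> 0"
    and b_regular: "\<And>j m. j \<in> I \<Longrightarrow> qpoch q (b1 * (\<xi> j * Q powi m)) \<noteq> 0 \<and> qpoch q (b2 * (\<xi> j * Q powi m)) \<noteq> 0"
    and contiguous: "\<And>j k l. j \<in> I \<Longrightarrow> k \<in> I \<Longrightarrow> (j \<le> n \<longleftrightarrow> k \<le> n) \<Longrightarrow> j \<le> l \<Longrightarrow> l \<le> k \<Longrightarrow> l \<in> I"
begin

definition zz :: "(nat \<Rightarrow> int) \<Rightarrow> nat \<Rightarrow> complex" where
  "zz \<nu> j = \<xi> j * Q powi \<nu> j"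

lemma zz_nonzero: "j \<in> I \<Longrightarrow> zz \<nu> j \<noteq> 0"
  using \<xi>_nonzero by (simp add: zz_def)

lemma zz_div: "zz \<nu> k / zz \<nu> j = \<xi> k / \<xi> j * Q powi (\<nu> k - \<nu> j)"
  by (simp add: zz_def power_int_diff)

lemma t_power_lattice_neq_1:
  assumes "d \<in> {1..n}" shows "t ^ d * Q ^ m \<noteq> 1"
  using qpoch_t[OF assms] unfolding qpoch_eq_0_iff by (auto simp: mult.commute)

text \<open>Within a block the ratio is \<open>t ^ (k - j) * Q ^ m\<close> with
  \<open>m \<ge> 0\<close>, so a zero of the denominator would be a zero of
  \<open>qpoch q (t ^ Suc (k - j))\<close>; \<open>k - j < n\<close> keeps this exponent in the
  range of \<open>qpoch_t\<close>. Between the blocks the theta conditions hold along the whole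
  lattice.\<close>

lemma chamber_regular:
  assumes \<nu>: "\<nu> \<in> ch I" and jk: "j \<in> I" "k \<in> I" "j < k"
  shows "zz \<nu> k / zz \<nu> j \<noteq> 1" "qpoch q (t * (zz \<nu> k / zz \<nu> j)) \<noteq> 0" "zz \<nu> j \<noteq> zz \<nu> k"
proof -
  have "zz \<nu> k / zz \<nu> j \<noteq> 1 \<and> qpoch q (t * (zz \<nu> k / zz \<nu> j)) \<noteq> 0"
  proof (cases "j \<le> n \<longleftrightarrow> k \<le> n")
    case True
    from same_block[OF jk True] have d: "\<xi> k / \<xi> j = t ^ (k - j)" "k - j < n"
      using \<xi>_nonzero jk by auto
    have le: "\<nu> j \<le> \<nu> k" using chD[OF \<nu> jk True] .
    define m where "m = nat (\<nu> k - \<nu> j)"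
    have u: "zz \<nu> k / zz \<nu> j = t ^ (k - j) * Q ^ m"
      unfolding zz_div d m_def using le by (simp add: power_int_def)
    have "Q ^ m * t ^ Suc (k - j) = t * (t ^ (k - j) * Q ^ m)" by simp
    moreover have "qpoch q (Q ^ m * t ^ Suc (k - j)) \<noteq> 0"
      using d jk by (intro qpoch_shift_nonzero qpoch_t) auto
    ultimately have "qpoch q (t * (t ^ (k - j) * Q ^ m)) \<noteq> 0" by metis
    moreover have "t ^ (k - j) * Q ^ m \<noteq> 1"
      using d jk by (intro t_power_lattice_neq_1) auto
    ultimately show ?thesis unfolding u by blast
  next
    case False
    have nz: "\<xi> k / \<xi> j \<noteq> 0" using \<xi>_nonzero jk by simp
    from cross_block[OF jk False] show ?thesis
      using qtheta_nonzero_imp_neq_1[OF nz, of "\<nu> k - \<nu> j"]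
        qtheta_nonzero_imp_qpoch[of "t * (\<xi> k / \<xi> j)" "\<nu> k - \<nu> j"] nz
      unfolding zz_div by (auto simp: mult_ac)
  qed
  thus "zz \<nu> k / zz \<nu> j \<noteq> 1" "qpoch q (t * (zz \<nu> k / zz \<nu> j)) \<noteq> 0" by blast+
  thus "zz \<nu> j \<noteq> zz \<nu> k" using zz_nonzero[OF jk(1)] by auto
qed

lemma inj_zz: "\<nu> \<in> ch I \<Longrightarrow> inj_on (zz \<nu>) I"
  by (rule linorder_inj_onI) (use chamber_regular(3) in auto)

lemma zz_distinct: "\<nu> \<in> ch I \<Longrightarrow> j \<in> I \<Longrightarrow> k \<in> I \<Longrightarrow> j \<noteq> k \<Longrightarrow> zz \<nu> k - zz \<nu> j \<noteq> 0"
  using inj_zz[of \<nu>] by (auto simp: inj_on_def)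

text \<open>The weights \<open>g\<close> are left open so that two estimates follow: one with all
  weights equal to \<open>gw\<close>, and one in which a single coordinate with nonnegative exponent
  is exempted.\<close>

lemma pairs_bound:
  "\<exists>K>0. \<forall>\<nu>\<in>ch I. \<forall>g. (\<forall>j\<in>I. g j = gw (\<nu> j) \<or> (g j = 1 \<and> 0 \<le> \<nu> j)) \<longrightarrow>
     (\<forall>j\<in>I. \<forall>l\<in>I. j < l \<longrightarrow> g j = gw (\<nu> j) \<or> g l = gw (\<nu> l)) \<longrightarrow>
     norm (pairs \<xi> I \<nu>) \<le> K * (\<Prod>j\<in>I. g j ^ (n - 1))"
proof -
  have "\<exists>K>0. \<forall>x y. ((j \<le> n \<longleftrightarrow> k \<le> n) \<longrightarrow> x \<le> y) \<longrightarrow>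
      norm (t powi (2 * x) * pair_fun t (\<xi> k / \<xi> j * Q powi (y - x))) \<le> K * norm t powi (2 * min x y)"
    if "j \<in> I" "k \<in> I" "j < k" for j k
    by (rule pair_lattice_bound) (use \<xi>_nonzero cross_block that in auto)
  then obtain K where K: "\<And>j k. j \<in> I \<Longrightarrow> k \<in> I \<Longrightarrow> j < k \<Longrightarrow> K j k > 0"
    "\<And>j k x y. j \<in> I \<Longrightarrow> k \<in> I \<Longrightarrow> j < k \<Longrightarrow> ((j \<le> n \<longleftrightarrow> k \<le> n) \<longrightarrow> x \<le> y) \<Longrightarrow>
      norm (t powi (2 * x) * pair_fun t (\<xi> k / \<xi> j * Q powi (y - x))) \<le> K j k * norm t powi (2 * min x y)"
    by metis
  define K0 where "K0 = (\<Prod>j\<in>I. \<Prod>k\<in>{k\<in>I. j < k}. K j k)"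
  have "norm (pairs \<xi> I \<nu>) \<le> K0 * (\<Prod>j\<in>I. g j ^ (n - 1))"
    if \<nu>: "\<nu> \<in> ch I" and g: "\<forall>j\<in>I. g j = gw (\<nu> j) \<or> (g j = 1 \<and> 0 \<le> \<nu> j)"
      "\<forall>j\<in>I. \<forall>l\<in>I. j < l \<longrightarrow> g j = gw (\<nu> j) \<or> g l = gw (\<nu> l)" for \<nu> g
  proof -
    have "norm (vv \<xi> \<nu> j k) \<le> K j k * (g j * g k)" if jk: "j \<in> I" "k \<in> I" "j < k" for j k
    proof -
      have "norm (vv \<xi> \<nu> j k) \<le> K j k * norm t powi (2 * min (\<nu> j) (\<nu> k))"
        unfolding vv_def using chD[OF \<nu>] jk by (intro K(2)) auto
      also have "\<dots> \<le> K j k * (g j * g k)"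
        using K(1)[OF jk] g jk by (intro mult_left_mono gw_min_le) (auto intro: less_imp_le)
      finally show ?thesis .
    qed
    hence "norm (pairs \<xi> I \<nu>) \<le> (\<Prod>j\<in>I. \<Prod>k\<in>{k\<in>I. j < k}. K j k * (g j * g k))"
      unfolding pairs_def prod_norm[symmetric] by (intro prod_mono conjI prod_nonneg) auto
    also have "\<dots> = K0 * (\<Prod>j\<in>I. \<Prod>k\<in>{k\<in>I. j < k}. g j * g k)"
      by (simp only: prod.distrib K0_def)
    also have "(\<Prod>j\<in>I. \<Prod>k\<in>{k\<in>I. j < k}. g j * g k) = (\<Prod>j\<in>I. g j ^ (n - 1))"
      unfolding card_I[symmetric] by (rule prod_pairs_weights) simp
    finally show ?thesis .
  qed
  moreover have "K0 > 0" unfolding K0_def using K(1) by (intro prod_pos) auto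
  ultimately show ?thesis by blast
qed

lemma pairs_bound_gw: "\<exists>K>0. \<forall>\<nu>\<in>ch I. norm (pairs \<xi> I \<nu>) \<le> K * (\<Prod>j\<in>I. gw (\<nu> j) ^ (n - 1))"
proof -
  obtain K where "K > 0" and K: "\<forall>\<nu>\<in>ch I. \<forall>g. (\<forall>j\<in>I. g j = gw (\<nu> j) \<or> (g j = 1 \<and> 0 \<le> \<nu> j)) \<longrightarrow>
     (\<forall>j\<in>I. \<forall>l\<in>I. j < l \<longrightarrow> g j = gw (\<nu> j) \<or> g l = gw (\<nu> l)) \<longrightarrow>
     norm (pairs \<xi> I \<nu>) \<le> K * (\<Prod>j\<in>I. g j ^ (n - 1))"
    using pairs_bound by blast
  have "norm (pairs \<xi> I \<nu>) \<le> K * (\<Prod>j\<in>I. gw (\<nu> j) ^ (n - 1))" if "\<nu> \<in> ch I" for \<nu>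
    using K[rule_format, OF that, of "\<lambda>j. gw (\<nu> j)"] by simp
  thus ?thesis using \<open>K > 0\<close> by blast
qed

lemma pairs_bound_omit:
  assumes k: "k \<in> I"
  shows "\<exists>K>0. \<forall>\<nu>\<in>ch I. 0 \<le> \<nu> k \<longrightarrow> norm (pairs \<xi> I \<nu>) \<le> K * (\<Prod>j\<in>I-{k}. gw (\<nu> j) ^ (n - 1))"
proof -
  obtain K where "K > 0" and K: "\<forall>\<nu>\<in>ch I. \<forall>g. (\<forall>j\<in>I. g j = gw (\<nu> j) \<or> (g j = 1 \<and> 0 \<le> \<nu> j)) \<longrightarrow>
     (\<forall>j\<in>I. \<forall>l\<in>I. j < l \<longrightarrow> g j = gw (\<nu> j) \<or> g l = gw (\<nu> l)) \<longrightarrow>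
     norm (pairs \<xi> I \<nu>) \<le> K * (\<Prod>j\<in>I. g j ^ (n - 1))"
    using pairs_bound by blast
  have "norm (pairs \<xi> I \<nu>) \<le> K * (\<Prod>j\<in>I-{k}. gw (\<nu> j) ^ (n - 1))" if "\<nu> \<in> ch I" "0 \<le> \<nu> k" for \<nu>
  proof -
    have "(\<Prod>j\<in>I. (if j = k then 1 else gw (\<nu> j)) ^ (n - 1)) = (\<Prod>j\<in>I-{k}. gw (\<nu> j) ^ (n - 1))"
      using k by (subst prod.remove[of _ k]) (auto intro!: prod.cong)
    thus ?thesis
      using K[rule_format, OF that(1), of "\<lambda>j. if j = k then 1 else gw (\<nu> j)"] that(2) by auto
  qed
  thus ?thesis using \<open>K > 0\<close> by blast
qed

text \<open>The bound is demanded only where the summand is nonzero. Convergent parameters and sums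
  truncated by zeros of \<open>phi\<close> are thereby treated alike.\<close>

definition dominated :: "nat \<Rightarrow> complex \<Rightarrow> complex \<Rightarrow> bool" where
  "dominated e \<alpha>1 \<alpha>2 \<longleftrightarrow> (\<exists>K \<rho>. K > 0 \<and> 0 < \<rho> \<and> \<rho> < 1 \<and>
    (\<forall>\<nu>\<in>ch I. DD \<alpha>1 \<alpha>2 \<xi> I \<nu> \<noteq> 0 \<longrightarrow>
      (\<forall>j\<in>I. norm (phi \<alpha>1 \<alpha>2 (zz \<nu> j)) * lat_wt e (\<xi> j) (\<nu> j) \<le> K * \<rho> ^ nat \<bar>\<nu> j\<bar>)))"

lemma DD_bound_aux:
  assumes K: "K > 0" "\<nu> \<in> ch I" "J \<subseteq> I"
    "\<And>j. j \<in> I \<Longrightarrow> norm (phi \<alpha>1 \<alpha>2 (zz \<nu> j)) * lat_wt e (\<xi> j) (\<nu> j) \<le> K * \<rho> ^ nat \<bar>\<nu> j\<bar>"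
  shows "(\<Prod>j\<in>J. norm (wt1 \<alpha>1 \<alpha>2 (\<xi> j) (\<nu> j)) * gw (\<nu> j) ^ (n - 1) * (1 + norm (zz \<nu> j)) ^ e) \<le>
    K ^ card J * (\<Prod>j\<in>J. \<rho> ^ nat \<bar>\<nu> j\<bar>)"
proof -
  have "(\<Prod>j\<in>J. norm (wt1 \<alpha>1 \<alpha>2 (\<xi> j) (\<nu> j)) * gw (\<nu> j) ^ (n - 1) * (1 + norm (zz \<nu> j)) ^ e) =
      (\<Prod>j\<in>J. norm (phi \<alpha>1 \<alpha>2 (zz \<nu> j)) * lat_wt e (\<xi> j) (\<nu> j))"
    by (intro prod.cong refl) (simp add: norm_wt1 lat_wt_def zz_def norm_mult norm_Q_powi mult_ac)
  also have "\<dots> \<le> (\<Prod>j\<in>J. K * \<rho> ^ nat \<bar>\<nu> j\<bar>)"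
    using K lat_wt_nonneg by (intro prod_mono) (auto intro!: mult_nonneg_nonneg)
  also have "\<dots> = K ^ card J * (\<Prod>j\<in>J. \<rho> ^ nat \<bar>\<nu> j\<bar>)" by (simp add: prod.distrib)
  finally show ?thesis .
qed

lemma DD_bound:
  assumes "dominated e \<alpha>1 \<alpha>2"
  shows "\<exists>K \<rho>. K > 0 \<and> 0 < \<rho> \<and> \<rho> < 1 \<and> (\<forall>\<nu>\<in>ch I.
    norm (DD \<alpha>1 \<alpha>2 \<xi> I \<nu>) * (\<Prod>j\<in>I. (1 + norm (zz \<nu> j)) ^ e) \<le> K * (\<Prod>j\<in>I. \<rho> ^ nat \<bar>\<nu> j\<bar>))"
proof -
  obtain K \<rho> where K: "K > 0" "0 < \<rho>" "\<rho> < 1" "\<And>\<nu> j. \<nu> \<in> ch I \<Longrightarrow> DD \<alpha>1 \<alpha>2 \<xi> I \<nu> \<noteq> 0 \<Longrightarrow> j \<in> I \<Longrightarrow>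
      norm (phi \<alpha>1 \<alpha>2 (zz \<nu> j)) * lat_wt e (\<xi> j) (\<nu> j) \<le> K * \<rho> ^ nat \<bar>\<nu> j\<bar>"
    using assms unfolding dominated_def by blast
  obtain K1 where K1: "K1 > 0" "\<And>\<nu>. \<nu> \<in> ch I \<Longrightarrow> norm (pairs \<xi> I \<nu>) \<le> K1 * (\<Prod>j\<in>I. gw (\<nu> j) ^ (n - 1))"
    using pairs_bound_gw by blast
  have "norm (DD \<alpha>1 \<alpha>2 \<xi> I \<nu>) * (\<Prod>j\<in>I. (1 + norm (zz \<nu> j)) ^ e) \<le> (K1 * K ^ n) * (\<Prod>j\<in>I. \<rho> ^ nat \<bar>\<nu> j\<bar>)"
    if \<nu>: "\<nu> \<in> ch I" for \<nu>
  proof (cases "DD \<alpha>1 \<alpha>2 \<xi> I \<nu> = 0")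
    case True
    thus ?thesis using K K1 by (auto intro!: mult_nonneg_nonneg prod_nonneg)
  next
    case False
    have "norm (DD \<alpha>1 \<alpha>2 \<xi> I \<nu>) * (\<Prod>j\<in>I. (1 + norm (zz \<nu> j)) ^ e) =
       norm (pairs \<xi> I \<nu>) * (\<Prod>j\<in>I. norm (wt1 \<alpha>1 \<alpha>2 (\<xi> j) (\<nu> j)) * (1 + norm (zz \<nu> j)) ^ e)"
      unfolding DD_def norm_mult prod_norm[symmetric] prod.distrib by (simp only: mult_ac)
    also have "\<dots> \<le> (K1 * (\<Prod>j\<in>I. gw (\<nu> j) ^ (n - 1))) *
        (\<Prod>j\<in>I. norm (wt1 \<alpha>1 \<alpha>2 (\<xi> j) (\<nu> j)) * (1 + norm (zz \<nu> j)) ^ e)"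
      by (intro mult_right_mono K1 \<nu> prod_nonneg) auto
    also have "\<dots> = K1 * (\<Prod>j\<in>I. norm (wt1 \<alpha>1 \<alpha>2 (\<xi> j) (\<nu> j)) * gw (\<nu> j) ^ (n - 1) * (1 + norm (zz \<nu> j)) ^ e)"
      unfolding prod.distrib by (simp only: mult_ac)
    also have "\<dots> \<le> K1 * (K ^ card I * (\<Prod>j\<in>I. \<rho> ^ nat \<bar>\<nu> j\<bar>))"
      by (intro mult_left_mono DD_bound_aux[OF K(1) \<nu> order.refl]) (use K K1 \<nu> False in auto)
    finally show ?thesis by (simp add: card_I)
  qed
  moreover have "K1 * K ^ n > 0" using K K1 by simp
  ultimately show ?thesis using K(2,3) by blast
qed

text \<open>Division by \<open>q powi \<nu> k\<close> destroys the decay in coordinate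
  \<open>k\<close>, so no growth of \<open>gw (\<nu> k)\<close> may be charged to it. The estimate
  of the pairs that omits \<open>k\<close> and the boundedness of \<open>phi\<close> near 0 give a
  bound uniform in \<open>\<nu> k \<ge> 0\<close>.\<close>

lemma DD_bound_omit:
  assumes "dominated 1 \<alpha>1 \<alpha>2" and k: "k \<in> I"
  shows "\<exists>K \<rho>. K > 0 \<and> 0 < \<rho> \<and> \<rho> < 1 \<and> (\<forall>\<nu>\<in>ch I. 0 \<le> \<nu> k \<longrightarrow>
    norm (DD \<alpha>1 \<alpha>2 \<xi> I \<nu>) / q powi \<nu> k * (\<Prod>j\<in>I-{k}. 1 + norm (zz \<nu> j)) \<le> K * (\<Prod>j\<in>I-{k}. \<rho> ^ nat \<bar>\<nu> j\<bar>))"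
proof -
  obtain K \<rho> where K: "K > 0" "0 < \<rho>" "\<rho> < 1" "\<And>\<nu> j. \<nu> \<in> ch I \<Longrightarrow> DD \<alpha>1 \<alpha>2 \<xi> I \<nu> \<noteq> 0 \<Longrightarrow> j \<in> I \<Longrightarrow>
      norm (phi \<alpha>1 \<alpha>2 (zz \<nu> j)) * lat_wt 1 (\<xi> j) (\<nu> j) \<le> K * \<rho> ^ nat \<bar>\<nu> j\<bar>"
    using assms unfolding dominated_def by blast
  obtain K1 where K1: "K1 > 0" "\<And>\<nu>. \<nu> \<in> ch I \<Longrightarrow> 0 \<le> \<nu> k \<Longrightarrow>
      norm (pairs \<xi> I \<nu>) \<le> K1 * (\<Prod>j\<in>I-{k}. gw (\<nu> j) ^ (n - 1))"
    using pairs_bound_omit[OF k] by blast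
  obtain K2 where K2: "K2 > 0" "\<And>m. norm (phi \<alpha>1 \<alpha>2 (\<xi> k * Q ^ m)) \<le> K2"
    using tendsto_imp_norm_bound[OF phi_tendsto_1] by blast
  have "norm (DD \<alpha>1 \<alpha>2 \<xi> I \<nu>) / q powi \<nu> k * (\<Prod>j\<in>I-{k}. 1 + norm (zz \<nu> j)) \<le>
      (K1 * K2 * K ^ (n - 1)) * (\<Prod>j\<in>I-{k}. \<rho> ^ nat \<bar>\<nu> j\<bar>)"
    if \<nu>: "\<nu> \<in> ch I" "0 \<le> \<nu> k" for \<nu>
  proof (cases "DD \<alpha>1 \<alpha>2 \<xi> I \<nu> = 0")
    case True
    thus ?thesis using K K1 K2 by (auto intro!: mult_nonneg_nonneg prod_nonneg)
  next
    case False
    have "norm (phi \<alpha>1 \<alpha>2 (\<xi> k * Q powi \<nu> k)) \<le> K2"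
      using K2(2)[of "nat (\<nu> k)"] \<nu>(2) by (simp add: power_int_def)
    hence wk: "norm (wt1 \<alpha>1 \<alpha>2 (\<xi> k) (\<nu> k)) / q powi \<nu> k \<le> K2"
      using q_pos by (simp add: norm_wt1)
    have "norm (DD \<alpha>1 \<alpha>2 \<xi> I \<nu>) / q powi \<nu> k * (\<Prod>j\<in>I-{k}. 1 + norm (zz \<nu> j)) =
       norm (pairs \<xi> I \<nu>) * (norm (wt1 \<alpha>1 \<alpha>2 (\<xi> k) (\<nu> k)) / q powi \<nu> k) *
        (\<Prod>j\<in>I-{k}. norm (wt1 \<alpha>1 \<alpha>2 (\<xi> j) (\<nu> j)) * (1 + norm (zz \<nu> j)))"
      unfolding DD_def norm_mult prod_norm[symmetric] prod.distrib prod.remove[OF finite_I k]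
      by (simp add: mult_ac)
    also have "\<dots> \<le> (K1 * (\<Prod>j\<in>I-{k}. gw (\<nu> j) ^ (n - 1))) * K2 *
        (\<Prod>j\<in>I-{k}. norm (wt1 \<alpha>1 \<alpha>2 (\<xi> j) (\<nu> j)) * (1 + norm (zz \<nu> j)))"
      using q_pos K1(1) K2(1) gw_ge_1
      by (intro mult_right_mono mult_mono K1 \<nu> wk prod_nonneg mult_nonneg_nonneg)
        (auto intro!: zero_le_power intro: order.trans[of 0 1] divide_nonneg_nonneg zero_le_power_int)
    also have "\<dots> = K1 * K2 * (\<Prod>j\<in>I-{k}. norm (wt1 \<alpha>1 \<alpha>2 (\<xi> j) (\<nu> j)) * gw (\<nu> j) ^ (n - 1) * (1 + norm (zz \<nu> j)) ^ 1)"
      unfolding prod.distrib power_one_right by (simp only: mult_ac)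
    also have "\<dots> \<le> K1 * K2 * (K ^ card (I - {k}) * (\<Prod>j\<in>I-{k}. \<rho> ^ nat \<bar>\<nu> j\<bar>))"
      by (intro mult_left_mono DD_bound_aux[OF K(1) \<nu>(1)]) (use K K1 K2 \<nu> False in auto)
    finally show ?thesis using k by (simp add: card_I mult_ac)
  qed
  moreover have "K1 * K2 * K ^ (n - 1) > 0" using K K1 K2 by simp
  ultimately show ?thesis using K(2,3) by blast
qed

lemma moebius_bound:
  assumes k: "k \<in> I"
  shows "\<exists>K>0. \<forall>\<nu>. norm (\<Prod>j\<in>I-{k}. (zz \<nu> k - t * zz \<nu> j) / (zz \<nu> k - zz \<nu> j)) \<le> K"
proof -
  have "\<exists>K>0. \<forall>m. norm ((\<xi> k / \<xi> j * Q powi m - t) / (\<xi> k / \<xi> j * Q powi m - 1)) \<le> K" if "j \<in> I" for j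
    using \<xi>_nonzero that k by (intro moebius_lattice_bound) auto
  then obtain K where K: "\<And>j. j \<in> I \<Longrightarrow> K j > 0"
      "\<And>j m. j \<in> I \<Longrightarrow> norm ((\<xi> k / \<xi> j * Q powi m - t) / (\<xi> k / \<xi> j * Q powi m - 1)) \<le> K j"
    by metis
  have "norm (\<Prod>j\<in>I-{k}. (zz \<nu> k - t * zz \<nu> j) / (zz \<nu> k - zz \<nu> j)) \<le> (\<Prod>j\<in>I-{k}. K j)" for \<nu>
    unfolding prod_norm[symmetric]
  proof (intro prod_mono conjI norm_ge_zero)
    fix j assume j: "j \<in> I - {k}"
    have nz: "zz \<nu> j \<noteq> 0" using zz_nonzero j by auto
    have "(zz \<nu> k - t * zz \<nu> j) / (zz \<nu> k - zz \<nu> j) = (zz \<nu> k / zz \<nu> j - t) / (zz \<nu> k / zz \<nu> j - 1)"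
    proof -
      have "zz \<nu> k / zz \<nu> j - s = (zz \<nu> k - s * zz \<nu> j) / zz \<nu> j" for s
        using nz by (simp add: field_simps)
      from this[of t] this[of 1] show ?thesis using nz by simp
    qed
    thus "norm ((zz \<nu> k - t * zz \<nu> j) / (zz \<nu> k - zz \<nu> j)) \<le> K j"
      using K(2) j unfolding zz_div by simp
  qed
  moreover have "(\<Prod>j\<in>I-{k}. K j) > 0" using K(1) by (intro prod_pos) auto
  ultimately show ?thesis by blast
qed
lemma vv_eq: "vv \<xi> \<nu> j k = t powi (2 * \<nu> j) * pair_fun t (zz \<nu> k / zz \<nu> j)"
  by (simp add: vv_def zz_div)

section \<open>Telescoping\<close>

text \<open>\<open>Gm\<close> and \<open>Gp\<close> are the summand times the two terms of the
  interpolation formula at the node \<open>zz \<nu> k\<close>, one for each quadratic. They are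
  built so that \<open>Gp\<close> is \<open>Gm\<close> after one step in coordinate
  \<open>k\<close>.\<close>

definition Gm :: "complex \<Rightarrow> complex \<Rightarrow> complex \<Rightarrow> nat \<Rightarrow> (nat \<Rightarrow> int) \<Rightarrow> complex" where
  "Gm \<alpha>1 \<alpha>2 c k \<nu> = DD \<alpha>1 \<alpha>2 \<xi> I \<nu> * (quad \<alpha>1 \<alpha>2 (zz \<nu> k) / zz \<nu> k) *
    (\<Prod>j\<in>I-{k}. (zz \<nu> k - t * zz \<nu> j) / (zz \<nu> k - zz \<nu> j) * (zz \<nu> j - c))"

definition Gp :: "complex \<Rightarrow> complex \<Rightarrow> complex \<Rightarrow> nat \<Rightarrow> (nat \<Rightarrow> int) \<Rightarrow> complex" where
  "Gp \<alpha>1 \<alpha>2 c k \<nu> = DD \<alpha>1 \<alpha>2 \<xi> I \<nu> * (t ^ (n - 1) * quad b1 b2 (zz \<nu> k) / zz \<nu> k) *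
    (\<Prod>j\<in>I-{k}. (t * zz \<nu> k - zz \<nu> j) / (zz \<nu> k - zz \<nu> j) * (zz \<nu> j - c))"

lemma zz_upd: "zz (\<nu>(k := x)) j = (if j = k then \<xi> k * Q powi x else zz \<nu> j)"
  by (simp add: zz_def)

lemma zz_Suc: "\<xi> k * Q powi (\<nu> k + 1) = Q * zz \<nu> k"
  by (simp add: zz_def power_int_add)

text \<open>The cofactors of the interpolation formula are what a pair factor produces under one
  step of one coordinate, up to a factor \<open>t\<close>. The moved coordinate stands in the
  numerator of the ratio if \<open>j < k\<close> and in the denominator otherwise; in the latter
  case \<open>t powi (2 * \<nu> k)\<close> moves as well and gives \<open>t\<^sup>2\<close>.\<close>

lemma pv_shift:
  assumes \<nu>: "\<nu> \<in> ch I" and \<nu>': "\<nu>(k := \<nu> k + 1) \<in> ch I" and k: "k \<in> I" and j: "j \<in> I - {k}"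
  shows "pv \<xi> (\<nu>(k := \<nu> k + 1)) k j * ((Q * zz \<nu> k - t * zz \<nu> j) / (Q * zz \<nu> k - zz \<nu> j)) =
    t * (pv \<xi> \<nu> k j * ((t * zz \<nu> k - zz \<nu> j) / (zz \<nu> k - zz \<nu> j)))"
proof -
  let ?\<nu>' = "\<nu>(k := \<nu> k + 1)"
  have z': "zz ?\<nu>' k = Q * zz \<nu> k" "zz ?\<nu>' j = zz \<nu> j"
    using j by (auto simp: zz_upd zz_Suc)
  have jI: "j \<in> I" "j \<noteq> k" using j by auto
  have nz: "zz \<nu> k \<noteq> 0" "zz \<nu> j \<noteq> 0" using zz_nonzero k jI by auto
  have neq: "Q * zz \<nu> k - zz \<nu> j \<noteq> 0" "zz \<nu> k - zz \<nu> j \<noteq> 0"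
    using zz_distinct[OF \<nu>' jI(1) k jI(2)] zz_distinct[OF \<nu> jI(1) k jI(2)] by (simp_all add: z')
  show ?thesis
  proof (cases "j < k")
    case True
    define u where "u = zz \<nu> k / zz \<nu> j"
    have zk: "zz \<nu> k = u * zz \<nu> j" using nz by (simp add: u_def)
    have neq': "Q * u - 1 \<noteq> 0" "u - 1 \<noteq> 0" using neq nz unfolding zk by (auto simp: algebra_simps)
    have "pair_fun t (Q * u) * (1 - Q * u / t) = pair_fun t u * ((1 - Q * u) * (1 - t * u) / (1 - u))"
      unfolding u_def by (intro pair_fun_shift chamber_regular \<nu> jI k True)
    hence *: "pair_fun t (Q * u) * ((Q * u - t) / (Q * u - 1)) = t * (pair_fun t u * ((t * u - 1) / (u - 1)))"
    proof -
      assume h: "pair_fun t (Q * u) * (1 - Q * u / t) = pair_fun t u * ((1 - Q * u) * (1 - t * u) / (1 - u))"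
      have "pair_fun t (Q * u) * ((Q * u - t) / (Q * u - 1)) =
          - t * (pair_fun t (Q * u) * (1 - Q * u / t)) / (Q * u - 1)"
        using neq' by (simp add: field_simps)
      also have "\<dots> = t * (pair_fun t u * ((t * u - 1) / (u - 1)))"
        unfolding h using neq' by (simp add: divide_simps) (simp add: algebra_simps)
      finally show ?thesis .
    qed
    have 1: "(Q * zz \<nu> k - t * zz \<nu> j) / (Q * zz \<nu> k - zz \<nu> j) = (Q * u - t) / (Q * u - 1)"
      and 2: "(t * zz \<nu> k - zz \<nu> j) / (zz \<nu> k - zz \<nu> j) = (t * u - 1) / (u - 1)"
    proof -
      have "(a * u * zz \<nu> j - b * zz \<nu> j) / (c * u * zz \<nu> j - zz \<nu> j) = (a * u - b) / (c * u - 1)" for a b c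
      proof -
        have "a * u * zz \<nu> j - b * zz \<nu> j = (a * u - b) * zz \<nu> j" "c * u * zz \<nu> j - zz \<nu> j = (c * u - 1) * zz \<nu> j"
          by (simp_all add: algebra_simps)
        thus ?thesis using nz by simp
      qed
      from this[of Q t Q] this[of t 1 1] show "(Q * zz \<nu> k - t * zz \<nu> j) / (Q * zz \<nu> k - zz \<nu> j) = (Q * u - t) / (Q * u - 1)"
        "(t * zz \<nu> k - zz \<nu> j) / (zz \<nu> k - zz \<nu> j) = (t * u - 1) / (u - 1)"
        unfolding zk by (simp_all add: mult.assoc)
    qed
    have 3: "pv \<xi> ?\<nu>' k j = t powi (2 * \<nu> j) * pair_fun t (Q * u)"
      "pv \<xi> \<nu> k j = t powi (2 * \<nu> j) * pair_fun t u"
      using True jI by (simp_all add: pv_def vv_eq z' u_def)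
    have "t powi (2 * \<nu> j) * (pair_fun t (Q * u) * ((Q * u - t) / (Q * u - 1))) =
        t powi (2 * \<nu> j) * (t * (pair_fun t u * ((t * u - 1) / (u - 1))))"
      unfolding * ..
    thus ?thesis unfolding 1 2 3 by (simp only: mult_ac)
  next
    case False
    hence kj: "k < j" using jI by simp
    define v where "v = zz \<nu> j / zz \<nu> k"
    have zj: "zz \<nu> j = v * zz \<nu> k" using nz by (simp add: v_def)
    have v': "zz ?\<nu>' j / zz ?\<nu>' k = v / Q" unfolding z' v_def by simp
    have neq': "Q - v \<noteq> 0" "1 - v \<noteq> 0" using neq nz unfolding zj by (auto simp: algebra_simps)
    \<comment> \<open>The step multiplies \<open>zz \<nu> k\<close> by \<open>Q\<close> and so
      divides the ratio by \<open>Q\<close>; the shift relation is applied at the moved point, whose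
      ratio is \<open>v / Q\<close>.\<close>
    have "pair_fun t (Q * (v / Q)) * (1 - Q * (v / Q) / t) =
        pair_fun t (v / Q) * ((1 - Q * (v / Q)) * (1 - t * (v / Q)) / (1 - v / Q))"
      unfolding v'[symmetric] by (intro pair_fun_shift chamber_regular \<nu>' jI k kj)
    hence h: "pair_fun t v * (1 - v / t) = pair_fun t (v / Q) * ((1 - v) * (1 - t * (v / Q)) / (1 - v / Q))"
      by simp
    have *: "t\<^sup>2 * pair_fun t (v / Q) * ((Q - t * v) / (Q - v)) = t * (pair_fun t v * ((t - v) / (1 - v)))"
    proof -
      have "t * (pair_fun t v * ((t - v) / (1 - v))) = t\<^sup>2 * (pair_fun t v * (1 - v / t)) / (1 - v)"
        using neq' by (simp add: field_simps power2_eq_square)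
      also have "\<dots> = t\<^sup>2 * pair_fun t (v / Q) * ((1 - t * (v / Q)) / (1 - v / Q))"
        unfolding h using neq' by simp
      also have "(1 - t * (v / Q)) / (1 - v / Q) = (Q - t * v) / (Q - v)"
      proof -
        have "1 - s * (v / Q) = (Q - s * v) / Q" for s by (simp add: field_simps)
        from this[of t] this[of 1] show ?thesis by simp
      qed
      finally show ?thesis by simp
    qed
    have 1: "(Q * zz \<nu> k - t * zz \<nu> j) / (Q * zz \<nu> k - zz \<nu> j) = (Q - t * v) / (Q - v)"
      and 2: "(t * zz \<nu> k - zz \<nu> j) / (zz \<nu> k - zz \<nu> j) = (t - v) / (1 - v)"
    proof -
      have "(a * zz \<nu> k - b * (v * zz \<nu> k)) / (c * zz \<nu> k - v * zz \<nu> k) = (a - b * v) / (c - v)" for a b c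
      proof -
        have "a * zz \<nu> k - b * (v * zz \<nu> k) = (a - b * v) * zz \<nu> k" "c * zz \<nu> k - v * zz \<nu> k = (c - v) * zz \<nu> k"
          by (simp_all add: algebra_simps)
        thus ?thesis using nz by simp
      qed
      from this[of Q t Q] this[of t 1 1] show "(Q * zz \<nu> k - t * zz \<nu> j) / (Q * zz \<nu> k - zz \<nu> j) = (Q - t * v) / (Q - v)"
        "(t * zz \<nu> k - zz \<nu> j) / (zz \<nu> k - zz \<nu> j) = (t - v) / (1 - v)"
        unfolding zj by simp_all
    qed
    have 3: "pv \<xi> ?\<nu>' k j = t powi (2 * \<nu> k) * (t\<^sup>2 * pair_fun t (v / Q))"
    proof -
      have "2 * (\<nu> k + 1) = 2 * \<nu> k + 2" by simp
      hence "t powi (2 * (\<nu> k + 1)) = t powi (2 * \<nu> k) * t\<^sup>2"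
        by (simp only: power_int_add[OF disjI1[OF t_nonzero]] power_int_numeral)
      thus ?thesis using False by (simp add: pv_def vv_eq v')
    qed
    have 4: "pv \<xi> \<nu> k j = t powi (2 * \<nu> k) * pair_fun t v"
      using False by (simp add: pv_def vv_eq v_def)
    have "t powi (2 * \<nu> k) * (t\<^sup>2 * pair_fun t (v / Q) * ((Q - t * v) / (Q - v))) =
        t powi (2 * \<nu> k) * (t * (pair_fun t v * ((t - v) / (1 - v))))"
      unfolding * ..
    thus ?thesis unfolding 1 2 3 4 by (simp only: mult_ac)
  qed
qed

text \<open>Every ingredient obeys its own first order equation: \<open>phi_Q_mult\<close> for the
  weight and \<open>pv_shift\<close> for each pair. The \<open>n - 1\<close> factors
  \<open>t\<close> from the pairs give the power of \<open>t\<close> in \<open>Gp\<close>.\<close>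

lemma Gm_shift:
  assumes \<nu>: "\<nu> \<in> ch I" and \<nu>': "\<nu>(k := \<nu> k + 1) \<in> ch I" and k: "k \<in> I"
  shows "Gm \<alpha>1 \<alpha>2 c k (\<nu>(k := \<nu> k + 1)) = Gp \<alpha>1 \<alpha>2 c k \<nu>"
proof -
  let ?\<nu>' = "\<nu>(k := \<nu> k + 1)"
  define D where "D = DD \<alpha>1 \<alpha>2 \<xi> (I - {k}) \<nu>"
  have D': "DD \<alpha>1 \<alpha>2 \<xi> (I - {k}) ?\<nu>' = D"
    unfolding D_def by (rule DD_cong) auto
  have zk: "zz ?\<nu>' k = Q * zz \<nu> k" by (simp add: zz_upd zz_Suc)
  have wt: "wt1 \<alpha>1 \<alpha>2 (\<xi> k) (\<nu> k + 1) * (quad \<alpha>1 \<alpha>2 (Q * zz \<nu> k) / (Q * zz \<nu> k)) =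
      wt1 \<alpha>1 \<alpha>2 (\<xi> k) (\<nu> k) * (quad b1 b2 (zz \<nu> k) / zz \<nu> k)"
  proof -
    have "wt1 \<alpha>1 \<alpha>2 (\<xi> k) (\<nu> k + 1) = Q powi \<nu> k * Q * phi \<alpha>1 \<alpha>2 (Q * zz \<nu> k)"
      by (simp only: wt1_def zz_Suc) (simp add: power_int_add)
    hence "wt1 \<alpha>1 \<alpha>2 (\<xi> k) (\<nu> k + 1) * (quad \<alpha>1 \<alpha>2 (Q * zz \<nu> k) / (Q * zz \<nu> k)) =
       Q powi \<nu> k * (phi \<alpha>1 \<alpha>2 (Q * zz \<nu> k) * quad \<alpha>1 \<alpha>2 (Q * zz \<nu> k)) / zz \<nu> k"
      by simp
    also have "\<dots> = Q powi \<nu> k * (phi \<alpha>1 \<alpha>2 (zz \<nu> k) * quad b1 b2 (zz \<nu> k)) / zz \<nu> k"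
      using b_regular[OF k] by (subst phi_Q_mult) (auto simp: zz_def)
    finally show ?thesis by (simp add: wt1_def zz_def)
  qed
  have "Gm \<alpha>1 \<alpha>2 c k ?\<nu>' = D * (wt1 \<alpha>1 \<alpha>2 (\<xi> k) (\<nu> k + 1) * (quad \<alpha>1 \<alpha>2 (Q * zz \<nu> k) / (Q * zz \<nu> k))) *
      (\<Prod>j\<in>I-{k}. pv \<xi> ?\<nu>' k j * ((Q * zz \<nu> k - t * zz \<nu> j) / (Q * zz \<nu> k - zz \<nu> j)) * (zz \<nu> j - c))"
  proof -
    have "(\<Prod>j\<in>I-{k}. (zz ?\<nu>' k - t * zz ?\<nu>' j) / (zz ?\<nu>' k - zz ?\<nu>' j) * (zz ?\<nu>' j - c)) =
        (\<Prod>j\<in>I-{k}. ((Q * zz \<nu> k - t * zz \<nu> j) / (Q * zz \<nu> k - zz \<nu> j)) * (zz \<nu> j - c))"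
      unfolding zk by (intro prod.cong refl) (auto simp: zz_upd)
    thus ?thesis unfolding Gm_def DD_remove[OF finite_I k] D' zk
      by (simp only: prod.distrib fun_upd_same mult_ac)
  qed
  also have "\<dots> = D * (wt1 \<alpha>1 \<alpha>2 (\<xi> k) (\<nu> k) * (quad b1 b2 (zz \<nu> k) / zz \<nu> k)) *
      (\<Prod>j\<in>I-{k}. t * (pv \<xi> \<nu> k j * ((t * zz \<nu> k - zz \<nu> j) / (zz \<nu> k - zz \<nu> j))) * (zz \<nu> j - c))"
  proof -
    have "(\<Prod>j\<in>I-{k}. pv \<xi> ?\<nu>' k j * ((Q * zz \<nu> k - t * zz \<nu> j) / (Q * zz \<nu> k - zz \<nu> j)) * (zz \<nu> j - c)) =
      (\<Prod>j\<in>I-{k}. t * (pv \<xi> \<nu> k j * ((t * zz \<nu> k - zz \<nu> j) / (zz \<nu> k - zz \<nu> j))) * (zz \<nu> j - c))"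
      by (rule prod.cong) (simp_all only: pv_shift[OF \<nu> \<nu>' k])
    thus ?thesis unfolding wt by (simp only:)
  qed
  also have "\<dots> = Gp \<alpha>1 \<alpha>2 c k \<nu>"
  proof -
    have "card (I - {k}) = n - 1" using k by (simp add: card_I)
    thus ?thesis
      unfolding Gp_def DD_remove[OF finite_I k] D_def[symmetric] prod.distrib prod_constant
      by (simp add: mult_ac)
  qed
  finally show ?thesis .
qed

text \<open>The step leaves the chamber only if the next label of the block carries the same
  exponent. By the spacing of the base values then \<open>t * zz \<nu> k = zz \<nu> (Suc k)\<close>,
  and one factor of \<open>Gp\<close> is zero.\<close>

lemma Gp_boundary:
  assumes \<nu>: "\<nu> \<in> ch I" and \<nu>': "\<nu>(k := \<nu> k + 1) \<notin> ch I" and k: "k \<in> I"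
  shows "Gp \<alpha>1 \<alpha>2 c k \<nu> = 0"
proof -
  let ?\<nu>' = "\<nu>(k := \<nu> k + 1)"
  have "?\<nu>' \<in> PiE I (\<lambda>_. UNIV)" using ch_subset \<nu> k by (auto simp: PiE_def extensional_def)
  then obtain j l where jl: "j \<in> I" "l \<in> I" "j < l" "j \<le> n \<longleftrightarrow> l \<le> n" "?\<nu>' j > ?\<nu>' l"
    using \<nu>' unfolding ch_def by fastforce
  have le: "\<nu> j \<le> \<nu> l" using chD[OF \<nu> jl(1-4)] .
  have jk: "j = k" using jl(5) le by (auto split: if_splits)
  have lk: "l \<noteq> k" using jl jk by auto
  have eq: "\<nu> l = \<nu> k" using jl(5) le jk lk by auto
  have S: "Suc k \<in> I" using contiguous[OF jl(1,2,4), of "Suc k"] jl(3) jk by auto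
  have same: "k \<le> n \<longleftrightarrow> Suc k \<le> n" "Suc k \<le> n \<longleftrightarrow> l \<le> n" using jl(3,4) jk by auto
  have 1: "\<nu> k \<le> \<nu> (Suc k)" using chD[OF \<nu> k S _ same(1)] by simp
  have 2: "\<nu> (Suc k) \<le> \<nu> l"
    using chD[OF \<nu> S jl(2) _ same(2)] jl(3) jk by (cases "l = Suc k") auto
  have "\<nu> (Suc k) = \<nu> k" using 1 2 eq by linarith
  hence "t * zz \<nu> k - zz \<nu> (Suc k) = 0"
    using same_block[OF k S _ same(1)] by (simp add: zz_def)
  hence "(\<Prod>j\<in>I-{k}. (t * zz \<nu> k - zz \<nu> j) / (zz \<nu> k - zz \<nu> j) * (zz \<nu> j - c)) = 0"
    using S by (intro prod_zero) (auto intro!: bexI[of _ "Suc k"])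
  thus ?thesis by (simp add: Gp_def)
qed

text \<open>If a step enters the chamber from outside, the preceding label of the block carries the
  exponent just reached, and the factor of \<open>Gm\<close> belonging to this label is
  zero.\<close>

lemma Gm_boundary:
  assumes \<nu>: "\<nu> \<in> PiE I (\<lambda>_. UNIV)" "\<nu> \<notin> ch I" and \<nu>': "\<nu>(k := \<nu> k + 1) \<in> ch I" and k: "k \<in> I"
  shows "Gm \<alpha>1 \<alpha>2 c k (\<nu>(k := \<nu> k + 1)) = 0"
proof -
  let ?\<nu>' = "\<nu>(k := \<nu> k + 1)"
  obtain j l where jl: "j \<in> I" "l \<in> I" "j < l" "j \<le> n \<longleftrightarrow> l \<le> n" "\<nu> j > \<nu> l"
    using \<nu> unfolding ch_def by fastforce
  have le: "?\<nu>' j \<le> ?\<nu>' l" using chD[OF \<nu>' jl(1-4)] .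
  have lk: "l = k" using jl(5) le by (auto split: if_splits)
  have jk: "j \<noteq> k" using jl lk by auto
  have eq: "\<nu> j = \<nu> k + 1" using jl(5) le jk lk by auto
  define m where "m = k - 1"
  have km: "k = Suc m" using jl(3) lk by (simp add: m_def)
  have S: "m \<in> I" using contiguous[OF jl(1,2,4), of m] jl(3) lk km by auto
  have same: "m \<le> n \<longleftrightarrow> k \<le> n" "j \<le> n \<longleftrightarrow> m \<le> n" using jl(3,4) lk km by auto
  have 1: "?\<nu>' m \<le> ?\<nu>' k" using chD[OF \<nu>' S k _ same(1)] km by simp
  have 2: "?\<nu>' j \<le> ?\<nu>' m"
    using chD[OF \<nu>' jl(1) S _ same(2)] jl(3) lk km by (cases "j = m") auto
  have "?\<nu>' m = ?\<nu>' k" using 1 2 eq jk by (auto simp: km)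
  hence "zz ?\<nu>' k - t * zz ?\<nu>' m = 0"
    using same_block[OF S k _ same(1)] km by (simp add: zz_def)
  hence "(\<Prod>j\<in>I-{k}. (zz ?\<nu>' k - t * zz ?\<nu>' j) / (zz ?\<nu>' k - zz ?\<nu>' j) * (zz ?\<nu>' j - c)) = 0"
    using S km by (intro prod_zero) (auto intro!: bexI[of _ m])
  thus ?thesis unfolding Gm_def by simp
qed

text \<open>Extension by zero from the chamber to the full lattice, where boxes are products and one
  coordinate can be summed separately.\<close>

definition Gh :: "complex \<Rightarrow> complex \<Rightarrow> complex \<Rightarrow> nat \<Rightarrow> (nat \<Rightarrow> int) \<Rightarrow> complex" where
  "Gh \<alpha>1 \<alpha>2 c k \<nu> = (if \<nu> \<in> ch I then Gm \<alpha>1 \<alpha>2 c k \<nu> else 0)"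

lemma Gh_diff:
  assumes "\<nu> \<in> PiE I (\<lambda>_. UNIV)" "k \<in> I"
  shows "Gh \<alpha>1 \<alpha>2 c k \<nu> - Gh \<alpha>1 \<alpha>2 c k (\<nu>(k := \<nu> k + 1)) =
    (if \<nu> \<in> ch I then Gm \<alpha>1 \<alpha>2 c k \<nu> - Gp \<alpha>1 \<alpha>2 c k \<nu> else 0)"
  unfolding Gh_def using Gm_shift Gp_boundary Gm_boundary assms by auto

lemma norm_quad_le: "norm (quad u v z) \<le> (max 1 (norm u) * max 1 (norm v)) * (1 + norm z)\<^sup>2"
proof -
  have *: "norm (1 - u * z) \<le> max 1 (norm u) * (1 + norm z)" for u
  proof -
    have "norm (1 - u * z) \<le> 1 + norm u * norm z"
      using norm_triangle_ineq4[of 1 "u * z"] by (simp add: norm_mult)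
    also have "\<dots> \<le> max 1 (norm u) + max 1 (norm u) * norm z"
      by (intro add_mono mult_right_mono) auto
    finally show ?thesis by (simp add: distrib_left)
  qed
  have "norm (quad u v z) \<le> (max 1 (norm u) * (1 + norm z)) * (max 1 (norm v) * (1 + norm z))"
    unfolding quad_def norm_mult by (intro mult_mono * norm_ge_zero) (auto intro!: mult_nonneg_nonneg)
  thus ?thesis by (simp add: power2_eq_square mult_ac)
qed

lemma norm_diff_le_const: "norm (z - c) \<le> max 1 (norm c) * (1 + norm z)" for z c :: complex
proof -
  have "norm (z - c) \<le> norm z + norm c" by (rule norm_triangle_ineq4)
  also have "\<dots> \<le> max 1 (norm c) * norm z + max 1 (norm c)"
  proof (intro add_mono)
    have "1 * norm z \<le> max 1 (norm c) * norm z" by (intro mult_right_mono) auto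
    thus "norm z \<le> max 1 (norm c) * norm z" by simp
  qed simp
  finally show ?thesis by (simp add: distrib_left add.commute)
qed

lemma prod_norm_diff_le:
  "norm (\<Prod>j\<in>J. zz \<nu> j - c) \<le> max 1 (norm c) ^ card J * (\<Prod>j\<in>J. 1 + norm (zz \<nu> j))"
proof -
  have "norm (\<Prod>j\<in>J. zz \<nu> j - c) \<le> (\<Prod>j\<in>J. max 1 (norm c) * (1 + norm (zz \<nu> j)))"
    unfolding prod_norm[symmetric] by (intro prod_mono conjI norm_ge_zero norm_diff_le_const)
  thus ?thesis by (simp add: prod.distrib)
qed

lemma norm_zz: "norm (zz \<nu> j) = norm (\<xi> j) * q powi \<nu> j"
  by (simp add: zz_def norm_mult norm_Q_powi)

lemma Gm_norm_aux:
  assumes k: "k \<in> I"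
  shows "\<exists>K>0. \<forall>\<nu>. norm (Gm \<alpha>1 \<alpha>2 c k \<nu>) \<le>
    K * (norm (DD \<alpha>1 \<alpha>2 \<xi> I \<nu>) * ((1 + norm (zz \<nu> k))\<^sup>2 / norm (zz \<nu> k)) * (\<Prod>j\<in>I-{k}. 1 + norm (zz \<nu> j)))"
proof -
  obtain K1 where K1: "K1 > 0"
    "\<And>\<nu>. norm (\<Prod>j\<in>I-{k}. (zz \<nu> k - t * zz \<nu> j) / (zz \<nu> k - zz \<nu> j)) \<le> K1"
    using moebius_bound[OF k] by blast
  define A where "A = max 1 (norm \<alpha>1) * max 1 (norm \<alpha>2)"
  define C where "C = max 1 (norm c) ^ card (I - {k})"
  have pos: "A > 0" "C > 0" by (auto simp: A_def C_def)
  have "norm (Gm \<alpha>1 \<alpha>2 c k \<nu>) \<le> (A * K1 * C) *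
     (norm (DD \<alpha>1 \<alpha>2 \<xi> I \<nu>) * ((1 + norm (zz \<nu> k))\<^sup>2 / norm (zz \<nu> k)) * (\<Prod>j\<in>I-{k}. 1 + norm (zz \<nu> j)))" for \<nu>
  proof -
    have "norm (Gm \<alpha>1 \<alpha>2 c k \<nu>) = norm (DD \<alpha>1 \<alpha>2 \<xi> I \<nu>) * (norm (quad \<alpha>1 \<alpha>2 (zz \<nu> k)) / norm (zz \<nu> k)) *
        (norm (\<Prod>j\<in>I-{k}. (zz \<nu> k - t * zz \<nu> j) / (zz \<nu> k - zz \<nu> j)) * norm (\<Prod>j\<in>I-{k}. zz \<nu> j - c))"
      by (simp only: Gm_def norm_mult norm_divide prod.distrib)
    also have "\<dots> \<le> norm (DD \<alpha>1 \<alpha>2 \<xi> I \<nu>) * (A * (1 + norm (zz \<nu> k))\<^sup>2 / norm (zz \<nu> k)) *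
        (K1 * (C * (\<Prod>j\<in>I-{k}. 1 + norm (zz \<nu> j))))"
      unfolding A_def C_def
      by (intro mult_mono order.refl divide_right_mono norm_quad_le K1 prod_norm_diff_le norm_ge_zero mult_nonneg_nonneg
          divide_nonneg_nonneg) (use K1(1) in \<open>auto intro: prod_nonneg\<close>)
    finally show ?thesis by (simp add: mult_ac)
  qed
  moreover have "A * K1 * C > 0" using K1 pos by simp
  ultimately show ?thesis by blast
qed

text \<open>The denominator \<open>zz \<nu> k\<close> of \<open>Gm\<close> cancels the factor
  \<open>q powi \<nu> k\<close> of the summand. The result decays in all other coordinates but
  merely stays bounded in coordinate \<open>k\<close>, so the upper boundary terms may have a
  nonzero limit.\<close>

lemma Gh_bound_pos:
  assumes "dominated 1 \<alpha>1 \<alpha>2" and k: "k \<in> I"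
  shows "\<exists>K \<rho>. K > 0 \<and> 0 < \<rho> \<and> \<rho> < 1 \<and>
    (\<forall>\<nu>. 0 \<le> \<nu> k \<longrightarrow> norm (Gh \<alpha>1 \<alpha>2 c k \<nu>) \<le> K * (\<Prod>j\<in>I-{k}. \<rho> ^ nat \<bar>\<nu> j\<bar>))"
proof -
  obtain K1 where K1: "K1 > 0" "\<And>\<nu>. norm (Gm \<alpha>1 \<alpha>2 c k \<nu>) \<le>
    K1 * (norm (DD \<alpha>1 \<alpha>2 \<xi> I \<nu>) * ((1 + norm (zz \<nu> k))\<^sup>2 / norm (zz \<nu> k)) * (\<Prod>j\<in>I-{k}. 1 + norm (zz \<nu> j)))"
    using Gm_norm_aux[OF k] by blast
  obtain K2 \<rho> where K2: "K2 > 0" "0 < \<rho>" "\<rho> < 1" "\<And>\<nu>. \<nu> \<in> ch I \<Longrightarrow> 0 \<le> \<nu> k \<Longrightarrow>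
    norm (DD \<alpha>1 \<alpha>2 \<xi> I \<nu>) / q powi \<nu> k * (\<Prod>j\<in>I-{k}. 1 + norm (zz \<nu> j)) \<le> K2 * (\<Prod>j\<in>I-{k}. \<rho> ^ nat \<bar>\<nu> j\<bar>)"
    using DD_bound_omit[OF assms] by blast
  define B where "B = (1 + norm (\<xi> k))\<^sup>2 / norm (\<xi> k)"
  have x0: "norm (\<xi> k) > 0" using \<xi>_nonzero[OF k] by simp
  have B: "B > 0" unfolding B_def using x0 by (intro divide_pos_pos zero_less_power add_pos_pos) auto
  have "norm (Gh \<alpha>1 \<alpha>2 c k \<nu>) \<le> (K1 * B * K2) * (\<Prod>j\<in>I-{k}. \<rho> ^ nat \<bar>\<nu> j\<bar>)" if \<nu>: "0 \<le> \<nu> k" for \<nu>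
  proof (cases "\<nu> \<in> ch I")
    case True
    have qp: "q powi \<nu> k > 0" using q_pos by simp
    have "q powi \<nu> k \<le> 1"
      using \<nu> q_pos q_less_1 by (auto simp: power_int_def intro: power_le_one)
    hence "norm (zz \<nu> k) \<le> norm (\<xi> k)" unfolding norm_zz by (intro mult_left_le) auto
    hence "(1 + norm (zz \<nu> k))\<^sup>2 \<le> (1 + norm (\<xi> k))\<^sup>2" by (intro power_mono) auto
    hence "(1 + norm (zz \<nu> k))\<^sup>2 / norm (zz \<nu> k) \<le> (1 + norm (\<xi> k))\<^sup>2 / norm (zz \<nu> k)"
      by (intro divide_right_mono) auto
    also have "\<dots> = B / q powi \<nu> k" by (simp add: B_def norm_zz)
    finally have le: "(1 + norm (zz \<nu> k))\<^sup>2 / norm (zz \<nu> k) \<le> B / q powi \<nu> k" .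
    have "norm (Gh \<alpha>1 \<alpha>2 c k \<nu>) \<le>
      K1 * (norm (DD \<alpha>1 \<alpha>2 \<xi> I \<nu>) * ((1 + norm (zz \<nu> k))\<^sup>2 / norm (zz \<nu> k)) * (\<Prod>j\<in>I-{k}. 1 + norm (zz \<nu> j)))"
      using K1(2) True by (simp add: Gh_def)
    also have "\<dots> \<le> K1 * (norm (DD \<alpha>1 \<alpha>2 \<xi> I \<nu>) * (B / q powi \<nu> k) * (\<Prod>j\<in>I-{k}. 1 + norm (zz \<nu> j)))"
      using K1(1) by (intro mult_left_mono mult_right_mono le) (auto intro: prod_nonneg)
    also have "\<dots> = K1 * B * (norm (DD \<alpha>1 \<alpha>2 \<xi> I \<nu>) / q powi \<nu> k * (\<Prod>j\<in>I-{k}. 1 + norm (zz \<nu> j)))"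
      by (simp add: mult_ac)
    also have "\<dots> \<le> K1 * B * (K2 * (\<Prod>j\<in>I-{k}. \<rho> ^ nat \<bar>\<nu> j\<bar>))"
      using K1(1) B by (intro mult_left_mono K2(4) True \<nu>) auto
    finally show ?thesis by (simp add: mult_ac)
  next
    case False
    thus ?thesis using K1(1) K2 B by (auto simp: Gh_def intro!: mult_nonneg_nonneg prod_nonneg)
  qed
  moreover have "K1 * B * K2 > 0" using K1 K2 B by simp
  ultimately show ?thesis using K2(2,3) by blast
qed

text \<open>For \<open>\<nu> k \<le> 0\<close> the quotient
  \<open>(1 + norm z)\<^sup>2 / norm z\<close> at \<open>z = zz \<nu> k\<close> is at most a
  constant times \<open>1 + norm z\<close>, which the exponent \<open>e = 1\<close> of the
  domination covers. There is decay in every coordinate, and the lower boundary terms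
  disappear.\<close>

lemma Gh_bound_neg:
  assumes "dominated 1 \<alpha>1 \<alpha>2" and k: "k \<in> I"
  shows "\<exists>K \<rho>. K > 0 \<and> 0 < \<rho> \<and> \<rho> < 1 \<and>
    (\<forall>\<nu>. \<nu> k \<le> 0 \<longrightarrow> norm (Gh \<alpha>1 \<alpha>2 c k \<nu>) \<le> K * (\<Prod>j\<in>I. \<rho> ^ nat \<bar>\<nu> j\<bar>))"
proof -
  obtain K1 where K1: "K1 > 0" "\<And>\<nu>. norm (Gm \<alpha>1 \<alpha>2 c k \<nu>) \<le>
    K1 * (norm (DD \<alpha>1 \<alpha>2 \<xi> I \<nu>) * ((1 + norm (zz \<nu> k))\<^sup>2 / norm (zz \<nu> k)) * (\<Prod>j\<in>I-{k}. 1 + norm (zz \<nu> j)))"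
    using Gm_norm_aux[OF k] by blast
  obtain K2 \<rho> where K2: "K2 > 0" "0 < \<rho>" "\<rho> < 1" "\<And>\<nu>. \<nu> \<in> ch I \<Longrightarrow>
    norm (DD \<alpha>1 \<alpha>2 \<xi> I \<nu>) * (\<Prod>j\<in>I. (1 + norm (zz \<nu> j)) ^ 1) \<le> K2 * (\<Prod>j\<in>I. \<rho> ^ nat \<bar>\<nu> j\<bar>)"
    using DD_bound[OF assms(1)] by blast
  define B where "B = 1 + 1 / norm (\<xi> k)"
  have x0: "norm (\<xi> k) > 0" using \<xi>_nonzero[OF k] by simp
  have B: "B > 0" unfolding B_def using x0 by (intro add_pos_pos) auto
  have "norm (Gh \<alpha>1 \<alpha>2 c k \<nu>) \<le> (K1 * B * K2) * (\<Prod>j\<in>I. \<rho> ^ nat \<bar>\<nu> j\<bar>)" if \<nu>: "\<nu> k \<le> 0" for \<nu>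
  proof (cases "\<nu> \<in> ch I")
    case True
    have "1 \<le> q powi \<nu> k"
    proof -
      have "q powi \<nu> k = 1 / q ^ nat (- \<nu> k)" using \<nu> by (simp add: power_int_def divide_inverse power_inverse)
      moreover have "q ^ nat (- \<nu> k) \<le> 1" using q_pos q_less_1 by (intro power_le_one) auto
      ultimately show ?thesis using q_pos by simp
    qed
    hence "norm (\<xi> k) \<le> norm (zz \<nu> k)" unfolding norm_zz using x0 by simp
    hence inv: "1 / norm (zz \<nu> k) \<le> 1 / norm (\<xi> k)" using x0 zz_nonzero[OF k] by (intro divide_left_mono mult_pos_pos) auto
    have "(1 + norm (zz \<nu> k))\<^sup>2 / norm (zz \<nu> k) = (1 + norm (zz \<nu> k)) * (1 + 1 / norm (zz \<nu> k))"
      using x0 zz_nonzero[OF k] by (simp add: field_simps power2_eq_square)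
    also have "\<dots> \<le> (1 + norm (zz \<nu> k)) * B"
      unfolding B_def by (intro mult_left_mono add_left_mono inv) auto
    finally have le: "(1 + norm (zz \<nu> k))\<^sup>2 / norm (zz \<nu> k) \<le> (1 + norm (zz \<nu> k)) * B" .
    have "norm (Gh \<alpha>1 \<alpha>2 c k \<nu>) \<le>
      K1 * (norm (DD \<alpha>1 \<alpha>2 \<xi> I \<nu>) * ((1 + norm (zz \<nu> k))\<^sup>2 / norm (zz \<nu> k)) * (\<Prod>j\<in>I-{k}. 1 + norm (zz \<nu> j)))"
      using K1(2) True by (simp add: Gh_def)
    also have "\<dots> \<le> K1 * (norm (DD \<alpha>1 \<alpha>2 \<xi> I \<nu>) * ((1 + norm (zz \<nu> k)) * B) * (\<Prod>j\<in>I-{k}. 1 + norm (zz \<nu> j)))"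
      using K1(1) by (intro mult_left_mono mult_right_mono le) (auto intro: prod_nonneg)
    also have "\<dots> = K1 * B * (norm (DD \<alpha>1 \<alpha>2 \<xi> I \<nu>) * (\<Prod>j\<in>I. (1 + norm (zz \<nu> j)) ^ 1))"
      unfolding prod.remove[OF finite_I k] by (simp add: mult_ac)
    also have "\<dots> \<le> K1 * B * (K2 * (\<Prod>j\<in>I. \<rho> ^ nat \<bar>\<nu> j\<bar>))"
      using K1(1) B by (intro mult_left_mono K2(4) True) auto
    finally show ?thesis by (simp add: mult_ac)
  next
    case False
    thus ?thesis using K1(1) K2 B by (auto simp: Gh_def intro!: mult_nonneg_nonneg prod_nonneg)
  qed
  moreover have "K1 * B * K2 > 0" using K1 K2 B by simp
  ultimately show ?thesis using K2(2,3) by blast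
qed

end

section \<open>Limits of the boundary terms\<close>

context q_base
begin

lemma pair_conn_powi:
  assumes "c \<noteq> 0" "t \<noteq> 0"
  shows "pair_conn t (c * Q powi m) = t powi (2 * m) * pair_conn t c"
proof -
  have step: "pair_conn t (u * Q) = t\<^sup>2 * pair_conn t u" if "u \<noteq> 0" for u
    using pair_conn_Q_div[of "u * Q" t] that assms by simp
  have pos: "pair_conn t (u * Q ^ k) = t ^ (2 * k) * pair_conn t u" if "u \<noteq> 0" for u k
  proof (induction k)
    case (Suc k)
    have "pair_conn t (u * Q ^ Suc k) = pair_conn t ((u * Q ^ k) * Q)" by (simp add: mult_ac)
    also have "\<dots> = t\<^sup>2 * pair_conn t (u * Q ^ k)" using that by (intro step) simp
    finally show ?case by (simp add: Suc power2_eq_square mult_ac)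
  qed simp
  show ?thesis
  proof (cases "m \<ge> 0")
    case True
    thus ?thesis using pos[OF assms(1), of "nat m"] by (simp add: power_int_def nat_mult_distrib)
  next
    case False
    define k where "k = nat (- m)"
    have m: "m = - int k" "2 * m = - int (2 * k)" using False by (simp_all add: k_def)
    have "pair_conn t c = pair_conn t ((c * Q powi m) * Q ^ k)"
      by (simp add: m power_int_minus mult.assoc)
    also have "\<dots> = t ^ (2 * k) * pair_conn t (c * Q powi m)"
      using assms by (intro pos) simp
    finally show ?thesis
      unfolding m(2) power_int_minus power_int_of_nat using assms by simp
  qed
qed

end

context q_config
begin

definition is_last :: "nat \<Rightarrow> bool" where
  "is_last k \<longleftrightarrow> (\<forall>l\<in>I. k < l \<longrightarrow> \<not> (k \<le> n \<longleftrightarrow> l \<le> n))"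

text \<open>What is left of \<open>Gm\<close> when the coordinate with label \<open>k\<close> tends
  to 0. Each earlier label contributes the limit 1 of its pair factor and each later label a
  connection factor; the additional \<open>t\<close> is the limit of the cofactor
  \<open>(zz \<nu> k - t * zz \<nu> j) / (zz \<nu> k - zz \<nu> j)\<close>.\<close>

definition Ginf :: "complex \<Rightarrow> complex \<Rightarrow> complex \<Rightarrow> nat \<Rightarrow> (nat \<Rightarrow> int) \<Rightarrow> complex" where
  "Ginf \<alpha>1 \<alpha>2 c k \<nu> = DD \<alpha>1 \<alpha>2 \<xi> (I - {k}) \<nu> * (1 / \<xi> k) *
    (\<Prod>j\<in>I-{k}. t powi (2 * \<nu> j) * (if j < k then 1 else pair_conn t (\<xi> j / \<xi> k)) * t * (zz \<nu> j - c))"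

text \<open>For \<open>j < k\<close> the ratio tends to 0. For \<open>k < j\<close> it tends to
  infinity; since \<open>k\<close> is the last label of its block, \<open>j\<close> lies in the
  other one, and the theta conditions between the blocks permit the backward formula.\<close>

lemma pv_limit:
  assumes k: "k \<in> I" "is_last k" and j: "j \<in> I - {k}"
  shows "(\<lambda>M. pv \<xi> (\<nu>(k := int M + 1)) k j) \<longlonglongrightarrow>
    t powi (2 * \<nu> j) * (if j < k then 1 else pair_conn t (\<xi> j / \<xi> k))"
proof (cases "j < k")
  case True
  define c where "c = \<xi> k / \<xi> j * Q powi (1 - \<nu> j)"
  have "pv \<xi> (\<nu>(k := int M + 1)) k j = t powi (2 * \<nu> j) * pair_fun t (c * Q ^ M)" for M
  proof -
    have e: "int M + 1 - \<nu> j = (1 - \<nu> j) + int M" by simp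
    have "Q powi (int M + 1 - \<nu> j) = Q powi (1 - \<nu> j) * Q ^ M"
      unfolding e by (subst power_int_add) auto
    thus ?thesis using True by (simp add: pv_def vv_def c_def mult_ac)
  qed
  moreover have "(\<lambda>M. t powi (2 * \<nu> j) * pair_fun t (c * Q ^ M)) \<longlonglongrightarrow> t powi (2 * \<nu> j) * 1"
    by (intro tendsto_intros pair_fun_tendsto_1)
  ultimately show ?thesis using True by simp
next
  case False
  hence kj: "k < j" using j by auto
  hence ns: "\<not> (k \<le> n \<longleftrightarrow> j \<le> n)" using k j by (auto simp: is_last_def)
  define c0 where "c0 = \<xi> j / \<xi> k"
  define c where "c = c0 * Q powi (\<nu> j - 1)"
  have c0: "c0 \<noteq> 0" using \<xi>_nonzero j k by (simp add: c0_def)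
  hence c: "c \<noteq> 0" by (simp add: c_def)
  have th: "qtheta q (t * c0) \<noteq> 0" "qtheta q (t / c0) \<noteq> 0"
    using cross_block[OF k(1) _ kj ns] j by (auto simp: c0_def)
  have "qtheta q (Q powi (\<nu> j - 1) * (t * c0)) \<noteq> 0"
    using th c0 by (intro qtheta_nonzero_shift) auto
  hence th1: "qtheta q (t * c) \<noteq> 0" by (simp add: c_def mult_ac)
  have "qtheta q (Q powi (- (\<nu> j - 1)) * (t / c0)) \<noteq> 0"
    using th c0 by (intro qtheta_nonzero_shift) auto
  moreover have "Q powi (- (\<nu> j - 1)) * (t / c0) = t / c"
    by (simp only: power_int_minus c_def) (simp add: divide_inverse)
  ultimately have th2: "qtheta q (t / c) \<noteq> 0" by metis
  have 1: "pv \<xi> (\<nu>(k := int M + 1)) k j = t\<^sup>2 * (pair_conn t c * pair_fun t (1 / c * Q ^ M))" for M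
  proof -
    have e: "\<nu> j - (int M + 1) = (\<nu> j - 1) - int M" "2 * (int M + 1) = 2 + int (2 * M)" by simp_all
    have "c0 * Q powi (\<nu> j - (int M + 1)) = c / Q ^ M"
      unfolding e c_def by (subst power_int_diff) auto
    moreover have "t powi (2 * (int M + 1)) = t\<^sup>2 * t ^ (2 * M)"
      unfolding e by (simp only: power_int_add[OF disjI1[OF t_nonzero]] power_int_of_nat power_int_numeral)
    ultimately have "pv \<xi> (\<nu>(k := int M + 1)) k j = t\<^sup>2 * (t ^ (2 * M) * pair_fun t (c / Q ^ M))"
      using False j by (simp add: pv_def vv_def c0_def mult.assoc)
    thus ?thesis using pair_fun_backward[OF c t_nonzero th1 th2] by simp
  qed
  have 2: "(\<lambda>M. t\<^sup>2 * (pair_conn t c * pair_fun t (1 / c * Q ^ M))) \<longlonglongrightarrow> t\<^sup>2 * (pair_conn t c * 1)"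
    by (intro tendsto_intros pair_fun_tendsto_1)
  have 3: "t\<^sup>2 * (pair_conn t c * 1) = t powi (2 * \<nu> j) * pair_conn t c0"
  proof -
    have "2 * \<nu> j = 2 + 2 * (\<nu> j - 1)" by simp
    hence "t powi (2 * \<nu> j) = t\<^sup>2 * t powi (2 * (\<nu> j - 1))"
      by (simp only: power_int_add[OF disjI1[OF t_nonzero]] power_int_numeral)
    thus ?thesis unfolding c_def pair_conn_powi[OF c0 t_nonzero] by simp
  qed
  show ?thesis unfolding 1 using 2[unfolded 3] False by (simp only: c0_def if_False)
qed

lemma Gm_limit:
  assumes k: "k \<in> I" "is_last k"
  shows "(\<lambda>M. Gm \<alpha>1 \<alpha>2 c k (\<nu>(k := int M + 1))) \<longlonglongrightarrow> Ginf \<alpha>1 \<alpha>2 c k \<nu>"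
proof -
  define D where "D = DD \<alpha>1 \<alpha>2 \<xi> (I - {k}) \<nu>"
  define y where "y = (\<lambda>M. \<xi> k * Q * Q ^ M)"
  have zk: "zz (\<nu>(k := int M + 1)) k = y M" for M
    by (simp add: zz_def y_def power_int_add mult_ac)
  have y0: "y \<longlonglongrightarrow> 0" unfolding y_def by (rule mult_Q_power_tendsto_0)
  have phi1: "(\<lambda>M. phi \<alpha>1 \<alpha>2 (y M)) \<longlonglongrightarrow> 1" unfolding y_def by (rule phi_tendsto_1)
  have Gm: "Gm \<alpha>1 \<alpha>2 c k (\<nu>(k := int M + 1)) = D * (phi \<alpha>1 \<alpha>2 (y M) / \<xi> k * quad \<alpha>1 \<alpha>2 (y M)) *
    (\<Prod>j\<in>I-{k}. pv \<xi> (\<nu>(k := int M + 1)) k j * ((y M - t * zz \<nu> j) / (y M - zz \<nu> j)) * (zz \<nu> j - c))" for M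
  proof -
    have D': "DD \<alpha>1 \<alpha>2 \<xi> (I - {k}) (\<nu>(k := int M + 1)) = D"
      unfolding D_def by (rule DD_cong) auto
    have w: "wt1 \<alpha>1 \<alpha>2 (\<xi> k) (int M + 1) * (quad \<alpha>1 \<alpha>2 (y M) / y M) = phi \<alpha>1 \<alpha>2 (y M) / \<xi> k * quad \<alpha>1 \<alpha>2 (y M)"
    proof -
      have "wt1 \<alpha>1 \<alpha>2 (\<xi> k) (int M + 1) = Q * Q ^ M * phi \<alpha>1 \<alpha>2 (y M)"
        by (simp add: wt1_def y_def power_int_add mult_ac)
      thus ?thesis by (simp add: y_def)
    qed
    have p: "(\<Prod>j\<in>I-{k}. (y M - t * zz (\<nu>(k := int M + 1)) j) / (y M - zz (\<nu>(k := int M + 1)) j) *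
        (zz (\<nu>(k := int M + 1)) j - c)) = (\<Prod>j\<in>I-{k}. ((y M - t * zz \<nu> j) / (y M - zz \<nu> j)) * (zz \<nu> j - c))"
      by (intro prod.cong refl) (auto simp: zz_upd)
    have "Gm \<alpha>1 \<alpha>2 c k (\<nu>(k := int M + 1)) = D * (wt1 \<alpha>1 \<alpha>2 (\<xi> k) (int M + 1) * (quad \<alpha>1 \<alpha>2 (y M) / y M)) *
     ((\<Prod>j\<in>I-{k}. pv \<xi> (\<nu>(k := int M + 1)) k j) * (\<Prod>j\<in>I-{k}. ((y M - t * zz \<nu> j) / (y M - zz \<nu> j)) * (zz \<nu> j - c)))"
      unfolding Gm_def DD_remove[OF finite_I k(1)] D' zk p by (simp only: fun_upd_same mult_ac)
    thus ?thesis unfolding w by (simp only: prod.distrib mult_ac)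
  qed
  have "(\<lambda>M. D * (phi \<alpha>1 \<alpha>2 (y M) / \<xi> k * quad \<alpha>1 \<alpha>2 (y M)) *
    (\<Prod>j\<in>I-{k}. pv \<xi> (\<nu>(k := int M + 1)) k j * ((y M - t * zz \<nu> j) / (y M - zz \<nu> j)) * (zz \<nu> j - c))) \<longlonglongrightarrow>
    D * (1 / \<xi> k * ((1 - \<alpha>1 * 0) * (1 - \<alpha>2 * 0))) * (\<Prod>j\<in>I-{k}. t powi (2 * \<nu> j) * (if j < k then 1 else pair_conn t (\<xi> j / \<xi> k)) *
      ((0 - t * zz \<nu> j) / (0 - zz \<nu> j)) * (zz \<nu> j - c))"
    unfolding quad_def
    by (intro tendsto_intros y0 phi1 pv_limit[OF k]) (use \<xi>_nonzero[OF k(1)] zz_nonzero in auto)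
  moreover have "D * (1 / \<xi> k * ((1 - \<alpha>1 * 0) * (1 - \<alpha>2 * 0))) * (\<Prod>j\<in>I-{k}. t powi (2 * \<nu> j) * (if j < k then 1 else pair_conn t (\<xi> j / \<xi> k)) *
      ((0 - t * zz \<nu> j) / (0 - zz \<nu> j)) * (zz \<nu> j - c)) = Ginf \<alpha>1 \<alpha>2 c k \<nu>"
  proof -
    have "(\<Prod>j\<in>I-{k}. t powi (2 * \<nu> j) * (if j < k then 1 else pair_conn t (\<xi> j / \<xi> k)) *
      ((0 - t * zz \<nu> j) / (0 - zz \<nu> j)) * (zz \<nu> j - c)) =
      (\<Prod>j\<in>I-{k}. t powi (2 * \<nu> j) * (if j < k then 1 else pair_conn t (\<xi> j / \<xi> k)) * t * (zz \<nu> j - c))"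
    proof (intro prod.cong refl)
      fix j assume "j \<in> I - {k}"
      hence "(0 - t * zz \<nu> j) / (0 - zz \<nu> j) = t" using zz_nonzero by simp
      thus "t powi (2 * \<nu> j) * (if j < k then 1 else pair_conn t (\<xi> j / \<xi> k)) * ((0 - t * zz \<nu> j) / (0 - zz \<nu> j)) * (zz \<nu> j - c) =
        t powi (2 * \<nu> j) * (if j < k then 1 else pair_conn t (\<xi> j / \<xi> k)) * t * (zz \<nu> j - c)" by (simp only:)
    qed
    thus ?thesis unfolding Ginf_def D_def by simp
  qed
  ultimately show ?thesis unfolding Gm by simp
qed

lemma fun_upd_mem_ch_iff:
  assumes k: "k \<in> I" and \<nu>: "\<nu> \<in> PiE (I - {k}) (\<lambda>_. UNIV)"
  shows "\<nu>(k := x) \<in> ch I \<longleftrightarrow> \<nu> \<in> ch (I - {k}) \<and>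
    (\<forall>j\<in>I. j < k \<and> (j \<le> n \<longleftrightarrow> k \<le> n) \<longrightarrow> \<nu> j \<le> x) \<and> (\<forall>l\<in>I. k < l \<and> (k \<le> n \<longleftrightarrow> l \<le> n) \<longrightarrow> x \<le> \<nu> l)"
    (is "?L \<longleftrightarrow> ?R")
proof -
  have E: "\<nu>(k := x) \<in> PiE I (\<lambda>_. UNIV)"
    using \<nu> k by (auto simp: PiE_def extensional_def)
  show ?thesis
  proof
    assume L: ?L
    have "\<nu> i \<le> \<nu> j" if "i \<in> I - {k}" "j \<in> I - {k}" "i < j" "i \<le> n \<longleftrightarrow> j \<le> n" for i j
      using chD[OF L, of i j] that by auto
    moreover have "\<nu> j \<le> x" if "j \<in> I" "j < k" "j \<le> n \<longleftrightarrow> k \<le> n" for j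
      using chD[OF L, of j k] that k by auto
    moreover have "x \<le> \<nu> l" if "l \<in> I" "k < l" "k \<le> n \<longleftrightarrow> l \<le> n" for l
      using chD[OF L, of k l] that k by auto
    ultimately show ?R using \<nu> by (simp add: ch_def)
  next
    assume R: ?R
    have "(\<nu>(k := x)) i \<le> (\<nu>(k := x)) j" if "i \<in> I" "j \<in> I" "i < j" "i \<le> n \<longleftrightarrow> j \<le> n" for i j
      using R chD[of \<nu> "I - {k}" i j] that by auto
    thus ?L using E by (simp add: ch_def)
  qed
qed

text \<open>If a label of the same block follows \<open>k\<close>, its exponent caps
  \<open>\<nu> k\<close>, and the edge of the box eventually lies outside the chamber. Only the last
  label of each block leaves a boundary term.\<close>

lemma Gh_limit:
  assumes k: "k \<in> I" and \<nu>: "\<nu> \<in> PiE (I - {k}) (\<lambda>_. UNIV)"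
  shows "(\<lambda>M. Gh \<alpha>1 \<alpha>2 c k (\<nu>(k := int M + 1))) \<longlonglongrightarrow>
    (if is_last k \<and> \<nu> \<in> ch (I - {k}) then Ginf \<alpha>1 \<alpha>2 c k \<nu> else 0)"
proof (cases "is_last k \<and> \<nu> \<in> ch (I - {k})")
  case True
  have "eventually (\<lambda>M. \<nu> j \<le> int M + 1) sequentially" for j
    by (rule eventually_sequentiallyI[of "nat \<bar>\<nu> j\<bar>"]) linarith
  hence "eventually (\<lambda>M. \<forall>j\<in>I. \<nu> j \<le> int M + 1) sequentially"
    by (simp add: eventually_ball_finite_distrib)
  hence "eventually (\<lambda>M. Gh \<alpha>1 \<alpha>2 c k (\<nu>(k := int M + 1)) = Gm \<alpha>1 \<alpha>2 c k (\<nu>(k := int M + 1))) sequentially"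
  proof eventually_elim
    case (elim M)
    hence "\<nu>(k := int M + 1) \<in> ch I"
      using fun_upd_mem_ch_iff[OF k \<nu>] True by (auto simp: is_last_def)
    thus ?case by (simp add: Gh_def)
  qed
  thus ?thesis using True Gm_limit[OF k, of \<alpha>1 \<alpha>2 c \<nu>] by (simp add: tendsto_cong)
next
  case False
  have "eventually (\<lambda>M. Gh \<alpha>1 \<alpha>2 c k (\<nu>(k := int M + 1)) = 0) sequentially"
  proof (cases "is_last k")
    case True
    hence "\<nu> \<notin> ch (I - {k})" using False by blast
    thus ?thesis using fun_upd_mem_ch_iff[OF k \<nu>] by (simp add: Gh_def)
  next
    case nl: False
    then obtain l where l: "l \<in> I" "k < l" "k \<le> n \<longleftrightarrow> l \<le> n" by (auto simp: is_last_def)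
    have "eventually (\<lambda>M. int M + 1 > \<nu> l) sequentially"
      by (rule eventually_sequentiallyI[of "nat \<bar>\<nu> l\<bar>"]) linarith
    thus ?thesis
    proof eventually_elim
      case (elim M)
      hence "\<nu>(k := int M + 1) \<notin> ch I"
        using fun_upd_mem_ch_iff[OF k \<nu>, of "int M + 1"] l by auto
      thus ?case by (simp add: Gh_def)
    qed
  qed
  thus ?thesis unfolding if_not_P[OF False] by (rule tendsto_eventually)
qed

lemma box_upper_tendsto:
  assumes "dominated 1 \<alpha>1 \<alpha>2" and k: "k \<in> I"
  shows "(\<lambda>M. \<Sum>\<nu>\<in>box (I - {k}) M. Gh \<alpha>1 \<alpha>2 c k (\<nu>(k := int M + 1))) \<longlonglongrightarrow>
    (if is_last k then infsum (Ginf \<alpha>1 \<alpha>2 c k) (ch (I - {k})) else 0)"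
proof -
  obtain K \<rho> where K: "K > 0" "0 < \<rho>" "\<rho> < 1"
    "\<And>\<nu>. 0 \<le> \<nu> k \<Longrightarrow> norm (Gh \<alpha>1 \<alpha>2 c k \<nu>) \<le> K * (\<Prod>j\<in>I-{k}. \<rho> ^ nat \<bar>\<nu> j\<bar>)"
    using Gh_bound_pos[OF assms, of c] by blast
  define g where "g = (\<lambda>\<nu>. if is_last k \<and> \<nu> \<in> ch (I - {k}) then Ginf \<alpha>1 \<alpha>2 c k \<nu> else 0)"
  have lim: "(\<lambda>M. \<Sum>\<nu>\<in>box (I - {k}) M. Gh \<alpha>1 \<alpha>2 c k (\<nu>(k := int M + 1))) \<longlonglongrightarrow>
      infsum g (PiE (I - {k}) (\<lambda>_. UNIV))"
  proof (rule sum_box_tendsto)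
    show "(\<lambda>\<nu>. K * (\<Prod>j\<in>I-{k}. \<rho> ^ nat \<bar>\<nu> j\<bar>)) summable_on PiE (I - {k}) (\<lambda>_. UNIV)"
      using K by (intro summable_on_cmult_right summable_on_prod_int_geometric) auto
    show "norm (Gh \<alpha>1 \<alpha>2 c k (\<nu>(k := int M + 1))) \<le> K * (\<Prod>j\<in>I-{k}. \<rho> ^ nat \<bar>\<nu> j\<bar>)" for M \<nu>
      using K(4)[of "\<nu>(k := int M + 1)"] by simp
    show "(\<lambda>M. Gh \<alpha>1 \<alpha>2 c k (\<nu>(k := int M + 1))) \<longlonglongrightarrow> g \<nu>"
      if "\<nu> \<in> PiE (I - {k}) (\<lambda>_. UNIV)" for \<nu>
      unfolding g_def by (rule Gh_limit[OF k that])
  qed simp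
  have eq: "infsum g (PiE (I - {k}) (\<lambda>_. UNIV)) =
      (if is_last k then infsum (Ginf \<alpha>1 \<alpha>2 c k) (ch (I - {k})) else 0)"
  proof (cases "is_last k")
    case True
    have "infsum g (PiE (I - {k}) (\<lambda>_. UNIV)) = infsum (Ginf \<alpha>1 \<alpha>2 c k) (ch (I - {k}))"
      by (rule infsum_cong_neutral) (use ch_subset[of "I - {k}"] True in \<open>auto simp: g_def\<close>)
    thus ?thesis using True by simp
  qed (simp add: g_def)
  show ?thesis using lim unfolding eq .
qed

lemma box_lower_tendsto:
  assumes "dominated 1 \<alpha>1 \<alpha>2" and k: "k \<in> I"
  shows "(\<lambda>M. \<Sum>\<nu>\<in>box (I - {k}) M. Gh \<alpha>1 \<alpha>2 c k (\<nu>(k := - int M))) \<longlonglongrightarrow> 0"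
proof -
  obtain K \<rho> where K: "K > 0" "0 < \<rho>" "\<rho> < 1"
    "\<And>\<nu>. \<nu> k \<le> 0 \<Longrightarrow> norm (Gh \<alpha>1 \<alpha>2 c k \<nu>) \<le> K * (\<Prod>j\<in>I. \<rho> ^ nat \<bar>\<nu> j\<bar>)"
    using Gh_bound_neg[OF assms, of c] by blast
  have bd: "norm (Gh \<alpha>1 \<alpha>2 c k (\<nu>(k := - int M))) \<le> \<rho> ^ M * (K * (\<Prod>j\<in>I-{k}. \<rho> ^ nat \<bar>\<nu> j\<bar>))" for M \<nu>
    using K(4)[of "\<nu>(k := - int M)"] unfolding prod.remove[OF finite_I k] by (simp add: mult_ac)
  have "(\<lambda>M. \<Sum>\<nu>\<in>box (I - {k}) M. Gh \<alpha>1 \<alpha>2 c k (\<nu>(k := - int M))) \<longlonglongrightarrow>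
      infsum (\<lambda>_. 0) (PiE (I - {k}) (\<lambda>_. UNIV :: int set))"
  proof (rule sum_box_tendsto)
    show "(\<lambda>\<nu>. K * (\<Prod>j\<in>I-{k}. \<rho> ^ nat \<bar>\<nu> j\<bar>)) summable_on PiE (I - {k}) (\<lambda>_. UNIV)"
      using K by (intro summable_on_cmult_right summable_on_prod_int_geometric) auto
    fix \<nu> :: "nat \<Rightarrow> int"
    have pos: "K * (\<Prod>j\<in>I-{k}. \<rho> ^ nat \<bar>\<nu> j\<bar>) \<ge> 0" using K by (auto intro!: mult_nonneg_nonneg prod_nonneg)
    show "norm (Gh \<alpha>1 \<alpha>2 c k (\<nu>(k := - int M))) \<le> K * (\<Prod>j\<in>I-{k}. \<rho> ^ nat \<bar>\<nu> j\<bar>)" for M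
    proof -
      have "\<rho> ^ M * (K * (\<Prod>j\<in>I-{k}. \<rho> ^ nat \<bar>\<nu> j\<bar>)) \<le> 1 * (K * (\<Prod>j\<in>I-{k}. \<rho> ^ nat \<bar>\<nu> j\<bar>))"
        using K pos by (intro mult_right_mono power_le_one) auto
      thus ?thesis using bd[of \<nu> M] by simp
    qed
    have "(\<lambda>M. \<rho> ^ M * (K * (\<Prod>j\<in>I-{k}. \<rho> ^ nat \<bar>\<nu> j\<bar>))) \<longlonglongrightarrow> 0"
      using K by (intro tendsto_mult_left_zero LIMSEQ_power_zero) auto
    thus "(\<lambda>M. Gh \<alpha>1 \<alpha>2 c k (\<nu>(k := - int M))) \<longlonglongrightarrow> 0"
      by (rule Lim_null_comparison[rotated]) (use bd in auto)
  qed auto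
  thus ?thesis by simp
qed

text \<open>The box sums have two limits: the full sum, by summability, and the sum of the edge
  contributions, of which the lower ones tend to 0.\<close>

lemma telescoped_sum:
  assumes dom: "dominated 1 \<alpha>1 \<alpha>2"
    and S: "(\<lambda>\<nu>. \<Sum>k\<in>I. Gm \<alpha>1 \<alpha>2 c k \<nu> - Gp \<alpha>1 \<alpha>2 c k \<nu>) summable_on ch I"
  shows "infsum (\<lambda>\<nu>. \<Sum>k\<in>I. Gm \<alpha>1 \<alpha>2 c k \<nu> - Gp \<alpha>1 \<alpha>2 c k \<nu>) (ch I) =
    - (\<Sum>k\<in>I. if is_last k then infsum (Ginf \<alpha>1 \<alpha>2 c k) (ch (I - {k})) else 0)"
proof -
  define f where "f = (\<lambda>\<nu>. \<Sum>k\<in>I. Gh \<alpha>1 \<alpha>2 c k \<nu> - Gh \<alpha>1 \<alpha>2 c k (\<nu>(k := \<nu> k + 1)))"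
  have f: "f \<nu> = (if \<nu> \<in> ch I then (\<Sum>k\<in>I. Gm \<alpha>1 \<alpha>2 c k \<nu> - Gp \<alpha>1 \<alpha>2 c k \<nu>) else 0)"
    if "\<nu> \<in> PiE I (\<lambda>_. UNIV)" for \<nu>
    unfolding f_def using Gh_diff[OF that] by simp
  have sub: "ch I \<subseteq> PiE I (\<lambda>_. UNIV)" by (rule ch_subset)
  have sf: "f summable_on PiE I (\<lambda>_. UNIV)"
    using S by (subst summable_on_cong_neutral[where T = "ch I"]) (use sub in \<open>auto simp: f\<close>)
  have e1: "infsum f (PiE I (\<lambda>_. UNIV)) = infsum (\<lambda>\<nu>. \<Sum>k\<in>I. Gm \<alpha>1 \<alpha>2 c k \<nu> - Gp \<alpha>1 \<alpha>2 c k \<nu>) (ch I)"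
    by (rule infsum_cong_neutral) (use sub in \<open>auto simp: f\<close>)
  have l1: "(\<lambda>M. \<Sum>\<nu>\<in>box I M. f \<nu>) \<longlonglongrightarrow> infsum f (PiE I (\<lambda>_. UNIV))"
    by (rule sum_box_tendsto[where h = "\<lambda>\<nu>. norm (f \<nu>)"])
      (use sf in \<open>auto simp: summable_on_iff_abs_summable_on_complex\<close>)
  have s1: "(\<Sum>\<nu>\<in>box I M. f \<nu>) = (\<Sum>k\<in>I. (\<Sum>\<nu>\<in>box (I - {k}) M. Gh \<alpha>1 \<alpha>2 c k (\<nu>(k := - int M))) -
      (\<Sum>\<nu>\<in>box (I - {k}) M. Gh \<alpha>1 \<alpha>2 c k (\<nu>(k := int M + 1))))" for M
  proof -
    have "(\<Sum>\<nu>\<in>box I M. f \<nu>) = (\<Sum>k\<in>I. \<Sum>\<nu>\<in>box I M. Gh \<alpha>1 \<alpha>2 c k \<nu> - Gh \<alpha>1 \<alpha>2 c k (\<nu>(k := \<nu> k + 1)))"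
      unfolding f_def by (rule sum.swap)
    also have "\<dots> = (\<Sum>k\<in>I. \<Sum>\<nu>\<in>box (I - {k}) M.
        Gh \<alpha>1 \<alpha>2 c k (\<nu>(k := - int M)) - Gh \<alpha>1 \<alpha>2 c k (\<nu>(k := int M + 1)))"
      by (rule sum.cong[OF refl]) (rule sum_box_telescope[OF finite_I])
    finally show ?thesis by (simp only: sum_subtractf)
  qed
  have l2: "(\<lambda>M. \<Sum>\<nu>\<in>box I M. f \<nu>) \<longlonglongrightarrow>
     (\<Sum>k\<in>I. 0 - (if is_last k then infsum (Ginf \<alpha>1 \<alpha>2 c k) (ch (I - {k})) else 0))"
    unfolding s1 by (intro tendsto_sum tendsto_diff box_lower_tendsto box_upper_tendsto dom)
  show ?thesis using LIMSEQ_unique[OF l1 l2] unfolding e1 by (simp add: sum_negf)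
qed

section \<open>The difference equation in the variable \<open>c\<close>\<close>

definition hh :: "(nat \<Rightarrow> int) \<Rightarrow> complex \<Rightarrow> complex" where
  "hh \<nu> c = (\<Prod>j\<in>I. zz \<nu> j - c)"

definition kap :: "complex \<Rightarrow> complex \<Rightarrow> complex" where
  "kap \<alpha>1 \<alpha>2 = t * \<alpha>1 * \<alpha>2 * (1 - 1 / t ^ n) + b1 * b2 * (1 - t ^ n)"

lemma DD_summable:
  assumes "dominated e \<alpha>1 \<alpha>2"
  shows "DD \<alpha>1 \<alpha>2 \<xi> I summable_on ch I"
proof -
  obtain K \<rho> where K: "K > 0" "0 < \<rho>" "\<rho> < 1" "\<And>\<nu>. \<nu> \<in> ch I \<Longrightarrow>
    norm (DD \<alpha>1 \<alpha>2 \<xi> I \<nu>) * (\<Prod>j\<in>I. (1 + norm (zz \<nu> j)) ^ e) \<le> K * (\<Prod>j\<in>I. \<rho> ^ nat \<bar>\<nu> j\<bar>)"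
    using DD_bound[OF assms] by blast
  have "(\<lambda>\<nu>. K * (\<Prod>j\<in>I. \<rho> ^ nat \<bar>\<nu> j\<bar>)) summable_on PiE I (\<lambda>_. UNIV)"
    using K by (intro summable_on_cmult_right summable_on_prod_int_geometric) auto
  hence s: "(\<lambda>\<nu>. K * (\<Prod>j\<in>I. \<rho> ^ nat \<bar>\<nu> j\<bar>)) summable_on ch I"
    by (rule summable_on_subset_banach[OF _ ch_subset])
  have "norm (DD \<alpha>1 \<alpha>2 \<xi> I \<nu>) \<le> K * (\<Prod>j\<in>I. \<rho> ^ nat \<bar>\<nu> j\<bar>)" if "\<nu> \<in> ch I" for \<nu>
  proof -
    have "1 \<le> (\<Prod>j\<in>I. (1 + norm (zz \<nu> j)) ^ e)" by (intro prod_ge_1 one_le_power) auto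
    hence "norm (DD \<alpha>1 \<alpha>2 \<xi> I \<nu>) * 1 \<le> norm (DD \<alpha>1 \<alpha>2 \<xi> I \<nu>) * (\<Prod>j\<in>I. (1 + norm (zz \<nu> j)) ^ e)"
      by (intro mult_left_mono) auto
    thus ?thesis using K(4)[OF that] by simp
  qed
  from abs_summable_summable[OF Infinite_Sum.abs_summable_on_comparison_test'[OF s this]]
  show ?thesis .
qed

lemma DD_mult_summable:
  assumes dom: "dominated 1 \<alpha>1 \<alpha>2"
    and u: "\<And>\<nu>. norm (u \<nu>) \<le> C * (\<Prod>j\<in>I. 1 + norm (zz \<nu> j))"
  shows "(\<lambda>\<nu>. DD \<alpha>1 \<alpha>2 \<xi> I \<nu> * u \<nu>) summable_on ch I"
proof -
  obtain K \<rho> where K: "K > 0" "0 < \<rho>" "\<rho> < 1" "\<And>\<nu>. \<nu> \<in> ch I \<Longrightarrow>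
    norm (DD \<alpha>1 \<alpha>2 \<xi> I \<nu>) * (\<Prod>j\<in>I. (1 + norm (zz \<nu> j)) ^ 1) \<le> K * (\<Prod>j\<in>I. \<rho> ^ nat \<bar>\<nu> j\<bar>)"
    using DD_bound[OF dom] by blast
  have "(\<lambda>\<nu>. \<bar>C\<bar> * (K * (\<Prod>j\<in>I. \<rho> ^ nat \<bar>\<nu> j\<bar>))) summable_on PiE I (\<lambda>_. UNIV)"
    using K by (intro summable_on_cmult_right summable_on_prod_int_geometric) auto
  hence s: "(\<lambda>\<nu>. \<bar>C\<bar> * (K * (\<Prod>j\<in>I. \<rho> ^ nat \<bar>\<nu> j\<bar>))) summable_on ch I"
    by (rule summable_on_subset_banach[OF _ ch_subset])
  have "norm (DD \<alpha>1 \<alpha>2 \<xi> I \<nu> * u \<nu>) \<le> \<bar>C\<bar> * (K * (\<Prod>j\<in>I. \<rho> ^ nat \<bar>\<nu> j\<bar>))" if "\<nu> \<in> ch I" for \<nu>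
  proof -
    have P: "0 \<le> (\<Prod>j\<in>I. 1 + norm (zz \<nu> j))" by (intro prod_nonneg) auto
    have "norm (u \<nu>) \<le> \<bar>C\<bar> * (\<Prod>j\<in>I. 1 + norm (zz \<nu> j))"
      using u[of \<nu>] mult_right_mono[OF abs_ge_self[of C] P] by linarith
    hence "norm (DD \<alpha>1 \<alpha>2 \<xi> I \<nu> * u \<nu>) \<le> norm (DD \<alpha>1 \<alpha>2 \<xi> I \<nu>) * (\<bar>C\<bar> * (\<Prod>j\<in>I. 1 + norm (zz \<nu> j)))"
      unfolding norm_mult by (intro mult_left_mono) auto
    also have "\<dots> = \<bar>C\<bar> * (norm (DD \<alpha>1 \<alpha>2 \<xi> I \<nu>) * (\<Prod>j\<in>I. (1 + norm (zz \<nu> j)) ^ 1))"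
      by (simp add: mult_ac)
    also have "\<dots> \<le> \<bar>C\<bar> * (K * (\<Prod>j\<in>I. \<rho> ^ nat \<bar>\<nu> j\<bar>))"
      by (intro mult_left_mono K(4) that) auto
    finally show ?thesis .
  qed
  from abs_summable_summable[OF Infinite_Sum.abs_summable_on_comparison_test'[OF s this]]
  show ?thesis .
qed

lemma DD_hh_summable:
  assumes "dominated 1 \<alpha>1 \<alpha>2"
  shows "(\<lambda>\<nu>. DD \<alpha>1 \<alpha>2 \<xi> I \<nu> * hh \<nu> c) summable_on ch I"
  using assms unfolding hh_def by (rule DD_mult_summable) (rule prod_norm_diff_le)

lemma DD_interpolation:
  assumes \<nu>: "\<nu> \<in> ch I"
  shows "DD \<alpha>1 \<alpha>2 \<xi> I \<nu> * (t * quad \<alpha>1 \<alpha>2 c * (hh \<nu> (c / t) - hh \<nu> c) +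
      quad b1 b2 c * (hh \<nu> (t * c) - hh \<nu> c) + c\<^sup>2 * kap \<alpha>1 \<alpha>2 * hh \<nu> c) =
    - (c\<^sup>2 * (1 - t) * (t / t ^ n)) * (\<Sum>k\<in>I. Gm \<alpha>1 \<alpha>2 c k \<nu> - Gp \<alpha>1 \<alpha>2 c k \<nu>)"
proof -
  have tn: "t ^ n / t = t ^ (n - 1)" using n_pos by (cases n) auto
  have *: "t * quad \<alpha>1 \<alpha>2 c * (hh \<nu> (c / t) - hh \<nu> c) +
      quad b1 b2 c * (hh \<nu> (t * c) - hh \<nu> c) + c\<^sup>2 * kap \<alpha>1 \<alpha>2 * hh \<nu> c =
    - (c\<^sup>2 * (1 - t) * (t / t ^ n)) *
      (\<Sum>k\<in>I. (quad \<alpha>1 \<alpha>2 (zz \<nu> k) * (\<Prod>j\<in>I-{k}. zz \<nu> k - t * zz \<nu> j) -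
          t ^ n / t * quad b1 b2 (zz \<nu> k) * (\<Prod>j\<in>I-{k}. t * zz \<nu> k - zz \<nu> j)) /
        (zz \<nu> k * (\<Prod>j\<in>I-{k}. zz \<nu> k - zz \<nu> j)) * (\<Prod>j\<in>I-{k}. zz \<nu> j - c))"
    using t_difference_interpolation[OF finite_I inj_zz[OF \<nu>] zz_nonzero t_nonzero, of \<alpha>1 \<alpha>2 c b1 b2]
    unfolding card_I hh_def kap_def .
  have "DD \<alpha>1 \<alpha>2 \<xi> I \<nu> * (\<Sum>k\<in>I. (quad \<alpha>1 \<alpha>2 (zz \<nu> k) * (\<Prod>j\<in>I-{k}. zz \<nu> k - t * zz \<nu> j) -
          t ^ n / t * quad b1 b2 (zz \<nu> k) * (\<Prod>j\<in>I-{k}. t * zz \<nu> k - zz \<nu> j)) /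
        (zz \<nu> k * (\<Prod>j\<in>I-{k}. zz \<nu> k - zz \<nu> j)) * (\<Prod>j\<in>I-{k}. zz \<nu> j - c)) =
     (\<Sum>k\<in>I. Gm \<alpha>1 \<alpha>2 c k \<nu> - Gp \<alpha>1 \<alpha>2 c k \<nu>)"
    unfolding sum_distrib_left
  proof (intro sum.cong refl)
    fix k
    have aux: "D * ((x * U - T * y * V) / (z * P) * W) = D * (x / z) * (U / P * W) - D * (T * y / z) * (V / P * W)"
      for D x y z U V P W T :: complex
      by (simp add: diff_divide_distrib left_diff_distrib right_diff_distrib mult_ac)
    show "DD \<alpha>1 \<alpha>2 \<xi> I \<nu> * ((quad \<alpha>1 \<alpha>2 (zz \<nu> k) * (\<Prod>j\<in>I-{k}. zz \<nu> k - t * zz \<nu> j) -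
          t ^ n / t * quad b1 b2 (zz \<nu> k) * (\<Prod>j\<in>I-{k}. t * zz \<nu> k - zz \<nu> j)) /
        (zz \<nu> k * (\<Prod>j\<in>I-{k}. zz \<nu> k - zz \<nu> j)) * (\<Prod>j\<in>I-{k}. zz \<nu> j - c)) = Gm \<alpha>1 \<alpha>2 c k \<nu> - Gp \<alpha>1 \<alpha>2 c k \<nu>"
      unfolding Gm_def Gp_def prod.distrib prod_dividef tn by (rule aux)
  qed
  thus ?thesis unfolding * mult.left_commute[of "DD \<alpha>1 \<alpha>2 \<xi> I \<nu>"] by (simp only:)
qed

lemma t_neq_1: "t \<noteq> 1"
  using qpoch_t[of 1] n_pos unfolding qpoch_eq_0_iff by (auto dest: spec[of _ 0])

theorem t_difference_equation:
  assumes dom: "dominated 1 \<alpha>1 \<alpha>2" and c: "c \<noteq> 0"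
  defines "h \<equiv> \<lambda>c. infsum (\<lambda>\<nu>. DD \<alpha>1 \<alpha>2 \<xi> I \<nu> * hh \<nu> c) (ch I)"
  shows "t * quad \<alpha>1 \<alpha>2 c * (h (c / t) - h c) + quad b1 b2 c * (h (t * c) - h c) + c\<^sup>2 * kap \<alpha>1 \<alpha>2 * h c =
    c\<^sup>2 * (1 - t) * (t / t ^ n) * (\<Sum>k\<in>I. if is_last k then infsum (Ginf \<alpha>1 \<alpha>2 c k) (ch (I - {k})) else 0)"
proof -
  define D where "D = DD \<alpha>1 \<alpha>2 \<xi> I"
  define f where "f = (\<lambda>c \<nu>. D \<nu> * hh \<nu> c)"
  have sf: "f c summable_on ch I" for c
    unfolding f_def D_def by (rule DD_hh_summable[OF dom])
  define A where "A = t * quad \<alpha>1 \<alpha>2 c"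
  define B where "B = quad b1 b2 c"
  define C where "C = c\<^sup>2 * kap \<alpha>1 \<alpha>2"
  define E where "E = - (c\<^sup>2 * (1 - t) * (t / t ^ n))"
  have E: "E \<noteq> 0" unfolding E_def using c t_neq_1 by simp
  define S where "S = (\<lambda>\<nu>. \<Sum>k\<in>I. Gm \<alpha>1 \<alpha>2 c k \<nu> - Gp \<alpha>1 \<alpha>2 c k \<nu>)"
  define g where "g = (\<lambda>\<nu>. A * (f (c / t) \<nu> - f c \<nu>) + B * (f (t * c) \<nu> - f c \<nu>) + C * f c \<nu>)"
  have gs: "(g has_sum (A * (h (c / t) - h c) + B * (h (t * c) - h c) + C * h c)) (ch I)"
  proof -
    have hs: "(f c has_sum h c) (ch I)" for c
      using has_sum_infsum[OF sf[of c]] by (simp add: h_def f_def D_def)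
    show ?thesis unfolding g_def
      unfolding diff_conv_add_uminus
      by (intro has_sum_add has_sum_cmult_right has_sum_uminusI hs)
  qed
  have gS: "g \<nu> = E * S \<nu>" if "\<nu> \<in> ch I" for \<nu>
    using DD_interpolation[OF that, of \<alpha>1 \<alpha>2 c]
    unfolding g_def f_def A_def B_def C_def E_def S_def D_def by (simp add: algebra_simps)
  \<comment> \<open>Summability of the differences is read off from the interpolation identity
    instead of being estimated. Division by \<open>E\<close> uses \<open>t \<noteq> 1\<close> and
    \<open>c \<noteq> 0\<close>.\<close>
  have "S summable_on ch I"
  proof -
    have "(\<lambda>\<nu>. (1 / E) * g \<nu>) summable_on ch I"
      using gs by (intro summable_on_cmult_right) (rule has_sum_imp_summable)
    moreover have "(1 / E) * g \<nu> = S \<nu>" if "\<nu> \<in> ch I" for \<nu> using gS[OF that] E by simp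
    ultimately show ?thesis by (simp cong: summable_on_cong)
  qed
  note S = this
  have "A * (h (c / t) - h c) + B * (h (t * c) - h c) + C * h c = infsum g (ch I)"
    using infsumI[OF gs] by simp
  also have "\<dots> = infsum (\<lambda>\<nu>. E * S \<nu>) (ch I)" by (intro infsum_cong gS)
  also have "\<dots> = E * infsum S (ch I)" by (rule infsum_cmult_right) (use S in auto)
  also have "infsum S (ch I) = - (\<Sum>k\<in>I. if is_last k then infsum (Ginf \<alpha>1 \<alpha>2 c k) (ch (I - {k})) else 0)"
    using telescoped_sum[OF dom] S unfolding S_def by blast
  finally show ?thesis unfolding A_def B_def C_def E_def by simp
qed

end

lemma has_sum_sum:
  fixes f :: "'i \<Rightarrow> 'b \<Rightarrow> complex"
  assumes "finite A" "\<And>i. i \<in> A \<Longrightarrow> (f i has_sum s i) X"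
  shows "((\<lambda>x. \<Sum>i\<in>A. f i x) has_sum (\<Sum>i\<in>A. s i)) X"
  using assms by (induction A rule: finite_induct) (auto intro: has_sum_add)

text \<open>With this bound the expansion in powers of \<open>c\<close> may be summed
  coefficientwise over the lattice, so that the sum with linear factors is again a polynomial in
  \<open>c\<close>.\<close>

lemma norm_coeff_prod_linear_le:
  fixes z :: "'b \<Rightarrow> complex"
  assumes "finite I"
  shows "norm (coeff (\<Prod>j\<in>I. [:z j, -1:]) m) \<le> (\<Prod>j\<in>I. 1 + norm (z j))"
  using assms
proof (induction I arbitrary: m rule: finite_induct)
  case empty
  show ?case by (cases m) auto
next
  case (insert k I)
  define p where "p = (\<Prod>j\<in>I. [:z j, -1:])"
  define P where "P = (\<Prod>j\<in>I. 1 + norm (z j))"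
  have IH: "norm (coeff p m) \<le> P" for m using insert.IH by (simp add: p_def P_def)
  have P: "P \<ge> 0" unfolding P_def by (intro prod_nonneg) auto
  have "coeff ([:z k, -1:] * p) m = z k * coeff p m - (case m of 0 \<Rightarrow> 0 | Suc m' \<Rightarrow> coeff p m')"
    by (simp add: coeff_pCons split: nat.splits)
  also have "norm \<dots> \<le> norm (z k) * P + P"
  proof (rule order.trans[OF norm_triangle_ineq4] , rule add_mono)
    show "norm (z k * coeff p m) \<le> norm (z k) * P"
      unfolding norm_mult by (intro mult_left_mono IH) auto
    show "norm (case m of 0 \<Rightarrow> 0 | Suc m' \<Rightarrow> coeff p m') \<le> P"
      using IH P by (auto split: nat.splits)
  qed
  also have "\<dots> = (1 + norm (z k)) * P" by (simp add: algebra_simps)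
  finally show ?case using insert by (simp add: p_def P_def)
qed

lemma coeff_prod_linear_card:
  fixes z :: "'b \<Rightarrow> 'c :: idom"
  assumes "finite I"
  shows "coeff (\<Prod>j\<in>I. [:z j, -1:]) (card I) = (-1) ^ card I"
  using assms
proof (induction I rule: finite_induct)
  case (insert k I)
  have "coeff (\<Prod>j\<in>I. [:z j, -1:]) (Suc (card I)) = 0"
    using degree_prod_linear_le[of z I] by (intro coeff_eq_0) simp
  thus ?case using insert by (simp add: coeff_pCons)
qed simp

context q_config
begin

definition hp :: "(nat \<Rightarrow> int) \<Rightarrow> complex poly" where
  "hp \<nu> = (\<Prod>j\<in>I. [:zz \<nu> j, -1:])"

lemma hh_eq: "hh \<nu> c = (\<Sum>m\<le>n. coeff (hp \<nu>) m * c ^ m)"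
proof -
  have "hh \<nu> c = poly (hp \<nu>) c" by (simp add: hh_def hp_def poly_prod)
  also have "\<dots> = (\<Sum>m\<le>n. coeff (hp \<nu>) m * c ^ m)"
    unfolding poly_altdef
    by (rule sum.mono_neutral_left)
      (use degree_prod_linear_le[of "zz \<nu>" I] card_I in \<open>auto simp: hp_def coeff_eq_0\<close>)
  finally show ?thesis .
qed

definition he :: "complex \<Rightarrow> complex \<Rightarrow> nat \<Rightarrow> complex" where
  "he \<alpha>1 \<alpha>2 m = infsum (\<lambda>\<nu>. DD \<alpha>1 \<alpha>2 \<xi> I \<nu> * coeff (hp \<nu>) m) (ch I)"

lemma infsum_hh_eq:
  assumes "dominated 1 \<alpha>1 \<alpha>2"
  shows "infsum (\<lambda>\<nu>. DD \<alpha>1 \<alpha>2 \<xi> I \<nu> * hh \<nu> c) (ch I) = (\<Sum>m\<le>n. he \<alpha>1 \<alpha>2 m * c ^ m)"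
proof -
  have "((\<lambda>\<nu>. \<Sum>m\<le>n. DD \<alpha>1 \<alpha>2 \<xi> I \<nu> * coeff (hp \<nu>) m * c ^ m) has_sum (\<Sum>m\<le>n. he \<alpha>1 \<alpha>2 m * c ^ m)) (ch I)"
  proof (intro has_sum_sum has_sum_cmult_left finite_atMost)
    fix m
    have "(\<lambda>\<nu>. DD \<alpha>1 \<alpha>2 \<xi> I \<nu> * coeff (hp \<nu>) m) summable_on ch I"
      by (rule DD_mult_summable[OF assms, where C = 1])
        (use norm_coeff_prod_linear_le[OF finite_I] in \<open>simp add: hp_def\<close>)
    thus "((\<lambda>\<nu>. DD \<alpha>1 \<alpha>2 \<xi> I \<nu> * coeff (hp \<nu>) m) has_sum he \<alpha>1 \<alpha>2 m) (ch I)"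
      unfolding he_def by (rule has_sum_infsum)
  qed
  moreover have "(\<Sum>m\<le>n. DD \<alpha>1 \<alpha>2 \<xi> I \<nu> * coeff (hp \<nu>) m * c ^ m) = DD \<alpha>1 \<alpha>2 \<xi> I \<nu> * hh \<nu> c" for \<nu>
    by (simp add: hh_eq sum_distrib_left mult.assoc)
  ultimately show ?thesis by (simp add: infsumI)
qed

lemma he_n: "he \<alpha>1 \<alpha>2 n = (-1) ^ n * infsum (DD \<alpha>1 \<alpha>2 \<xi> I) (ch I)"
proof -
  have "coeff (hp \<nu>) n = (-1) ^ n" for \<nu>
    using coeff_prod_linear_card[OF finite_I, of "zz \<nu>"] by (simp add: hp_def card_I)
  thus ?thesis by (simp add: he_def mult.commute infsum_cmult_right')
qed

text \<open>At \<open>c = 1 / \<alpha>1\<close> the linear factors are, up to a constant, the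
  missing first factors of \<open>qpoch q (\<alpha>1 * z)\<close>. A value of the polynomial in
  \<open>c\<close> is therefore a bare sum with a changed parameter.\<close>

lemma DD_shift_alpha:
  assumes "\<alpha>1 \<noteq> 0"
  shows "DD \<alpha>1 \<alpha>2 \<xi> I \<nu> * hh \<nu> (1 / \<alpha>1) = (- 1 / \<alpha>1) ^ n * DD (\<alpha>1 / Q) \<alpha>2 \<xi> I \<nu>"
proof -
  have w: "wt1 (\<alpha>1 / Q) \<alpha>2 (\<xi> j) (\<nu> j) = wt1 \<alpha>1 \<alpha>2 (\<xi> j) (\<nu> j) * (1 - \<alpha>1 * zz \<nu> j)" for j
  proof -
    have "qpoch q (\<alpha>1 * zz \<nu> j) = (1 - \<alpha>1 * zz \<nu> j) * qpoch q (Q * \<alpha>1 * zz \<nu> j)"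
      by (subst qpoch_rec) (simp add: mult_ac)
    thus ?thesis by (simp add: wt1_def phi_def zz_def[symmetric])
  qed
  have "hh \<nu> (1 / \<alpha>1) = (\<Prod>j\<in>I. (- 1 / \<alpha>1) * (1 - \<alpha>1 * zz \<nu> j))"
    unfolding hh_def using assms by (intro prod.cong) (auto simp: field_simps)
  also have "\<dots> = (- 1 / \<alpha>1) ^ n * (\<Prod>j\<in>I. 1 - \<alpha>1 * zz \<nu> j)"
    by (simp only: prod.distrib prod_constant card_I)
  finally show ?thesis unfolding DD_def w prod.distrib by (simp only: mult_ac)
qed

end

section \<open>Boundary terms and the recursion in \<open>\<alpha>1\<close>\<close>

context q_selberg
begin

definition xi :: "complex \<Rightarrow> complex \<Rightarrow> nat \<Rightarrow> complex" where
  "xi x1 x2 l = (if l \<le> n then x1 * t ^ (l - 1) else x2 * t ^ (l - n - 1))"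

definition labels :: "nat \<Rightarrow> nat set" where
  "labels i = {1..i} \<union> {n+1..2*n-i}"

text \<open>The exponents between \<open>1 - n\<close> and \<open>n - 1\<close> cover the theta
  functions in \<open>Th\<close>, up to inversion of the argument, and all ratios between the two
  blocks together with their multiples by \<open>t\<close> and by \<open>1 / t\<close>.\<close>

definition generic :: "complex \<Rightarrow> complex \<Rightarrow> bool" where
  "generic x1 x2 \<longleftrightarrow> x1 \<noteq> 0 \<and> x2 \<noteq> 0 \<and>
    (\<forall>e. 1 - int n \<le> e \<and> e \<le> int n - 1 \<longrightarrow> qtheta q (x1 / x2 * t powi e) \<noteq> 0) \<and>
    (\<forall>x\<in>{x1, x2}. \<forall>b\<in>{b1, b2}. \<forall>k<n. qtheta q (x * b * t ^ k) \<noteq> 0)"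

definition Th :: "complex \<Rightarrow> complex \<Rightarrow> nat \<Rightarrow> complex" where
  "Th x1 x2 i = (\<Prod>j\<in>{1..i}. qtheta q (x2 / x1 * t powi (1 - int j))) *
    (\<Prod>k\<in>{1..n-i}. qtheta q (x1 / x2 * t powi (int i - int k + 1)))"

definition FF :: "complex \<Rightarrow> complex \<Rightarrow> complex \<Rightarrow> complex \<Rightarrow> complex" where
  "FF x1 x2 \<alpha>1 \<alpha>2 = (\<Sum>i\<le>n. infsum (DD \<alpha>1 \<alpha>2 (xi x1 x2) (labels i)) (ch (labels i)) / Th x1 x2 i)"

lemma genericD:
  assumes "generic x1 x2"
  shows "x1 \<noteq> 0" "x2 \<noteq> 0"
    "\<And>e. 1 - int n \<le> e \<Longrightarrow> e \<le> int n - 1 \<Longrightarrow> qtheta q (x1 / x2 * t powi e) \<noteq> 0"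
    "\<And>x b k. x \<in> {x1, x2} \<Longrightarrow> b \<in> {b1, b2} \<Longrightarrow> k < n \<Longrightarrow> qtheta q (x * b * t ^ k) \<noteq> 0"
  using assms unfolding generic_def by blast+

lemma generic_config:
  assumes g: "generic x1 x2" and i: "i \<le> n"
  shows "q_config q t b1 b2 n (xi x1 x2) (labels i)"
proof
  note G = genericD[OF g]
  show "finite (labels i)" by (simp add: labels_def)
  show "card (labels i) = n"
  proof -
    have "card (labels i) = card {1..i} + card {n+1..2*n-i}"
      unfolding labels_def using i by (intro card_Un_disjoint) auto
    thus ?thesis using i by simp
  qed
  show "xi x1 x2 j \<noteq> 0" for j using G by (simp add: xi_def)
  show "xi x1 x2 k = xi x1 x2 j * t ^ (k - j) \<and> k - j < n"
    if "j \<in> labels i" "k \<in> labels i" "j < k" "j \<le> n \<longleftrightarrow> k \<le> n" for j k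
  proof (cases "k \<le> n")
    case True
    hence "k - 1 = (j - 1) + (k - j)" using that by (auto simp: labels_def)
    hence "t ^ (k - 1) = t ^ (j - 1) * t ^ (k - j)" by (metis power_add)
    thus ?thesis using that True by (auto simp: xi_def labels_def)
  next
    case False
    hence "k - n - 1 = (j - n - 1) + (k - j)" using that by (auto simp: labels_def)
    hence "t ^ (k - n - 1) = t ^ (j - n - 1) * t ^ (k - j)" by (metis power_add)
    thus ?thesis using that False i by (auto simp: xi_def labels_def)
  qed
  show "qtheta q (xi x1 x2 k / xi x1 x2 j) \<noteq> 0 \<and> qtheta q (t * (xi x1 x2 k / xi x1 x2 j)) \<noteq> 0 \<and>
      qtheta q (t / (xi x1 x2 k / xi x1 x2 j)) \<noteq> 0"
    if jk: "j \<in> labels i" "k \<in> labels i" "j < k" "\<not> (j \<le> n \<longleftrightarrow> k \<le> n)" for j k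
  proof -
    have r: "1 \<le> j" "j \<le> i" "n + 1 \<le> k" "k \<le> 2 * n - i" using jk i by (auto simp: labels_def)
    \<comment> \<open>Each ratio between the blocks is the inverse of \<open>u e\<close>. Since both
      blocks are nonempty here, \<open>1 \<le> i < n\<close>, and this keeps \<open>e - 1\<close>,
      \<open>e\<close> and \<open>e + 1\<close> in the range of \<open>generic\<close>.\<close>
    define e where "e = int j - (int k - int n)"
    define u where "u = (\<lambda>e. x1 / x2 * t powi e)"
    have u0: "u e \<noteq> 0" for e using G by (simp add: u_def)
    have pj: "t ^ (j - 1) = t powi (int j - 1)" and pk: "t ^ (k - n - 1) = t powi (int k - int n - 1)"
      using r by (simp_all add: power_int_def nat_diff_distrib)
    have "t powi e = t powi (int j - 1) / t powi (int k - int n - 1)"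
      unfolding e_def by (subst power_int_diff[symmetric]) (auto simp: algebra_simps)
    moreover have "xi x1 x2 k = x2 * t powi (int k - int n - 1)" "xi x1 x2 j = x1 * t powi (int j - 1)"
      unfolding pj[symmetric] pk[symmetric] using r i by (simp_all add: xi_def)
    ultimately have q1: "xi x1 x2 k / xi x1 x2 j = 1 / u e"
      using G(1,2) by (simp add: u_def)
    have q2: "t * (xi x1 x2 k / xi x1 x2 j) = 1 / u (e - 1)"
      unfolding q1 using G by (simp add: u_def power_int_diff)
    have q3: "t / (xi x1 x2 k / xi x1 x2 j) = u (e + 1)"
      unfolding q1 by (simp add: u_def power_int_add)
    have nz: "qtheta q (u e) \<noteq> 0" "qtheta q (u (e - 1)) \<noteq> 0" "qtheta q (u (e + 1)) \<noteq> 0"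
      unfolding u_def by (rule G(3); use r i in \<open>simp add: e_def\<close>)+
    show ?thesis unfolding q1 q2[unfolded q1] q3[unfolded q1]
      using nz u0 qtheta_inverse_nonzero by blast
  qed
  show "qpoch q (b1 * (xi x1 x2 j * Q powi m)) \<noteq> 0 \<and> qpoch q (b2 * (xi x1 x2 j * Q powi m)) \<noteq> 0"
    if j: "j \<in> labels i" for j m
  proof -
    obtain x k where xk: "x \<in> {x1, x2}" "k < n" "xi x1 x2 j = x * t ^ k"
    proof (cases "j \<le> n")
      case True
      thus ?thesis using j n_pos by (intro that[of x1 "j - 1"]) (auto simp: xi_def labels_def)
    next
      case False
      thus ?thesis using j n_pos i by (intro that[of x2 "j - n - 1"]) (auto simp: xi_def labels_def)
    qed
    have "qpoch q (b * (xi x1 x2 j * Q powi m)) \<noteq> 0" if b: "b \<in> {b1, b2}" for b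
    proof -
      have "qpoch q (Q powi m * (x * b * t ^ k)) \<noteq> 0"
        using G(4)[OF xk(1) b xk(2)] G(1,2) xk(1) b b_nonzero by (intro qtheta_nonzero_imp_qpoch) auto
      thus ?thesis by (simp add: xk(3) mult_ac)
    qed
    thus ?thesis by blast
  qed
  show "l \<in> labels i" if "j \<in> labels i" "k \<in> labels i" "j \<le> n \<longleftrightarrow> k \<le> n" "j \<le> l" "l \<le> k" for j k l
    using that i by (auto simp: labels_def)
qed

lemma Th_nonzero:
  assumes g: "generic x1 x2" and i: "i \<le> n"
  shows "Th x1 x2 i \<noteq> 0"
proof -
  note G = genericD[OF g]
  have "qtheta q (x2 / x1 * t powi (1 - int j)) \<noteq> 0" if "j \<in> {1..i}" for j
  proof -
    have "qtheta q (1 / (x1 / x2 * t powi (int j - 1))) \<noteq> 0"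
      by (intro qtheta_inverse_nonzero G(3)) (use that i G(1,2) in auto)
    moreover have "1 / (x1 / x2 * t powi (int j - 1)) = x2 / x1 * t powi (1 - int j)"
      using power_int_minus[of t "int j - 1"] by (simp add: divide_inverse)
    ultimately show ?thesis by simp
  qed
  moreover have "qtheta q (x1 / x2 * t powi (int i - int k + 1)) \<noteq> 0" if "k \<in> {1..n-i}" for k
    by (intro G(3)) (use that i in auto)
  ultimately show ?thesis unfolding Th_def by simp
qed

text \<open>The weights \<open>1 / Th i\<close> are such that boundary terms at \<open>z = 0\<close> cancel between neighbouring \<open>i\<close>.\<close>

lemma connection_coefficient:
  assumes g: "generic x1 x2" and i: "1 \<le> i" "i \<le> n"
  shows "(1 / xi x1 x2 i) * (\<Prod>l\<in>{n+1..2*n-i}. pair_conn t (xi x1 x2 l / xi x1 x2 i)) / Th x1 x2 i =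
    - (1 / xi x1 x2 (2*n-i+1) / Th x1 x2 (i - 1))"
proof -
  note G = genericD[OF g]
  define m where "m = n - i"
  define th where "th = (\<lambda>e. qtheta q (x1 / x2 * t powi e))"
  have x0: "x1 / x2 \<noteq> 0" using G by simp
  define P where "P = (\<Prod>j\<in>{1..i-1}. qtheta q (x2 / x1 * t powi (1 - int j)))"
  \<comment> \<open>\<open>Th\<close> at \<open>i\<close> and at \<open>i - 1\<close> differ, up to
    monomials, in that the former contains \<open>A\<close> where the latter contains
    \<open>B\<close>; the connection factors supply precisely the quotient
    \<open>A / B\<close>.\<close>
  define A where "A = (\<Prod>k\<in>{1..m}. th (int i - int k + 1))"
  define B where "B = (\<Prod>k\<in>{1..m}. th (int i - int k - 1))"
  have B0: "B \<noteq> 0"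
  proof -
    have "th (int i - int k - 1) \<noteq> 0" if "k \<in> {1..m}" for k
      unfolding th_def by (rule G(3)) (use that i in \<open>auto simp: m_def\<close>)
    thus ?thesis by (simp add: B_def)
  qed
  have conn: "(\<Prod>l\<in>{n+1..2*n-i}. pair_conn t (xi x1 x2 l / xi x1 x2 i)) = (1 / t) ^ m * (A / B)"
  proof -
    have "(\<Prod>l\<in>{n+1..2*n-i}. pair_conn t (xi x1 x2 l / xi x1 x2 i)) =
        (\<Prod>k\<in>{1..m}. pair_conn t (xi x1 x2 (k + n) / xi x1 x2 i))"
      by (rule prod.reindex_bij_witness[of _ "\<lambda>k. k + n" "\<lambda>l. l - n"]) (use i in \<open>auto simp: m_def\<close>)
    also have "\<dots> = (\<Prod>k\<in>{1..m}. (1 / t) * (th (int i - int k + 1) / th (int i - int k - 1)))"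
    proof (intro prod.cong refl)
      fix k assume k: "k \<in> {1..m}"
      define u where "u = x1 / x2 * t powi (int i - int k)"
      have u0: "u \<noteq> 0" using x0 by (simp add: u_def)
      have "t powi (int i - int k) = t ^ (i - 1) / t ^ (k - 1)"
      proof -
        have "int i - int k = int (i - 1) - int (k - 1)" using k i by simp
        thus ?thesis by (simp only: power_int_diff[OF disjI1[OF t_nonzero]] power_int_of_nat)
      qed
      hence c: "xi x1 x2 (k + n) / xi x1 x2 i = 1 / u"
        using k i G by (simp add: xi_def u_def)
      have tc: "qtheta q (t / (1 / u)) = th (int i - int k + 1)"
        unfolding th_def by (rule arg_cong[of _ _ "qtheta q"]) (simp add: u_def power_int_add mult_ac)
      have ti: "t * (1 / u) = 1 / (u / t)" by simp
      have ut: "u / t = x1 / x2 * t powi (int i - int k - 1)"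
        by (simp add: u_def power_int_diff)
      have t2: "qtheta q (t * (1 / u)) = - (1 / (u / t)) * th (int i - int k - 1)"
        unfolding ti using u0 G(1,2) by (subst qtheta_inverse) (auto simp: th_def ut)
      show "pair_conn t (xi x1 x2 (k + n) / xi x1 x2 i) = (1 / t) * (th (int i - int k + 1) / th (int i - int k - 1))"
        unfolding c pair_conn_def t2 tc using u0 by simp
    qed
    also have "\<dots> = (1 / t) ^ m * (A / B)"
      unfolding A_def B_def prod.distrib prod_dividef by (simp add: power_one_over)
    finally show ?thesis .
  qed
  have Thi: "Th x1 x2 i = P * (- (x2 / x1 * t powi (1 - int i)) * th (int i - 1)) * A"
  proof -
    have "{1..i} = insert i {1..i-1}" using i by auto
    moreover have "i \<notin> {1..i-1}" using i by auto
    ultimately have "(\<Prod>j\<in>{1..i}. qtheta q (x2 / x1 * t powi (1 - int j))) =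
        P * qtheta q (x2 / x1 * t powi (1 - int i))"
      unfolding P_def by (simp add: mult.commute)
    also have "x2 / x1 * t powi (1 - int i) = 1 / (x1 / x2 * t powi (int i - 1))"
      using power_int_minus[of t "int i - 1"] by (simp add: divide_inverse)
    also have "qtheta q \<dots> = - (1 / (x1 / x2 * t powi (int i - 1))) * th (int i - 1)"
      unfolding th_def using x0 by (intro qtheta_inverse) auto
    also have "1 / (x1 / x2 * t powi (int i - 1)) = x2 / x1 * t powi (1 - int i)"
      using power_int_minus[of t "int i - 1"] by (simp add: divide_inverse)
    finally show ?thesis unfolding Th_def A_def m_def th_def by simp
  qed
  have Thi': "Th x1 x2 (i - 1) = P * (th (int i - 1) * B)"
  proof -
    have "(\<Prod>k\<in>{1..n-(i-1)}. qtheta q (x1 / x2 * t powi (int (i - 1) - int k + 1))) =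
        (\<Prod>k\<in>{1..Suc m}. th (int i - int k))"
      using i by (intro prod.cong) (auto simp: m_def th_def of_nat_diff)
    also have "\<dots> = th (int i - int 1) * (\<Prod>k\<in>{1..m}. th (int i - int (Suc k)))"
      unfolding One_nat_def prod.atLeast1_atMost_eq by (rule prod.lessThan_Suc_shift)
    also have "(\<Prod>k\<in>{1..m}. th (int i - int (Suc k))) = B"
      unfolding B_def by (intro prod.cong) (auto simp: algebra_simps)
    finally show ?thesis unfolding Th_def P_def by simp
  qed
  have nz: "P \<noteq> 0" "A \<noteq> 0" "th (int i - 1) \<noteq> 0"
    using Th_nonzero[OF g i(2)] unfolding Thi by auto
  have xii: "xi x1 x2 i = x1 * t powi (int i - 1)"
    using i by (simp add: xi_def power_int_def nat_diff_distrib)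
  have xil: "xi x1 x2 (2*n-i+1) = x2 * t ^ m"
  proof -
    have "\<not> 2 * n - i + 1 \<le> n" "2 * n - i + 1 - n - 1 = n - i" using i by linarith+
    thus ?thesis by (simp only: xi_def m_def if_False)
  qed
  have tt: "t powi (int i - 1) * t powi (1 - int i) = 1"
    by (subst power_int_add[symmetric]) auto
  have *: "xi x1 x2 i * (x2 / x1 * t powi (1 - int i)) = x2"
  proof -
    have "xi x1 x2 i * (x2 / x1 * t powi (1 - int i)) = (x1 * x2 / x1) * (t powi (int i - 1) * t powi (1 - int i))"
      unfolding xii by (simp add: mult_ac)
    thus ?thesis unfolding tt using G by simp
  qed
  have "(1 / xi x1 x2 i) * ((1 / t) ^ m * (A / B)) / Th x1 x2 i =
     - (A / A) * (1 / t) ^ m / (B * P * th (int i - 1) * (xi x1 x2 i * (x2 / x1 * t powi (1 - int i))))"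
    unfolding Thi by simp
  also have "\<dots> = - (1 / xi x1 x2 (2*n-i+1) / Th x1 x2 (i - 1))"
    unfolding * xil Thi' using nz by (simp add: power_one_over mult_ac)
  finally show ?thesis unfolding conn .
qed
text \<open>\<open>bd\<close>, \<open>domin\<close> and \<open>hF\<close> restate
  \<open>Ginf\<close>, \<open>dominated\<close> and the sum of \<open>hh\<close> outside the locale
  of a single configuration, because boundary terms of different configurations have to be
  compared.\<close>

definition bd :: "complex \<Rightarrow> complex \<Rightarrow> complex \<Rightarrow> (nat \<Rightarrow> complex) \<Rightarrow> nat set \<Rightarrow> nat \<Rightarrow> complex" where
  "bd \<alpha>1 \<alpha>2 c \<xi> J k = infsum (\<lambda>\<nu>. DD \<alpha>1 \<alpha>2 \<xi> J \<nu> * (1 / \<xi> k) *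
    (\<Prod>j\<in>J. t powi (2 * \<nu> j) * (if j < k then 1 else pair_conn t (\<xi> j / \<xi> k)) * t * (\<xi> j * Q powi \<nu> j - c))) (ch J)"

definition domin :: "nat \<Rightarrow> complex \<Rightarrow> complex \<Rightarrow> (nat \<Rightarrow> complex) \<Rightarrow> nat set \<Rightarrow> bool" where
  "domin e \<alpha>1 \<alpha>2 \<xi> I \<longleftrightarrow> (\<exists>K \<rho>. K > 0 \<and> 0 < \<rho> \<and> \<rho> < 1 \<and>
    (\<forall>\<nu>\<in>ch I. DD \<alpha>1 \<alpha>2 \<xi> I \<nu> \<noteq> 0 \<longrightarrow>
      (\<forall>j\<in>I. norm (phi \<alpha>1 \<alpha>2 (\<xi> j * Q powi \<nu> j)) * lat_wt e (\<xi> j) (\<nu> j) \<le> K * \<rho> ^ nat \<bar>\<nu> j\<bar>)))"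

definition hF :: "complex \<Rightarrow> complex \<Rightarrow> (nat \<Rightarrow> complex) \<Rightarrow> nat set \<Rightarrow> complex \<Rightarrow> complex" where
  "hF \<alpha>1 \<alpha>2 \<xi> I c = infsum (\<lambda>\<nu>. DD \<alpha>1 \<alpha>2 \<xi> I \<nu> * (\<Prod>j\<in>I. \<xi> j * Q powi \<nu> j - c)) (ch I)"

end

context q_config
begin

lemma dominated_iff: "dominated e \<alpha>1 \<alpha>2 \<longleftrightarrow> domin e \<alpha>1 \<alpha>2 \<xi> I"
  unfolding dominated_def domin_def zz_def ..

lemma hF_eq: "hF \<alpha>1 \<alpha>2 \<xi> I c = infsum (\<lambda>\<nu>. DD \<alpha>1 \<alpha>2 \<xi> I \<nu> * hh \<nu> c) (ch I)"
  unfolding hF_def hh_def zz_def ..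

lemma hF_equation:
  assumes "domin 1 \<alpha>1 \<alpha>2 \<xi> I" "c \<noteq> 0"
  defines "h \<equiv> hF \<alpha>1 \<alpha>2 \<xi> I"
  shows "t * quad \<alpha>1 \<alpha>2 c * (h (c / t) - h c) + quad b1 b2 c * (h (t * c) - h c) +
      c\<^sup>2 * (t * \<alpha>1 * \<alpha>2 * (1 - 1 / t ^ n) + b1 * b2 * (1 - t ^ n)) * h c =
    c\<^sup>2 * (1 - t) * (t / t ^ n) * (\<Sum>k\<in>I. if is_last k then bd \<alpha>1 \<alpha>2 c \<xi> (I - {k}) k else 0)"
proof -
  have "infsum (Ginf \<alpha>1 \<alpha>2 c k) (ch (I - {k})) = bd \<alpha>1 \<alpha>2 c \<xi> (I - {k}) k" for k
    unfolding Ginf_def bd_def zz_def ..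
  note b = this
  show ?thesis
    using t_difference_equation[of \<alpha>1 \<alpha>2 c] assms(1,2) unfolding h_def hF_eq kap_def dominated_iff b by blast
qed

lemma hF_poly:
  assumes "domin 1 \<alpha>1 \<alpha>2 \<xi> I"
  shows "\<exists>e. (\<forall>c. hF \<alpha>1 \<alpha>2 \<xi> I c = (\<Sum>m\<le>n. e m * c ^ m)) \<and>
    e n = (-1) ^ n * infsum (DD \<alpha>1 \<alpha>2 \<xi> I) (ch I)"
  using infsum_hh_eq[of \<alpha>1 \<alpha>2] he_n[of \<alpha>1 \<alpha>2] assms unfolding hF_eq dominated_iff
  by (intro exI[of _ "he \<alpha>1 \<alpha>2"]) auto

lemma hF_shift_alpha:
  assumes "\<alpha>1 \<noteq> 0"
  shows "hF \<alpha>1 \<alpha>2 \<xi> I (1 / \<alpha>1) = (- 1 / \<alpha>1) ^ n * infsum (DD (\<alpha>1 / Q) \<alpha>2 \<xi> I) (ch I)"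
  unfolding hF_eq DD_shift_alpha[OF assms] by (rule infsum_cmult_right')

end

context q_selberg
begin

lemma labels_remove:
  assumes "1 \<le> i" "i \<le> n"
  shows "labels i - {i} = {1..i-1} \<union> {n+1..2*n-i}"
    "labels (i - 1) - {2*n-i+1} = {1..i-1} \<union> {n+1..2*n-i}"
  using assms by (auto simp: labels_def)

text \<open>Both terms are sums over the same chamber with the same label set \<open>J\<close>.
  Label \<open>2 * n - i + 1\<close> exceeds all of \<open>J\<close>, so all its pair limits are 1;
  the labels of \<open>J\<close> beyond \<open>i\<close> are those of the second block, and they
  yield the connection factors.\<close>

lemma bd_cancel:
  assumes g: "generic x1 x2" and i: "1 \<le> i" "i \<le> n"
  shows "bd \<alpha>1 \<alpha>2 c (xi x1 x2) (labels i - {i}) i / Th x1 x2 i +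
    bd \<alpha>1 \<alpha>2 c (xi x1 x2) (labels (i - 1) - {2*n-i+1}) (2*n-i+1) / Th x1 x2 (i - 1) = 0"
proof -
  define J where "J = {1..i-1} \<union> {n+1..2*n-i}"
  define \<xi> where "\<xi> = xi x1 x2"
  define f where "f = (\<lambda>\<nu>. DD \<alpha>1 \<alpha>2 \<xi> J \<nu> * (\<Prod>j\<in>J. t powi (2 * \<nu> j) * t * (\<xi> j * Q powi \<nu> j - c)))"
  define s where "s = infsum f (ch J)"
  define C where "C = (\<Prod>l\<in>{n+1..2*n-i}. pair_conn t (\<xi> l / \<xi> i))"
  have C: "(\<Prod>j\<in>J. if j < i then 1 else pair_conn t (\<xi> j / \<xi> i)) = C"
    unfolding C_def by (rule prod.mono_neutral_cong_right) (use i in \<open>auto simp: J_def\<close>)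
  have "DD \<alpha>1 \<alpha>2 \<xi> J \<nu> * (1 / \<xi> i) *
      (\<Prod>j\<in>J. t powi (2 * \<nu> j) * (if j < i then 1 else pair_conn t (\<xi> j / \<xi> i)) * t * (\<xi> j * Q powi \<nu> j - c)) =
    (1 / \<xi> i * C) * f \<nu>" for \<nu>
    unfolding f_def prod.distrib C by (simp only: mult_ac)
  hence 1: "bd \<alpha>1 \<alpha>2 c \<xi> J i = (1 / \<xi> i * C) * s"
    unfolding bd_def s_def by (simp only: infsum_cmult_right')
  have "DD \<alpha>1 \<alpha>2 \<xi> J \<nu> * (1 / \<xi> (2*n-i+1)) *
      (\<Prod>j\<in>J. t powi (2 * \<nu> j) * (if j < 2*n-i+1 then 1 else pair_conn t (\<xi> j / \<xi> (2*n-i+1))) * t * (\<xi> j * Q powi \<nu> j - c)) =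
    (1 / \<xi> (2*n-i+1)) * f \<nu>" for \<nu>
  proof -
    have "(\<Prod>j\<in>J. t powi (2 * \<nu> j) * (if j < 2*n-i+1 then 1 else pair_conn t (\<xi> j / \<xi> (2*n-i+1))) * t * (\<xi> j * Q powi \<nu> j - c)) =
      (\<Prod>j\<in>J. t powi (2 * \<nu> j) * t * (\<xi> j * Q powi \<nu> j - c))"
      by (rule prod.cong) (use i in \<open>auto simp: J_def\<close>)
    thus ?thesis unfolding f_def by (simp only: mult_ac)
  qed
  hence 2: "bd \<alpha>1 \<alpha>2 c \<xi> J (2*n-i+1) = (1 / \<xi> (2*n-i+1)) * s"
    unfolding bd_def s_def by (simp only: infsum_cmult_right')
  have "(1 / \<xi> i) * C / Th x1 x2 i = - (1 / \<xi> (2*n-i+1) / Th x1 x2 (i - 1))"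
    unfolding C_def \<xi>_def by (rule connection_coefficient[OF g i])
  hence "(1 / \<xi> i * C) * s / Th x1 x2 i = - (1 / \<xi> (2*n-i+1) / Th x1 x2 (i - 1)) * s"
    by (metis times_divide_eq_left)
  thus ?thesis
    unfolding labels_remove[OF i] J_def[symmetric] \<xi>_def[symmetric] 1 2 by simp
qed

lemma sum_is_last:
  assumes "q_config q t b1 b2 n \<xi> (labels i)" and i: "i \<le> n"
  shows "(\<Sum>k\<in>labels i. if q_config.is_last n (labels i) k then f k else 0) =
    (if 1 \<le> i then f i else 0) + (if i < n then f (2*n-i) else (0 :: complex))"
proof -
  interpret q_config q t b1 b2 n \<xi> "labels i" by fact
  have fin: "finite (labels i)" by simp
  have "(\<Sum>k\<in>labels i. if is_last k then f k else 0) = sum f {k\<in>labels i. is_last k}"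
    using fin by (simp add: sum.inter_filter)
  also have "{k\<in>labels i. is_last k} = (if 1 \<le> i then {i} else {}) \<union> (if i < n then {2*n-i} else {})"
  proof -
    have mem: "k \<in> labels i \<longleftrightarrow> (1 \<le> k \<and> k \<le> i) \<or> (n + 1 \<le> k \<and> k \<le> 2 * n - i)" for k
      by (simp add: labels_def)
    have "is_last k \<longleftrightarrow> k = i \<or> k = 2 * n - i" if k: "k \<in> labels i" for k
    proof
      assume L: "is_last k"
      show "k = i \<or> k = 2 * n - i"
      proof (rule ccontr)
        assume nk: "\<not> (k = i \<or> k = 2 * n - i)"
        have "(1 \<le> k \<and> Suc k \<le> i) \<or> (n + 1 \<le> k \<and> Suc k \<le> 2 * n - i)"
          using k nk unfolding mem by linarith
        hence "Suc k \<in> labels i" "k \<le> n \<longleftrightarrow> Suc k \<le> n" using i unfolding mem by linarith+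
        thus False using L unfolding is_last_def by blast
      qed
    next
      assume ki: "k = i \<or> k = 2 * n - i"
      show "is_last k" unfolding is_last_def
      proof (intro ballI impI)
        fix l assume "l \<in> labels i" "k < l"
        thus "\<not> (k \<le> n \<longleftrightarrow> l \<le> n)" using ki k i unfolding mem by linarith
      qed
    qed
    moreover have "i \<in> labels i \<longleftrightarrow> 1 \<le> i \<or> i = n \<and> False" "2 * n - i \<in> labels i \<longleftrightarrow> i < n \<or> i = n \<and> 1 \<le> i"
      unfolding mem using i by presburger+
    ultimately show ?thesis using i by (cases "i = n") auto
  qed
  also have "sum f \<dots> = (if 1 \<le> i then f i else 0) + (if i < n then f (2*n-i) else 0)"
    using i by (subst sum.union_disjoint) auto
  finally show ?thesis .
qed

text \<open>The first block at \<open>Suc i\<close> cancels against the second block at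
  \<open>i\<close>. Nothing is left over at the ends, since the first block is empty at
  \<open>i = 0\<close> and the second one at \<open>i = n\<close>.\<close>

lemma bd_total:
  assumes g: "generic x1 x2"
  shows "(\<Sum>i\<le>n. (\<Sum>k\<in>labels i. if q_config.is_last n (labels i) k
      then bd \<alpha>1 \<alpha>2 c (xi x1 x2) (labels i - {k}) k else 0) / Th x1 x2 i) = 0"
proof -
  define X where "X = (\<lambda>i. bd \<alpha>1 \<alpha>2 c (xi x1 x2) (labels i - {i}) i / Th x1 x2 i)"
  define Y where "Y = (\<lambda>i. bd \<alpha>1 \<alpha>2 c (xi x1 x2) (labels i - {2*n-i}) (2*n-i) / Th x1 x2 i)"
  have "(\<Sum>i\<le>n. (\<Sum>k\<in>labels i. if q_config.is_last n (labels i) k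
      then bd \<alpha>1 \<alpha>2 c (xi x1 x2) (labels i - {k}) k else 0) / Th x1 x2 i) =
    (\<Sum>i\<le>n. (if 1 \<le> i then X i else 0) + (if i < n then Y i else 0))"
  proof (intro sum.cong refl)
    fix i assume i: "i \<in> {..n}"
    hence "i \<le> n" by simp
    show "(\<Sum>k\<in>labels i. if q_config.is_last n (labels i) k
      then bd \<alpha>1 \<alpha>2 c (xi x1 x2) (labels i - {k}) k else 0) / Th x1 x2 i =
      (if 1 \<le> i then X i else 0) + (if i < n then Y i else 0)"
      unfolding sum_is_last[OF generic_config[OF g \<open>i \<le> n\<close>] \<open>i \<le> n\<close>]
      by (simp add: X_def Y_def add_divide_distrib)
  qed
  also have "\<dots> = (\<Sum>i\<le>n. if 1 \<le> i then X i else 0) + (\<Sum>i\<le>n. if i < n then Y i else 0)"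
    by (rule sum.distrib)
  also have "(\<Sum>i\<le>n. if 1 \<le> i then X i else 0) = (\<Sum>i<n. X (Suc i))"
    unfolding lessThan_Suc_atMost[symmetric] by (subst sum.lessThan_Suc_shift) simp
  also have "(\<Sum>i\<le>n. if i < n then Y i else 0) = (\<Sum>i<n. Y i)"
    unfolding lessThan_Suc_atMost[symmetric] by simp
  also have "(\<Sum>i<n. X (Suc i)) + (\<Sum>i<n. Y i) = (\<Sum>i<n. X (Suc i) + Y i)"
    by (rule sum.distrib[symmetric])
  also have "\<dots> = 0"
  proof (intro sum.neutral ballI)
    fix i assume i: "i \<in> {..<n}"
    hence e: "2 * n - Suc i + 1 = 2 * n - i" by auto
    show "X (Suc i) + Y i = 0"
      using bd_cancel[OF g, of "Suc i" \<alpha>1 \<alpha>2 c] i unfolding X_def Y_def e by simp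
  qed
  finally show ?thesis .
qed

lemma t_power_neq_1: "s \<in> {1..n} \<Longrightarrow> t ^ s \<noteq> 1"
  using qpoch_t[of s] unfolding qpoch_eq_0_iff by (auto dest: spec[of _ 0])

theorem FF_recursion:
  assumes g: "generic x1 x2" and dom: "\<And>i. i \<le> n \<Longrightarrow> domin 1 \<alpha>1 \<alpha>2 (xi x1 x2) (labels i)"
  shows "FF x1 x2 (\<alpha>1 / Q) \<alpha>2 * (\<Prod>s<n. 1 - \<alpha>1 * \<alpha>2 / (b1 * b2 * t ^ (n + s - 1))) =
    (\<Prod>s<n. (1 - \<alpha>1 / (b1 * t ^ s)) * (1 - \<alpha>1 / (b2 * t ^ s))) * FF x1 x2 \<alpha>1 \<alpha>2"
proof (cases "\<alpha>1 = 0")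
  case False
  define \<xi> where "\<xi> = xi x1 x2"
  have "\<exists>e. (\<forall>c. hF \<alpha>1 \<alpha>2 \<xi> (labels i) c = (\<Sum>m\<le>n. e m * c ^ m)) \<and>
      e n = (-1) ^ n * infsum (DD \<alpha>1 \<alpha>2 \<xi> (labels i)) (ch (labels i))" if i: "i \<le> n" for i
    unfolding \<xi>_def by (rule q_config.hF_poly[OF generic_config[OF g i] dom[OF i]])
  then obtain e where e: "\<And>i c. i \<le> n \<Longrightarrow> hF \<alpha>1 \<alpha>2 \<xi> (labels i) c = (\<Sum>m\<le>n. e i m * c ^ m)"
    "\<And>i. i \<le> n \<Longrightarrow> e i n = (-1) ^ n * infsum (DD \<alpha>1 \<alpha>2 \<xi> (labels i)) (ch (labels i))"
    by metis
  define H where "H = (\<Sum>m\<le>n. monom (\<Sum>i\<le>n. e i m / Th x1 x2 i) m)"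
  have H: "poly H c = (\<Sum>i\<le>n. hF \<alpha>1 \<alpha>2 \<xi> (labels i) c / Th x1 x2 i)" for c
  proof -
    have "poly H c = (\<Sum>m\<le>n. \<Sum>i\<le>n. e i m / Th x1 x2 i * c ^ m)"
      by (simp add: H_def poly_sum poly_monom sum_distrib_right)
    also have "\<dots> = (\<Sum>i\<le>n. \<Sum>m\<le>n. e i m / Th x1 x2 i * c ^ m)" by (rule sum.swap)
    also have "\<dots> = (\<Sum>i\<le>n. hF \<alpha>1 \<alpha>2 \<xi> (labels i) c / Th x1 x2 i)"
      by (intro sum.cong refl) (simp add: e(1) sum_divide_distrib)
    finally show ?thesis .
  qed
  have deg: "degree H \<le> n"
    unfolding H_def by (intro degree_sum_le) (auto intro: order.trans[OF degree_monom_le])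
  have lead: "coeff H n = (-1) ^ n * FF x1 x2 \<alpha>1 \<alpha>2"
  proof -
    have "coeff H n = (\<Sum>m\<le>n. if m = n then (\<Sum>i\<le>n. e i m / Th x1 x2 i) else 0)"
      by (simp add: H_def coeff_sum)
    also have "\<dots> = (\<Sum>i\<le>n. e i n / Th x1 x2 i)" by simp
    also have "\<dots> = (-1) ^ n * FF x1 x2 \<alpha>1 \<alpha>2"
      by (simp add: e(2) FF_def \<xi>_def sum_distrib_left)
    finally show ?thesis .
  qed
  define a where "a = 1 / \<alpha>1"
  have a: "a \<noteq> 0" "1 / a = \<alpha>1" using False by (auto simp: a_def)
  have Ha: "poly H a = (- a) ^ n * FF x1 x2 (\<alpha>1 / Q) \<alpha>2"
  proof -
    have "hF \<alpha>1 \<alpha>2 \<xi> (labels i) a = (- a) ^ n * infsum (DD (\<alpha>1 / Q) \<alpha>2 \<xi> (labels i)) (ch (labels i))" if i: "i \<le> n" for i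
      using q_config.hF_shift_alpha[OF generic_config[OF g i] False] by (simp add: a_def \<xi>_def)
    thus ?thesis by (simp add: H FF_def \<xi>_def sum_distrib_left)
  qed
  \<comment> \<open>The equation for a single \<open>i\<close> is inhomogeneous; only after
    weighting by \<open>1 / Th\<close> and summing over \<open>i\<close> does the right-hand side
    vanish.\<close>
  have eq: "t * quad (1 / a) \<alpha>2 c * (poly H (c / t) - poly H c) + quad b1 b2 c * (poly H (t * c) - poly H c) +
      c\<^sup>2 * (t * (1 / a) * \<alpha>2 * (1 - 1 / t ^ n) + b1 * b2 * (1 - t ^ n)) * poly H c = 0" if c: "c \<noteq> 0" for c
  proof -
    define A where "A = t * quad \<alpha>1 \<alpha>2 c"
    define B where "B = quad b1 b2 c"
    define C where "C = c\<^sup>2 * (t * \<alpha>1 * \<alpha>2 * (1 - 1 / t ^ n) + b1 * b2 * (1 - t ^ n))"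
    define E where "E = c\<^sup>2 * (1 - t) * (t / t ^ n)"
    define h where "h = (\<lambda>i. hF \<alpha>1 \<alpha>2 \<xi> (labels i))"
    define R where "R = (\<lambda>i. \<Sum>k\<in>labels i. if q_config.is_last n (labels i) k
      then bd \<alpha>1 \<alpha>2 c (xi x1 x2) (labels i - {k}) k else 0)"
    have hi: "A * (h i (c / t) - h i c) + B * (h i (t * c) - h i c) + C * h i c = E * R i" if i: "i \<le> n" for i
      using q_config.hF_equation[OF generic_config[OF g i] dom[OF i] c]
      unfolding A_def B_def C_def E_def h_def R_def \<xi>_def .
    have "A * (poly H (c / t) - poly H c) + B * (poly H (t * c) - poly H c) + C * poly H c =
      (\<Sum>i\<le>n. (A * (h i (c / t) - h i c) + B * (h i (t * c) - h i c) + C * h i c) / Th x1 x2 i)"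
      unfolding H
      by (simp add: h_def sum_subtractf sum.distrib sum_distrib_left add_divide_distrib diff_divide_distrib right_diff_distrib)
    also have "\<dots> = (\<Sum>i\<le>n. E * R i / Th x1 x2 i)"
      by (rule sum.cong[OF refl]) (simp only: hi atMost_iff)
    also have "\<dots> = E * (\<Sum>i\<le>n. R i / Th x1 x2 i)"
      by (simp add: sum_distrib_left)
    also have "(\<Sum>i\<le>n. R i / Th x1 x2 i) = 0"
      unfolding R_def by (rule bd_total[OF g])
    finally show ?thesis unfolding a(2) A_def B_def C_def by simp
  qed
  have main: "poly H a * (\<Prod>s<n. t * (1 / a) * \<alpha>2 * (1 / t ^ s - 1 / t ^ n) + b1 * b2 * (t ^ s - t ^ n)) =
    (\<Prod>s<n. (1 - t ^ Suc s) * (1 - a * b1 * t ^ s) * (1 - a * b2 * t ^ s) / (a * t ^ s)) * coeff H n"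
    by (rule t_difference_leading_coeff[OF deg a(1) t_nonzero t_power_neq_1 eq])
  have bb: "b1 * b2 \<noteq> 0" using b_nonzero by simp
  \<comment> \<open>The factors are normalised so that \<open>t ^ s * (b1 * b2)\<close> and
    \<open>1 - t ^ k\<close> with \<open>1 \<le> k \<le> n\<close> split off on both sides of
    \<open>main\<close>. On the left the powers come as \<open>n - s\<close>, on the right as
    \<open>Suc s\<close>, which explains the reversal \<open>rev\<close>.\<close>
  have f1: "t * (1 / a) * \<alpha>2 * (1 / t ^ s - 1 / t ^ n) + b1 * b2 * (t ^ s - t ^ n) =
      (t ^ s * (b1 * b2)) * ((1 - t ^ (n - s)) * (1 - \<alpha>1 * \<alpha>2 / (b1 * b2 * t ^ (n + s - 1))))" if s: "s < n" for s
  proof -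
    define T where "T = t ^ s"
    define U where "U = t ^ (n - s)"
    have TU: "T \<noteq> 0" "U \<noteq> 0" by (simp_all add: T_def U_def)
    have tn: "t ^ n = T * U" unfolding T_def U_def using s by (simp add: power_add[symmetric])
    have "t * t ^ (n + s - 1) = t ^ (n + s)" using n_pos by (cases n) auto
    hence ts: "t ^ (n + s - 1) = T * U * T / t" by (simp add: power_add tn T_def divide_simps mult_ac)
    show ?thesis
      unfolding a(2) T_def[symmetric] U_def[symmetric] tn ts using TU bb
      by (simp add: field_simps)
  qed
  have f2: "(1 - t ^ Suc s) * (1 - a * b1 * t ^ s) * (1 - a * b2 * t ^ s) / (a * t ^ s) =
      (t ^ s * (b1 * b2)) * ((1 - t ^ Suc s) * (a * ((1 - \<alpha>1 / (b1 * t ^ s)) * (1 - \<alpha>1 / (b2 * t ^ s)))))" for s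
  proof -
    define T where "T = t ^ s"
    define W where "W = 1 - t ^ Suc s"
    have T: "T \<noteq> 0" by (simp add: T_def)
    show ?thesis
      unfolding T_def[symmetric] W_def[symmetric] a(2)[symmetric] using T a(1) b_nonzero
      by (simp add: field_simps power2_eq_square)
  qed
  have rev: "(\<Prod>s<n. 1 - t ^ (n - s)) = (\<Prod>s<n. 1 - t ^ Suc s)"
    by (rule prod.reindex_bij_witness[of _ "\<lambda>s. n - Suc s" "\<lambda>s. n - Suc s"]) (auto simp: Suc_diff_Suc)
  define P where "P = (\<Prod>s<n. 1 - \<alpha>1 * \<alpha>2 / (b1 * b2 * t ^ (n + s - 1)))"
  define R where "R = (\<Prod>s<n. (1 - \<alpha>1 / (b1 * t ^ s)) * (1 - \<alpha>1 / (b2 * t ^ s)))"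
  define W where "W = (\<Prod>s<n. 1 - t ^ Suc s)"
  define V where "V = (\<Prod>s<n. t ^ s * (b1 * b2))"
  have V: "V \<noteq> 0" unfolding V_def using bb by simp
  have W: "W \<noteq> 0" unfolding W_def
  proof -
    have "1 - t ^ Suc s \<noteq> 0" if "s < n" for s using t_power_neq_1[of "Suc s"] that by auto
    thus "(\<Prod>s<n. 1 - t ^ Suc s) \<noteq> 0" by (simp only: prod_zero_iff finite_lessThan) blast
  qed
  have l: "(\<Prod>s<n. t * (1 / a) * \<alpha>2 * (1 / t ^ s - 1 / t ^ n) + b1 * b2 * (t ^ s - t ^ n)) = V * (W * P)"
  proof -
    have "(\<Prod>s<n. t * (1 / a) * \<alpha>2 * (1 / t ^ s - 1 / t ^ n) + b1 * b2 * (t ^ s - t ^ n)) =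
      (\<Prod>s<n. (t ^ s * (b1 * b2)) * ((1 - t ^ (n - s)) * (1 - \<alpha>1 * \<alpha>2 / (b1 * b2 * t ^ (n + s - 1)))))"
      by (rule prod.cong[OF refl]) (simp only: f1 lessThan_iff)
    thus ?thesis unfolding prod.distrib V_def W_def P_def rev by (simp only: prod.distrib)
  qed
  have r: "(\<Prod>s<n. (1 - t ^ Suc s) * (1 - a * b1 * t ^ s) * (1 - a * b2 * t ^ s) / (a * t ^ s)) = V * (W * (a ^ n * R))"
  proof -
    have "(\<Prod>s<n. (1 - t ^ Suc s) * (1 - a * b1 * t ^ s) * (1 - a * b2 * t ^ s) / (a * t ^ s)) =
      (\<Prod>s<n. (t ^ s * (b1 * b2)) * ((1 - t ^ Suc s) * (a * ((1 - \<alpha>1 / (b1 * t ^ s)) * (1 - \<alpha>1 / (b2 * t ^ s))))))"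
      by (rule prod.cong[OF refl f2])
    thus ?thesis unfolding prod.distrib V_def W_def R_def by (simp only: prod.distrib prod_constant card_lessThan)
  qed
  have "(- a) ^ n * FF x1 x2 (\<alpha>1 / Q) \<alpha>2 * (V * (W * P)) = V * (W * (a ^ n * R)) * ((-1) ^ n * FF x1 x2 \<alpha>1 \<alpha>2)"
    using main unfolding l r Ha lead .
  hence "(V * W * (- a) ^ n) * (FF x1 x2 (\<alpha>1 / Q) \<alpha>2 * P) = (V * W * (- a) ^ n) * (R * FF x1 x2 \<alpha>1 \<alpha>2)"
    unfolding power_minus[of a] by (simp only: mult_ac)
  moreover have "V * W * (- a) ^ n \<noteq> 0" using V W a by simp
  ultimately have "FF x1 x2 (\<alpha>1 / Q) \<alpha>2 * P = R * FF x1 x2 \<alpha>1 \<alpha>2"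
    using mult_left_cancel by blast
  thus ?thesis unfolding P_def R_def .
\<comment> \<open>The case \<open>\<alpha>1 = 0\<close>: the parameter does not move and all factors
  are 1.\<close>
qed simp

end

section \<open>The limit \<open>\<alpha>1, \<alpha>2 \<rightarrow> 0\<close>\<close>

lemma uniform_geometric_bound:
  fixes f :: "'a \<Rightarrow> int \<Rightarrow> real"
  assumes "finite I" "\<And>j. j \<in> I \<Longrightarrow> \<exists>K \<rho>. K > 0 \<and> 0 < \<rho> \<and> \<rho> < 1 \<and> (\<forall>m\<in>S. f j m \<le> K * \<rho> ^ nat \<bar>m\<bar>)"
  shows "\<exists>K \<rho>. K > 0 \<and> 0 < \<rho> \<and> \<rho> < 1 \<and> (\<forall>j\<in>I. \<forall>m\<in>S. f j m \<le> K * \<rho> ^ nat \<bar>m\<bar>)"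
  using assms
proof (induction I rule: finite_induct)
  case empty
  show ?case by (intro exI[of _ 1] exI[of _ "1/2"]) auto
next
  case (insert k I)
  obtain K1 \<rho>1 where 1: "K1 > 0" "0 < \<rho>1" "\<rho>1 < 1" "\<And>j m. j \<in> I \<Longrightarrow> m \<in> S \<Longrightarrow> f j m \<le> K1 * \<rho>1 ^ nat \<bar>m\<bar>"
    using insert by auto
  obtain K2 \<rho>2 where 2: "K2 > 0" "0 < \<rho>2" "\<rho>2 < 1" "\<And>m. m \<in> S \<Longrightarrow> f k m \<le> K2 * \<rho>2 ^ nat \<bar>m\<bar>"
    using insert.prems[of k] by auto
  have "f j m \<le> max K1 K2 * (max \<rho>1 \<rho>2) ^ nat \<bar>m\<bar>" if "j \<in> insert k I" "m \<in> S" for j m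
  proof (cases "j = k")
    case True
    have "K2 * \<rho>2 ^ nat \<bar>m\<bar> \<le> max K1 K2 * (max \<rho>1 \<rho>2) ^ nat \<bar>m\<bar>"
      using 1 2 by (intro mult_mono power_mono) auto
    thus ?thesis using 2(4)[OF that(2)] True by simp
  next
    case False
    have "K1 * \<rho>1 ^ nat \<bar>m\<bar> \<le> max K1 K2 * (max \<rho>1 \<rho>2) ^ nat \<bar>m\<bar>"
      using 1 2 by (intro mult_mono power_mono) auto
    thus ?thesis using 1(4)[of j m] that False by simp
  qed
  thus ?case using 1 2 by (intro exI[of _ "max K1 K2"] exI[of _ "max \<rho>1 \<rho>2"]) auto
qed

context q_config
begin

text \<open>\<open>C\<close> comes from the pair factors alone and does not depend on
  \<open>\<alpha>1\<close>, \<open>\<alpha>2\<close>, as dominated convergence in the parameters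
  requires.\<close>

lemma DD_uniform_bound:
  "\<exists>C>0. \<forall>\<alpha>1 \<alpha>2 K \<rho>. \<forall>\<nu>\<in>ch I. K > 0 \<longrightarrow>
    (\<forall>j\<in>I. norm (phi \<alpha>1 \<alpha>2 (\<xi> j * Q powi \<nu> j)) * lat_wt 0 (\<xi> j) (\<nu> j) \<le> K * \<rho> ^ nat \<bar>\<nu> j\<bar>) \<longrightarrow>
    norm (DD \<alpha>1 \<alpha>2 \<xi> I \<nu>) \<le> C * K ^ n * (\<Prod>j\<in>I. \<rho> ^ nat \<bar>\<nu> j\<bar>)"
proof -
  obtain C where C: "C > 0" "\<And>\<nu>. \<nu> \<in> ch I \<Longrightarrow> norm (pairs \<xi> I \<nu>) \<le> C * (\<Prod>j\<in>I. gw (\<nu> j) ^ (n - 1))"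
    using pairs_bound_gw by blast
  have "norm (DD \<alpha>1 \<alpha>2 \<xi> I \<nu>) \<le> C * K ^ n * (\<Prod>j\<in>I. \<rho> ^ nat \<bar>\<nu> j\<bar>)"
    if \<nu>: "\<nu> \<in> ch I" and K: "K > 0"
      "\<And>j. j \<in> I \<Longrightarrow> norm (phi \<alpha>1 \<alpha>2 (\<xi> j * Q powi \<nu> j)) * lat_wt 0 (\<xi> j) (\<nu> j) \<le> K * \<rho> ^ nat \<bar>\<nu> j\<bar>"
    for \<alpha>1 \<alpha>2 K \<rho> \<nu>
  proof -
    have "norm (DD \<alpha>1 \<alpha>2 \<xi> I \<nu>) = (\<Prod>j\<in>I. norm (wt1 \<alpha>1 \<alpha>2 (\<xi> j) (\<nu> j))) * norm (pairs \<xi> I \<nu>)"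
      by (simp add: DD_def norm_mult prod_norm)
    also have "\<dots> \<le> (\<Prod>j\<in>I. norm (wt1 \<alpha>1 \<alpha>2 (\<xi> j) (\<nu> j))) * (C * (\<Prod>j\<in>I. gw (\<nu> j) ^ (n - 1)))"
      by (intro mult_left_mono C \<nu> prod_nonneg) auto
    also have "\<dots> = C * (\<Prod>j\<in>I. norm (wt1 \<alpha>1 \<alpha>2 (\<xi> j) (\<nu> j)) * gw (\<nu> j) ^ (n - 1) * (1 + norm (zz \<nu> j)) ^ 0)"
      by (simp add: prod.distrib mult_ac)
    also have "\<dots> \<le> C * (K ^ card I * (\<Prod>j\<in>I. \<rho> ^ nat \<bar>\<nu> j\<bar>))"
      using C(1) by (intro mult_left_mono DD_bound_aux[OF K(1) \<nu> order.refl]) (use K in \<open>auto simp: zz_def\<close>)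
    finally show ?thesis by (simp add: card_I mult_ac)
  qed
  thus ?thesis using C(1) by blast
qed

end

context q_selberg
begin

text \<open>For \<open>e = 0\<close> this is the second convergence condition of the theorem, for
  \<open>e = 1\<close> the stronger one under which the difference equation is available.\<close>

definition conv :: "nat \<Rightarrow> complex \<Rightarrow> complex \<Rightarrow> bool" where
  "conv e \<alpha>1 \<alpha>2 \<longleftrightarrow> q ^ (1 - e) * (norm \<alpha>1 * norm \<alpha>2) < norm b1 * norm b2 * tmin"

lemma phi_wt_uniform:
  assumes g: "generic x1 x2" and i: "i \<le> n" and e: "e \<le> 1"
    and A: "A1 \<ge> 0" "A2 \<ge> 0" and c: "q ^ (1 - e) * (A1 * A2) < norm b1 * norm b2 * tmin"
  shows "\<exists>K \<rho>. K > 0 \<and> 0 < \<rho> \<and> \<rho> < 1 \<and> (\<forall>j\<in>labels i. \<forall>m\<in>UNIV.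
    phi_maj A1 A2 (xi x1 x2 j * Q powi m) * lat_wt e (xi x1 x2 j) m \<le> K * \<rho> ^ nat \<bar>m\<bar>)"
proof -
  interpret q_config q t b1 b2 n "xi x1 x2" "labels i" by (rule generic_config[OF g i])
  show ?thesis
  proof (rule uniform_geometric_bound)
    fix j assume j: "j \<in> labels i"
    show "\<exists>K \<rho>. K > 0 \<and> 0 < \<rho> \<and> \<rho> < 1 \<and> (\<forall>m\<in>UNIV.
      phi_maj A1 A2 (xi x1 x2 j * Q powi m) * lat_wt e (xi x1 x2 j) m \<le> K * \<rho> ^ nat \<bar>m\<bar>)"
      using phi_maj_wt_conv[OF \<xi>_nonzero[OF j] A e _ _ c] b_regular[OF j] by simp
  qed simp
qed

lemma domin_conv:
  assumes g: "generic x1 x2" and i: "i \<le> n" and e: "e \<le> 1" and c: "conv e \<alpha>1 \<alpha>2"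
  shows "domin e \<alpha>1 \<alpha>2 (xi x1 x2) (labels i)"
proof -
  obtain K \<rho> where K: "K > 0" "0 < \<rho>" "\<rho> < 1" "\<And>j m. j \<in> labels i \<Longrightarrow>
    phi_maj (norm \<alpha>1) (norm \<alpha>2) (xi x1 x2 j * Q powi m) * lat_wt e (xi x1 x2 j) m \<le> K * \<rho> ^ nat \<bar>m\<bar>"
    using phi_wt_uniform[OF g i e _ _ c[unfolded conv_def]] by auto
  have "norm (phi \<alpha>1 \<alpha>2 (xi x1 x2 j * Q powi m)) * lat_wt e (xi x1 x2 j) m \<le> K * \<rho> ^ nat \<bar>m\<bar>"
    if "j \<in> labels i" for j m
    using mult_right_mono[OF phi_le_maj[of \<alpha>1 "norm \<alpha>1" \<alpha>2 "norm \<alpha>2" "xi x1 x2 j * Q powi m"] lat_wt_nonneg[of e "xi x1 x2 j" m]]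
      K(4)[OF that, of m] by simp
  thus ?thesis unfolding domin_def using K by blast
qed

lemma qpoch_Q_powi_nonpos: "m \<le> 0 \<Longrightarrow> qpoch q (Q powi m) = 0"
  unfolding qpoch_eq_0_iff by (intro exI[of _ "nat (- m)"]) (simp add: power_int_def divide_simps power_inverse)

text \<open>
  If \<open>1 / \<alpha>1\<close> and \<open>1 / \<alpha>2\<close> lie on the lattices through \<open>x1\<close> and \<open>x2\<close>, the sum is truncated from
  below, so that no growth condition is needed.
\<close>

lemma DD_truncated:
  assumes i: "i \<le> n" and \<nu>: "\<nu> \<in> ch (labels i)" and x: "x1 \<noteq> 0" "x2 \<noteq> 0"
    and D: "DD (Q powi k1 / x1) (Q powi k2 / x2) (xi x1 x2) (labels i) \<nu> \<noteq> 0" and j: "j \<in> labels i"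
  shows "\<nu> j \<ge> (if j \<le> n then - k1 else - k2)"
proof -
  have fin: "finite (labels i)" by (simp add: labels_def)
  have w: "wt1 (Q powi k1 / x1) (Q powi k2 / x2) (xi x1 x2 l) (\<nu> l) \<noteq> 0" if "l \<in> labels i" for l
    using D that fin unfolding DD_def by auto
  show ?thesis
  proof (cases "j \<le> n")
    case True
    \<comment> \<open>It suffices to look at the first label of the block: there the weight has a
      zero below the bound, and the order in the chamber carries the bound to the other
      labels.\<close>
    hence 1: "1 \<in> labels i" using j by (auto simp: labels_def)
    have "qpoch q (Q * (Q powi k1 / x1) * (xi x1 x2 1 * Q powi \<nu> 1)) \<noteq> 0"
      using w[OF 1] by (auto simp: wt1_def phi_def)
    moreover have "Q * (Q powi k1 / x1) * (xi x1 x2 1 * Q powi \<nu> 1) = Q powi (1 + k1 + \<nu> 1)"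
      using x n_pos by (simp add: xi_def power_int_add)
    ultimately have "1 + k1 + \<nu> 1 > 0" using qpoch_Q_powi_nonpos[of "1 + k1 + \<nu> 1"] by force
    moreover have "\<nu> 1 \<le> \<nu> j"
      using chD[OF \<nu> 1 j] True j by (cases "j = 1") (auto simp: labels_def)
    ultimately show ?thesis using True by simp
  next
    case False
    hence 1: "n + 1 \<in> labels i" using j i by (auto simp: labels_def)
    have "qpoch q (Q * (Q powi k2 / x2) * (xi x1 x2 (n + 1) * Q powi \<nu> (n + 1))) \<noteq> 0"
      using w[OF 1] by (auto simp: wt1_def phi_def)
    moreover have "Q * (Q powi k2 / x2) * (xi x1 x2 (n + 1) * Q powi \<nu> (n + 1)) = Q powi (1 + k2 + \<nu> (n + 1))"
      using x by (simp add: xi_def power_int_add)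
    ultimately have "1 + k2 + \<nu> (n + 1) > 0" using qpoch_Q_powi_nonpos[of "1 + k2 + \<nu> (n + 1)"] by force
    moreover have "\<nu> (n + 1) \<le> \<nu> j"
      using chD[OF \<nu> 1 j] False j i by (cases "j = n + 1") (auto simp: labels_def)
    ultimately show ?thesis using False by simp
  qed
qed

lemma domin_truncated:
  assumes g: "generic x1 x2" and i: "i \<le> n"
  shows "domin e (Q powi k1 / x1) (Q powi k2 / x2) (xi x1 x2) (labels i)"
proof -
  define \<alpha>1 where "\<alpha>1 = Q powi k1 / x1"
  define \<alpha>2 where "\<alpha>2 = Q powi k2 / x2"
  define M where "M = nat \<bar>k1\<bar> + nat \<bar>k2\<bar>"
  have qt: "0 < q * tmax" using q_pos tmax_ge_1 by simp
  have "\<exists>K \<rho>. K > 0 \<and> 0 < \<rho> \<and> \<rho> < 1 \<and> (\<forall>j\<in>labels i. \<forall>m\<in>{- int M..}.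
      phi_maj (norm \<alpha>1) (norm \<alpha>2) (xi x1 x2 j * Q powi m) * lat_wt e (xi x1 x2 j) m \<le> K * \<rho> ^ nat \<bar>m\<bar>)"
  proof (rule uniform_geometric_bound)
    fix j
    show "\<exists>K \<rho>. K > 0 \<and> 0 < \<rho> \<and> \<rho> < 1 \<and> (\<forall>m\<in>{- int M..}.
      phi_maj (norm \<alpha>1) (norm \<alpha>2) (xi x1 x2 j * Q powi m) * lat_wt e (xi x1 x2 j) m \<le> K * \<rho> ^ nat \<bar>m\<bar>)"
      using phi_maj_wt_bounded_below[of M "norm \<alpha>1" "norm \<alpha>2" "xi x1 x2 j" e] qt q_tmax by auto
  qed (simp add: labels_def)
  then obtain K \<rho> where K: "K > 0" "0 < \<rho>" "\<rho> < 1" "\<And>j m. j \<in> labels i \<Longrightarrow> m \<ge> - int M \<Longrightarrow>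
      phi_maj (norm \<alpha>1) (norm \<alpha>2) (xi x1 x2 j * Q powi m) * lat_wt e (xi x1 x2 j) m \<le> K * \<rho> ^ nat \<bar>m\<bar>"
    by auto
  have "norm (phi \<alpha>1 \<alpha>2 (xi x1 x2 j * Q powi \<nu> j)) * lat_wt e (xi x1 x2 j) (\<nu> j) \<le> K * \<rho> ^ nat \<bar>\<nu> j\<bar>"
    if \<nu>: "\<nu> \<in> ch (labels i)" "DD \<alpha>1 \<alpha>2 (xi x1 x2) (labels i) \<nu> \<noteq> 0" and j: "j \<in> labels i" for \<nu> j
  proof -
    have "\<nu> j \<ge> (if j \<le> n then - k1 else - k2)"
      using DD_truncated[OF i \<nu>(1) genericD(1,2)[OF g] \<nu>(2)[unfolded \<alpha>1_def \<alpha>2_def] j] .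
    hence "\<nu> j \<ge> - int M" by (auto simp: M_def split: if_splits)
    from K(4)[OF j this] show ?thesis
      using mult_right_mono[OF phi_le_maj[of \<alpha>1 "norm \<alpha>1" \<alpha>2 "norm \<alpha>2" "xi x1 x2 j * Q powi \<nu> j"]
        lat_wt_nonneg[of e "xi x1 x2 j" "\<nu> j"]] by simp
  qed
  thus ?thesis unfolding domin_def \<alpha>1_def[symmetric] \<alpha>2_def[symmetric] using K by blast
qed

text \<open>The two situations in which the recursion may be used. Both persist under
  \<open>\<alpha>1 \<mapsto> Q * \<alpha>1\<close>, so that it can be iterated.\<close>

definition good :: "complex \<Rightarrow> complex \<Rightarrow> complex \<Rightarrow> complex \<Rightarrow> bool" where
  "good x1 x2 \<alpha>1 \<alpha>2 \<longleftrightarrow> conv 1 \<alpha>1 \<alpha>2 \<or> (\<exists>k1 k2. \<alpha>1 = Q powi k1 / x1 \<and> \<alpha>2 = Q powi k2 / x2)"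

lemma good_domin:
  assumes "generic x1 x2" "i \<le> n" "good x1 x2 \<alpha>1 \<alpha>2"
  shows "domin 1 \<alpha>1 \<alpha>2 (xi x1 x2) (labels i)"
  using assms domin_conv[of x1 x2 i 1] domin_truncated[of x1 x2 i 1] unfolding good_def by auto

lemma good_shift:
  assumes "good x1 x2 (Q * \<alpha>1) \<alpha>2" shows "good x1 x2 (Q ^ Suc m * \<alpha>1) \<alpha>2"
  using assms unfolding good_def
proof (elim disjE exE conjE)
  assume c: "conv 1 (Q * \<alpha>1) \<alpha>2"
  have "norm (Q ^ Suc m * \<alpha>1) = q ^ m * norm (Q * \<alpha>1)"
    using q_pos by (simp add: norm_mult norm_power)
  also have "\<dots> \<le> 1 * norm (Q * \<alpha>1)"
    using q_pos q_less_1 by (intro mult_right_mono power_le_one) auto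
  finally have "norm (Q ^ Suc m * \<alpha>1) * norm \<alpha>2 \<le> norm (Q * \<alpha>1) * norm \<alpha>2"
    by (intro mult_right_mono) auto
  thus "conv 1 (Q ^ Suc m * \<alpha>1) \<alpha>2 \<or> (\<exists>k1 k2. Q ^ Suc m * \<alpha>1 = Q powi k1 / x1 \<and> \<alpha>2 = Q powi k2 / x2)"
    using c unfolding conv_def by auto
next
  fix k1 k2 assume k: "Q * \<alpha>1 = Q powi k1 / x1" "\<alpha>2 = Q powi k2 / x2"
  have "Q ^ Suc m * \<alpha>1 = Q ^ m * (Q * \<alpha>1)" by simp
  also have "\<dots> = Q powi (int m + k1) / x1" unfolding k by (simp add: power_int_add)
  finally show "conv 1 (Q ^ Suc m * \<alpha>1) \<alpha>2 \<or> (\<exists>k1 k2. Q ^ Suc m * \<alpha>1 = Q powi k1 / x1 \<and> \<alpha>2 = Q powi k2 / x2)"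
    using k(2) by blast
qed

text \<open>Relating the sums at \<open>\<alpha>1\<close> and at \<open>Q * \<alpha>1\<close>
  involves the difference equation with parameter \<open>Q * \<alpha>1\<close>; the assumption
  therefore concerns \<open>Q * \<alpha>1\<close> and says nothing of the kind about
  \<open>\<alpha>1\<close> itself.\<close>

lemma FF_iterate:
  assumes g: "generic x1 x2" and good: "good x1 x2 (Q * \<alpha>1) \<alpha>2"
  shows "FF x1 x2 \<alpha>1 \<alpha>2 * (\<Prod>s<n. \<Prod>l<N. 1 - Q ^ l * (Q * \<alpha>1 * \<alpha>2 / (b1 * b2 * t ^ (n + s - 1)))) =
    (\<Prod>s<n. (\<Prod>l<N. 1 - Q ^ l * (Q * \<alpha>1 / (b1 * t ^ s))) * (\<Prod>l<N. 1 - Q ^ l * (Q * \<alpha>1 / (b2 * t ^ s)))) *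
      FF x1 x2 (\<alpha>1 * Q ^ N) \<alpha>2"
proof (induction N)
  case (Suc N)
  define P where "P = (\<lambda>N. \<Prod>s<n. \<Prod>l<N. 1 - Q ^ l * (Q * \<alpha>1 * \<alpha>2 / (b1 * b2 * t ^ (n + s - 1))))"
  define R where "R = (\<lambda>N. \<Prod>s<n. (\<Prod>l<N. 1 - Q ^ l * (Q * \<alpha>1 / (b1 * t ^ s))) * (\<Prod>l<N. 1 - Q ^ l * (Q * \<alpha>1 / (b2 * t ^ s))))"
  define p where "p = (\<Prod>s<n. 1 - Q ^ N * (Q * \<alpha>1 * \<alpha>2 / (b1 * b2 * t ^ (n + s - 1))))"
  define r where "r = (\<Prod>s<n. (1 - Q ^ N * (Q * \<alpha>1 / (b1 * t ^ s))) * (1 - Q ^ N * (Q * \<alpha>1 / (b2 * t ^ s))))"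
  have P: "P (Suc N) = P N * p" by (simp add: P_def p_def prod.distrib)
  have R: "R (Suc N) = R N * r" by (simp add: R_def r_def prod.distrib mult_ac)
  have IH: "FF x1 x2 \<alpha>1 \<alpha>2 * P N = R N * FF x1 x2 (\<alpha>1 * Q ^ N) \<alpha>2"
    using Suc.IH by (simp add: P_def R_def)
  have "domin 1 (\<alpha>1 * Q ^ Suc N) \<alpha>2 (xi x1 x2) (labels i)" if "i \<le> n" for i
    using good_domin[OF g that good_shift[OF good, of N]] by (simp only: mult.commute)
  from FF_recursion[OF g this]
  have "FF x1 x2 (\<alpha>1 * Q ^ N) \<alpha>2 * p = r * FF x1 x2 (\<alpha>1 * Q ^ Suc N) \<alpha>2"
    by (simp add: p_def r_def mult_ac)
  hence "FF x1 x2 \<alpha>1 \<alpha>2 * P (Suc N) = R (Suc N) * FF x1 x2 (\<alpha>1 * Q ^ Suc N) \<alpha>2"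
    unfolding P R using IH by (metis mult.assoc)
  thus ?case by (simp only: P_def R_def)
qed simp

lemma FF_tendsto:
  assumes g: "generic x1 x2"
  shows "(\<lambda>N. FF x1 x2 (\<alpha>1 * Q ^ N) \<alpha>2) \<longlonglongrightarrow> FF x1 x2 0 \<alpha>2"
proof -
  have "(\<lambda>N. norm (\<alpha>1 * Q ^ N) * norm \<alpha>2) \<longlonglongrightarrow> norm (0 :: complex) * norm \<alpha>2"
    by (intro tendsto_intros mult_Q_power_tendsto_0)
  moreover have "norm (0 :: complex) * norm \<alpha>2 < norm b1 * norm b2 * tmin"
    using b_nonzero tmin_pos by simp
  ultimately have "eventually (\<lambda>N. norm (\<alpha>1 * Q ^ N) * norm \<alpha>2 < norm b1 * norm b2 * tmin) sequentially"
    by (rule order_tendstoD(2))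
  \<comment> \<open>In the truncated case \<open>\<alpha>1\<close> may be too large for the
    majorant. From \<open>N0\<close> on all parameters are bounded by one \<open>A\<close> that
    satisfies the convergence condition.\<close>
  then obtain N0 where N0: "norm (\<alpha>1 * Q ^ N0) * norm \<alpha>2 < norm b1 * norm b2 * tmin"
    by (auto simp: eventually_sequentially)
  define A where "A = norm (\<alpha>1 * Q ^ N0)"
  have A: "norm (\<alpha>1 * Q ^ (N + N0)) \<le> A" for N
  proof -
    have "norm (\<alpha>1 * Q ^ (N + N0)) = q ^ N * A"
      using q_pos by (simp add: A_def norm_mult norm_power power_add)
    also have "\<dots> \<le> 1 * A" using q_pos q_less_1 by (intro mult_right_mono power_le_one) (auto simp: A_def)
    finally show ?thesis by simp
  qed
  have cA: "q ^ (1 - 0) * (A * norm \<alpha>2) < norm b1 * norm b2 * tmin"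
  proof -
    have "q * (A * norm \<alpha>2) \<le> 1 * (A * norm \<alpha>2)"
      using q_less_1 by (intro mult_right_mono) (auto simp: A_def)
    thus ?thesis using N0 by (simp add: A_def)
  qed
  have "(\<lambda>N. infsum (DD (\<alpha>1 * Q ^ (N + N0)) \<alpha>2 (xi x1 x2) (labels i)) (ch (labels i))) \<longlonglongrightarrow>
      infsum (DD 0 \<alpha>2 (xi x1 x2) (labels i)) (ch (labels i))" if i: "i \<le> n" for i
  proof -
    interpret q_config q t b1 b2 n "xi x1 x2" "labels i" by (rule generic_config[OF g i])
    obtain K \<rho> where K: "K > 0" "0 < \<rho>" "\<rho> < 1" "\<And>j m. j \<in> labels i \<Longrightarrow>
      phi_maj A (norm \<alpha>2) (xi x1 x2 j * Q powi m) * lat_wt 0 (xi x1 x2 j) m \<le> K * \<rho> ^ nat \<bar>m\<bar>"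
      using phi_wt_uniform[OF g i _ _ _ cA] by (auto simp: A_def)
    obtain C where C: "C > 0" "\<And>\<alpha>1 \<alpha>2 K \<rho> \<nu>. \<nu> \<in> ch (labels i) \<Longrightarrow> K > 0 \<Longrightarrow>
      (\<And>j. j \<in> labels i \<Longrightarrow> norm (phi \<alpha>1 \<alpha>2 (xi x1 x2 j * Q powi \<nu> j)) * lat_wt 0 (xi x1 x2 j) (\<nu> j) \<le> K * \<rho> ^ nat \<bar>\<nu> j\<bar>) \<Longrightarrow>
      norm (DD \<alpha>1 \<alpha>2 (xi x1 x2) (labels i) \<nu>) \<le> C * K ^ n * (\<Prod>j\<in>labels i. \<rho> ^ nat \<bar>\<nu> j\<bar>)"
      using DD_uniform_bound by metis
    show ?thesis
    proof (rule infsum_dominated_tendsto)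
      show "(\<lambda>\<nu>. C * K ^ n * (\<Prod>j\<in>labels i. \<rho> ^ nat \<bar>\<nu> j\<bar>)) summable_on ch (labels i)"
        by (rule summable_on_subset_banach[OF _ ch_subset])
          (use K in \<open>intro summable_on_cmult_right summable_on_prod_int_geometric, auto\<close>)
      fix \<nu> assume \<nu>: "\<nu> \<in> ch (labels i)"
      show "norm (DD (\<alpha>1 * Q ^ (N + N0)) \<alpha>2 (xi x1 x2) (labels i) \<nu>) \<le> C * K ^ n * (\<Prod>j\<in>labels i. \<rho> ^ nat \<bar>\<nu> j\<bar>)" for N
      proof (rule C(2)[OF \<nu> K(1)])
        fix j assume j: "j \<in> labels i"
        show "norm (phi (\<alpha>1 * Q ^ (N + N0)) \<alpha>2 (xi x1 x2 j * Q powi \<nu> j)) * lat_wt 0 (xi x1 x2 j) (\<nu> j) \<le> K * \<rho> ^ nat \<bar>\<nu> j\<bar>"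
          using mult_right_mono[OF phi_le_maj[OF A[of N] order.refl[of "norm \<alpha>2"], of "xi x1 x2 j * Q powi \<nu> j"]
            lat_wt_nonneg[of 0 "xi x1 x2 j" "\<nu> j"]] K(4)[OF j, of "\<nu> j"] by linarith
      qed
      have lim: "(\<lambda>N. qpoch q (Q * (\<alpha>1 * Q ^ (N + N0)) * z)) \<longlonglongrightarrow> qpoch q (Q * 0 * z)" for z
      proof -
        have "(\<lambda>N. qpoch q (Q * \<alpha>1 * Q ^ N0 * z * Q ^ N)) \<longlonglongrightarrow> 1" by (rule qpoch_tendsto_1)
        thus ?thesis by (simp add: power_add mult_ac)
      qed
      have den: "qpoch q (b1 * (xi x1 x2 j * Q powi \<nu> j)) * qpoch q (b2 * (xi x1 x2 j * Q powi \<nu> j)) \<noteq> 0"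
        if "j \<in> labels i" for j
        using b_regular[OF that] by simp
      show "(\<lambda>N. DD (\<alpha>1 * Q ^ (N + N0)) \<alpha>2 (xi x1 x2) (labels i) \<nu>) \<longlonglongrightarrow> DD 0 \<alpha>2 (xi x1 x2) (labels i) \<nu>"
        unfolding DD_def wt1_def phi_def by (intro tendsto_intros lim den)
    qed
  qed
  hence "(\<lambda>N. FF x1 x2 (\<alpha>1 * Q ^ (N + N0)) \<alpha>2) \<longlonglongrightarrow> FF x1 x2 0 \<alpha>2"
    unfolding FF_def by (intro tendsto_sum tendsto_divide tendsto_const) (use Th_nonzero[OF g] in auto)
  thus ?thesis by (rule LIMSEQ_offset)
qed

lemma FF_limit_formula:
  assumes g: "generic x1 x2" and good: "good x1 x2 (Q * \<alpha>1) \<alpha>2"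
  shows "FF x1 x2 \<alpha>1 \<alpha>2 * (\<Prod>s<n. qpoch q (Q * \<alpha>1 * \<alpha>2 / (b1 * b2 * t ^ (n + s - 1)))) =
    (\<Prod>s<n. qpoch q (Q * \<alpha>1 / (b1 * t ^ s)) * qpoch q (Q * \<alpha>1 / (b2 * t ^ s))) * FF x1 x2 0 \<alpha>2"
proof (rule LIMSEQ_unique)
  show "(\<lambda>N. FF x1 x2 \<alpha>1 \<alpha>2 * (\<Prod>s<n. \<Prod>l<N. 1 - Q ^ l * (Q * \<alpha>1 * \<alpha>2 / (b1 * b2 * t ^ (n + s - 1))))) \<longlonglongrightarrow>
    FF x1 x2 \<alpha>1 \<alpha>2 * (\<Prod>s<n. qpoch q (Q * \<alpha>1 * \<alpha>2 / (b1 * b2 * t ^ (n + s - 1))))"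
    by (intro tendsto_intros tendsto_prod qpoch_partial_tendsto)
  show "(\<lambda>N. FF x1 x2 \<alpha>1 \<alpha>2 * (\<Prod>s<n. \<Prod>l<N. 1 - Q ^ l * (Q * \<alpha>1 * \<alpha>2 / (b1 * b2 * t ^ (n + s - 1))))) \<longlonglongrightarrow>
    (\<Prod>s<n. qpoch q (Q * \<alpha>1 / (b1 * t ^ s)) * qpoch q (Q * \<alpha>1 / (b2 * t ^ s))) * FF x1 x2 0 \<alpha>2"
    unfolding FF_iterate[OF g good]
    by (intro tendsto_mult tendsto_prod qpoch_partial_tendsto FF_tendsto g)
qed

lemma FF_commute: "FF x1 x2 \<alpha>1 \<alpha>2 = FF x1 x2 \<alpha>2 \<alpha>1"
  unfolding FF_def DD_def wt1_def phi_def by (simp only: mult.commute)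

text \<open>The limit formula is applied in each parameter. For the second application the other
  parameter is already 0, so the convergence condition is trivially true.\<close>

theorem FF_formula:
  assumes g: "generic x1 x2" and good: "good x1 x2 (Q * \<alpha>1) \<alpha>2"
  shows "FF x1 x2 \<alpha>1 \<alpha>2 * (\<Prod>s<n. qpoch q (Q * \<alpha>1 * \<alpha>2 / (b1 * b2 * t ^ (n + s - 1)))) =
    (\<Prod>s<n. qpoch q (Q * \<alpha>1 / (b1 * t ^ s)) * qpoch q (Q * \<alpha>1 / (b2 * t ^ s))) *
    ((\<Prod>s<n. qpoch q (Q * \<alpha>2 / (b1 * t ^ s)) * qpoch q (Q * \<alpha>2 / (b2 * t ^ s))) * FF x1 x2 0 0)"
proof -
  have "good x1 x2 (Q * \<alpha>2) 0"
    using b_nonzero tmin_pos by (simp add: good_def conv_def)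
  from FF_limit_formula[OF g this]
  have "FF x1 x2 0 \<alpha>2 = (\<Prod>s<n. qpoch q (Q * \<alpha>2 / (b1 * t ^ s)) * qpoch q (Q * \<alpha>2 / (b2 * t ^ s))) * FF x1 x2 0 0"
    by (simp add: FF_commute[of x1 x2 \<alpha>2 0])
  thus ?thesis using FF_limit_formula[OF g good] by simp
qed

end

section \<open>Quasi-periodicity in the base points\<close>

lemma prod_power_int:
  fixes t :: "'a :: field"
  assumes "t \<noteq> 0" shows "(\<Prod>x\<in>A. t powi f x) = t powi (\<Sum>x\<in>A. f x)"
  by (induction A rule: infinite_finite_induct) (use assms in \<open>auto simp: power_int_add\<close>)

lemma double_gauss_sum_int: "2 * (\<Sum>j\<in>{1..i}. int j) = int i * (int i + 1)"
  by (induction i) (auto simp: algebra_simps)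

context q_selberg
begin

definition block_shift :: "int \<Rightarrow> int \<Rightarrow> nat \<Rightarrow> int" where
  "block_shift d1 d2 l = (if l \<le> n then d1 else d2)"

lemma xi_block_shift:
  "xi (x1 * Q powi d1) (x2 * Q powi d2) l = xi x1 x2 l * Q powi block_shift d1 d2 l"
  by (simp add: xi_def block_shift_def)

lemma vv_block_shift:
  "vv (xi (x1 * Q powi d1) (x2 * Q powi d2)) \<nu> j k =
    t powi (- 2 * block_shift d1 d2 j) * vv (xi x1 x2) (\<lambda>l. \<nu> l + block_shift d1 d2 l) j k"
proof -
  define s where "s = block_shift d1 d2"
  have "xi x1 x2 k * Q powi s k / (xi x1 x2 j * Q powi s j) * Q powi (\<nu> k - \<nu> j) =
      xi x1 x2 k / xi x1 x2 j * (Q powi s k / Q powi s j * Q powi (\<nu> k - \<nu> j))"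
    by simp
  also have "Q powi s k / Q powi s j * Q powi (\<nu> k - \<nu> j) = Q powi (\<nu> k + s k - (\<nu> j + s j))"
    by (subst power_int_diff[symmetric], simp, subst power_int_add[symmetric]) (simp_all add: algebra_simps)
  finally have 1: "xi x1 x2 k * Q powi s k / (xi x1 x2 j * Q powi s j) * Q powi (\<nu> k - \<nu> j) =
      xi x1 x2 k / xi x1 x2 j * Q powi (\<nu> k + s k - (\<nu> j + s j))" .
  have 2: "t powi (2 * \<nu> j) = t powi (- 2 * s j) * t powi (2 * (\<nu> j + s j))"
    by (subst power_int_add[symmetric]) (simp_all add: algebra_simps)
  show ?thesis unfolding vv_def xi_block_shift s_def[symmetric] 1 unfolding 2 by (simp only: mult.assoc)
qed

lemma wt1_block_shift:
  "wt1 \<alpha>1 \<alpha>2 (x * Q powi d) m = Q powi (- d) * wt1 \<alpha>1 \<alpha>2 x (m + d)"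
proof -
  have 1: "x * Q powi d * Q powi m = x * Q powi (m + d)" by (simp add: power_int_add mult_ac)
  have 2: "Q powi m = Q powi (- d) * Q powi (m + d)"
    by (subst power_int_add[symmetric]) simp_all
  show ?thesis unfolding wt1_def 1 mult.assoc[symmetric] 2[symmetric] ..
qed

text \<open>Moving the base points along their lattices is a reindexing of the summand, except that
  the powers of \<open>Q\<close> and \<open>t\<close> are normalised relative to the base points.
  This produces the explicit monomial; the cardinality counts the pairs in which \<open>j\<close>
  comes first.\<close>

lemma DD_block_shift:
  "DD \<alpha>1 \<alpha>2 (xi (x1 * Q powi d1) (x2 * Q powi d2)) I \<nu> =
    (\<Prod>j\<in>I. Q powi (- block_shift d1 d2 j) * (t powi (- 2 * block_shift d1 d2 j)) ^ card {k\<in>I. j < k}) *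
     DD \<alpha>1 \<alpha>2 (xi x1 x2) I (\<lambda>l. \<nu> l + block_shift d1 d2 l)"
  unfolding DD_def pairs_def vv_block_shift
  unfolding xi_block_shift wt1_block_shift prod.distrib prod_constant
  by (simp only: mult_ac)

text \<open>A shift by a constant on each block preserves the chamber, because exponents are
  compared only within a block.\<close>

lemma infsum_ch_shift:
  "infsum (\<lambda>\<nu>. DD \<alpha>1 \<alpha>2 \<xi> I (\<lambda>l. \<nu> l + block_shift d1 d2 l)) (ch I) = infsum (DD \<alpha>1 \<alpha>2 \<xi> I) (ch I)"
proof (rule infsum_reindex_bij_witness[where
    i = "\<lambda>\<nu>. \<lambda>l\<in>I. \<nu> l - block_shift d1 d2 l" and j = "\<lambda>\<nu>. \<lambda>l\<in>I. \<nu> l + block_shift d1 d2 l"])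
  fix \<nu> assume \<nu>: "\<nu> \<in> ch I"
  hence ext: "\<nu> \<in> extensional I" by (auto simp: ch_def PiE_def)
  show "(\<lambda>l\<in>I. (\<lambda>l\<in>I. \<nu> l + block_shift d1 d2 l) l - block_shift d1 d2 l) = \<nu>"
    by (rule extensionalityI[OF _ ext]) auto
  show "(\<lambda>l\<in>I. (\<lambda>l\<in>I. \<nu> l - block_shift d1 d2 l) l + block_shift d1 d2 l) = \<nu>"
    by (rule extensionalityI[OF _ ext]) auto
  show "(\<lambda>l\<in>I. \<nu> l + block_shift d1 d2 l) \<in> ch I" "(\<lambda>l\<in>I. \<nu> l - block_shift d1 d2 l) \<in> ch I"
    using \<nu> by (auto simp: ch_def block_shift_def)
  show "DD \<alpha>1 \<alpha>2 \<xi> I (\<lambda>l\<in>I. \<nu> l + block_shift d1 d2 l) = DD \<alpha>1 \<alpha>2 \<xi> I (\<lambda>l. \<nu> l + block_shift d1 d2 l)"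
    by (rule DD_cong) simp
qed

lemma generic_shift:
  assumes g: "generic x1 x2"
  shows "generic (x1 * Q powi d1) (x2 * Q powi d2)"
proof -
  note G = genericD[OF g]
  have 1: "qtheta q (x1 * Q powi d1 / (x2 * Q powi d2) * t powi e) \<noteq> 0"
    if "1 - int n \<le> e" "e \<le> int n - 1" for e
  proof -
    have "x1 * Q powi d1 / (x2 * Q powi d2) * t powi e = Q powi (d1 - d2) * (x1 / x2 * t powi e)"
      by (simp add: power_int_diff mult_ac)
    moreover have "qtheta q (Q powi (d1 - d2) * (x1 / x2 * t powi e)) \<noteq> 0"
      by (intro qtheta_nonzero_shift G(3) that) (use G(1,2) in auto)
    ultimately show ?thesis by (simp only: not_False_eq_True)
  qed
  have 2: "qtheta q (x * Q powi d * b * t ^ k) \<noteq> 0" if "x \<in> {x1, x2}" "b \<in> {b1, b2}" "k < n" for x d b k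
  proof -
    have "qtheta q (Q powi d * (x * b * t ^ k)) \<noteq> 0"
      using G(4)[OF that] G(1,2) that(1,2) b_nonzero by (intro qtheta_nonzero_shift) auto
    thus ?thesis by (simp add: mult_ac)
  qed
  show ?thesis unfolding generic_def using G(1,2) 1 2 by auto
qed

lemma card_labels_above:
  assumes i: "i \<le> n"
  shows "j \<in> {1..i} \<Longrightarrow> card {k\<in>labels i. j < k} = n - j"
    "k \<in> {1..n-i} \<Longrightarrow> card {l\<in>labels i. n + k < l} = n - i - k"
proof -
  assume j: "j \<in> {1..i}"
  have "{k\<in>labels i. j < k} = {j<..i} \<union> {n+1..2*n-i}" using j i by (auto simp: labels_def)
  also have "card \<dots> = card {j<..i} + card {n+1..2*n-i}" using i by (intro card_Un_disjoint) auto
  finally show "card {k\<in>labels i. j < k} = n - j" using j i by simp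
next
  assume k: "k \<in> {1..n-i}"
  have "{l\<in>labels i. n + k < l} = {n+k<..2*n-i}" using k i by (auto simp: labels_def)
  thus "card {l\<in>labels i. n + k < l} = n - i - k" by simp
qed

lemma prod_labels:
  assumes i: "i \<le> n"
  shows "(\<Prod>j\<in>labels i. f j) = (\<Prod>j\<in>{1..i}. f j) * (\<Prod>k\<in>{1..n-i}. f (n + k))"
proof -
  have "(\<Prod>j\<in>labels i. f j) = (\<Prod>j\<in>{1..i}. f j) * (\<Prod>j\<in>{n+1..2*n-i}. f j)"
    unfolding labels_def using i by (intro prod.union_disjoint) auto
  also have "(\<Prod>j\<in>{n+1..2*n-i}. f j) = (\<Prod>k\<in>{1..n-i}. f (n + k))"
    by (rule prod.reindex_bij_witness[of _ "\<lambda>k. n + k" "\<lambda>j. j - n"]) (use i in auto)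
  finally show ?thesis .
qed

definition shift_mult :: "complex \<Rightarrow> complex" where
  "shift_mult r = (\<Prod>s<n. - r / t ^ s)"

lemma shift_mult_eq: "shift_mult r = (- r) ^ n * t powi (- (\<Sum>s<n. int s))"
proof -
  have "shift_mult r = (\<Prod>s<n. - r * t powi (- int s))"
    unfolding shift_mult_def by (intro prod.cong) (auto simp: power_int_minus divide_inverse)
  also have "\<dots> = (- r) ^ n * t powi (- (\<Sum>s<n. int s))"
    unfolding prod.distrib prod_power_int[OF t_nonzero] by (simp add: sum_negf)
  finally show ?thesis .
qed

lemma double_sum_lessThan: "2 * (\<Sum>s<n. int s) = int n * (int n - 1)"
proof -
  have "2 * (\<Sum>s<m. int s) = int m * (int m - 1)" for m
    by (induction m) (auto simp: algebra_simps)
  thus ?thesis .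
qed

lemma power_inverse_square: "(t powi (- 2 * 1)) ^ k = t powi (- 2 * int k)"
  unfolding power_int_of_nat[symmetric, of _ k] power_int_mult[symmetric] by simp

text \<open>For each \<open>i\<close> both the sum and \<open>Th\<close> acquire a monomial that
  depends on \<open>i\<close>, but the quotient of the two monomials does not. Hence the whole sum
  over \<open>i\<close> is multiplied by the single factor
  \<open>shift_mult (x1 / x2)\<close>.\<close>

lemma FF_shift_1:
  assumes g: "generic x1 x2"
  shows "FF (x1 * Q) x2 \<alpha>1 \<alpha>2 = shift_mult (x1 / x2) * FF x1 x2 \<alpha>1 \<alpha>2"
proof -
  note G = genericD[OF g]
  define r where "r = x1 / x2"
  have r: "r \<noteq> 0" "x2 / x1 = 1 / r" using G by (auto simp: r_def)
  have "infsum (DD \<alpha>1 \<alpha>2 (xi (x1 * Q) x2) (labels i)) (ch (labels i)) / Th (x1 * Q) x2 i =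
     shift_mult r * (infsum (DD \<alpha>1 \<alpha>2 (xi x1 x2) (labels i)) (ch (labels i)) / Th x1 x2 i)" if i: "i \<le> n" for i
  proof -
    define m where "m = n - i"
    define c where "c = (\<Prod>j\<in>labels i. Q powi (- block_shift 1 0 j) * (t powi (- 2 * block_shift 1 0 j)) ^ card {k\<in>labels i. j < k})"
    have S: "infsum (DD \<alpha>1 \<alpha>2 (xi (x1 * Q) x2) (labels i)) (ch (labels i)) =
        c * infsum (DD \<alpha>1 \<alpha>2 (xi x1 x2) (labels i)) (ch (labels i))"
    proof -
      have "DD \<alpha>1 \<alpha>2 (xi (x1 * Q) x2) (labels i) \<nu> = c * DD \<alpha>1 \<alpha>2 (xi x1 x2) (labels i) (\<lambda>l. \<nu> l + block_shift 1 0 l)" for \<nu>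
        unfolding c_def using DD_block_shift[of \<alpha>1 \<alpha>2 x1 1 x2 0 "labels i" \<nu>]
        by (simp only: power_int_1_right power_int_0_right mult_1_right)
      hence "infsum (DD \<alpha>1 \<alpha>2 (xi (x1 * Q) x2) (labels i)) (ch (labels i)) =
          infsum (\<lambda>\<nu>. c * DD \<alpha>1 \<alpha>2 (xi x1 x2) (labels i) (\<lambda>l. \<nu> l + block_shift 1 0 l)) (ch (labels i))"
        by (rule infsum_cong)
      thus ?thesis by (simp only: infsum_cmult_right' infsum_ch_shift)
    qed
    have c: "c = (1 / Q) ^ i * t powi (\<Sum>j\<in>{1..i}. - 2 * (int n - int j))"
    proof -
      have "c = (\<Prod>j\<in>{1..i}. (1 / Q) * t powi (- 2 * (int n - int j)))"
      proof -
        have "(\<Prod>j\<in>{1..i}. Q powi (- block_shift 1 0 j) * (t powi (- 2 * block_shift 1 0 j)) ^ card {k\<in>labels i. j < k}) =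
          (\<Prod>j\<in>{1..i}. (1 / Q) * t powi (- 2 * (int n - int j)))"
        proof (rule prod.cong[OF refl])
          fix j assume j: "j \<in> {1..i}"
          have b: "block_shift 1 0 j = 1" using j i by (simp add: block_shift_def)
          have nj: "int (n - j) = int n - int j" using j i by simp
          show "Q powi (- block_shift 1 0 j) * (t powi (- 2 * block_shift 1 0 j)) ^ card {k\<in>labels i. j < k} =
            (1 / Q) * t powi (- 2 * (int n - int j))"
            unfolding b card_labels_above(1)[OF i j] power_inverse_square nj by (simp add: power_int_minus divide_inverse)
        qed
        moreover have "(\<Prod>k\<in>{1..n-i}. Q powi (- block_shift 1 0 (n + k)) * (t powi (- 2 * block_shift 1 0 (n + k))) ^ card {l\<in>labels i. n + k < l}) = 1"
          by (intro prod.neutral ballI) (auto simp: block_shift_def)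
        ultimately show ?thesis unfolding c_def prod_labels[OF i] by simp
      qed
      thus ?thesis unfolding prod.distrib prod_power_int[OF t_nonzero] by simp
    qed
    have Th: "Th (x1 * Q) x2 i = Th x1 x2 i * ((- (1 / r) / Q) ^ i * t powi (\<Sum>j\<in>{1..i}. 1 - int j) *
        ((- (1 / r)) ^ m * t powi (\<Sum>k\<in>{1..m}. - (int i - int k + 1))))"
    proof -
      have 1: "(\<Prod>j\<in>{1..i}. qtheta q (x2 / (x1 * Q) * t powi (1 - int j))) =
         (\<Prod>j\<in>{1..i}. (- (1 / r) / Q) * t powi (1 - int j) * qtheta q (x2 / x1 * t powi (1 - int j)))"
      proof (intro prod.cong refl)
        fix j
        have "x2 / (x1 * Q) * t powi (1 - int j) = (x2 / x1 * t powi (1 - int j)) / Q" by simp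
        also have "qtheta q \<dots> = - ((x2 / x1 * t powi (1 - int j)) / Q) * qtheta q (x2 / x1 * t powi (1 - int j))"
          using G by (intro qtheta_Q_div) auto
        finally show "qtheta q (x2 / (x1 * Q) * t powi (1 - int j)) =
           (- (1 / r) / Q) * t powi (1 - int j) * qtheta q (x2 / x1 * t powi (1 - int j))"
            unfolding r(2)[symmetric] by simp
      qed
      have 2: "(\<Prod>k\<in>{1..m}. qtheta q (x1 * Q / x2 * t powi (int i - int k + 1))) =
         (\<Prod>k\<in>{1..m}. (- (1 / r)) * t powi (- (int i - int k + 1)) * qtheta q (x1 / x2 * t powi (int i - int k + 1)))"
      proof (intro prod.cong refl)
        fix k
        have "x1 * Q / x2 * t powi (int i - int k + 1) = Q * (x1 / x2 * t powi (int i - int k + 1))" by simp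
        also have "qtheta q \<dots> = - (1 / (x1 / x2 * t powi (int i - int k + 1))) * qtheta q (x1 / x2 * t powi (int i - int k + 1))"
          using G by (intro qtheta_Q_mult) auto
        finally show "qtheta q (x1 * Q / x2 * t powi (int i - int k + 1)) =
          (- (1 / r)) * t powi (- (int i - int k + 1)) * qtheta q (x1 / x2 * t powi (int i - int k + 1))"
          by (simp only: power_int_minus r_def) (simp add: divide_inverse)
      qed
      show ?thesis
        unfolding Th_def m_def[symmetric] 1 2 prod.distrib prod_power_int[OF t_nonzero]
        by (simp add: mult_ac)
    qed
    \<comment> \<open>The exponents of \<open>t\<close> agree by \<open>n = i + m\<close> and the
      sums of arithmetic progressions; everything is doubled to stay within the integers.\<close>
    have expo: "(\<Sum>j\<in>{1..i}. - 2 * (int n - int j)) = - (\<Sum>s<n. int s) + ((\<Sum>j\<in>{1..i}. 1 - int j) + (\<Sum>k\<in>{1..m}. - (int i - int k + 1)))"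
    proof -
      have n: "int n = int i + int m" using i by (simp add: m_def)
      have "2 * (\<Sum>j\<in>{1..i}. - 2 * (int n - int j)) = - 4 * int n * int i + 2 * (2 * (\<Sum>j\<in>{1..i}. int j))"
        unfolding sum_distrib_left[symmetric] by (simp add: sum_subtractf algebra_simps)
      moreover have "2 * (\<Sum>j\<in>{1..i}. 1 - int j) = 2 * int i - 2 * (\<Sum>j\<in>{1..i}. int j)"
        by (simp add: sum_subtractf)
      moreover have "2 * (\<Sum>k\<in>{1..m}. - (int i - int k + 1)) = 2 * (\<Sum>k\<in>{1..m}. int k) - 2 * (int i + 1) * int m"
        by (simp add: sum_subtractf sum.distrib sum_negf algebra_simps)
      ultimately have "2 * (\<Sum>j\<in>{1..i}. - 2 * (int n - int j)) =
        2 * (- (\<Sum>s<n. int s) + ((\<Sum>j\<in>{1..i}. 1 - int j) + (\<Sum>k\<in>{1..m}. - (int i - int k + 1))))"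
        using double_gauss_sum_int[of i] double_gauss_sum_int[of m] double_sum_lessThan n
        by (simp add: algebra_simps)
      thus ?thesis by simp
    qed
    have "c = shift_mult r * ((- (1 / r) / Q) ^ i * t powi (\<Sum>j\<in>{1..i}. 1 - int j) *
        ((- (1 / r)) ^ m * t powi (\<Sum>k\<in>{1..m}. - (int i - int k + 1))))"
    proof -
      have "n = i + m" using i by (simp add: m_def)
      hence "(- r) ^ n * ((- (1 / r) / Q) ^ i * (- (1 / r)) ^ m) = ((- r) * (- (1 / r) / Q)) ^ i * ((- r) * (- (1 / r))) ^ m"
        unfolding power_mult_distrib by (simp add: power_add)
      also have "\<dots> = (1 / Q) ^ i" using r by simp
      finally have a: "(1 / Q) ^ i = (- r) ^ n * ((- (1 / r) / Q) ^ i * (- (1 / r)) ^ m)" ..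
      show ?thesis
        unfolding c shift_mult_eq expo power_int_add[OF disjI1[OF t_nonzero]] a by (simp only: mult_ac)
    qed
    moreover have "Th (x1 * Q) x2 i \<noteq> 0"
      using Th_nonzero[OF generic_shift[OF g, of 1 0] i] by simp
    ultimately show ?thesis unfolding S Th using r(1) by simp
  qed
  thus ?thesis unfolding FF_def r_def by (simp add: sum_distrib_left)
qed

text \<open>The order of the labels enters the pair factors, so \<open>FF\<close> is not visibly
  symmetric in the two blocks. The count is repeated with the second block, whose
  \<open>k\<close>-th label is followed by \<open>m - k\<close> labels only.\<close>

lemma FF_shift_2:
  assumes g: "generic x1 x2"
  shows "FF x1 (x2 * Q) \<alpha>1 \<alpha>2 = shift_mult (x2 / x1) * FF x1 x2 \<alpha>1 \<alpha>2"
proof -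
  note G = genericD[OF g]
  define r where "r = x2 / x1"
  have r: "r \<noteq> 0" "x1 / x2 = 1 / r" using G by (auto simp: r_def)
  have "infsum (DD \<alpha>1 \<alpha>2 (xi x1 (x2 * Q)) (labels i)) (ch (labels i)) / Th x1 (x2 * Q) i =
     shift_mult r * (infsum (DD \<alpha>1 \<alpha>2 (xi x1 x2) (labels i)) (ch (labels i)) / Th x1 x2 i)" if i: "i \<le> n" for i
  proof -
    define m where "m = n - i"
    define c where "c = (\<Prod>j\<in>labels i. Q powi (- block_shift 0 1 j) * (t powi (- 2 * block_shift 0 1 j)) ^ card {k\<in>labels i. j < k})"
    have S: "infsum (DD \<alpha>1 \<alpha>2 (xi x1 (x2 * Q)) (labels i)) (ch (labels i)) =
        c * infsum (DD \<alpha>1 \<alpha>2 (xi x1 x2) (labels i)) (ch (labels i))"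
    proof -
      have "DD \<alpha>1 \<alpha>2 (xi x1 (x2 * Q)) (labels i) \<nu> = c * DD \<alpha>1 \<alpha>2 (xi x1 x2) (labels i) (\<lambda>l. \<nu> l + block_shift 0 1 l)" for \<nu>
        unfolding c_def using DD_block_shift[of \<alpha>1 \<alpha>2 x1 0 x2 1 "labels i" \<nu>]
        by (simp only: power_int_1_right power_int_0_right mult_1_right)
      hence "infsum (DD \<alpha>1 \<alpha>2 (xi x1 (x2 * Q)) (labels i)) (ch (labels i)) =
          infsum (\<lambda>\<nu>. c * DD \<alpha>1 \<alpha>2 (xi x1 x2) (labels i) (\<lambda>l. \<nu> l + block_shift 0 1 l)) (ch (labels i))"
        by (rule infsum_cong)
      thus ?thesis by (simp only: infsum_cmult_right' infsum_ch_shift)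
    qed
    have c: "c = (1 / Q) ^ m * t powi (\<Sum>k\<in>{1..m}. - 2 * (int m - int k))"
    proof -
      have "c = (\<Prod>k\<in>{1..m}. (1 / Q) * t powi (- 2 * (int m - int k)))"
      proof -
        have "(\<Prod>k\<in>{1..n-i}. Q powi (- block_shift 0 1 (n + k)) * (t powi (- 2 * block_shift 0 1 (n + k))) ^ card {l\<in>labels i. n + k < l}) =
          (\<Prod>k\<in>{1..n-i}. (1 / Q) * t powi (- 2 * (int m - int k)))"
        proof (rule prod.cong[OF refl])
          fix k assume k: "k \<in> {1..n-i}"
          have b: "block_shift 0 1 (n + k) = 1" using k i by (simp add: block_shift_def)
          have "i + k \<le> n" using k by auto
          hence nk: "int (n - i - k) = int m - int k" using i by (simp add: m_def of_nat_diff)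
          show "Q powi (- block_shift 0 1 (n + k)) * (t powi (- 2 * block_shift 0 1 (n + k))) ^ card {l\<in>labels i. n + k < l} =
            (1 / Q) * t powi (- 2 * (int m - int k))"
            unfolding b card_labels_above(2)[OF i k] power_inverse_square nk by (simp add: power_int_minus divide_inverse)
        qed
        moreover have "(\<Prod>j\<in>{1..i}. Q powi (- block_shift 0 1 j) * (t powi (- 2 * block_shift 0 1 j)) ^ card {l\<in>labels i. j < l}) = 1"
          by (intro prod.neutral ballI) (use i in \<open>auto simp: block_shift_def\<close>)
        ultimately show ?thesis unfolding c_def prod_labels[OF i] m_def by simp
      qed
      thus ?thesis unfolding prod.distrib prod_power_int[OF t_nonzero] by simp
    qed
    have Th: "Th x1 (x2 * Q) i = Th x1 x2 i * ((- (1 / r)) ^ i * t powi (\<Sum>j\<in>{1..i}. - (1 - int j)) *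
        ((- (1 / r) / Q) ^ m * t powi (\<Sum>k\<in>{1..m}. int i - int k + 1)))"
    proof -
      have 1: "(\<Prod>j\<in>{1..i}. qtheta q (x2 * Q / x1 * t powi (1 - int j))) =
         (\<Prod>j\<in>{1..i}. (- (1 / r)) * t powi (- (1 - int j)) * qtheta q (x2 / x1 * t powi (1 - int j)))"
      proof (intro prod.cong refl)
        fix j
        have "x2 * Q / x1 * t powi (1 - int j) = Q * (x2 / x1 * t powi (1 - int j))" by simp
        also have "qtheta q \<dots> = - (1 / (x2 / x1 * t powi (1 - int j))) * qtheta q (x2 / x1 * t powi (1 - int j))"
          using G by (intro qtheta_Q_mult) auto
        finally show "qtheta q (x2 * Q / x1 * t powi (1 - int j)) =
           (- (1 / r)) * t powi (- (1 - int j)) * qtheta q (x2 / x1 * t powi (1 - int j))"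
          by (simp only: power_int_minus r_def) (simp add: divide_inverse)
      qed
      have 2: "(\<Prod>k\<in>{1..m}. qtheta q (x1 / (x2 * Q) * t powi (int i - int k + 1))) =
         (\<Prod>k\<in>{1..m}. (- (1 / r) / Q) * t powi (int i - int k + 1) * qtheta q (x1 / x2 * t powi (int i - int k + 1)))"
      proof (intro prod.cong refl)
        fix k
        have "x1 / (x2 * Q) * t powi (int i - int k + 1) = (x1 / x2 * t powi (int i - int k + 1)) / Q" by simp
        also have "qtheta q \<dots> = - ((x1 / x2 * t powi (int i - int k + 1)) / Q) * qtheta q (x1 / x2 * t powi (int i - int k + 1))"
          using G by (intro qtheta_Q_div) auto
        finally show "qtheta q (x1 / (x2 * Q) * t powi (int i - int k + 1)) =
          (- (1 / r) / Q) * t powi (int i - int k + 1) * qtheta q (x1 / x2 * t powi (int i - int k + 1))"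
            unfolding r(2)[symmetric] by simp
      qed
      show ?thesis
        unfolding Th_def m_def[symmetric] 1 2 prod.distrib prod_power_int[OF t_nonzero]
        by (simp add: mult_ac)
    qed
    have expo: "(\<Sum>k\<in>{1..m}. - 2 * (int m - int k)) = - (\<Sum>s<n. int s) + ((\<Sum>j\<in>{1..i}. - (1 - int j)) + (\<Sum>k\<in>{1..m}. int i - int k + 1))"
    proof -
      have n: "int n = int i + int m" using i by (simp add: m_def)
      have "2 * (\<Sum>k\<in>{1..m}. - 2 * (int m - int k)) = - 4 * int m * int m + 2 * (2 * (\<Sum>k\<in>{1..m}. int k))"
        unfolding sum_distrib_left[symmetric] by (simp add: sum_subtractf algebra_simps)
      moreover have "2 * (\<Sum>j\<in>{1..i}. - (1 - int j)) = 2 * (\<Sum>j\<in>{1..i}. int j) - 2 * int i"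
        by (simp add: sum_subtractf sum_negf)
      moreover have "2 * (\<Sum>k\<in>{1..m}. int i - int k + 1) = 2 * (int i + 1) * int m - 2 * (\<Sum>k\<in>{1..m}. int k)"
        by (simp add: sum_subtractf sum.distrib algebra_simps)
      ultimately have "2 * (\<Sum>k\<in>{1..m}. - 2 * (int m - int k)) =
        2 * (- (\<Sum>s<n. int s) + ((\<Sum>j\<in>{1..i}. - (1 - int j)) + (\<Sum>k\<in>{1..m}. int i - int k + 1)))"
        using double_gauss_sum_int[of i] double_gauss_sum_int[of m] double_sum_lessThan n
        by (simp add: algebra_simps)
      thus ?thesis by simp
    qed
    have "c = shift_mult r * ((- (1 / r)) ^ i * t powi (\<Sum>j\<in>{1..i}. - (1 - int j)) *
        ((- (1 / r) / Q) ^ m * t powi (\<Sum>k\<in>{1..m}. int i - int k + 1)))"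
    proof -
      have "n = i + m" using i by (simp add: m_def)
      hence "(- r) ^ n * ((- (1 / r)) ^ i * (- (1 / r) / Q) ^ m) = ((- r) * (- (1 / r))) ^ i * ((- r) * (- (1 / r) / Q)) ^ m"
        unfolding power_mult_distrib by (simp add: power_add)
      also have "\<dots> = (1 / Q) ^ m" using r by simp
      finally have a: "(1 / Q) ^ m = (- r) ^ n * ((- (1 / r)) ^ i * (- (1 / r) / Q) ^ m)" ..
      show ?thesis
        unfolding c shift_mult_eq expo power_int_add[OF disjI1[OF t_nonzero]] a by (simp only: mult_ac)
    qed
    moreover have "Th x1 (x2 * Q) i \<noteq> 0"
      using Th_nonzero[OF generic_shift[OF g, of 0 1] i] by simp
    ultimately show ?thesis unfolding S Th using r(1) by simp
  qed
  thus ?thesis unfolding FF_def r_def by (simp add: sum_distrib_left)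
qed

text \<open>\<open>side_l\<close> and \<open>side_r\<close> are the two sides of the evaluation at
  vanishing parameters with the theta denominators cleared; their ratio will be a constant.\<close>

definition side_l :: "complex \<Rightarrow> complex \<Rightarrow> complex" where
  "side_l x1 x2 = FF x1 x2 0 0 * (\<Prod>s<n. qtheta q (x1 * b1 * t ^ s) * qtheta q (x1 * b2 * t ^ s) *
     (qtheta q (x2 * b1 * t ^ s) * qtheta q (x2 * b2 * t ^ s)))"

definition side_r :: "complex \<Rightarrow> complex \<Rightarrow> complex" where
  "side_r x1 x2 = (\<Prod>s<n. qtheta q (x1 * x2 * b1 * b2 * t ^ (n + s - 1)))"

text \<open>Reversing the order of the factors shows that the product of \<open>t ^ (2 * s)\<close>
  equals that of \<open>t ^ (n - 1)\<close> over \<open>s < n\<close>. This is where the exponents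
  \<open>n + s - 1\<close> in \<open>side_r\<close> come from.\<close>

lemma theta_multipliers:
  assumes x: "x \<noteq> 0" "y \<noteq> 0"
  shows "shift_mult (x / y) * (\<Prod>s<n. (- (1 / (x * b1 * t ^ s))) * (- (1 / (x * b2 * t ^ s)))) =
    (\<Prod>s<n. - (1 / (x * y * b1 * b2 * t ^ (n + s - 1))))"
proof -
  have "(\<Prod>s<n. t ^ s * t ^ s) = (\<Prod>s<n. t ^ s) * (\<Prod>s<n. t ^ (n - Suc s))"
    unfolding prod.distrib by (subst prod.nat_diff_reindex[symmetric]) (rule refl)
  also have "\<dots> = (\<Prod>s<n. t ^ (n - 1))"
    unfolding prod.distrib[symmetric] by (intro prod.cong) (auto simp: power_add[symmetric])
  finally have tt: "(\<Prod>s<n. t ^ s * t ^ s) = (\<Prod>s<n. t ^ (n - 1))" .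
  define B where "B = (\<lambda>s. t ^ s * t ^ s)"
  have dist: "(\<Prod>s<n. A s * (1 / C s)) = (\<Prod>s<n. A s) * (1 / (\<Prod>s<n. C s))" for A C :: "nat \<Rightarrow> complex"
    by (simp add: prod.distrib prod_dividef)
  have "shift_mult (x / y) * (\<Prod>s<n. (- (1 / (x * b1 * t ^ s))) * (- (1 / (x * b2 * t ^ s)))) =
    (\<Prod>s<n. - (1 / (x * y * b1 * b2)) / t ^ s * (1 / B s))"
    unfolding shift_mult_def prod.distrib[symmetric] B_def using x by (intro prod.cong) auto
  also have "\<dots> = (\<Prod>s<n. - (1 / (x * y * b1 * b2)) / t ^ s) * (1 / (\<Prod>s<n. t ^ (n - 1)))"
    unfolding dist B_def tt ..
  also have "\<dots> = (\<Prod>s<n. - (1 / (x * y * b1 * b2)) / t ^ s * (1 / t ^ (n - 1)))"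
    unfolding dist ..
  also have "\<dots> = (\<Prod>s<n. - (1 / (x * y * b1 * b2 * t ^ (n + s - 1))))"
  proof (intro prod.cong refl)
    fix s
    have "n + s - 1 = s + (n - 1)" using n_pos by simp
    hence "t ^ (n + s - 1) = t ^ s * t ^ (n - 1)" by (simp only: power_add)
    thus "- (1 / (x * y * b1 * b2)) / t ^ s * (1 / t ^ (n - 1)) = - (1 / (x * y * b1 * b2 * t ^ (n + s - 1)))"
      by (simp add: mult_ac)
  qed
  finally show ?thesis .
qed

lemma sides_shift_1:
  assumes g: "generic x1 x2"
  shows "\<exists>\<mu>. \<mu> \<noteq> 0 \<and> side_l (x1 * Q) x2 = \<mu> * side_l x1 x2 \<and> side_r (x1 * Q) x2 = \<mu> * side_r x1 x2"
proof -
  note G = genericD[OF g]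
  define \<mu> where "\<mu> = (\<Prod>s<n. - (1 / (x1 * x2 * b1 * b2 * t ^ (n + s - 1))))"
  have \<mu>: "\<mu> \<noteq> 0" using G b_nonzero by (simp add: \<mu>_def)
  have th: "qtheta q (x1 * Q * b * t ^ s) = - (1 / (x1 * b * t ^ s)) * qtheta q (x1 * b * t ^ s)" if "b \<noteq> 0" for b s
    using qtheta_Q_mult[of "x1 * b * t ^ s"] that G by (simp add: mult_ac)
  have "side_l (x1 * Q) x2 = (shift_mult (x1 / x2) * (\<Prod>s<n. (- (1 / (x1 * b1 * t ^ s))) * (- (1 / (x1 * b2 * t ^ s))))) * side_l x1 x2"
    unfolding side_l_def FF_shift_1[OF g] th[OF b_nonzero(1)] th[OF b_nonzero(2)] prod.distrib by (simp only: mult_ac)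
  also have "\<dots> = \<mu> * side_l x1 x2" unfolding \<mu>_def by (simp only: theta_multipliers[OF G(1,2)])
  finally have 1: "side_l (x1 * Q) x2 = \<mu> * side_l x1 x2" .
  have "side_r (x1 * Q) x2 = \<mu> * side_r x1 x2"
  proof -
    have "qtheta q (x1 * Q * x2 * b1 * b2 * t ^ k) = - (1 / (x1 * x2 * b1 * b2 * t ^ k)) * qtheta q (x1 * x2 * b1 * b2 * t ^ k)" for k
      using qtheta_Q_mult[of "x1 * x2 * b1 * b2 * t ^ k"] G b_nonzero by (simp add: mult_ac)
    thus ?thesis unfolding side_r_def \<mu>_def prod.distrib[symmetric] by (simp only:)
  qed
  with 1 \<mu> show ?thesis by blast
qed

lemma sides_shift_2:
  assumes g: "generic x1 x2"
  shows "\<exists>\<mu>. \<mu> \<noteq> 0 \<and> side_l x1 (x2 * Q) = \<mu> * side_l x1 x2 \<and> side_r x1 (x2 * Q) = \<mu> * side_r x1 x2"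
proof -
  note G = genericD[OF g]
  define \<mu> where "\<mu> = (\<Prod>s<n. - (1 / (x2 * x1 * b1 * b2 * t ^ (n + s - 1))))"
  have \<mu>: "\<mu> \<noteq> 0" using G b_nonzero by (simp add: \<mu>_def)
  have th: "qtheta q (x2 * Q * b * t ^ s) = - (1 / (x2 * b * t ^ s)) * qtheta q (x2 * b * t ^ s)" if "b \<noteq> 0" for b s
    using qtheta_Q_mult[of "x2 * b * t ^ s"] that G by (simp add: mult_ac)
  have "side_l x1 (x2 * Q) = (shift_mult (x2 / x1) * (\<Prod>s<n. (- (1 / (x2 * b1 * t ^ s))) * (- (1 / (x2 * b2 * t ^ s))))) * side_l x1 x2"
    unfolding side_l_def FF_shift_2[OF g] th[OF b_nonzero(1)] th[OF b_nonzero(2)] prod.distrib by (simp only: mult_ac)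
  also have "\<dots> = \<mu> * side_l x1 x2" unfolding \<mu>_def by (simp only: theta_multipliers[OF G(2,1)])
  finally have 1: "side_l x1 (x2 * Q) = \<mu> * side_l x1 x2" .
  have "side_r x1 (x2 * Q) = \<mu> * side_r x1 x2"
  proof -
    have "qtheta q (x1 * (x2 * Q) * b1 * b2 * t ^ k) = - (1 / (x2 * x1 * b1 * b2 * t ^ k)) * qtheta q (x1 * x2 * b1 * b2 * t ^ k)" for k
      using qtheta_Q_mult[of "x1 * x2 * b1 * b2 * t ^ k"] G b_nonzero by (simp add: mult_ac)
    thus ?thesis unfolding side_r_def \<mu>_def prod.distrib[symmetric] by (simp only:)
  qed
  with 1 \<mu> show ?thesis by blast
qed

text \<open>Only the existence of a common nonzero multiplier is recorded, since it cancels when the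
  two sides are compared.\<close>

lemma sides_shift:
  assumes g: "generic x1 x2"
  shows "\<exists>\<mu>. \<mu> \<noteq> 0 \<and> side_l (x1 * Q ^ N1) (x2 * Q ^ N2) = \<mu> * side_l x1 x2 \<and>
    side_r (x1 * Q ^ N1) (x2 * Q ^ N2) = \<mu> * side_r x1 x2"
proof -
  have gg: "generic (x1 * Q ^ M1) (x2 * Q ^ M2)" for M1 M2
    using generic_shift[OF g, of "int M1" "int M2"] by simp
  have 1: "\<exists>\<mu>. \<mu> \<noteq> 0 \<and> side_l (x1 * Q ^ N) x2 = \<mu> * side_l x1 x2 \<and> side_r (x1 * Q ^ N) x2 = \<mu> * side_r x1 x2" for N
  proof (induction N)
    case 0
    show ?case by (intro exI[of _ 1]) simp
  next
    case (Suc N)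
    then obtain \<mu> where \<mu>: "\<mu> \<noteq> 0" "side_l (x1 * Q ^ N) x2 = \<mu> * side_l x1 x2" "side_r (x1 * Q ^ N) x2 = \<mu> * side_r x1 x2"
      by blast
    obtain \<mu>' where "\<mu>' \<noteq> 0" "side_l (x1 * Q ^ N * Q) x2 = \<mu>' * side_l (x1 * Q ^ N) x2"
        "side_r (x1 * Q ^ N * Q) x2 = \<mu>' * side_r (x1 * Q ^ N) x2"
      using sides_shift_1[OF gg[of N 0, simplified]] by blast
    thus ?case using \<mu> by (intro exI[of _ "\<mu>' * \<mu>"]) (simp add: mult_ac)
  qed
  show ?thesis
  proof (induction N2)
    case 0
    show ?case using 1[of N1] by simp
  next
    case (Suc N)
    then obtain \<mu> where \<mu>: "\<mu> \<noteq> 0" "side_l (x1 * Q ^ N1) (x2 * Q ^ N) = \<mu> * side_l x1 x2"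
        "side_r (x1 * Q ^ N1) (x2 * Q ^ N) = \<mu> * side_r x1 x2"
      by blast
    obtain \<mu>' where "\<mu>' \<noteq> 0" "side_l (x1 * Q ^ N1) (x2 * Q ^ N * Q) = \<mu>' * side_l (x1 * Q ^ N1) (x2 * Q ^ N)"
        "side_r (x1 * Q ^ N1) (x2 * Q ^ N * Q) = \<mu>' * side_r (x1 * Q ^ N1) (x2 * Q ^ N)"
      using sides_shift_2[OF gg[of N1 N]] by blast
    thus ?case using \<mu> by (intro exI[of _ "\<mu>' * \<mu>"]) (simp add: mult_ac)
  qed
qed

text \<open>
  The sum truncated at \<open>X1 = 1 / \<alpha>1\<close> and \<open>X2 = 1 / \<alpha>2\<close> determines \<open>FF x1 x2 0 0\<close>, since \<open>X1, X2\<close>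
  may be moved towards \<open>0\<close> along the lattices through \<open>x1, x2\<close>.
\<close>

lemma side_l_truncated:
  assumes g: "generic x1 x2"
  defines "X1 \<equiv> \<lambda>N. x1 * Q ^ N" and "X2 \<equiv> \<lambda>N. x2 * Q ^ (2 * N)"
  shows "side_l x1 x2 * (\<Prod>s<n. qpoch q (X1 N * X2 N * b1 * b2 * t ^ (n + s - 1))) =
    FF (X1 N) (X2 N) (1 / X1 N) (1 / X2 N) *
    (\<Prod>s<n. qpoch q (X1 N * b1 * t ^ s) * qpoch q (X1 N * b2 * t ^ s) *
       (qpoch q (X2 N * b1 * t ^ s) * qpoch q (X2 N * b2 * t ^ s))) * side_r x1 x2"
proof -
  note G = genericD[OF g]
  define Y1 where "Y1 = X1 N"
  define Y2 where "Y2 = X2 N"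
  have gY: "generic Y1 Y2"
    using generic_shift[OF g, of "int N" "int (2 * N)"] unfolding Y1_def Y2_def X1_def X2_def power_int_of_nat .
  \<comment> \<open>\<open>Q / Y1\<close> lies on the lattice through \<open>1 / Y1\<close> with
    exponent 1, and \<open>1 / Y2\<close> is itself the second base value with exponent 0.\<close>
  have good: "good Y1 Y2 (Q * (1 / Y1)) (1 / Y2)"
    unfolding good_def by (intro disjI2 exI[of _ 1] exI[of _ 0]) simp
  obtain \<mu> where \<mu>: "\<mu> \<noteq> 0" "side_l Y1 Y2 = \<mu> * side_l x1 x2" "side_r Y1 Y2 = \<mu> * side_r x1 x2"
    using sides_shift[OF g, of N "2 * N"] unfolding Y1_def Y2_def X1_def X2_def by blast
  define F where "F = FF Y1 Y2 (1 / Y1) (1 / Y2)"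
  define u where "u = (\<Prod>s<n. qpoch q (Y1 * Y2 * b1 * b2 * t ^ (n + s - 1)))"
  define v where "v = (\<Prod>s<n. qpoch q (Q / (Y1 * Y2 * b1 * b2 * t ^ (n + s - 1))))"
  define a where "a = (\<Prod>s<n. qpoch q (Y1 * b1 * t ^ s) * qpoch q (Y1 * b2 * t ^ s) *
       (qpoch q (Y2 * b1 * t ^ s) * qpoch q (Y2 * b2 * t ^ s)))"
  define c1 where "c1 = (\<Prod>s<n. qpoch q (Q / (Y1 * b1 * t ^ s)) * qpoch q (Q / (Y1 * b2 * t ^ s)))"
  define c2 where "c2 = (\<Prod>s<n. qpoch q (Q / (Y2 * b1 * t ^ s)) * qpoch q (Q / (Y2 * b2 * t ^ s)))"
  have r: "side_r Y1 Y2 = u * v"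
    unfolding side_r_def u_def v_def qtheta_def prod.distrib ..
  have l: "side_l Y1 Y2 = FF Y1 Y2 0 0 * (a * (c1 * c2))"
    unfolding side_l_def a_def c1_def c2_def qtheta_def prod.distrib by (simp only: mult_ac)
  \<comment> \<open>\<open>c1\<close>, \<open>c2\<close> and \<open>v\<close> are the halves with
    inverted argument of the theta functions in \<open>side_l\<close> and \<open>side_r\<close>.
    They cancel, leaving the halves \<open>a\<close> and \<open>u\<close>, which tend to 1 as
    \<open>N\<close> grows.\<close>
  have "F * v = c1 * (c2 * FF Y1 Y2 0 0)"
    using FF_formula[OF gY good] by (simp add: F_def v_def c1_def c2_def mult_ac)
  hence "side_l Y1 Y2 = F * v * a" unfolding l by simp
  hence "side_l Y1 Y2 * u = F * a * side_r Y1 Y2" unfolding r by simp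
  hence "side_l x1 x2 * u = F * a * side_r x1 x2"
  proof -
    assume h: "side_l Y1 Y2 * u = F * a * side_r Y1 Y2"
    have "\<mu> * (side_l x1 x2 * u) = \<mu> * (F * a * side_r x1 x2)"
      using h unfolding \<mu>(2,3) by (simp only: mult_ac)
    thus ?thesis using \<mu>(1) by simp
  qed
  thus ?thesis unfolding u_def F_def a_def Y1_def Y2_def .
qed

end

section \<open>The limit of the truncated sums\<close>

context q_base
begin

text \<open>The ratio of the two values is the inverse of the product of \<open>\<nu>\<close>
  consecutive factors \<open>1 - y * Q powi j\<close>. Near 0 these form a convergent product
  without zeros, far out each has norm at least 1, and only finitely many starting indices lie in
  between. So the bound is uniform in \<open>m\<close> and \<open>\<nu>\<close>.\<close>

lemma qpoch_ratio_bound: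
  assumes y: "y \<noteq> 0" "qtheta q y \<noteq> 0"
  shows "\<exists>K>0. \<forall>m (\<nu>::nat). norm (qpoch q (y * Q powi (m + int \<nu>))) \<le> K * norm (qpoch q (y * Q powi m))"
proof -
  define w where "w = (\<lambda>m. norm (qpoch q (y * Q powi m)))"
  have w0: "w m > 0" for m
    using qtheta_nonzero_imp_qpoch[OF y, of m] by (simp add: w_def mult.commute)
  have rec: "w m = norm (1 - y * Q powi m) * w (m + 1)" for m
    unfolding w_def by (subst qpoch_rec) (simp add: norm_mult power_int_add mult_ac)
  have pos: "\<exists>K>0. \<forall>k \<nu>. w (int k + int \<nu>) \<le> K * w (int k)"
  proof -
    have l: "(\<lambda>k. qpoch q (y * Q ^ k)) \<longlonglongrightarrow> 1" by (rule qpoch_tendsto_1)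
    have "(\<lambda>k. inverse (qpoch q (y * Q ^ k))) \<longlonglongrightarrow> inverse 1" by (intro tendsto_inverse l) simp
    from tendsto_imp_norm_bound[OF this] obtain K2 where K2: "K2 > 0" "\<And>k. norm (inverse (qpoch q (y * Q ^ k))) \<le> K2"
      by blast
    obtain K1 where K1: "K1 > 0" "\<And>k. norm (qpoch q (y * Q ^ k)) \<le> K1"
      using tendsto_imp_norm_bound[OF l] by blast
    have "w (int k + int \<nu>) \<le> (K1 * K2) * w (int k)" for k \<nu>
    proof -
      have "w (int k + int \<nu>) \<le> K1" using K1(2)[of "k + \<nu>"] by (simp add: w_def flip: of_nat_add)
      moreover have "inverse (w (int k)) \<le> K2" using K2(2)[of k] by (simp add: w_def norm_inverse)
      hence "1 \<le> K2 * w (int k)" using w0[of "int k"] by (simp add: field_simps)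
      hence "K1 * 1 \<le> K1 * (K2 * w (int k))" using K1(1) by (intro mult_left_mono) auto
      ultimately show ?thesis by simp
    qed
    thus ?thesis using K1 K2 by (intro exI[of _ "K1 * K2"]) auto
  qed
  define P where "P = (\<lambda>k C. \<forall>\<nu>::nat. w (- int k + int \<nu>) \<le> C * w (- int k))"
  \<comment> \<open>Starting one index lower divides the ratio by the norm of one factor; the
    maximum with 1 accounts for \<open>\<nu> = 0\<close>.\<close>
  have step: "P (Suc k) (max 1 (C / norm (1 - y * Q powi (- int (Suc k)))))" if P: "P k C" for k C
    unfolding P_def
  proof
    fix \<nu> :: nat
    define d where "d = norm (1 - y * Q powi (- int (Suc k)))"
    have r: "w (- int (Suc k)) = d * w (- int k)" unfolding d_def by (subst rec) simp
    have d: "d > 0" using r w0[of "- int (Suc k)"] w0[of "- int k"] zero_less_mult_pos2 by metis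
    show "w (- int (Suc k) + int \<nu>) \<le> max 1 (C / d) * w (- int (Suc k))"
    proof (cases \<nu>)
      case 0
      have "1 * w (- int (Suc k)) \<le> max 1 (C / d) * w (- int (Suc k))"
        using w0 by (intro mult_right_mono) (auto intro: less_imp_le)
      thus ?thesis using 0 by simp
    next
      case (Suc \<nu>')
      hence "w (- int (Suc k) + int \<nu>) = w (- int k + int \<nu>')" by simp
      also have "\<dots> \<le> C * w (- int k)" using P by (simp add: P_def)
      also have "\<dots> = (C / d) * w (- int (Suc k))" using d r by simp
      also have "\<dots> \<le> max 1 (C / d) * w (- int (Suc k))"
        using w0 by (intro mult_right_mono) (auto intro: less_imp_le)
      finally show ?thesis .
    qed
  qed
  have ex: "\<exists>C\<ge>1. P k C" for k
  proof (induction k)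
    case 0
    obtain K where K: "K > 0" "\<And>k \<nu>. w (int k + int \<nu>) \<le> K * w (int k)" using pos by blast
    have "w (int \<nu>) \<le> max 1 K * w 0" for \<nu>
    proof -
      have "w (int \<nu>) \<le> K * w 0" using K(2)[of 0 \<nu>] by simp
      also have "\<dots> \<le> max 1 K * w 0" using w0[of 0] by (intro mult_right_mono) auto
      finally show ?thesis .
    qed
    thus ?case by (intro exI[of _ "max 1 K"]) (auto simp: P_def)
  next
    case (Suc k)
    then obtain C where "P k C" by blast
    from step[OF this] show ?case by (blast intro: max.cobounded1)
  qed
  then obtain C where C: "\<And>k. C k \<ge> 1" "\<And>k. P k (C k)" by metis
  have "(\<lambda>k. Q ^ Suc k) \<longlonglongrightarrow> 0" using Q_power_tendsto_0 by (rule LIMSEQ_Suc)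
  hence "(\<lambda>k. norm (Q ^ Suc k)) \<longlonglongrightarrow> 0" by (rule tendsto_norm_zero)
  hence "eventually (\<lambda>k. norm (Q ^ Suc k) < norm y / 2) sequentially"
    using y by (intro order_tendstoD(2)) auto
  then obtain k0 where k0: "\<And>k. k \<ge> k0 \<Longrightarrow> norm (Q ^ Suc k) < norm y / 2"
    by (auto simp: eventually_sequentially)
  \<comment> \<open>From \<open>k0\<close> on the additional factor has norm at least 1, so the
    constant stops growing.\<close>
  have big: "1 \<le> norm (1 - y * Q powi (- int (Suc k)))" if "k \<ge> k0" for k
  proof -
    have "norm (y * Q powi (- int (Suc k))) = norm y / norm (Q ^ Suc k)"
      unfolding power_int_minus power_int_of_nat by (simp only: norm_mult norm_inverse divide_inverse)
    also have "\<dots> \<ge> 2" using k0[OF that] q_pos by (simp add: norm_power norm_mult field_simps)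
    finally have "2 \<le> norm (y * Q powi (- int (Suc k)))" .
    thus ?thesis using norm_triangle_ineq2[of "y * Q powi (- int (Suc k))" 1] by (simp add: norm_minus_commute)
  qed
  have late: "P (k0 + l) (C k0)" for l
  proof (induction l)
    case (Suc l)
    define d where "d = norm (1 - y * Q powi (- int (Suc (k0 + l))))"
    have d: "1 \<le> d" unfolding d_def by (rule big) simp
    have "max 1 (C k0 / d) \<le> C k0"
      using C(1)[of k0] d by (simp add: divide_le_eq mult_left_le_one_le mult_le_cancel_left1)
    moreover have "P (Suc (k0 + l)) (max 1 (C k0 / d))" unfolding d_def by (rule step) (rule Suc.IH)
    ultimately have "w (- int (Suc (k0 + l)) + int \<nu>) \<le> C k0 * w (- int (Suc (k0 + l)))" for \<nu> :: nat
      unfolding P_def using mult_right_mono[of "max 1 (C k0 / d)" "C k0" "w (- int (Suc (k0 + l)))"]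
        less_imp_le[OF w0[of "- int (Suc (k0 + l))"]] order.trans by blast
    thus ?case unfolding P_def add_Suc_right by blast
  qed (simp add: C)
  obtain K0 where K0: "K0 > 0" "\<And>k \<nu>. w (int k + int \<nu>) \<le> K0 * w (int k)" using pos by blast
  define K where "K = K0 + (\<Sum>k\<le>k0. C k)"
  have CK: "C k \<le> K" if "k \<le> k0" for k
  proof -
    have "C k \<le> (\<Sum>k\<le>k0. C k)" using that C(1) by (intro member_le_sum) (auto intro: order.trans[of 0 1])
    thus ?thesis using K0(1) by (simp add: K_def)
  qed
  have Kpos: "K > 0" using CK[of 0] C(1)[of 0] by simp
  have "w (m + int \<nu>) \<le> K * w m" for m and \<nu> :: nat
  proof (cases "m \<ge> 0")
    case True
    have "w (m + int \<nu>) \<le> K0 * w m" using K0(2)[of "nat m" \<nu>] True by simp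
    also have "\<dots> \<le> K * w m"
      using w0[of m] C(1) unfolding K_def by (intro mult_right_mono) (auto intro!: sum_nonneg intro: order.trans[of 0 1])
    finally show ?thesis .
  next
    case False
    define k where "k = nat (- m)"
    have m: "m = - int k" using False by (simp add: k_def)
    have "\<exists>C'\<le>K. P k C'"
    proof (cases "k \<le> k0")
      case True thus ?thesis using C(2) CK by blast
    next
      case False
      hence "P k (C k0)" using late[of "k - k0"] by simp
      thus ?thesis using CK[of k0] by blast
    qed
    then obtain C' where C': "C' \<le> K" "P k C'" by blast
    have "w (m + int \<nu>) \<le> C' * w m" using C'(2) by (simp add: P_def m)
    also have "\<dots> \<le> K * w m" using C'(1) w0[of m] by (intro mult_right_mono) auto
    finally show ?thesis .
  qed
  thus ?thesis using Kpos by (auto simp: w_def)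
qed

text \<open>As \<open>m \<ge> 1\<close>, the factor \<open>1 - y * Q powi (1 - int N)\<close> can be
  split off the denominator. It grows like the inverse of \<open>q ^ N\<close>, while the remaining
  ratio is bounded uniformly in \<open>N\<close>.\<close>

lemma qpoch_ratio_tendsto_0:
  assumes y: "y \<noteq> 0" "qtheta q y \<noteq> 0" and m: "m \<ge> 1"
  shows "(\<lambda>N. qpoch q (y * Q powi (1 - int N + int m)) / qpoch q (y * Q powi (1 - int N))) \<longlonglongrightarrow> 0"
proof -
  obtain K where K: "K > 0" "\<And>m (\<nu>::nat). norm (qpoch q (y * Q powi (m + int \<nu>))) \<le> K * norm (qpoch q (y * Q powi m))"
    using qpoch_ratio_bound[OF y] by blast
  have nz: "qpoch q (y * Q powi m) \<noteq> 0" for m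
    using qtheta_nonzero_imp_qpoch[OF y, of m] by (simp add: mult.commute)
  have "norm (qpoch q (y * Q powi (1 - int N + int m)) / qpoch q (y * Q powi (1 - int N))) \<le>
      norm (K * (Q ^ N / (1 * Q ^ N - y * Q)))" for N
  proof -
    define e where "e = 1 - int N"
    have r: "qpoch q (y * Q powi e) = (1 - y * Q powi e) * qpoch q (y * Q powi (e + 1))"
      by (subst qpoch_rec) (simp add: power_int_add mult_ac)
    have d: "1 - y * Q powi e \<noteq> 0" using r nz[of e] by auto
    have em: "e + int m = (e + 1) + int (m - 1)" using m by simp
    have "norm (qpoch q (y * Q powi (e + int m))) \<le> K * norm (qpoch q (y * Q powi (e + 1)))"
      unfolding em by (rule K(2))
    also have "norm (qpoch q (y * Q powi (e + 1))) = norm (qpoch q (y * Q powi e)) / norm (1 - y * Q powi e)"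
      using d by (simp add: r norm_mult)
    finally have "norm (qpoch q (y * Q powi (e + int m))) / norm (qpoch q (y * Q powi e)) \<le> K / norm (1 - y * Q powi e)"
      using nz[of e] by (simp add: field_simps)
    moreover have "1 / (1 - y * Q powi e) = Q ^ N / (1 * Q ^ N - y * Q)"
    proof -
      have "Q powi e = Q / Q ^ N" by (simp add: e_def power_int_diff)
      hence "1 - y * Q powi e = (1 * Q ^ N - y * Q) / Q ^ N" by (simp add: field_simps)
      thus ?thesis by simp
    qed
    hence "norm (K * (Q ^ N / (1 * Q ^ N - y * Q))) = norm (K * (1 / (1 - y * Q powi e)))" by (simp only:)
    hence "norm (K * (Q ^ N / (1 * Q ^ N - y * Q))) = K / norm (1 - y * Q powi e)"
      using K(1) by (simp only: norm_mult norm_divide) simp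
    ultimately show ?thesis unfolding e_def by (simp add: norm_divide)
  qed
  moreover have "(\<lambda>N. norm (K * (Q ^ N / (1 * Q ^ N - y * Q)))) \<longlonglongrightarrow> norm (K * (0 / (0 - y * Q)))"
    by (intro tendsto_intros mult_Q_power_tendsto_0 Q_power_tendsto_0) (use y in auto)
  hence "(\<lambda>N. norm (K * (Q ^ N / (1 * Q ^ N - y * Q)))) \<longlonglongrightarrow> 0" by simp
  ultimately show ?thesis by (rule Lim_null_comparison[OF always_eventually[OF allI]])
qed

text \<open>By quasi-periodicity the norms of consecutive terms are related by the factor
  \<open>q ^ Suc N / norm v\<close>, which tends to 0.\<close>

lemma inverse_qtheta_tendsto_0:
  assumes v: "v \<noteq> 0"
  shows "(\<lambda>N. 1 / qtheta q (v / Q ^ N)) \<longlonglongrightarrow> 0"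
proof -
  have "\<exists>K. \<forall>N. norm (1 / qtheta q (v / Q ^ N)) \<le> K * (1 / 2) ^ N"
  proof (rule geometric_bound_of_ratio)
    have "(\<lambda>N. q ^ Suc N / norm v) \<longlonglongrightarrow> 0 / norm v"
      using q_pos q_less_1 v by (intro tendsto_divide tendsto_const LIMSEQ_Suc LIMSEQ_power_zero) auto
    thus "(\<lambda>N. q ^ Suc N / norm v) \<longlonglongrightarrow> 0" by simp
    fix N
    have "qtheta q (v / Q ^ Suc N) = - (v / Q ^ Suc N) * qtheta q (v / Q ^ N)"
      using qtheta_Q_div[of "v / Q ^ N"] v by (simp add: mult_ac)
    hence "norm (1 / qtheta q (v / Q ^ Suc N)) = q ^ Suc N / norm v * norm (1 / qtheta q (v / Q ^ N))"
      using q_pos by (simp add: norm_divide norm_mult norm_power)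
    thus "norm (1 / qtheta q (v / Q ^ Suc N)) \<le> q ^ Suc N / norm v * norm (1 / qtheta q (v / Q ^ N))" by simp
  qed auto
  then obtain K where K: "\<And>N. norm (1 / qtheta q (v / Q ^ N)) \<le> K * (1 / 2) ^ N" by blast
  have "(\<lambda>N. K * (1 / 2) ^ N :: real) \<longlonglongrightarrow> 0"
    by (intro tendsto_mult_right_zero LIMSEQ_power_zero) simp
  thus ?thesis by (rule Lim_null_comparison[rotated]) (simp add: K)
qed

lemma tendsto_1_inverse_bound:
  assumes "f \<longlonglongrightarrow> (1 :: complex)" shows "\<exists>K>0. \<forall>m. norm (1 / f m) \<le> K"
proof (rule tendsto_imp_norm_bound)
  show "(\<lambda>m. 1 / f m) \<longlonglongrightarrow> 1 / 1" by (intro tendsto_divide tendsto_const assms) simp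
qed

end

section \<open>Termwise limits of the truncated sums\<close>

context q_selberg
begin

text \<open>The theta denominators of \<open>Th\<close> are distributed over the coordinates, one to
  each. In the first block a numerator of the weight is unbounded as \<open>N\<close> grows, and
  only its quotient with the matching theta function is under control.\<close>

definition trunc_term :: "complex \<Rightarrow> complex \<Rightarrow> nat \<Rightarrow> nat \<Rightarrow> int \<Rightarrow> complex" where
  "trunc_term X1 X2 i j m = wt1 (1 / X1) (1 / X2) (xi X1 X2 j) m /
    (if j \<le> n then qtheta q (X2 / X1 * t powi (1 - int j)) else qtheta q (X1 / X2 * t powi (int i - int (j - n) + 1)))"

lemma DD_Th_eq:
  assumes i: "i \<le> n"
  shows "DD (1 / X1) (1 / X2) (xi X1 X2) (labels i) \<nu> / Th X1 X2 i =
    (\<Prod>j\<in>labels i. trunc_term X1 X2 i j (\<nu> j)) * pairs (xi X1 X2) (labels i) \<nu>"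
proof -
  have "Th X1 X2 i = (\<Prod>j\<in>labels i. if j \<le> n then qtheta q (X2 / X1 * t powi (1 - int j))
      else qtheta q (X1 / X2 * t powi (int i - int (j - n) + 1)))"
    unfolding prod_labels[OF i] Th_def
    by (intro arg_cong2[of _ _ _ _ "(*)"] prod.cong) (use i in auto)
  thus ?thesis unfolding trunc_term_def prod_dividef DD_def by simp
qed

text \<open>\<open>X1 / X2\<close> grows like the inverse of \<open>q ^ N\<close>, so the numerator
  with parameter \<open>1 / X2\<close> is taken at large arguments. One half of the theta
  denominator compensates it: their quotient \<open>R\<close> is 1 for \<open>m = 0\<close> and
  tends to 0 otherwise.\<close>

lemma trunc_term_1:
  assumes g: "generic x1 x2" and j: "1 \<le> j" "j \<le> n"
  defines "X1 \<equiv> \<lambda>N. x1 * Q ^ N" and "X2 \<equiv> \<lambda>N. x2 * Q ^ (2 * N)"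
  shows "\<exists>K>0. \<forall>N m. norm (trunc_term (X1 N) (X2 N) i j (int m)) \<le> K * q ^ m"
    "(\<lambda>N. trunc_term (X1 N) (X2 N) i j (int m)) \<longlonglongrightarrow> (if m = 0 then qpoch q (Q * t ^ (j - 1)) else 0)"
proof -
  note G = genericD[OF g]
  define y where "y = x1 / x2 * t ^ (j - 1)"
  have y: "y \<noteq> 0" "qtheta q y \<noteq> 0"
  proof -
    show "y \<noteq> 0" using G by (simp add: y_def)
    have "qtheta q (x1 / x2 * t powi (int (j - 1))) \<noteq> 0" by (rule G(3)) (use j in auto)
    thus "qtheta q y \<noteq> 0" by (simp add: y_def)
  qed
  define R where "R = (\<lambda>N m. qpoch q (y * Q powi (1 - int N + int m)) / qpoch q (y * Q powi (1 - int N)))"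
  define c where "c = (\<lambda>b. b * x1 * t ^ (j - 1))"
  have eq: "trunc_term (X1 N) (X2 N) i j (int m) = Q ^ m * qpoch q (Q * t ^ (j - 1) * Q ^ m) * R N m *
      (1 / qpoch q (1 / y * Q ^ N)) * (1 / qpoch q (c b1 * Q ^ (N + m))) * (1 / qpoch q (c b2 * Q ^ (N + m)))" for N m
  proof -
    have X: "xi (X1 N) (X2 N) j = X1 N * t ^ (j - 1)" using j by (simp add: xi_def)
    have X0: "X1 N \<noteq> 0" "X2 N \<noteq> 0" using G by (auto simp: X1_def X2_def)
    have X12: "X1 N / X2 N = x1 / x2 / Q ^ N" by (simp add: X1_def X2_def mult_2 power_add)
    have a1: "Q * (1 / X1 N) * (X1 N * t ^ (j - 1) * Q powi int m) = Q * t ^ (j - 1) * Q ^ m"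
      using X0 by simp
    have "Q * (1 / X2 N) * (X1 N * t ^ (j - 1) * Q powi int m) = Q * (X1 N / X2 N) * t ^ (j - 1) * Q ^ m" by simp
    also have "\<dots> = y * (Q * Q ^ m / Q ^ N)" unfolding X12 y_def by simp
    also have "Q * Q ^ m / Q ^ N = Q powi (1 - int N + int m)"
      by (simp add: power_int_add power_int_diff)
    finally have a2: "Q * (1 / X2 N) * (X1 N * t ^ (j - 1) * Q powi int m) = y * Q powi (1 - int N + int m)" .
    have a3: "b * (X1 N * t ^ (j - 1) * Q powi int m) = c b * Q ^ (N + m)" for b
      by (simp add: c_def X1_def power_add mult_ac)
    have tj: "t powi (1 - int j) = 1 / t ^ (j - 1)"
    proof -
      have "1 - int j = - int (j - 1)" using j by simp
      thus ?thesis by (simp only: power_int_minus power_int_of_nat divide_inverse mult_1_left)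
    qed
    have "X2 N / X1 N = 1 / (X1 N / X2 N)" by simp
    hence a4: "X2 N / X1 N * t powi (1 - int j) = 1 / y * Q ^ N"
      unfolding X12 tj y_def by simp
    have "Q / (1 / y * Q ^ N) = y * Q powi (1 - int N)" by (simp add: power_int_diff)
    hence th: "qtheta q (X2 N / X1 N * t powi (1 - int j)) = qpoch q (1 / y * Q ^ N) * qpoch q (y * Q powi (1 - int N))"
      unfolding a4 qtheta_def by simp
    show ?thesis
      unfolding trunc_term_def X wt1_def phi_def a1 a2 a3[of b1] a3[of b2] th R_def using j by (simp add: mult_ac)
  qed
  obtain K1 where K1: "K1 > 0" "\<And>m. norm (qpoch q (Q * t ^ (j - 1) * Q ^ m)) \<le> K1"
    using tendsto_imp_norm_bound[OF qpoch_tendsto_1] by blast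
  obtain K2 where K2: "K2 > 0" "\<And>m (\<nu>::nat). norm (qpoch q (y * Q powi (m + int \<nu>))) \<le> K2 * norm (qpoch q (y * Q powi m))"
    using qpoch_ratio_bound[OF y] by blast
  have R: "norm (R N m) \<le> K2" for N m
    using K2(2)[of "1 - int N" m] K2(1) unfolding R_def norm_divide
    by (cases "qpoch q (y * Q powi (1 - int N)) = 0") (auto simp: divide_le_eq)
  obtain K3 where K3: "K3 > 0" "\<And>N. norm (1 / qpoch q (1 / y * Q ^ N)) \<le> K3"
    using tendsto_1_inverse_bound[OF qpoch_tendsto_1] by blast
  obtain K4 where K4: "K4 > 0" "\<And>N. norm (1 / qpoch q (c b1 * Q ^ N)) \<le> K4"
    using tendsto_1_inverse_bound[OF qpoch_tendsto_1] by blast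
  obtain K5 where K5: "K5 > 0" "\<And>N. norm (1 / qpoch q (c b2 * Q ^ N)) \<le> K5"
    using tendsto_1_inverse_bound[OF qpoch_tendsto_1] by blast
  have "norm (trunc_term (X1 N) (X2 N) i j (int m)) \<le> q ^ m * K1 * K2 * K3 * K4 * K5" for N m
    unfolding eq norm_mult[of _ "1 / qpoch q (c b2 * Q ^ (N + m))"] norm_mult[of _ "1 / qpoch q (c b1 * Q ^ (N + m))"]
      norm_mult[of _ "1 / qpoch q (1 / y * Q ^ N)"] norm_mult[of _ "R N m"] norm_mult[of "Q ^ m"]
    using K1(1) K2(1) K3(1) K4(1) q_pos
    by (intro mult_mono R K1(2) K3(2) K4(2) K5(2) norm_ge_zero mult_nonneg_nonneg) (auto simp: norm_power)
  thus "\<exists>K>0. \<forall>N m. norm (trunc_term (X1 N) (X2 N) i j (int m)) \<le> K * q ^ m"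
    using K1(1) K2(1) K3(1) K4(1) K5(1)
    by (intro exI[of _ "K1 * K2 * K3 * K4 * K5"]) (auto simp: mult_ac)
  have "(\<lambda>N. R N m) \<longlonglongrightarrow> (if m = 0 then 1 else 0)"
  proof (cases "m = 0")
    case True
    have "qpoch q (y * Q powi (1 - int N)) \<noteq> 0" for N
      using qtheta_nonzero_imp_qpoch[OF y, of "1 - int N"] by (simp add: mult.commute)
    thus ?thesis using True by (simp add: R_def)
  next
    case False
    thus ?thesis unfolding R_def using qpoch_ratio_tendsto_0[OF y, of m] by simp
  qed
  moreover have "(\<lambda>N. qpoch q (c b * Q ^ (N + m))) \<longlonglongrightarrow> 1" for b
    using qpoch_tendsto_1[of "c b * Q ^ m"] by (simp add: power_add mult_ac)
  ultimately have "(\<lambda>N. trunc_term (X1 N) (X2 N) i j (int m)) \<longlonglongrightarrow>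
     Q ^ m * qpoch q (Q * t ^ (j - 1) * Q ^ m) * (if m = 0 then 1 else 0) * (1 / 1) * (1 / 1) * (1 / 1)"
    unfolding eq by (intro tendsto_mult tendsto_divide tendsto_const qpoch_tendsto_1) auto
  thus "(\<lambda>N. trunc_term (X1 N) (X2 N) i j (int m)) \<longlonglongrightarrow> (if m = 0 then qpoch q (Q * t ^ (j - 1)) else 0)"
    by (cases "m = 0") auto
qed

text \<open>Here the numerators stay bounded because \<open>X2 / X1\<close> tends to 0, whereas the
  theta denominator at \<open>v / Q ^ N\<close> grows without bound. This asymmetry between the
  blocks is the purpose of the exponent \<open>2 * N\<close> in \<open>X2\<close>.\<close>

lemma trunc_term_2:
  assumes g: "generic x1 x2" and j: "n < j"
  defines "X1 \<equiv> \<lambda>N. x1 * Q ^ N" and "X2 \<equiv> \<lambda>N. x2 * Q ^ (2 * N)"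
  shows "\<exists>K>0. \<forall>N m. norm (trunc_term (X1 N) (X2 N) i j (int m)) \<le> K * q ^ m"
    "(\<lambda>N. trunc_term (X1 N) (X2 N) i j (int m)) \<longlonglongrightarrow> 0"
proof -
  note G = genericD[OF g]
  define s where "s = t ^ (j - n - 1)"
  define v where "v = x1 / x2 * t powi (int i - int (j - n) + 1)"
  have v: "v \<noteq> 0" using G by (simp add: v_def)
  define c where "c = (\<lambda>b. b * x2 * s)"
  have eq: "trunc_term (X1 N) (X2 N) i j (int m) = Q ^ m * qpoch q (Q * x2 / x1 * s * Q ^ (N + m)) * qpoch q (Q * s * Q ^ m) *
      (1 / qtheta q (v / Q ^ N)) * (1 / qpoch q (c b1 * Q ^ (2 * N + m))) * (1 / qpoch q (c b2 * Q ^ (2 * N + m)))" for N m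
  proof -
    have X: "xi (X1 N) (X2 N) j = X2 N * s" using j by (simp add: xi_def s_def)
    have X0: "X1 N \<noteq> 0" "X2 N \<noteq> 0" using G by (auto simp: X1_def X2_def)
    have X21: "X2 N / X1 N = x2 / x1 * Q ^ N" by (simp add: X1_def X2_def mult_2 power_add)
    have X12: "X1 N / X2 N = x1 / x2 / Q ^ N" by (simp add: X1_def X2_def mult_2 power_add)
    have a1: "Q * (1 / X2 N) * (X2 N * s * Q powi int m) = Q * s * Q ^ m"
      using X0 by simp
    have "Q * (1 / X1 N) * (X2 N * s * Q powi int m) = Q * (X2 N / X1 N) * s * Q ^ m" by simp
    also have "\<dots> = Q * x2 / x1 * s * Q ^ (N + m)" unfolding X21 by (simp add: power_add)
    finally have a2: "Q * (1 / X1 N) * (X2 N * s * Q powi int m) = Q * x2 / x1 * s * Q ^ (N + m)" .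
    have a3: "b * (X2 N * s * Q powi int m) = c b * Q ^ (2 * N + m)" for b
      by (simp add: c_def X2_def power_add mult_ac)
    have a4: "X1 N / X2 N * t powi (int i - int (j - n) + 1) = v / Q ^ N"
      unfolding X12 v_def by simp
    show ?thesis
      unfolding trunc_term_def X wt1_def phi_def a1 a2 a3[of b1] a3[of b2] a4 using j by (simp add: mult_ac)
  qed
  obtain K1 where K1: "K1 > 0" "\<And>m. norm (qpoch q (Q * x2 / x1 * s * Q ^ m)) \<le> K1"
    using tendsto_imp_norm_bound[OF qpoch_tendsto_1] by blast
  obtain K2 where K2: "K2 > 0" "\<And>m. norm (qpoch q (Q * s * Q ^ m)) \<le> K2"
    using tendsto_imp_norm_bound[OF qpoch_tendsto_1] by blast
  obtain K3 where K3: "K3 > 0" "\<And>N. norm (1 / qtheta q (v / Q ^ N)) \<le> K3"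
    using tendsto_imp_norm_bound[OF inverse_qtheta_tendsto_0[OF v]] by blast
  obtain K4 where K4: "K4 > 0" "\<And>N. norm (1 / qpoch q (c b1 * Q ^ N)) \<le> K4"
    using tendsto_1_inverse_bound[OF qpoch_tendsto_1] by blast
  obtain K5 where K5: "K5 > 0" "\<And>N. norm (1 / qpoch q (c b2 * Q ^ N)) \<le> K5"
    using tendsto_1_inverse_bound[OF qpoch_tendsto_1] by blast
  have bd: "norm (trunc_term (X1 N) (X2 N) i j (int m)) \<le> q ^ m * K1 * K2 * norm (1 / qtheta q (v / Q ^ N)) * K4 * K5" for N m
    unfolding eq norm_mult[of _ "1 / qpoch q (c b2 * Q ^ (2 * N + m))"] norm_mult[of _ "1 / qpoch q (c b1 * Q ^ (2 * N + m))"]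
      norm_mult[of _ "1 / qtheta q (v / Q ^ N)"] norm_mult[of _ "qpoch q (Q * s * Q ^ m)"] norm_mult[of "Q ^ m"]
    using K1(1) K2(1) K4(1) q_pos
    by (intro mult_mono K1(2) K2(2) K4(2) K5(2) norm_ge_zero mult_nonneg_nonneg) (auto simp: norm_power)
  also have "q ^ m * K1 * K2 * norm (1 / qtheta q (v / Q ^ N)) * K4 * K5 \<le> q ^ m * K1 * K2 * K3 * K4 * K5" for N m
    using K1(1) K2(1) K4(1) K5(1) q_pos by (intro mult_right_mono mult_left_mono K3(2)) auto
  finally have "norm (trunc_term (X1 N) (X2 N) i j (int m)) \<le> q ^ m * K1 * K2 * K3 * K4 * K5" for N m .
  thus "\<exists>K>0. \<forall>N m. norm (trunc_term (X1 N) (X2 N) i j (int m)) \<le> K * q ^ m"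
    using K1(1) K2(1) K3(1) K4(1) K5(1)
    by (intro exI[of _ "K1 * K2 * K3 * K4 * K5"]) (auto simp: mult_ac)
  have "(\<lambda>N. q ^ m * K1 * K2 * norm (1 / qtheta q (v / Q ^ N)) * K4 * K5) \<longlonglongrightarrow> q ^ m * K1 * K2 * norm (0 :: complex) * K4 * K5"
    by (intro tendsto_mult tendsto_const tendsto_norm inverse_qtheta_tendsto_0 v)
  hence "(\<lambda>N. q ^ m * K1 * K2 * norm (1 / qtheta q (v / Q ^ N)) * K4 * K5) \<longlonglongrightarrow> 0" by simp
  thus "(\<lambda>N. trunc_term (X1 N) (X2 N) i j (int m)) \<longlonglongrightarrow> 0"
    by (rule Lim_null_comparison[OF always_eventually[OF allI[OF bd]]])
qed

lemma trunc_term_bound: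
  assumes g: "generic x1 x2" and i: "i \<le> n"
  shows "\<exists>K>0. \<forall>j\<in>labels i. \<forall>N m. norm (trunc_term (x1 * Q ^ N) (x2 * Q ^ (2 * N)) i j (int m)) \<le> K * q ^ m"
proof -
  have "\<exists>K>0. \<forall>N m. norm (trunc_term (x1 * Q ^ N) (x2 * Q ^ (2 * N)) i j (int m)) \<le> K * q ^ m" if "j \<in> labels i" for j
    using trunc_term_1(1)[OF g, of j i] trunc_term_2(1)[OF g, of j i] that by (cases "j \<le> n") (auto simp: labels_def)
  then obtain K where K: "\<And>j. j \<in> labels i \<Longrightarrow> K j > 0"
    "\<And>j N m. j \<in> labels i \<Longrightarrow> norm (trunc_term (x1 * Q ^ N) (x2 * Q ^ (2 * N)) i j (int m)) \<le> K j * q ^ m"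
    by metis
  have fin: "finite (labels i)" by (simp add: labels_def)
  define K0 where "K0 = 1 + (\<Sum>j\<in>labels i. K j)"
  have le: "K j \<le> K0" if "j \<in> labels i" for j
  proof -
    have "K j \<le> (\<Sum>j\<in>labels i. K j)"
      by (rule member_le_sum) (use that K(1) fin in \<open>auto intro: less_imp_le\<close>)
    thus ?thesis by (simp add: K0_def)
  qed
  have "norm (trunc_term (x1 * Q ^ N) (x2 * Q ^ (2 * N)) i j (int m)) \<le> K0 * q ^ m" if "j \<in> labels i" for j N m
    by (rule order.trans[OF K(2)[OF that] mult_right_mono[OF le[OF that]]]) (use q_pos in simp)
  moreover have "K0 > 0" unfolding K0_def using K(1) by (intro add_pos_nonneg sum_nonneg) (auto intro: less_imp_le)
  ultimately show ?thesis by blast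
qed

text \<open>The second block, whose labels come later, is shifted further than the first, so moving
  the base points only raises the exponent \<open>y\<close> of the later label relative to the
  earlier one. As \<open>y\<close> is nonnegative it may be given weight 1, and the bound does not
  depend on \<open>N\<close>.\<close>

lemma pairs_trunc_bound:
  assumes g: "generic x1 x2" and i: "i \<le> n"
  shows "\<exists>C>0. \<forall>N. \<forall>\<nu>\<in>ch (labels i). (\<forall>j\<in>labels i. 0 \<le> \<nu> j) \<longrightarrow>
    norm (pairs (xi (x1 * Q ^ N) (x2 * Q ^ (2 * N))) (labels i) \<nu>) \<le> C * (\<Prod>j\<in>labels i. gw (\<nu> j) ^ (n - 1))"
proof -
  interpret q_config q t b1 b2 n "xi x1 x2" "labels i" by (rule generic_config[OF g i])
  define I where "I = labels i"
  define \<xi> where "\<xi> = xi x1 x2"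
  have "\<exists>K>0. \<forall>x y. ((j \<le> n \<longleftrightarrow> k \<le> n) \<longrightarrow> x \<le> y) \<longrightarrow>
      norm (t powi (2 * x) * pair_fun t (\<xi> k / \<xi> j * Q powi (y - x))) \<le> K * norm t powi (2 * min x y)"
    if "j \<in> I" "k \<in> I" "j < k" for j k
    by (rule pair_lattice_bound) (use \<xi>_nonzero cross_block that in \<open>auto simp: I_def \<xi>_def\<close>)
  then obtain K where K: "\<And>j k. j \<in> I \<Longrightarrow> k \<in> I \<Longrightarrow> j < k \<Longrightarrow> K j k > 0"
    "\<And>j k x y. j \<in> I \<Longrightarrow> k \<in> I \<Longrightarrow> j < k \<Longrightarrow> ((j \<le> n \<longleftrightarrow> k \<le> n) \<longrightarrow> x \<le> y) \<Longrightarrow>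
      norm (t powi (2 * x) * pair_fun t (\<xi> k / \<xi> j * Q powi (y - x))) \<le> K j k * norm t powi (2 * min x y)"
    by metis
  define C where "C = (\<Prod>j\<in>I. \<Prod>k\<in>{k\<in>I. j < k}. K j k)"
  have "norm (pairs (xi (x1 * Q ^ N) (x2 * Q ^ (2 * N))) I \<nu>) \<le> C * (\<Prod>j\<in>I. gw (\<nu> j) ^ (n - 1))"
    if \<nu>: "\<nu> \<in> ch I" "\<forall>j\<in>I. 0 \<le> \<nu> j" for N \<nu>
  proof -
    define s where "s = block_shift (int N) (int (2 * N))"
    have X: "xi (x1 * Q ^ N) (x2 * Q ^ (2 * N)) l = \<xi> l * Q powi s l" for l
      using xi_block_shift[of x1 "int N" x2 "int (2 * N)" l] unfolding s_def \<xi>_def power_int_of_nat .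
    have "norm (vv (xi (x1 * Q ^ N) (x2 * Q ^ (2 * N))) \<nu> j k) \<le> K j k * (gw (\<nu> j) * gw (\<nu> k))"
      if jk: "j \<in> I" "k \<in> I" "j < k" for j k
    proof -
      define y where "y = \<nu> k + s k - s j"
      have s: "s j \<le> s k" using jk by (auto simp: s_def block_shift_def)
      have y: "\<nu> k \<le> y" using s by (simp add: y_def)
      have e: "\<xi> k * Q powi s k / (\<xi> j * Q powi s j) * Q powi (\<nu> k - \<nu> j) = \<xi> k / \<xi> j * Q powi (y - \<nu> j)"
      proof -
        have "Q powi s k / Q powi s j * Q powi (\<nu> k - \<nu> j) = Q powi (y - \<nu> j)"
          unfolding y_def by (subst power_int_diff[symmetric], simp, subst power_int_add[symmetric]) (simp_all add: algebra_simps)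
        moreover have "\<xi> k * Q powi s k / (\<xi> j * Q powi s j) * Q powi (\<nu> k - \<nu> j) =
          \<xi> k / \<xi> j * (Q powi s k / Q powi s j * Q powi (\<nu> k - \<nu> j))" by simp
        ultimately show ?thesis by simp
      qed
      have "norm (vv (xi (x1 * Q ^ N) (x2 * Q ^ (2 * N))) \<nu> j k) =
          norm (t powi (2 * \<nu> j) * pair_fun t (\<xi> k / \<xi> j * Q powi (y - \<nu> j)))"
        unfolding vv_def X e ..
      also have "\<dots> \<le> K j k * norm t powi (2 * min (\<nu> j) y)"
        using chD[OF \<nu>(1) jk] y by (intro K(2) jk) auto
      also have "\<dots> \<le> K j k * (gw (\<nu> j) * 1)"
        using K(1)[OF jk] \<nu>(2) jk y by (intro mult_left_mono gw_min_le) (auto intro: less_imp_le order.trans)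
      also have "\<dots> \<le> K j k * (gw (\<nu> j) * gw (\<nu> k))"
        using K(1)[OF jk] gw_ge_1[of "\<nu> j"] gw_ge_1[of "\<nu> k"] by (intro mult_left_mono) auto
      finally show ?thesis .
    qed
    hence "norm (pairs (xi (x1 * Q ^ N) (x2 * Q ^ (2 * N))) I \<nu>) \<le> (\<Prod>j\<in>I. \<Prod>k\<in>{k\<in>I. j < k}. K j k * (gw (\<nu> j) * gw (\<nu> k)))"
      unfolding pairs_def prod_norm[symmetric] by (intro prod_mono conjI prod_nonneg) auto
    also have "\<dots> = C * (\<Prod>j\<in>I. \<Prod>k\<in>{k\<in>I. j < k}. gw (\<nu> j) * gw (\<nu> k))"
      by (simp only: prod.distrib C_def)
    also have "(\<Prod>j\<in>I. \<Prod>k\<in>{k\<in>I. j < k}. gw (\<nu> j) * gw (\<nu> k)) = (\<Prod>j\<in>I. gw (\<nu> j) ^ (n - 1))"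
      using prod_pairs_weights[of I "\<lambda>j. gw (\<nu> j)"] card_I by (simp add: I_def)
    finally show ?thesis .
  qed
  moreover have "C > 0" unfolding C_def using K(1) by (intro prod_pos) auto
  ultimately show ?thesis unfolding I_def by blast
qed

section \<open>The surviving term\<close>

definition Lconst :: complex where
  "Lconst = (\<Prod>k\<in>{1..n}. qpoch q Q * qpoch q t / qpoch q (t ^ k))"

lemma qpoch_Q_t_nonzero: "d < n \<Longrightarrow> qpoch q (Q * t ^ d) \<noteq> 0"
proof (cases "d = 0")
  case True
  have "Q ^ i * Q \<noteq> 1" for i
  proof
    assume "Q ^ i * Q = 1"
    hence "norm (Q ^ Suc i) = 1" by (simp add: mult.commute)
    moreover have "norm (Q ^ Suc i) = q ^ Suc i" unfolding norm_power using q_pos by simp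
    moreover have "q ^ Suc i < 1" by (rule power_Suc_less_one[OF q_pos q_less_1])
    ultimately show False by linarith
  qed
  thus ?thesis using True qpoch_eq_0_iff[of Q] by simp
next
  case False
  assume "d < n"
  hence "qpoch q (t ^ d) \<noteq> 0" using False by (intro qpoch_t) auto
  thus ?thesis using qpoch_shift_nonzero[of "t ^ d" 1] by simp
qed

text \<open>Writing \<open>1 - t ^ d\<close> as \<open>qpoch q (t ^ d) / qpoch q (Q * t ^ d)\<close>
  turns the pair factors at consecutive powers of \<open>t\<close> into quotients that cancel
  successively.\<close>

lemma prod_pair_fun_telescope:
  "M < n \<Longrightarrow> (\<Prod>d\<in>{1..M}. pair_fun t (t ^ d)) = qpoch q t * qpoch q Q / (qpoch q (t ^ Suc M) * qpoch q (Q * t ^ M))"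
proof (induction M)
  case 0
  show ?case using qpoch_t[of 1] qpoch_Q_t_nonzero[of 0] n_pos by simp
next
  case (Suc M)
  have nz: "qpoch q (t ^ Suc M) \<noteq> 0" "qpoch q (t ^ Suc (Suc M)) \<noteq> 0" "qpoch q (Q * t ^ M) \<noteq> 0" "qpoch q (Q * t ^ Suc M) \<noteq> 0"
    using Suc.prems by (intro qpoch_t qpoch_Q_t_nonzero; simp)+
  have 1: "1 - t ^ Suc M = qpoch q (t ^ Suc M) / qpoch q (Q * t ^ Suc M)"
    using qpoch_rec[of "t ^ Suc M"] nz by (simp add: field_simps)
  have 2: "pair_fun t (t ^ Suc M) = (1 - t ^ Suc M) * qpoch q (Q * t ^ M) / qpoch q (t ^ Suc (Suc M))"
    by (simp add: pair_fun_def)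
  have "(\<Prod>d\<in>{1..Suc M}. pair_fun t (t ^ d)) = (\<Prod>d\<in>{1..M}. pair_fun t (t ^ d)) * pair_fun t (t ^ Suc M)"
    by (simp add: mult.commute)
  also have "\<dots> = qpoch q t * qpoch q Q / (qpoch q (t ^ Suc M) * qpoch q (Q * t ^ M)) *
      (qpoch q (t ^ Suc M) / qpoch q (Q * t ^ Suc M) * qpoch q (Q * t ^ M) / qpoch q (t ^ Suc (Suc M)))"
    unfolding 2 1 using Suc by simp
  also have "\<dots> = qpoch q t * qpoch q Q / (qpoch q (t ^ Suc (Suc M)) * qpoch q (Q * t ^ Suc M))"
    using nz by (simp del: power_Suc)
  finally show ?case .
qed

text \<open>The left-hand side is the limit of the only surviving term, with all coordinates in the
  first block and all exponents 0; the right-hand side is the form in which it enters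
  \<open>C0\<close>.\<close>

lemma Lconst_eq:
  "(\<Prod>j\<in>{1..n}. qpoch q (Q * t ^ (j - 1))) *
     (\<Prod>j\<in>{1..n}. \<Prod>k\<in>{k\<in>{1..n}. j < k}. pair_fun t (t ^ (k - j))) = Lconst"
proof -
  define f where "f = (\<lambda>M. qpoch q t * qpoch q Q / (qpoch q (t ^ Suc M) * qpoch q (Q * t ^ M)))"
  have "(\<Prod>k\<in>{k\<in>{1..n}. j < k}. pair_fun t (t ^ (k - j))) = f (n - j)" if j: "j \<in> {1..n}" for j
  proof -
    have "(\<Prod>k\<in>{k\<in>{1..n}. j < k}. pair_fun t (t ^ (k - j))) = (\<Prod>d\<in>{1..n-j}. pair_fun t (t ^ d))"
      by (rule prod.reindex_bij_witness[of _ "\<lambda>d. d + j" "\<lambda>k. k - j"]) (use j in auto)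
    also have "\<dots> = f (n - j)" unfolding f_def using j by (intro prod_pair_fun_telescope) auto
    finally show ?thesis .
  qed
  hence "(\<Prod>j\<in>{1..n}. \<Prod>k\<in>{k\<in>{1..n}. j < k}. pair_fun t (t ^ (k - j))) = (\<Prod>j\<in>{1..n}. f (n - j))"
    by (intro prod.cong) auto
  also have "\<dots> = (\<Prod>m<n. f m)"
    by (rule prod.reindex_bij_witness[of _ "\<lambda>m. n - m" "\<lambda>j. n - j"]) auto
  finally have 1: "(\<Prod>j\<in>{1..n}. \<Prod>k\<in>{k\<in>{1..n}. j < k}. pair_fun t (t ^ (k - j))) = (\<Prod>m<n. f m)" .
  have 2: "(\<Prod>j\<in>{1..n}. qpoch q (Q * t ^ (j - 1))) = (\<Prod>m<n. qpoch q (Q * t ^ m))"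
    by (rule prod.reindex_bij_witness[of _ Suc "\<lambda>j. j - 1"]) auto
  have "Lconst = (\<Prod>m<n. qpoch q Q * qpoch q t / qpoch q (t ^ Suc m))"
    unfolding Lconst_def by (rule prod.reindex_bij_witness[of _ Suc "\<lambda>j. j - 1"]) auto
  also have "\<dots> = (\<Prod>m<n. qpoch q (Q * t ^ m) * f m)"
    by (intro prod.cong refl) (use qpoch_Q_t_nonzero in \<open>auto simp: f_def simp del: power_Suc\<close>)
  finally show ?thesis unfolding 1 2 prod.distrib ..
qed

text \<open>Negative exponents are excluded by the truncation, any coordinate in the second block
  makes the term tend to 0, and so does a positive exponent in the first block. This leaves
  \<open>i = n\<close> and \<open>\<nu>0\<close>. The common majorant is geometric with ratio
  \<open>q * tmax\<close>.\<close>

lemma FF_trunc_tendsto: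
  assumes g: "generic x1 x2"
  defines "X1 \<equiv> \<lambda>N. x1 * Q ^ N" and "X2 \<equiv> \<lambda>N. x2 * Q ^ (2 * N)"
  shows "(\<lambda>N. FF (X1 N) (X2 N) (1 / X1 N) (1 / X2 N)) \<longlonglongrightarrow> Lconst"
proof -
  note G = genericD[OF g]
  define f where "f = (\<lambda>i N \<nu>. DD (1 / X1 N) (1 / X2 N) (xi (X1 N) (X2 N)) (labels i) \<nu> / Th (X1 N) (X2 N) i)"
  define \<nu>0 :: "nat \<Rightarrow> int" where "\<nu>0 = (\<lambda>j\<in>labels n. 0)"
  define gl where "gl = (\<lambda>i \<nu>. if i = n \<and> \<nu> = \<nu>0 then Lconst else 0)"
  have labn: "labels n = {1..n}" by (auto simp: labels_def)
  have lim: "(\<lambda>N. infsum (f i N) (ch (labels i))) \<longlonglongrightarrow> infsum (gl i) (ch (labels i))" if i: "i \<le> n" for i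
  proof -
    have fin: "finite (labels i)" by (simp add: labels_def)
    have cardl: "card (labels i) = n" by (rule q_config.card_I[OF generic_config[OF g i]])
    obtain K where K: "K > 0" "\<And>j N m. j \<in> labels i \<Longrightarrow> norm (trunc_term (X1 N) (X2 N) i j (int m)) \<le> K * q ^ m"
      using trunc_term_bound[OF g i] unfolding X1_def X2_def by blast
    obtain C where C: "C > 0" "\<And>N \<nu>. \<nu> \<in> ch (labels i) \<Longrightarrow> (\<forall>j\<in>labels i. 0 \<le> \<nu> j) \<Longrightarrow>
      norm (pairs (xi (X1 N) (X2 N)) (labels i) \<nu>) \<le> C * (\<Prod>j\<in>labels i. gw (\<nu> j) ^ (n - 1))"
      using pairs_trunc_bound[OF g i] unfolding X1_def X2_def by blast
    have f_eq: "f i N \<nu> = (\<Prod>j\<in>labels i. trunc_term (X1 N) (X2 N) i j (\<nu> j)) * pairs (xi (X1 N) (X2 N)) (labels i) \<nu>" for N \<nu>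
      unfolding f_def by (rule DD_Th_eq[OF i])
    have neg: "f i N \<nu> = 0" if \<nu>: "\<nu> \<in> ch (labels i)" "\<not> (\<forall>j\<in>labels i. 0 \<le> \<nu> j)" for N \<nu>
    proof (rule ccontr)
      assume "f i N \<nu> \<noteq> 0"
      hence "DD (Q powi 0 / X1 N) (Q powi 0 / X2 N) (xi (X1 N) (X2 N)) (labels i) \<nu> \<noteq> 0"
        by (auto simp: f_def)
      from DD_truncated[OF i \<nu>(1) _ _ this] have "\<nu> j \<ge> 0" if "j \<in> labels i" for j
        using that G(1,2) by (fastforce simp: X1_def X2_def)
      thus False using \<nu>(2) by blast
    qed
    have tb: "norm (trunc_term (X1 N) (X2 N) i j (\<nu> j)) \<le> K * q ^ nat (\<nu> j)"
      if "\<forall>j\<in>labels i. 0 \<le> \<nu> j" "j \<in> labels i" for N j and \<nu> :: "nat \<Rightarrow> int"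
      using K(2)[OF that(2), of N "nat (\<nu> j)"] that by simp
    show ?thesis
    proof (rule infsum_dominated_tendsto)
      show "(\<lambda>\<nu>. K ^ n * C * (\<Prod>j\<in>labels i. (q * tmax) ^ nat \<bar>\<nu> j\<bar>)) summable_on ch (labels i)"
        by (rule summable_on_subset_banach[OF _ ch_subset], intro summable_on_cmult_right summable_on_prod_int_geometric)
          (use fin q_pos tmax_ge_1 q_tmax in auto)
      fix \<nu> assume \<nu>: "\<nu> \<in> ch (labels i)"
      show "norm (f i N \<nu>) \<le> K ^ n * C * (\<Prod>j\<in>labels i. (q * tmax) ^ nat \<bar>\<nu> j\<bar>)" for N
      proof (cases "\<forall>j\<in>labels i. 0 \<le> \<nu> j")
        case True
        have "norm (f i N \<nu>) = (\<Prod>j\<in>labels i. norm (trunc_term (X1 N) (X2 N) i j (\<nu> j))) * norm (pairs (xi (X1 N) (X2 N)) (labels i) \<nu>)"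
          by (simp add: f_eq norm_mult prod_norm)
        also have "\<dots> \<le> (\<Prod>j\<in>labels i. K * q ^ nat (\<nu> j)) * (C * (\<Prod>j\<in>labels i. gw (\<nu> j) ^ (n - 1)))"
          using tb[OF True] K(1) q_pos by (intro mult_mono prod_mono C(2) \<nu> True conjI norm_ge_zero prod_nonneg) auto
        also have "(\<Prod>j\<in>labels i. gw (\<nu> j) ^ (n - 1)) = (\<Prod>j\<in>labels i. tmax ^ nat (\<nu> j))"
          by (intro prod.cong refl) (use True gw_pow_nonneg[of "nat (\<nu> _)"] in \<open>metis int_nat_eq\<close>)
        also have "(\<Prod>j\<in>labels i. K * q ^ nat (\<nu> j)) * (C * (\<Prod>j\<in>labels i. tmax ^ nat (\<nu> j))) =
            K ^ n * C * (\<Prod>j\<in>labels i. (q * tmax) ^ nat (\<nu> j))"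
          by (simp add: prod.distrib power_mult_distrib cardl mult_ac)
        also have "(\<Prod>j\<in>labels i. (q * tmax) ^ nat (\<nu> j)) = (\<Prod>j\<in>labels i. (q * tmax) ^ nat \<bar>\<nu> j\<bar>)"
          using True by (intro prod.cong) auto
        finally show ?thesis .
      next
        case False
        thus ?thesis using neg[OF \<nu> False] K(1) C(1) q_pos tmax_ge_1
          by (auto intro!: mult_nonneg_nonneg prod_nonneg)
      qed
      show "(\<lambda>N. f i N \<nu>) \<longlonglongrightarrow> gl i \<nu>"
      proof (cases "\<forall>j\<in>labels i. 0 \<le> \<nu> j")
        case False
        hence "\<nu> \<noteq> \<nu>0 \<or> i \<noteq> n" by (auto simp: \<nu>0_def)
        thus ?thesis using neg[OF \<nu> False] by (auto simp: gl_def)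
      next
        case True
        show ?thesis
        proof (cases "i = n")
          case False
          hence k: "n + 1 \<in> labels i" using i by (auto simp: labels_def)
          define B where "B = (\<Prod>j\<in>labels i-{n+1}. K * q ^ nat (\<nu> j)) * (C * (\<Prod>j\<in>labels i. gw (\<nu> j) ^ (n - 1)))"
          have "norm (f i N \<nu>) \<le> norm (trunc_term (X1 N) (X2 N) i (n + 1) (\<nu> (n + 1))) * B" for N
          proof -
            have "norm (f i N \<nu>) = norm (trunc_term (X1 N) (X2 N) i (n + 1) (\<nu> (n + 1))) *
                ((\<Prod>j\<in>labels i-{n+1}. norm (trunc_term (X1 N) (X2 N) i j (\<nu> j))) * norm (pairs (xi (X1 N) (X2 N)) (labels i) \<nu>))"
              unfolding f_eq norm_mult prod_norm[symmetric] prod.remove[OF fin k] by (simp only: mult.assoc)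
            also have "\<dots> \<le> norm (trunc_term (X1 N) (X2 N) i (n + 1) (\<nu> (n + 1))) * B"
              unfolding B_def using tb[OF True] K(1) q_pos
              by (intro mult_left_mono mult_mono prod_mono C(2) \<nu> True conjI norm_ge_zero prod_nonneg) auto
            finally show ?thesis .
          qed
          moreover have "(\<lambda>N. norm (trunc_term (X1 N) (X2 N) i (n + 1) (\<nu> (n + 1))) * B) \<longlonglongrightarrow> 0"
          proof -
            have "0 \<le> \<nu> (n + 1)" using True k by blast
            hence "(\<lambda>N. trunc_term (X1 N) (X2 N) i (n + 1) (\<nu> (n + 1))) \<longlonglongrightarrow> 0"
              using trunc_term_2(2)[OF g, of "n + 1" i "nat (\<nu> (n + 1))"] by (simp add: X1_def X2_def)
            hence "(\<lambda>N. norm (trunc_term (X1 N) (X2 N) i (n + 1) (\<nu> (n + 1)))) \<longlonglongrightarrow> 0"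
              by (rule tendsto_norm_zero)
            thus ?thesis by (rule tendsto_mult_left_zero)
          qed
          ultimately have "(\<lambda>N. f i N \<nu>) \<longlonglongrightarrow> 0"
            by (rule Lim_null_comparison[OF always_eventually[OF allI]])
          thus ?thesis using False by (simp add: gl_def)
        next
          case in': True
          have pX: "pairs (xi (X1 N) (X2 N)) (labels i) \<nu> = pairs (xi x1 x2) (labels i) \<nu>" for N
          proof -
            have "xi (X1 N) (X2 N) k / xi (X1 N) (X2 N) j = xi x1 x2 k / xi x1 x2 j" if "j \<in> labels n" "k \<in> labels n" for j k
              using that G by (simp add: labn xi_def X1_def)
            thus ?thesis unfolding pairs_def vv_def in' by (intro prod.cong refl) auto
          qed
          define c where "c = (\<lambda>j. if nat (\<nu> j) = 0 then qpoch q (Q * t ^ (j - 1)) else 0)"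
          have "(\<lambda>N. f i N \<nu>) \<longlonglongrightarrow> (\<Prod>j\<in>labels i. c j) * pairs (xi x1 x2) (labels i) \<nu>"
            unfolding f_eq pX
          proof (intro tendsto_mult tendsto_prod tendsto_const)
            fix j assume j: "j \<in> labels i"
            hence jn: "1 \<le> j" "j \<le> n" using in' by (auto simp: labn)
            have "int (nat (\<nu> j)) = \<nu> j" using True j by auto
            moreover have "(\<lambda>N. trunc_term (X1 N) (X2 N) i j (int (nat (\<nu> j)))) \<longlonglongrightarrow> c j"
              unfolding c_def X1_def X2_def by (rule trunc_term_1(2)[OF g jn])
            ultimately show "(\<lambda>N. trunc_term (X1 N) (X2 N) i j (\<nu> j)) \<longlonglongrightarrow> c j" by (simp only:)
          qed
          moreover have "(\<Prod>j\<in>labels i. c j) * pairs (xi x1 x2) (labels i) \<nu> = gl i \<nu>"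
          proof (cases "\<nu> = \<nu>0")
            case True
            have "(\<Prod>j\<in>labels i. c j) = (\<Prod>j\<in>{1..n}. qpoch q (Q * t ^ (j - 1)))"
              unfolding in' labn by (intro prod.cong) (auto simp: c_def True \<nu>0_def labn)
            moreover have "pairs (xi x1 x2) (labels i) \<nu> = (\<Prod>j\<in>{1..n}. \<Prod>k\<in>{k\<in>{1..n}. j < k}. pair_fun t (t ^ (k - j)))"
              unfolding pairs_def in' labn
            proof (intro prod.cong refl)
              fix j k assume jk: "j \<in> {1..n}" "k \<in> {k \<in> {1..n}. j < k}"
              have "xi x1 x2 k / xi x1 x2 j = t ^ (k - j)"
                using q_config.same_block[OF generic_config[OF g order.refl], of j k]
                  q_config.\<xi>_nonzero[OF generic_config[OF g order.refl], of j] jk by (auto simp: labn)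
              thus "vv (xi x1 x2) \<nu> j k = pair_fun t (t ^ (k - j))"
                using jk by (simp add: vv_def True \<nu>0_def labn)
            qed
            ultimately show ?thesis using Lconst_eq True in' by (simp add: gl_def)
          next
            case False
            have "\<exists>j\<in>labels i. \<nu> j \<noteq> 0"
            proof (rule ccontr)
              assume z: "\<not> (\<exists>j\<in>labels i. \<nu> j \<noteq> 0)"
              have "\<nu> = \<nu>0"
                by (rule extensionalityI[of _ "labels n"]) (use \<nu> z in' in \<open>auto simp: ch_def PiE_def \<nu>0_def\<close>)
              thus False using False by blast
            qed
            then obtain j where j: "j \<in> labels i" "\<nu> j \<noteq> 0" by blast
            hence "c j = 0" using True by (auto simp: c_def)
            hence "(\<Prod>j\<in>labels i. c j) = 0" using j fin by (intro prod_zero) auto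
            thus ?thesis using False by (simp add: gl_def)
          qed
          ultimately show ?thesis by simp
        qed
      qed
    qed
  qed
  have val: "infsum (gl i) (ch (labels i)) = (if i = n then Lconst else 0)" if "i \<le> n" for i
  proof (cases "i = n")
    case True
    have "\<nu>0 \<in> ch (labels n)" by (auto simp: ch_def \<nu>0_def)
    hence "infsum (gl i) (ch (labels i)) = infsum (gl i) {\<nu>0}"
      using True by (intro infsum_cong_neutral) (auto simp: gl_def)
    thus ?thesis using True by (simp add: gl_def)
  qed (simp add: gl_def)
  have "FF (X1 N) (X2 N) (1 / X1 N) (1 / X2 N) = (\<Sum>i\<le>n. infsum (f i N) (ch (labels i)))" for N
    unfolding FF_def f_def divide_inverse by (simp only: infsum_cmult_left')
  moreover have "(\<lambda>N. \<Sum>i\<le>n. infsum (f i N) (ch (labels i))) \<longlonglongrightarrow> (\<Sum>i\<le>n. infsum (gl i) (ch (labels i)))"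
    by (intro tendsto_sum lim) simp
  moreover have "(\<Sum>i\<le>n. infsum (gl i) (ch (labels i))) = (\<Sum>i\<le>n. if i = n then Lconst else 0)"
    by (intro sum.cong refl val) simp
  ultimately show ?thesis by simp
qed

lemma qpoch_tendsto_1_mult: "k > 0 \<Longrightarrow> (\<lambda>N. qpoch q (c * Q ^ (k * N))) \<longlonglongrightarrow> 1"
  by (rule filterlim_compose[OF qpoch_tendsto_1[of c] filterlim_subseq]) (auto simp: strict_mono_def)

theorem side_eq:
  assumes g: "generic x1 x2"
  shows "side_l x1 x2 = Lconst * side_r x1 x2"
proof (rule LIMSEQ_unique)
  define X1 where "X1 = (\<lambda>N. x1 * Q ^ N)"
  define X2 where "X2 = (\<lambda>N. x2 * Q ^ (2 * N))"
  define u where "u = (\<lambda>N. \<Prod>s<n. qpoch q (X1 N * X2 N * b1 * b2 * t ^ (n + s - 1)))"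
  define a where "a = (\<lambda>N. \<Prod>s<n. qpoch q (X1 N * b1 * t ^ s) * qpoch q (X1 N * b2 * t ^ s) *
       (qpoch q (X2 N * b1 * t ^ s) * qpoch q (X2 N * b2 * t ^ s)))"
  have l1: "(\<lambda>N. qpoch q (X1 N * b * c)) \<longlonglongrightarrow> 1" for b c
    using qpoch_tendsto_1[of "x1 * b * c"] by (simp add: X1_def mult_ac)
  have l2: "(\<lambda>N. qpoch q (X2 N * b * c)) \<longlonglongrightarrow> 1" for b c
    using qpoch_tendsto_1_mult[of 2 "x2 * b * c"] by (simp add: X2_def mult_ac)
  have l3: "(\<lambda>N. qpoch q (X1 N * X2 N * b1 * b2 * c)) \<longlonglongrightarrow> 1" for c
  proof -
    have e: "X1 N * X2 N * b1 * b2 * c = (x1 * x2 * b1 * b2 * c) * Q ^ (3 * N)" for N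
    proof -
      have "3 * N = N + 2 * N" by simp
      hence "Q ^ (3 * N) = Q ^ N * Q ^ (2 * N)" by (simp only: power_add)
      thus ?thesis by (simp add: X1_def X2_def mult_ac)
    qed
    show ?thesis unfolding e by (rule qpoch_tendsto_1_mult) simp
  qed
  have "u \<longlonglongrightarrow> (\<Prod>s<n. 1)" unfolding u_def by (intro tendsto_prod l3)
  hence "(\<lambda>N. side_l x1 x2 * u N) \<longlonglongrightarrow> side_l x1 x2 * (\<Prod>s<n. 1)" by (intro tendsto_mult tendsto_const)
  thus "(\<lambda>N. side_l x1 x2 * u N) \<longlonglongrightarrow> side_l x1 x2" by simp
  have "a \<longlonglongrightarrow> (\<Prod>s<n. 1 * 1 * (1 * 1))" unfolding a_def by (intro tendsto_prod tendsto_mult l1 l2)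
  hence "(\<lambda>N. FF (X1 N) (X2 N) (1 / X1 N) (1 / X2 N) * a N * side_r x1 x2) \<longlonglongrightarrow> Lconst * (\<Prod>s<n. 1 * 1 * (1 * 1)) * side_r x1 x2"
    unfolding X1_def X2_def by (intro tendsto_mult tendsto_const FF_trunc_tendsto g)
  moreover have "side_l x1 x2 * u N = FF (X1 N) (X2 N) (1 / X1 N) (1 / X2 N) * a N * side_r x1 x2" for N
    unfolding u_def a_def X1_def X2_def by (rule side_l_truncated[OF g])
  ultimately show "(\<lambda>N. side_l x1 x2 * u N) \<longlonglongrightarrow> Lconst * side_r x1 x2" by simp
qed

theorem FF_evaluation:
  assumes g: "generic x1 x2" and c: "conv 0 \<alpha>1 \<alpha>2"
  shows "FF x1 x2 \<alpha>1 \<alpha>2 * (\<Prod>s<n. qpoch q (Q * \<alpha>1 * \<alpha>2 / (b1 * b2 * t ^ (n + s - 1)))) *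
      (\<Prod>s<n. qtheta q (x1 * b1 * t ^ s) * qtheta q (x1 * b2 * t ^ s) * (qtheta q (x2 * b1 * t ^ s) * qtheta q (x2 * b2 * t ^ s))) =
    (\<Prod>s<n. qpoch q (Q * \<alpha>1 / (b1 * t ^ s)) * qpoch q (Q * \<alpha>1 / (b2 * t ^ s))) *
    (\<Prod>s<n. qpoch q (Q * \<alpha>2 / (b1 * t ^ s)) * qpoch q (Q * \<alpha>2 / (b2 * t ^ s))) *
    Lconst * (\<Prod>s<n. qtheta q (x1 * x2 * b1 * b2 * t ^ (n + s - 1)))"
proof -
  \<comment> \<open>The condition with \<open>e = 0\<close> for \<open>\<alpha>1\<close> is the
    condition with \<open>e = 1\<close> for \<open>Q * \<alpha>1\<close>, since
    \<open>norm Q = q\<close>.\<close>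
  have "good x1 x2 (Q * \<alpha>1) \<alpha>2"
    using c q_pos unfolding good_def conv_def by (simp add: norm_mult mult_ac)
  from FF_formula[OF g this] side_eq[OF g, unfolded side_l_def side_r_def]
  show ?thesis by simp
qed

end

section \<open>Complex powers and the sums \<open>J\<close>\<close>

context q_base
begin

lemma exp_ln_q: "exp (of_real (ln q)) = Q"
  using q_pos by (metis exp_ln exp_of_real)

lemma exp_of_int_ln_q: "exp (of_int m * of_real (ln q)) = Q powi m"
proof (cases "m \<ge> 0")
  case True
  then obtain k where "m = int k" using nonneg_int_cases by blast
  thus ?thesis by (simp add: exp_of_nat_mult exp_ln_q)
next
  case False
  then obtain k where "m = - int k" by (metis nonpos_int_cases linear)
  thus ?thesis by (simp add: exp_minus exp_of_nat_mult exp_ln_q power_int_minus)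
qed

lemma exp_tau: "exp (\<tau> * of_real (ln q)) = qt q \<tau>"
  unfolding qt_def powr_def using q_pos by (simp add: Ln_of_real)

lemma qt_nonzero: "qt q \<tau> \<noteq> 0"
  unfolding exp_tau[symmetric] by simp

lemma exp_int_tau: "exp (of_int m * (\<tau> * of_real (ln q))) = qt q \<tau> powi m"
proof (cases "m \<ge> 0")
  case True
  then obtain k where "m = int k" using nonneg_int_cases by blast
  thus ?thesis by (simp add: exp_of_nat_mult exp_tau)
next
  case False
  then obtain k where "m = - int k" by (metis nonpos_int_cases linear)
  thus ?thesis by (simp add: exp_minus exp_of_nat_mult exp_tau power_int_minus)
qed

end

context q_selberg
begin

definition label :: "nat \<Rightarrow> nat \<Rightarrow> nat" where
  "label i l = (if l \<le> i then l else l - i + n)"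

definition relabel :: "nat \<Rightarrow> (nat \<Rightarrow> int) \<Rightarrow> nat \<Rightarrow> int" where
  "relabel i \<nu> = (\<lambda>l\<in>{1..n}. \<nu> (label i l))"

lemma label_bij:
  assumes i: "i \<le> n"
  shows "bij_betw (label i) {1..n} (labels i)"
  by (rule bij_betwI[where g = "\<lambda>j. if j \<le> n then j else j + i - n"])
    (use i in \<open>auto simp: label_def labels_def\<close>)

lemma label_less_iff: "i \<le> n \<Longrightarrow> label i l < label i m \<longleftrightarrow> l < m"
  by (auto simp: label_def)

lemma label_le_n_iff: "i \<le> n \<Longrightarrow> label i l \<le> n \<longleftrightarrow> l \<le> i"
  by (auto simp: label_def)

lemma label_pairs_bij:
  assumes i: "i \<le> n" and l: "l \<in> {1..n}"
  shows "bij_betw (label i) {l<..n} {k\<in>labels i. label i l < k}"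
proof -
  have "bij_betw (label i) {m\<in>{1..n}. l < m} {k\<in>labels i. label i l < k}"
  proof (rule bij_betw_subset[OF label_bij[OF i]])
    have "labels i = label i ` {1..n}" using label_bij[OF i] by (simp add: bij_betw_def)
    hence "{k\<in>labels i. label i l < k} = {k\<in>label i ` {1..n}. label i l < k}" by (simp only:)
    also have "\<dots> = label i ` {m\<in>{1..n}. l < m}" using label_less_iff[OF i, of l] by blast
    finally show "label i ` {m\<in>{1..n}. l < m} = {k\<in>labels i. label i l < k}" ..
  qed blast
  moreover have "{m\<in>{1..n}. l < m} = {l<..n}" using l by auto
  ultimately show ?thesis by simp
qed

text \<open>\<open>u\<close> inverts \<open>label i\<close>. Since \<open>label i\<close> is
  increasing and respects the blocks, the two systems of order conditions correspond to each
  other.\<close>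

lemma relabel_bij:
  assumes i: "i \<le> n"
  shows "bij_betw (relabel i) (ch (labels i)) (chamber n i)"
proof -
  define u where "u = (\<lambda>j. if j \<le> n then j else j + i - n)"
  have lab: "label i l \<in> labels i" if "l \<in> {1..n}" for l
    using bij_betwE[OF label_bij[OF i]] that by blast
  have u1: "u j \<in> {1..n}" "label i (u j) = j" "u j \<le> i \<longleftrightarrow> j \<le> n" if "j \<in> labels i" for j
    using that i by (auto simp: u_def label_def labels_def)
  have u2: "u (label i l) = l" if "l \<in> {1..n}" for l
    using that i by (auto simp: u_def label_def)
  have u3: "u j \<le> u k" if "j < k" "j \<in> labels i" "k \<in> labels i" for j k
    using that i by (auto simp: u_def labels_def)
  show ?thesis
  proof (rule bij_betwI[where g = "\<lambda>\<nu>. \<lambda>j\<in>labels i. \<nu> (u j)"])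
    show "relabel i \<in> ch (labels i) \<rightarrow> chamber n i"
    proof
      fix \<nu> assume \<nu>: "\<nu> \<in> ch (labels i)"
      have mono: "\<nu> (label i j) \<le> \<nu> (label i k)" if "j \<in> {1..n}" "k \<in> {1..n}" "j \<le> k" "j \<le> i \<longleftrightarrow> k \<le> i" for j k
      proof (cases "j = k")
        case False
        hence "label i j < label i k" using that label_less_iff[OF i] by simp
        thus ?thesis using \<nu> lab[OF that(1)] lab[OF that(2)] that(4) label_le_n_iff[OF i]
          unfolding ch_def by blast
      qed simp
      show "relabel i \<nu> \<in> chamber n i"
        unfolding chamber_def lattice_pts_def relabel_def using mono i by auto
    qed
    show "(\<lambda>\<nu>. \<lambda>j\<in>labels i. \<nu> (u j)) \<in> chamber n i \<rightarrow> ch (labels i)"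
    proof
      fix \<nu> assume \<nu>: "\<nu> \<in> chamber n i"
      have "\<nu> (u j) \<le> \<nu> (u k)" if jk: "j \<in> labels i" "k \<in> labels i" "j < k" "j \<le> n \<longleftrightarrow> k \<le> n" for j k
      proof (cases "j \<le> n")
        case True
        thus ?thesis using \<nu> u1[OF jk(1)] u1[OF jk(2)] u3[OF jk(3,1,2)] jk(4) unfolding chamber_def by simp
      next
        case False
        hence "i < u j" using u1(3)[OF jk(1)] by simp
        moreover have "u k \<le> n" using u1(1)[OF jk(2)] by simp
        ultimately show ?thesis using \<nu> u3[OF jk(3,1,2)] unfolding chamber_def by blast
      qed
      thus "(\<lambda>j\<in>labels i. \<nu> (u j)) \<in> ch (labels i)" unfolding ch_def by auto
    qed
    show "(\<lambda>j\<in>labels i. relabel i \<nu> (u j)) = \<nu>" if "\<nu> \<in> ch (labels i)" for \<nu>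
    proof (rule extensionalityI[of _ "labels i"])
      show "\<nu> \<in> extensional (labels i)" using that by (simp add: ch_def PiE_def)
    qed (use u1 in \<open>simp_all add: relabel_def\<close>)
    show "relabel i (\<lambda>j\<in>labels i. \<nu> (u j)) = \<nu>" if "\<nu> \<in> chamber n i" for \<nu>
    proof (rule extensionalityI[of _ "{1..n}"])
      show "\<nu> \<in> extensional {1..n}" using that by (simp add: chamber_def lattice_pts_def PiE_def)
      show "relabel i (\<lambda>j\<in>labels i. \<nu> (u j)) \<in> extensional {1..n}" by (simp add: relabel_def)
      show "relabel i (\<lambda>j\<in>labels i. \<nu> (u j)) l = \<nu> l" if "l \<in> {1..n}" for l
        using that lab[OF that] u2[OF that] by (simp add: relabel_def)
    qed
  qed
qed

lemma exp_zeta_log: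
  assumes t: "t = qt q \<tau>" and l: "1 \<le> l" and i: "i \<le> n"
  shows "exp (zeta_log q \<tau> L i l) = xi (exp (L 1)) (exp (L 2)) (label i l)"
proof -
  have e: "exp (w + of_nat m * \<tau> * of_real (ln q)) = exp w * t ^ m" for w m
    by (simp add: exp_add mult.assoc exp_of_nat_mult exp_tau t)
  show ?thesis
  proof (cases "l \<le> i")
    case True
    thus ?thesis using i unfolding zeta_log_def xi_def label_def by (simp only: if_True e order.trans)
  next
    case False
    hence "\<not> l - i + n \<le> n" "l - i + n - n - 1 = l - i - 1" by auto
    thus ?thesis using False unfolding zeta_log_def xi_def label_def by (simp only: if_False e)
  qed
qed

text \<open>The constant left by coordinate \<open>l\<close> has exponent
  \<open>1 + 2 * (n - l) * \<tau>\<close>: 1 from the single factor \<open>z l\<close>, and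
  \<open>2 * \<tau>\<close> from each of the \<open>n - l\<close> pairs in which \<open>l\<close>
  comes first, after the Vandermonde factor has raised \<open>2 * \<tau> - 1\<close> by 1.\<close>

lemma J_term_eq:
  fixes L :: "nat \<Rightarrow> complex"
  assumes t: "t = qt q \<tau>" and i: "i \<le> n" and b: "b 1 = b1" "b 2 = b2"
  defines "w \<equiv> zeta_log q \<tau> L i"
  shows "J_term q n \<tau> a b w (relabel i \<nu>) =
    (\<Prod>l\<in>{1..n}. exp (w l * (1 + 2 * of_nat (n - l) * \<tau>))) *
    DD (inverse (a 1)) (inverse (a 2)) (xi (exp (L 1)) (exp (L 2))) (labels i) \<nu>"
proof -
  define \<xi> where "\<xi> = xi (exp (L 1)) (exp (L 2))"
  define \<mu> where "\<mu> = (\<lambda>l. \<nu> (label i l))"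
  define W where "W = qshift q w (relabel i \<nu>)"
  define z where "z = (\<lambda>l. exp (W l))"
  have W: "W l = w l + of_int (\<mu> l) * of_real (ln q)" if "l \<in> {1..n}" for l
    using that by (simp add: W_def qshift_def relabel_def \<mu>_def)
  have \<xi>: "exp (w l) = \<xi> (label i l)" if "l \<in> {1..n}" for l
    using that exp_zeta_log[OF t _ i, of l L] by (simp add: w_def \<xi>_def)
  have z: "z l = \<xi> (label i l) * Q powi \<mu> l" if "l \<in> {1..n}" for l
    unfolding z_def W[OF that] exp_add exp_of_int_ln_q \<xi>[OF that] ..
  have z0: "z l \<noteq> 0" for l by (simp add: z_def)
  have single: "z l * (qpoch q (Q * inverse (a 1) * z l) * qpoch q (Q * inverse (a 2) * z l)) /
      (qpoch q (b 1 * z l) * qpoch q (b 2 * z l)) =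
      exp (w l) * wt1 (inverse (a 1)) (inverse (a 2)) (\<xi> (label i l)) (\<nu> (label i l))"
    if "l \<in> {1..n}" for l
  proof -
    have "z l = exp (w l) * Q powi \<mu> l" using z[OF that] \<xi>[OF that] by simp
    moreover have "wt1 (inverse (a 1)) (inverse (a 2)) (\<xi> (label i l)) (\<nu> (label i l)) =
       Q powi \<mu> l * phi (inverse (a 1)) (inverse (a 2)) (z l)"
      unfolding wt1_def z[OF that] \<mu>_def ..
    ultimately show ?thesis unfolding phi_def b by (simp add: mult.assoc)
  qed
  have pair: "exp ((2 * \<tau> - 1) * W l) * qpoch q (Q * inverse t * z m / z l) / qpoch q (t * z m / z l) * (z l - z m) =
      exp (2 * \<tau> * w l) * vv \<xi> \<nu> (label i l) (label i m)" if lm: "l \<in> {1..n}" "m \<in> {1..n}" for l m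
  proof -
    define u where "u = z m / z l"
    have u: "u = \<xi> (label i m) / \<xi> (label i l) * Q powi (\<nu> (label i m) - \<nu> (label i l))"
      unfolding u_def z[OF lm(1)] z[OF lm(2)] \<mu>_def by (simp add: power_int_diff)
    have 1: "exp ((2 * \<tau> - 1) * W l) * z l = exp (2 * \<tau> * w l) * t powi (2 * \<nu> (label i l))"
    proof -
      have "exp ((2 * \<tau> - 1) * W l) * z l = exp (2 * \<tau> * W l)"
        unfolding z_def exp_add[symmetric] by (simp add: algebra_simps)
      also have "2 * \<tau> * W l = 2 * \<tau> * w l + of_int (2 * \<nu> (label i l)) * (\<tau> * of_real (ln q))"
        unfolding W[OF lm(1)] \<mu>_def by (simp add: algebra_simps)
      finally show ?thesis by (simp only: exp_add exp_int_tau t)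
    qed
    have 2: "z l - z m = z l * (1 - u)" using z0[of l] by (simp add: u_def field_simps)
    have 3: "Q * inverse t * z m / z l = Q * u / t" "t * z m / z l = t * u"
      by (simp_all add: u_def divide_inverse mult_ac)
    have "exp ((2 * \<tau> - 1) * W l) * qpoch q (Q * inverse t * z m / z l) / qpoch q (t * z m / z l) * (z l - z m) =
        (exp ((2 * \<tau> - 1) * W l) * z l) * pair_fun t u"
      unfolding 2 3 pair_fun_def by simp
    thus ?thesis unfolding 1 vv_def u by simp
  qed
  have inner: "(\<Prod>m\<in>{l<..n}. exp (2 * \<tau> * w l) * vv \<xi> \<nu> (label i l) (label i m)) =
      exp (w l * (2 * of_nat (n - l) * \<tau>)) * (\<Prod>k\<in>{k\<in>labels i. label i l < k}. vv \<xi> \<nu> (label i l) k)"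
    if l: "l \<in> {1..n}" for l
  proof -
    have "exp (2 * \<tau> * w l) ^ (n - l) = exp (w l * (2 * of_nat (n - l) * \<tau>))"
      by (simp add: exp_of_nat_mult[symmetric] mult_ac)
    thus ?thesis
      by (simp add: prod.distrib prod.reindex_bij_betw[OF label_pairs_bij[OF i l]])
  qed
  have "J_term q n \<tau> a b w (relabel i \<nu>) =
     (\<Prod>l\<in>{1..n}. z l * (qpoch q (Q * inverse (a 1) * z l) * qpoch q (Q * inverse (a 2) * z l)) /
        (qpoch q (b 1 * z l) * qpoch q (b 2 * z l))) *
     (\<Prod>l\<in>{1..n}. \<Prod>m\<in>{l<..n}. exp ((2 * \<tau> - 1) * W l) * qpoch q (Q * inverse t * z m / z l) / qpoch q (t * z m / z l) * (z l - z m))"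
    unfolding J_term_def Phi_def Vandermonde_def Let_def W_def[symmetric] t[symmetric] prod.distrib z_def
    by (simp only: mult.assoc)
  also have "\<dots> = (\<Prod>l\<in>{1..n}. exp (w l) * wt1 (inverse (a 1)) (inverse (a 2)) (\<xi> (label i l)) (\<nu> (label i l))) *
     (\<Prod>l\<in>{1..n}. \<Prod>m\<in>{l<..n}. exp (2 * \<tau> * w l) * vv \<xi> \<nu> (label i l) (label i m))"
    by (intro arg_cong2[of _ _ _ _ "(*)"] prod.cong refl single pair) auto
  also have "\<dots> = (\<Prod>l\<in>{1..n}. exp (w l) * wt1 (inverse (a 1)) (inverse (a 2)) (\<xi> (label i l)) (\<nu> (label i l))) *
     (\<Prod>l\<in>{1..n}. exp (w l * (2 * of_nat (n - l) * \<tau>)) * (\<Prod>k\<in>{k\<in>labels i. label i l < k}. vv \<xi> \<nu> (label i l) k))"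
    by (intro arg_cong2[of _ _ _ _ "(*)"] prod.cong refl inner)
  also have "\<dots> = (\<Prod>l\<in>{1..n}. exp (w l) * exp (w l * (2 * of_nat (n - l) * \<tau>))) *
     ((\<Prod>l\<in>{1..n}. wt1 (inverse (a 1)) (inverse (a 2)) (\<xi> (label i l)) (\<nu> (label i l))) *
      (\<Prod>l\<in>{1..n}. \<Prod>k\<in>{k\<in>labels i. label i l < k}. vv \<xi> \<nu> (label i l) k))"
    unfolding prod.distrib by (simp only: mult_ac)
  also have "(\<Prod>l\<in>{1..n}. exp (w l) * exp (w l * (2 * of_nat (n - l) * \<tau>))) =
     (\<Prod>l\<in>{1..n}. exp (w l * (1 + 2 * of_nat (n - l) * \<tau>)))"
    by (intro prod.cong refl) (simp add: exp_add[symmetric] algebra_simps)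
  also have "(\<Prod>l\<in>{1..n}. wt1 (inverse (a 1)) (inverse (a 2)) (\<xi> (label i l)) (\<nu> (label i l))) =
     (\<Prod>j\<in>labels i. wt1 (inverse (a 1)) (inverse (a 2)) (\<xi> j) (\<nu> j))"
    by (rule prod.reindex_bij_betw[OF label_bij[OF i]])
  also have "(\<Prod>l\<in>{1..n}. \<Prod>k\<in>{k\<in>labels i. label i l < k}. vv \<xi> \<nu> (label i l) k) = pairs \<xi> (labels i) \<nu>"
    unfolding pairs_def by (rule prod.reindex_bij_betw[OF label_bij[OF i]])
  finally show ?thesis unfolding DD_def \<xi>_def .
qed

text \<open>Outside the chamber the exponents drop between two adjacent coordinates of one block. At
  such a pair the argument of the numerator product in \<open>Phi\<close> is \<open>Q\<close> to a
  nonpositive power, hence a zero of \<open>qpoch\<close>.\<close>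

lemma J_term_outside_chamber:
  assumes t: "t = qt q \<tau>" and i: "i \<le> n" and \<nu>: "\<nu> \<in> lattice_pts n - chamber n i"
  shows "J_term q n \<tau> a b (zeta_log q \<tau> L i) \<nu> = 0"
proof -
  have "\<exists>l\<in>{1..n}. l + 1 \<le> n \<and> l \<noteq> i \<and> \<nu> (l + 1) < \<nu> l"
  proof (rule ccontr)
    assume no: "\<not> ?thesis"
    have step: "\<nu> l \<le> \<nu> (Suc l)" if "1 \<le> l" "Suc l \<le> n" "l \<noteq> i" for l
      using no that by fastforce
    have chain: "k \<le> n \<Longrightarrow> (k \<le> i \<or> i < j) \<Longrightarrow> \<nu> j \<le> \<nu> k" if "j \<le> k" "1 \<le> j" for j k
      using that(1)
    proof (induction k rule: dec_induct)
      case (step k)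
      thus ?case using \<open>\<And>l. 1 \<le> l \<Longrightarrow> Suc l \<le> n \<Longrightarrow> l \<noteq> i \<Longrightarrow> \<nu> l \<le> \<nu> (Suc l)\<close>[of k] that(2) by force
    qed simp
    have "\<nu> \<in> chamber n i" unfolding chamber_def using \<nu> chain i by auto
    thus False using \<nu> by blast
  qed
  then obtain l where l: "l \<in> {1..n}" "l + 1 \<le> n" "l \<noteq> i" "\<nu> (l + 1) < \<nu> l" by blast
  define w where "w = qshift q (zeta_log q \<tau> L i) \<nu>"
  \<comment> \<open>The exponent drops by at least 1, and this 1 is absorbed by the factor
    \<open>Q\<close> in the numerator; hence the shift that makes \<open>e\<close> a natural number,
    with 0 allowed.\<close>
  define e where "e = nat (\<nu> l - \<nu> (l + 1) - 1)"
  have e: "\<nu> (l + 1) - \<nu> l = - int (Suc e)" using l(4) by (simp add: e_def)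
  have "zeta_log q \<tau> L i (l + 1) - zeta_log q \<tau> L i l = \<tau> * of_real (ln q)"
  proof (cases "l + 1 \<le> i")
    case True
    have "(of_nat l :: complex) = of_nat (l - 1) + 1" using l(1) by (simp add: of_nat_diff)
    thus ?thesis using True by (simp add: zeta_log_def algebra_simps)
  next
    case False
    hence "i < l" using l(3) by simp
    hence "(of_nat (l - i) :: complex) = of_nat (l - i - 1) + 1" by (simp add: of_nat_diff)
    thus ?thesis using \<open>i < l\<close> by (simp add: zeta_log_def algebra_simps)
  qed
  hence "w (l + 1) - w l = \<tau> * of_real (ln q) + of_int (\<nu> (l + 1) - \<nu> l) * of_real (ln q)"
    by (simp add: w_def qshift_def algebra_simps)
  hence "exp (w (l + 1) - w l) = t * Q powi (- int (Suc e))"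
    unfolding e by (simp only: exp_add exp_of_int_ln_q) (simp only: exp_tau t)
  hence "Q * inverse t * exp (w (l + 1)) / exp (w l) = Q * Q powi (- int (Suc e))"
    by (simp add: exp_diff field_simps)
  also have "\<dots> = inverse (Q ^ e)" unfolding power_int_minus power_int_of_nat by simp
  finally have arg: "Q * inverse t * exp (w (l + 1)) / exp (w l) = inverse (Q ^ e)" .
  have "qpoch q (Q * inverse t * exp (w (l + 1)) / exp (w l)) = 0"
    unfolding arg qpoch_eq_0_iff by (intro exI[of _ e]) simp
  hence "(\<Prod>m\<in>{l<..n}. exp ((2 * \<tau> - 1) * w l) * qpoch q (Q * inverse t * exp (w m) / exp (w l)) /
      qpoch q (t * exp (w m) / exp (w l))) = 0"
    using l by (intro prod_zero finite_greaterThanAtMost bexI[of _ "l + 1"]) auto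
  hence "(\<Prod>j\<in>{1..n}. \<Prod>m\<in>{j<..n}. exp ((2 * \<tau> - 1) * w j) * qpoch q (Q * inverse t * exp (w m) / exp (w j)) /
      qpoch q (t * exp (w m) / exp (w j))) = 0"
    using l(1) by (rule prod_zero[OF finite_atLeastAtMost bexI[of _ l]])
  thus ?thesis unfolding J_term_def Phi_def Let_def w_def[symmetric] t[symmetric] by simp
qed

text \<open>In both cases of \<open>J_range\<close> the index set lies between the chamber and the
  full lattice, and all terms outside the chamber are zero.\<close>

lemma J_range_reduce:
  assumes t: "t = qt q \<tau>" and i: "i \<le> n"
  shows "J_term q n \<tau> a b (zeta_log q \<tau> L i) summable_on J_range q n \<tau> i \<longleftrightarrow>
      J_term q n \<tau> a b (zeta_log q \<tau> L i) summable_on chamber n i"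
    "infsum (J_term q n \<tau> a b (zeta_log q \<tau> L i)) (J_range q n \<tau> i) =
      infsum (J_term q n \<tau> a b (zeta_log q \<tau> L i)) (chamber n i)"
proof -
  have sub: "chamber n i \<subseteq> J_range q n \<tau> i" "J_range q n \<tau> i \<subseteq> lattice_pts n"
    by (auto simp: J_range_def chamber_def)
  show "J_term q n \<tau> a b (zeta_log q \<tau> L i) summable_on J_range q n \<tau> i \<longleftrightarrow>
      J_term q n \<tau> a b (zeta_log q \<tau> L i) summable_on chamber n i"
    by (rule summable_on_cong_neutral) (use sub J_term_outside_chamber[OF t i] in auto)
  show "infsum (J_term q n \<tau> a b (zeta_log q \<tau> L i)) (J_range q n \<tau> i) =
      infsum (J_term q n \<tau> a b (zeta_log q \<tau> L i)) (chamber n i)"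
    by (rule infsum_cong_neutral) (use sub J_term_outside_chamber[OF t i] in auto)
qed

lemma J_sum_eq:
  assumes t: "t = qt q \<tau>" and i: "i \<le> n" and b: "b 1 = b1" "b 2 = b2"
    and g: "generic (exp (L 1)) (exp (L 2))" and c: "conv 0 (inverse (a 1)) (inverse (a 2))"
  defines "w \<equiv> zeta_log q \<tau> L i"
    and "D \<equiv> DD (inverse (a 1)) (inverse (a 2)) (xi (exp (L 1)) (exp (L 2))) (labels i)"
  shows "J_term q n \<tau> a b w summable_on J_range q n \<tau> i"
    "J_zeta q n \<tau> a b L i = of_real (1 - q) ^ n * (\<Prod>l\<in>{1..n}. exp (w l * (1 + 2 * of_nat (n - l) * \<tau>))) *
       infsum D (ch (labels i))"
proof -
  interpret qc: q_config q t b1 b2 n "xi (exp (L 1)) (exp (L 2))" "labels i" by (rule generic_config[OF g i])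
  define E where "E = (\<Prod>l\<in>{1..n}. exp (w l * (1 + 2 * of_nat (n - l) * \<tau>)))"
  have "D summable_on ch (labels i)"
    unfolding D_def by (rule qc.DD_summable[OF iffD2[OF qc.dominated_iff domin_conv[OF g i _ c]]]) simp
  moreover have eq: "J_term q n \<tau> a b w (relabel i \<nu>) = E * D \<nu>" for \<nu>
    unfolding E_def D_def w_def by (rule J_term_eq[OF t i b])
  ultimately have "(\<lambda>\<nu>. J_term q n \<tau> a b w (relabel i \<nu>)) summable_on ch (labels i)"
    by (simp only: summable_on_cmult_right)
  thus "J_term q n \<tau> a b w summable_on J_range q n \<tau> i"
    unfolding w_def J_range_reduce(1)[OF t i] summable_on_reindex_bij_betw[OF relabel_bij[OF i]] .
  have "infsum (J_term q n \<tau> a b w) (chamber n i) = infsum (\<lambda>\<nu>. J_term q n \<tau> a b w (relabel i \<nu>)) (ch (labels i))"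
    by (rule infsum_reindex_bij_betw[OF relabel_bij[OF i], symmetric])
  also have "\<dots> = E * infsum D (ch (labels i))" unfolding eq by (rule infsum_cmult_right')
  finally have "infsum (J_term q n \<tau> a b w) (chamber n i) = E * infsum D (ch (labels i))" .
  thus "J_zeta q n \<tau> a b L i = of_real (1 - q) ^ n * (\<Prod>l\<in>{1..n}. exp (w l * (1 + 2 * of_nat (n - l) * \<tau>))) *
       infsum D (ch (labels i))"
    unfolding J_zeta_def J_sum_def E_def[symmetric] using J_range_reduce(2)[OF t i, of a b L] by (simp add: w_def)
qed

text \<open>The complex powers in the theorem are the inverses of the constants split off from the
  terms of \<open>J\<close>, coordinate by coordinate; coordinate \<open>i + k\<close> precedes
  \<open>n - i - k\<close> others.\<close>

lemma prefactor_eq: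
  assumes i: "i \<le> n"
  shows "(\<Prod>l\<in>{1..n}. exp (zeta_log q \<tau> L i l * (1 + 2 * of_nat (n - l) * \<tau>))) *
    (\<Prod>j\<in>{1..i}. xt_pow q \<tau> (L 1) (j - 1) (- 1 - 2 * (of_nat n - of_nat j) * \<tau>)) *
    (\<Prod>k\<in>{1..n - i}. xt_pow q \<tau> (L 2) (k - 1) (- 1 - 2 * (of_nat n - of_nat i - of_nat k) * \<tau>)) = 1"
proof -
  define E where "E = (\<lambda>l. exp (zeta_log q \<tau> L i l * (1 + 2 * of_nat (n - l) * \<tau>)))"
  have "(\<Prod>l\<in>{1..n}. E l) = (\<Prod>l\<in>{1..i}. E l) * (\<Prod>l\<in>{i+1..n}. E l)"
    using i by (subst prod.union_disjoint[symmetric]) (auto intro!: prod.cong)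
  also have "(\<Prod>l\<in>{i+1..n}. E l) = (\<Prod>k\<in>{1..n-i}. E (i + k))"
    by (rule prod.reindex_bij_witness[of _ "\<lambda>k. i + k" "\<lambda>l. l - i"]) (use i in auto)
  finally have s: "(\<Prod>l\<in>{1..n}. E l) = (\<Prod>l\<in>{1..i}. E l) * (\<Prod>k\<in>{1..n-i}. E (i + k))" .
  have 1: "E l * xt_pow q \<tau> (L 1) (l - 1) (- 1 - 2 * (of_nat n - of_nat l) * \<tau>) = 1" if "l \<in> {1..i}" for l
  proof -
    have n: "(of_nat (n - l) :: complex) = of_nat n - of_nat l" using that i by (intro of_nat_diff) auto
    have z: "zeta_log q \<tau> L i l = L 1 + of_nat (l - 1) * \<tau> * of_real (ln q)"
      using that by (simp add: zeta_log_def)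
    have "(L 1 + of_nat (l - 1) * \<tau> * of_real (ln q)) * (1 + 2 * (of_nat n - of_nat l) * \<tau>) +
        (- 1 - 2 * (of_nat n - of_nat l) * \<tau>) * (L 1 + of_nat (l - 1) * \<tau> * of_real (ln q)) = 0"
      by (simp add: algebra_simps)
    thus ?thesis unfolding E_def xt_pow_def exp_add[symmetric] n z by simp
  qed
  have 2: "E (i + k) * xt_pow q \<tau> (L 2) (k - 1) (- 1 - 2 * (of_nat n - of_nat i - of_nat k) * \<tau>) = 1" if "k \<in> {1..n-i}" for k
  proof -
    have "(of_nat (n - (i + k)) :: complex) = of_nat n - of_nat (i + k)" using that i by (intro of_nat_diff) auto
    hence n: "(of_nat (n - (i + k)) :: complex) = of_nat n - of_nat i - of_nat k" by simp
    have z: "zeta_log q \<tau> L i (i + k) = L 2 + of_nat (k - 1) * \<tau> * of_real (ln q)"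
      using that by (simp add: zeta_log_def)
    have "(L 2 + of_nat (k - 1) * \<tau> * of_real (ln q)) * (1 + 2 * (of_nat n - of_nat i - of_nat k) * \<tau>) +
        (- 1 - 2 * (of_nat n - of_nat i - of_nat k) * \<tau>) * (L 2 + of_nat (k - 1) * \<tau> * of_real (ln q)) = 0"
      by (simp add: algebra_simps)
    thus ?thesis unfolding E_def xt_pow_def exp_add[symmetric] n z by simp
  qed
  have "(\<Prod>l\<in>{1..n}. E l) *
    (\<Prod>j\<in>{1..i}. xt_pow q \<tau> (L 1) (j - 1) (- 1 - 2 * (of_nat n - of_nat j) * \<tau>)) *
    (\<Prod>k\<in>{1..n - i}. xt_pow q \<tau> (L 2) (k - 1) (- 1 - 2 * (of_nat n - of_nat i - of_nat k) * \<tau>)) =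
    (\<Prod>l\<in>{1..i}. E l * xt_pow q \<tau> (L 1) (l - 1) (- 1 - 2 * (of_nat n - of_nat l) * \<tau>)) *
    (\<Prod>k\<in>{1..n-i}. E (i + k) * xt_pow q \<tau> (L 2) (k - 1) (- 1 - 2 * (of_nat n - of_nat i - of_nat k) * \<tau>))"
    unfolding s prod.distrib by (simp only: mult_ac)
  also have "\<dots> = (\<Prod>l\<in>{1..i}. 1) * (\<Prod>k\<in>{1..n-i}. 1)"
    by (intro arg_cong2[of _ _ _ _ "(*)"] prod.cong refl 1 2)
  finally show ?thesis unfolding E_def by simp
qed

lemma J_weighted_sum:
  fixes x :: "nat \<Rightarrow> complex"
  assumes t: "t = qt q \<tau>" and b: "b 1 = b1" "b 2 = b2"
    and x: "exp (L 1) = x 1" "exp (L 2) = x 2"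
    and g: "generic (x 1) (x 2)" and c: "conv 0 (inverse (a 1)) (inverse (a 2))"
  shows "(\<Sum>i\<in>{0..n}. J_zeta q n \<tau> a b L i *
       (\<Prod>j\<in>{1..i}. xt_pow q \<tau> (L 1) (j - 1) (- 1 - 2 * (of_nat n - of_nat j) * \<tau>) /
          qtheta q (x 2 * inverse (x 1) * t powi (- int j + 1))) *
       (\<Prod>k\<in>{1..n - i}. xt_pow q \<tau> (L 2) (k - 1) (- 1 - 2 * (of_nat n - of_nat i - of_nat k) * \<tau>) /
          qtheta q (x 1 * inverse (x 2) * t powi (int i - int k + 1)))) =
    of_real (1 - q) ^ n * FF (x 1) (x 2) (inverse (a 1)) (inverse (a 2))"
proof -
  have "J_zeta q n \<tau> a b L i *
       (\<Prod>j\<in>{1..i}. xt_pow q \<tau> (L 1) (j - 1) (- 1 - 2 * (of_nat n - of_nat j) * \<tau>) /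
          qtheta q (x 2 * inverse (x 1) * t powi (- int j + 1))) *
       (\<Prod>k\<in>{1..n - i}. xt_pow q \<tau> (L 2) (k - 1) (- 1 - 2 * (of_nat n - of_nat i - of_nat k) * \<tau>) /
          qtheta q (x 1 * inverse (x 2) * t powi (int i - int k + 1))) =
     of_real (1 - q) ^ n * (infsum (DD (inverse (a 1)) (inverse (a 2)) (xi (x 1) (x 2)) (labels i)) (ch (labels i)) /
       Th (x 1) (x 2) i)" if i: "i \<le> n" for i
  proof -
    define D where "D = infsum (DD (inverse (a 1)) (inverse (a 2)) (xi (x 1) (x 2)) (labels i)) (ch (labels i))"
    define E where "E = (\<Prod>l\<in>{1..n}. exp (zeta_log q \<tau> L i l * (1 + 2 * of_nat (n - l) * \<tau>)))"
    define P1 where "P1 = (\<Prod>j\<in>{1..i}. xt_pow q \<tau> (L 1) (j - 1) (- 1 - 2 * (of_nat n - of_nat j) * \<tau>))"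
    define P2 where "P2 = (\<Prod>k\<in>{1..n - i}. xt_pow q \<tau> (L 2) (k - 1) (- 1 - 2 * (of_nat n - of_nat i - of_nat k) * \<tau>))"
    have J: "J_zeta q n \<tau> a b L i = of_real (1 - q) ^ n * E * D"
      unfolding E_def D_def by (rule J_sum_eq(2)[OF t i b _ c, where L = L, unfolded x, OF g])
    have EP: "E * P1 * P2 = 1" unfolding E_def P1_def P2_def by (rule prefactor_eq[OF i])
    have T: "Th (x 1) (x 2) i = (\<Prod>j\<in>{1..i}. qtheta q (x 2 * inverse (x 1) * t powi (- int j + 1))) *
        (\<Prod>k\<in>{1..n - i}. qtheta q (x 1 * inverse (x 2) * t powi (int i - int k + 1)))"
      unfolding Th_def divide_inverse by (simp add: add.commute)
    have "of_real (1 - q) ^ n * E * D * (P1 / T1) * (P2 / T2) = of_real (1 - q) ^ n * (D / (T1 * T2))" for T1 T2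
    proof -
      have "of_real (1 - q) ^ n * E * D * (P1 / T1) * (P2 / T2) = of_real (1 - q) ^ n * (D / (T1 * T2)) * (E * P1 * P2)"
        by (simp add: divide_inverse mult_ac)
      thus ?thesis by (simp only: EP mult_1_right)
    qed
    thus ?thesis
      unfolding prod_dividef P1_def[symmetric] P2_def[symmetric] T D_def[symmetric] J .
  qed
  thus ?thesis unfolding FF_def sum_distrib_left atMost_atLeast0 by (intro sum.cong refl) auto
qed

end

theorem theorem4p1:
  fixes q :: real and n :: nat and \<tau> t :: complex
    and a b x L :: "nat \<Rightarrow> complex"
  assumes q: "0 < q" "q < 1"
    and n: "n \<ge> 1"
    and t: "t = qt q \<tau>"
    and a: "a 1 \<noteq> 0" "a 2 \<noteq> 0"
    and b: "b 1 \<noteq> 0" "b 2 \<noteq> 0"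
    and conv0: "\<And>i. i \<in> {1..n} \<Longrightarrow> norm (of_real q * t powi (2 * int i - 2)) < 1"
    and conv_inf: "\<And>i. i \<in> {1..n} \<Longrightarrow> q < norm (a 1 * a 2 * b 1 * b 2 * t powi (2 * int i - 2))"
    and x: "x 1 \<noteq> 0" "x 2 \<noteq> 0"
    and L: "exp (L 1) = x 1" "exp (L 2) = x 2"
    and J_defined: "\<And>i \<nu>. i \<le> n \<Longrightarrow> \<nu> \<in> J_range q n \<tau> i \<Longrightarrow>
          Phi_defined q n \<tau> b (qshift q (zeta_log q \<tau> L i) \<nu>)"
    and den_x1: "\<And>i j. i \<le> n \<Longrightarrow> j \<in> {1..i} \<Longrightarrow>
          qtheta q (x 2 * inverse (x 1) * t powi (- int j + 1)) \<noteq> 0"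
    and den_x2: "\<And>i k. i \<le> n \<Longrightarrow> k \<in> {1..n - i} \<Longrightarrow>
          qtheta q (x 1 * inverse (x 2) * t powi (int i - int k + 1)) \<noteq> 0"
    and den_xb: "\<And>i j k. i \<in> {1..2} \<Longrightarrow> j \<in> {1..2} \<Longrightarrow> k \<in> {1..n} \<Longrightarrow>
          qtheta q (x i * b j * t ^ (k - 1)) \<noteq> 0"
    and den_C0: "\<And>k. k \<in> {1..n} \<Longrightarrow> qpoch q (t ^ k) \<noteq> 0"
      "\<And>k. k \<in> {1..n} \<Longrightarrow>
          qpoch q (of_real q * inverse (a 1) * inverse (a 2) * inverse (b 1) * inverse (b 2) *
                   t powi (- (int n + int k - 2))) \<noteq> 0"
  shows "(\<forall>i\<le>n. J_term q n \<tau> a b (zeta_log q \<tau> L i) summable_on J_range q n \<tau> i) \<and>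
    (\<Sum>i\<in>{0..n}. J_zeta q n \<tau> a b L i *
       (\<Prod>j\<in>{1..i}. xt_pow q \<tau> (L 1) (j - 1) (- 1 - 2 * (of_nat n - of_nat j) * \<tau>) /
          qtheta q (x 2 * inverse (x 1) * t powi (- int j + 1))) *
       (\<Prod>k\<in>{1..n - i}. xt_pow q \<tau> (L 2) (k - 1) (- 1 - 2 * (of_nat n - of_nat i - of_nat k) * \<tau>) /
          qtheta q (x 1 * inverse (x 2) * t powi (int i - int k + 1)))) =
    C0 q n \<tau> a b *
    (\<Prod>k\<in>{1..n}. qtheta q (x 1 * x 2 * b 1 * b 2 * t powi (int n + int k - 2)) /
       (\<Prod>i\<in>{1..2}. \<Prod>j\<in>{1..2}. qtheta q (x i * b j * t ^ (k - 1))))"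
proof -
  interpret q_base q by standard (use q in auto)
  have t0: "t \<noteq> 0" unfolding t by (rule qt_nonzero)
  have n2: "2 * int n - 2 = int (2 * (n - 1))" using n by (simp add: of_nat_diff)
  interpret q_selberg q t "b 1" "b 2" n
  proof
    show "q * norm t ^ (2 * (n - 1)) < 1"
      using conv0[of n] n q unfolding n2 power_int_of_nat by (simp add: norm_mult norm_power)
  qed (use t0 b n den_C0(1) in auto)
  define \<alpha>1 where "\<alpha>1 = inverse (a 1)"
  define \<alpha>2 where "\<alpha>2 = inverse (a 2)"
  \<comment> \<open>A nonnegative exponent \<open>e\<close> of \<open>t\<close> occurs in the second
    theta product at \<open>i = e\<close>, \<open>k = 1\<close>, a negative one at
    \<open>i = 0\<close>, \<open>k = 1 - e\<close>.\<close>
  have g: "generic (x 1) (x 2)"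
    unfolding generic_def
  proof (intro conjI allI impI ballI)
    fix e assume e: "1 - int n \<le> e \<and> e \<le> int n - 1"
    show "qtheta q (x 1 / x 2 * t powi e) \<noteq> 0"
    proof (cases "e \<ge> 0")
      case True
      then obtain k where k: "e = int k" using nonneg_int_cases by blast
      hence "1 \<le> n - k" using e by arith
      thus ?thesis using den_x2[of k 1] e k by (simp add: divide_inverse)
    next
      case False
      define k where "k = nat (1 - e)"
      have k: "1 - e = int k" using False by (simp add: k_def)
      hence "e = int 0 - int k + 1" by simp
      moreover have "k \<in> {1..n - 0}" using k e False by auto
      ultimately show ?thesis using den_x2[of 0 k] by (simp only: divide_inverse zero_le simp_thms)
    qed
  next
    fix y c k assume yc: "y \<in> {x 1, x 2}" "c \<in> {b 1, b 2}" and k: "k < n"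
    have "qtheta q (x i * b j * t ^ k) \<noteq> 0" if "i \<in> {1..2}" "j \<in> {1..2}" for i j
      using den_xb[OF that, of "Suc k"] k by simp
    from this[of 1 1] this[of 1 2] this[of 2 1] this[of 2 2]
    show "qtheta q (y * c * t ^ k) \<noteq> 0" using yc by auto
  qed (use x in auto)
  \<comment> \<open>The minimum \<open>tmin\<close> is attained at \<open>i = n\<close> if
    \<open>norm t \<le> 1\<close> and at \<open>i = 1\<close> otherwise.\<close>
  have c: "conv 0 \<alpha>1 \<alpha>2"
  proof -
    have "q < norm (a 1) * norm (a 2) * (norm (b 1) * norm (b 2) * tmin)"
    proof (cases "norm t \<le> 1")
      case True
      thus ?thesis using conv_inf[of n] n unfolding n2 power_int_of_nat tmin_def
        by (simp add: norm_mult norm_power mult_ac min_def)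
    next
      case False
      thus ?thesis using conv_inf[of 1] n unfolding tmin_def by (simp add: norm_mult mult_ac min_def)
    qed
    moreover have "norm (a 1) > 0" "norm (a 2) > 0" using a by simp_all
    ultimately show ?thesis
      unfolding conv_def \<alpha>1_def \<alpha>2_def norm_inverse by (simp add: field_simps del: norm_of_real)
  qed
  have summable: "J_term q n \<tau> a b (zeta_log q \<tau> L i) summable_on J_range q n \<tau> i" if "i \<le> n" for i
    by (rule J_sum_eq(1)[OF t that refl refl]) (use g c in \<open>simp_all only: L \<alpha>1_def \<alpha>2_def\<close>)
  define A where "A = (\<lambda>s. qpoch q (Q * \<alpha>1 * \<alpha>2 / (b 1 * b 2 * t ^ (n + s - 1))))"
  define B where "B = (\<lambda>s. qtheta q (x 1 * b 1 * t ^ s) * qtheta q (x 1 * b 2 * t ^ s) *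
    (qtheta q (x 2 * b 1 * t ^ s) * qtheta q (x 2 * b 2 * t ^ s)))"
  define U where "U = (\<lambda>s. qpoch q (Q * \<alpha>1 / (b 1 * t ^ s)) * qpoch q (Q * \<alpha>1 / (b 2 * t ^ s)) *
    (qpoch q (Q * \<alpha>2 / (b 1 * t ^ s)) * qpoch q (Q * \<alpha>2 / (b 2 * t ^ s))))"
  define R where "R = (\<lambda>s. qtheta q (x 1 * x 2 * b 1 * b 2 * t ^ (n + s - 1)))"
  \<comment> \<open>With \<open>k = Suc s\<close> the integer exponent \<open>n + k - 2\<close> is
    the natural number \<open>n + s - 1\<close>, because \<open>n \<ge> 1\<close>.\<close>
  have pw: "t powi (int n + int (Suc s) - 2) = t ^ (n + s - 1)" "t powi (- (int n + int (Suc s) - 2)) = inverse (t ^ (n + s - 1))" for s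
  proof -
    have "int n + int (Suc s) - 2 = int (n + s - 1)" using n by (simp add: of_nat_diff)
    thus "t powi (int n + int (Suc s) - 2) = t ^ (n + s - 1)" "t powi (- (int n + int (Suc s) - 2)) = inverse (t ^ (n + s - 1))"
      by (simp_all only: power_int_minus power_int_of_nat)
  qed
  have A: "A s = qpoch q (of_real q * inverse (a 1) * inverse (a 2) * inverse (b 1) * inverse (b 2) *
                   t powi (- (int n + int (Suc s) - 2)))" for s
    unfolding A_def pw \<alpha>1_def \<alpha>2_def by (simp add: divide_inverse mult.assoc)
  have A0: "A s \<noteq> 0" if "s < n" for s unfolding A by (rule den_C0(2)) (use that in auto)
  have two: "{1..2::nat} = {1, 2}" by auto
  have B: "B s = (\<Prod>i\<in>{1..2}. \<Prod>j\<in>{1..2}. qtheta q (x i * b j * t ^ (Suc s - 1)))" for s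
    unfolding B_def two by simp
  have B0: "B s \<noteq> 0" if "s < n" for s
    using den_xb[of 1 1 "Suc s"] den_xb[of 1 2 "Suc s"] den_xb[of 2 1 "Suc s"] den_xb[of 2 2 "Suc s"] that
    unfolding B_def by simp
  have U: "U s = (\<Prod>i\<in>{1..2}. \<Prod>j\<in>{1..2}. qpoch q (of_real q * inverse (a i) * inverse (b j) * t powi (- (int (Suc s) - 1))))" for s
  proof -
    have "- (int (Suc s) - 1) = - int s" by simp
    hence "t powi (- (int (Suc s) - 1)) = inverse (t ^ s)" by (simp only: power_int_minus power_int_of_nat)
    thus ?thesis unfolding U_def two \<alpha>1_def \<alpha>2_def by (simp add: divide_inverse mult.assoc)
  qed
  have shift: "(\<Prod>k\<in>{1..n}. f k) = (\<Prod>s<n. f (Suc s))" for f :: "nat \<Rightarrow> complex"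
    by (rule prod.reindex_bij_witness[of _ Suc "\<lambda>j. j - 1"]) auto
  have C0: "C0 q n \<tau> a b = of_real (1 - q) ^ n * (Lconst * (\<Prod>s<n. U s) / (\<Prod>s<n. A s))"
    unfolding C0_def Let_def t[symmetric] shift Lconst_def A U
    by (simp only: prod.distrib prod_dividef times_divide_eq_left times_divide_eq_right divide_divide_eq_left mult_ac)
  have rhs: "(\<Prod>k\<in>{1..n}. qtheta q (x 1 * x 2 * b 1 * b 2 * t powi (int n + int k - 2)) /
       (\<Prod>i\<in>{1..2}. \<Prod>j\<in>{1..2}. qtheta q (x i * b j * t ^ (k - 1)))) = (\<Prod>s<n. R s) / (\<Prod>s<n. B s)"
    unfolding shift B pw R_def prod_dividef ..
  have "FF (x 1) (x 2) \<alpha>1 \<alpha>2 * (\<Prod>s<n. A s) * (\<Prod>s<n. B s) = (\<Prod>s<n. U s) * Lconst * (\<Prod>s<n. R s)"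
    using FF_evaluation[OF g c] unfolding A_def B_def U_def R_def by (simp only: prod.distrib mult_ac)
  moreover have "(\<Prod>s<n. A s) \<noteq> 0" "(\<Prod>s<n. B s) \<noteq> 0" using A0 B0 by auto
  ultimately have "FF (x 1) (x 2) \<alpha>1 \<alpha>2 = Lconst * (\<Prod>s<n. U s) / (\<Prod>s<n. A s) * ((\<Prod>s<n. R s) / (\<Prod>s<n. B s))"
    by (simp add: field_simps)
  moreover have "(\<Sum>i\<in>{0..n}. J_zeta q n \<tau> a b L i *
       (\<Prod>j\<in>{1..i}. xt_pow q \<tau> (L 1) (j - 1) (- 1 - 2 * (of_nat n - of_nat j) * \<tau>) /
          qtheta q (x 2 * inverse (x 1) * t powi (- int j + 1))) *
       (\<Prod>k\<in>{1..n - i}. xt_pow q \<tau> (L 2) (k - 1) (- 1 - 2 * (of_nat n - of_nat i - of_nat k) * \<tau>) /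
          qtheta q (x 1 * inverse (x 2) * t powi (int i - int k + 1)))) =
    of_real (1 - q) ^ n * FF (x 1) (x 2) \<alpha>1 \<alpha>2"
    unfolding \<alpha>1_def \<alpha>2_def by (rule J_weighted_sum[OF t refl refl L g c[unfolded \<alpha>1_def \<alpha>2_def]])
  ultimately show ?thesis using summable unfolding C0 rhs by (simp add: mult.assoc)
qed

end
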